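(* Let $f\colon[0,m+1]\to\mathbb{R}$ be a generic piecewise linear map (defined from a list of $m$ distinct values with hooks, as in the context) with $n$ maxima. After removing all non-critical items in $O(m)$ time, the up-tree $\mathcal U(f)$ and the down-tree $\mathcal D(f)$ can be constructed in $O(n)$ time, and the augmented persistence diagram of $f$ can be computed from these two trees in $O(n)$ time.
   Context: A linear list is a sequence of distinct reals $c_1,\dots,c_m$, $m\ge 2$. It defines the piecewise linear map $f\colon[0,m+1]\to\mathbb{R}$ with $f(i)=c_i$ for $1\le i\le m$, linear interpolation between consecutive integers, and artificial ends ("hooks") $f(0)=c_1+\varepsilon\,\mathrm{sign}(c_2-c_1)$, $f(m+1)=c_m+\varepsilon\,\mathrm{sign}(c_{m-1}-c_m)$, where $\varepsilon>0$ is smaller than any difference of two values. The map is generic if all item values are distinct. Items are the integers; the critical items are the local minima and local maxima (so that $f$ has critical items $a_0<b_1<a_1<\dots<b_n<a_n$ alternating between minima $a_i$ and maxima $b_i$); non-critical items are all others. Banana tree of $f$ (denoted $\mathcal U(f)$, the up-tree; the down-tree $\mathcal D(f)$ is the banana tree of $-f$): (1) Form the unique full binary tree on the critical items whose in-order traversal is the order of positions and in which values increase along every leaf-to-root path (leaves are the minima, internal nodes the maxima). (2) Add a special root $\beta$ whose only child is the old root, with $\beta$ larger than every item both in value and position. Decompose the edges into paths: each leaf $a$ is joined to its nearest ancestor $b$ for which $a$ does not have the smallest value in the subtree of $b$ (or to $\beta$ if none exists); the path from $a$ to $b$ is said to be spanned by $a,b$. (3) Split each such path into two trails, both starting at $a$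 and ending at $b$: the left trail consists of $a$, $b$ and the path nodes whose right child lies on the path; the right trail consists of $a$, $b$ and the path nodes whose left child lies on the path. The pair of trails is the banana spanned by $a,b$. Each node stores pointers to its neighbours along trails and, for each banana, pointers linking its lower end $a$ and upper end $b$. Windows: for critical points $a,b$ with $A=f(a)<f(b)=B$ lying in the same connected component $[x,y]$ of $f^{-1}[A,B]$, the frame $[x,y]\times[A,B]$ is a triple-panel window (written $⟦a,b⟧$) if $a<b$ and $f(y)=A$, or $b<a$ and $f(x)=A$; the global window is the one spanned by the global minimum and global maximum, whose support is the whole domain. For $a<b$ the in-panel, mid-panel, out-panel are $[x,a]$, $[a,b]$, $[b,y]$ times $[A,B]$ (mirror-image for $b<a$); the double-panel window is the union of in- and mid-panel. The augmented persistence diagram of $f$ consists of: the points $(f(a),f(b))$ for each triple-panel window $⟦a,b⟧$ of $f$ (ordinary subdiagram), the points $(f(b),f(a))$ for each triple-panel window $⟦b,a⟧$ of $-f$ (relative subdiagram), the point of the global window of $f$ (essential subdiagram), together with an arrow between two points whenever their double-panel windows are nested with no other double-panel window nested between them.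
   Formalization: A triple-panel window must also have f(x)=B or x the domain's end (mirrored for b<a); else -1,5,0,10,-2 pairs minimum 0 with both 5 and 10. For nesting, the global window is its whole support, and f and -f are nested separately. Ends critical only for -f are kept. *)

theory Defs
  imports "HOL-Analysis.Analysis"
begin

section \<open>Piecewise linear maps from linear lists\<close>

definition linear_list :: "real list \<Rightarrow> bool" where
  "linear_list c \<longleftrightarrow> 2 \<le> length c \<and> distinct c"

definition hook_size :: "real list \<Rightarrow> real \<Rightarrow> bool" where
  "hook_size c \<epsilon> \<longleftrightarrow> 0 < \<epsilon> \<and> (\<forall>x\<in>set c. \<forall>y\<in>set c. x \<noteq> y \<longrightarrow> \<epsilon> < \<bar>x - y\<bar>)"

text \<open>Lists are indexed from 0 here, so \<open>c\<^sub>i\<close> is \<open>c ! (i - 1)\<close>.\<close>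

definition item_value :: "real list \<Rightarrow> real \<Rightarrow> nat \<Rightarrow> real" where
  "item_value c \<epsilon> i =
     (if i = 0 then c ! 0 + \<epsilon> * sgn (c ! 1 - c ! 0)
      else if i \<le> length c then c ! (i - 1)
      else c ! (length c - 1) + \<epsilon> * sgn (c ! (length c - 2) - c ! (length c - 1)))"

text \<open>Only the values on \<open>[0, length c + 1]\<close> matter.\<close>

definition pl_map :: "real list \<Rightarrow> real \<Rightarrow> real \<Rightarrow> real" where
  "pl_map c \<epsilon> t =
     (let i = nat \<lfloor>t\<rfloor>
      in item_value c \<epsilon> i + (t - real i) * (item_value c \<epsilon> (Suc i) - item_value c \<epsilon> i))"

text \<open>From here on a map is given by \<open>f :: real \<Rightarrow> real\<close> together with the right end \<open>N\<close> of its
  domain \<open>[0, N]\<close>; its items are the integers \<open>0, \<dots>, N\<close>. For a list of length \<open>m\<close>, \<open>N = m + 1\<close>.\<close>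

definition generic :: "(real \<Rightarrow> real) \<Rightarrow> nat \<Rightarrow> bool" where
  "generic f N \<longleftrightarrow> inj_on (\<lambda>i::nat. f (real i)) {0..N}"

text \<open>An endpoint counts as a minimum if it is lower than its only neighbour, but it is never a
  maximum: sublevel sets do not change topology there. So the critical items of \<open>f\<close>
  alternate, beginning and ending with a minimum. An endpoint that is not critical for \<open>f\<close> is a
  minimum of \<open>-f\<close>.\<close>

definition minimum :: "(real \<Rightarrow> real) \<Rightarrow> nat \<Rightarrow> nat \<Rightarrow> bool" where
  "minimum f N i \<longleftrightarrow> i \<le> N \<and> (0 < i \<longrightarrow> f (real i) < f (real (i - 1)))
                          \<and> (i < N \<longrightarrow> f (real i) < f (real (i + 1)))"

definition maximum :: "(real \<Rightarrow> real) \<Rightarrow> nat \<Rightarrow> nat \<Rightarrow> bool" where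
  "maximum f N i \<longleftrightarrow> 0 < i \<and> i < N \<and> f (real (i - 1)) < f (real i) \<and> f (real (i + 1)) < f (real i)"

definition critical :: "(real \<Rightarrow> real) \<Rightarrow> nat \<Rightarrow> nat \<Rightarrow> bool" where
  "critical f N i \<longleftrightarrow> minimum f N i \<or> maximum f N i"

definition critical_list :: "(real \<Rightarrow> real) \<Rightarrow> nat \<Rightarrow> nat list" where
  "critical_list f N = filter (critical f N) [0..<Suc N]"

text \<open>The items that survive the removal of non-critical items. Since both \<open>f\<close> and \<open>-f\<close> are
  processed, an item is removed only if it is critical for neither; apart from the two endpoints
  the critical items of \<open>f\<close> and \<open>-f\<close> are the same.\<close>

definition kept_list :: "(real \<Rightarrow> real) \<Rightarrow> nat \<Rightarrow> nat list" where
  "kept_list f N = filter (\<lambda>i. critical f N i \<or> critical (\<lambda>t. - f t) N i) [0..<Suc N]"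


section \<open>Banana trees\<close>

datatype (items: 'a) full_tree =
    Tip (root: 'a)
  | Bin (left_child: "'a full_tree") (root: 'a) (right_child: "'a full_tree")

fun in_order :: "'a full_tree \<Rightarrow> 'a list" where
  "in_order (Tip a) = [a]"
| "in_order (Bin l b r) = in_order l @ b # in_order r"

fun increasing_upwards :: "('a \<Rightarrow> real) \<Rightarrow> 'a full_tree \<Rightarrow> bool" where
  "increasing_upwards v (Tip a) \<longleftrightarrow> True"
| "increasing_upwards v (Bin l b r) \<longleftrightarrow>
     v (root l) < v b \<and> v (root r) < v b \<and> increasing_upwards v l \<and> increasing_upwards v r"

definition critical_tree :: "(real \<Rightarrow> real) \<Rightarrow> nat \<Rightarrow> nat full_tree" where
  "critical_tree f N =
     (THE t. in_order t = critical_list f N \<and> increasing_upwards (\<lambda>i. f (real i)) t)"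

text \<open>The subtrees rooted at the proper ancestors of the leaf \<open>a\<close>, nearest ancestor first.\<close>

fun ancestors :: "'a full_tree \<Rightarrow> 'a \<Rightarrow> 'a full_tree list" where
  "ancestors (Tip x) a = []"
| "ancestors (Bin l b r) a =
     (if a \<in> items l then ancestors l a else ancestors r a) @ [Bin l b r]"

definition is_smallest :: "(real \<Rightarrow> real) \<Rightarrow> nat \<Rightarrow> nat full_tree \<Rightarrow> bool" where
  "is_smallest f a t \<longleftrightarrow> (\<forall>x\<in>items t. f (real a) \<le> f (real x))"

text \<open>The special root \<open>\<beta>\<close> is the number \<open>Suc N\<close>, beyond every item in position. It has no value;
  being larger than every item in value is reflected in its being an ancestor of every
  leaf, reached only when all ancestors in the critical tree fail.\<close>

definition upper_end :: "(real \<Rightarrow> real) \<Rightarrow> nat \<Rightarrow> nat \<Rightarrow> nat" where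
  "upper_end f N a =
     (case find (\<lambda>t. \<not> is_smallest f a t) (ancestors (critical_tree f N) a) of
        None \<Rightarrow> Suc N | Some t \<Rightarrow> root t)"

text \<open>The subtrees rooted at the nodes strictly between the two ends of the path spanned by \<open>a\<close>.\<close>

definition inner_path :: "(real \<Rightarrow> real) \<Rightarrow> nat \<Rightarrow> nat \<Rightarrow> nat full_tree list" where
  "inner_path f N a = takeWhile (is_smallest f a) (ancestors (critical_tree f N) a)"

definition path_nodes :: "(real \<Rightarrow> real) \<Rightarrow> nat \<Rightarrow> nat \<Rightarrow> nat set" where
  "path_nodes f N a = {a} \<union> root ` set (inner_path f N a) \<union> {upper_end f N a}"

definition left_trail :: "(real \<Rightarrow> real) \<Rightarrow> nat \<Rightarrow> nat \<Rightarrow> nat list" where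
  "left_trail f N a =
     a # map root (filter (\<lambda>t. root (right_child t) \<in> path_nodes f N a) (inner_path f N a))
       @ [upper_end f N a]"

definition right_trail :: "(real \<Rightarrow> real) \<Rightarrow> nat \<Rightarrow> nat \<Rightarrow> nat list" where
  "right_trail f N a =
     a # map root (filter (\<lambda>t. root (left_child t) \<in> path_nodes f N a) (inner_path f N a))
       @ [upper_end f N a]"

text \<open>The banana tree as a set of bananas \<open>(a, b, left trail, right trail)\<close>, trails listed from
  the lower end \<open>a\<close> to the upper end \<open>b\<close>.\<close>

definition banana_tree :: "(real \<Rightarrow> real) \<Rightarrow> nat \<Rightarrow> (nat \<times> nat \<times> nat list \<times> nat list) set" where
  "banana_tree f N =
     {(a, upper_end f N a, left_trail f N a, right_trail f N a) | a. minimum f N a}"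

definition up_tree :: "(real \<Rightarrow> real) \<Rightarrow> nat \<Rightarrow> (nat \<times> nat \<times> nat list \<times> nat list) set" where
  "up_tree f N = banana_tree f N"

definition down_tree :: "(real \<Rightarrow> real) \<Rightarrow> nat \<Rightarrow> (nat \<times> nat \<times> nat list \<times> nat list) set" where
  "down_tree f N = banana_tree (\<lambda>t. - f t) N"


section \<open>Windows and the augmented persistence diagram\<close>

text \<open>\<open>spans_frame f N a b x y\<close>: the critical points \<open>a\<close> and \<open>b\<close> span the frame
  \<open>[x, y] \<times> [f a, f b]\<close>.\<close>

definition spans_frame :: "(real \<Rightarrow> real) \<Rightarrow> nat \<Rightarrow> nat \<Rightarrow> nat \<Rightarrow> real \<Rightarrow> real \<Rightarrow> bool" where
  "spans_frame f N a b x y \<longleftrightarrow>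
     critical f N a \<and> critical f N b \<and> f (real a) < f (real b) \<and>
     connected_component_set {t \<in> {0..real N}. f t \<in> {f (real a)..f (real b)}} (real a) = {x..y} \<and>
     real a \<in> {x..y} \<and> real b \<in> {x..y}"

text \<open>For \<open>a < b\<close> the wave enters the frame through its top (or begins inside it, at the end of
  the domain), runs through \<open>a\<close> and \<open>b\<close> and leaves through the bottom. The clause on the entry is
  needed: without it, in the list \<open>-1, 5, 0, 10, -2\<close> the minimum \<open>0\<close> would also be paired with
  \<open>10\<close>, although it is paired with \<open>5\<close> in persistent homology.\<close>

definition triple_panel_window ::
    "(real \<Rightarrow> real) \<Rightarrow> nat \<Rightarrow> nat \<Rightarrow> nat \<Rightarrow> real \<Rightarrow> real \<Rightarrow> bool" where
  "triple_panel_window f N a b x y \<longleftrightarrow>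
     spans_frame f N a b x y \<and>
     (a < b \<and> f y = f (real a) \<and> (x = 0 \<or> f x = f (real b)) \<or>
      b < a \<and> f x = f (real a) \<and> (y = real N \<or> f y = f (real b)))"

definition global_window :: "(real \<Rightarrow> real) \<Rightarrow> nat \<Rightarrow> nat \<Rightarrow> nat \<Rightarrow> bool" where
  "global_window f N a b \<longleftrightarrow> a \<le> N \<and> b \<le> N \<and>
     (\<forall>t\<in>{0..real N}. f (real a) \<le> f t \<and> f t \<le> f (real b))"

definition in_panel ::
    "(real \<Rightarrow> real) \<Rightarrow> nat \<Rightarrow> nat \<Rightarrow> real \<Rightarrow> real \<Rightarrow> (real \<times> real) set" where
  "in_panel f a b x y =
     (if a < b then {x..real a} else {real a..y}) \<times> {f (real a)..f (real b)}"

definition mid_panel :: "(real \<Rightarrow> real) \<Rightarrow> nat \<Rightarrow> nat \<Rightarrow> (real \<times> real) set" where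
  "mid_panel f a b =
     (if a < b then {real a..real b} else {real b..real a}) \<times> {f (real a)..f (real b)}"

definition double_panel_window ::
    "(real \<Rightarrow> real) \<Rightarrow> nat \<Rightarrow> nat \<Rightarrow> real \<Rightarrow> real \<Rightarrow> (real \<times> real) set" where
  "double_panel_window f a b x y = in_panel f a b x y \<union> mid_panel f a b"

datatype subdiagram = Ordinary | Relative | Essential

type_synonym diagram_point = "subdiagram \<times> real \<times> real"

text \<open>The points contributed by the windows of \<open>f\<close>, resp.\ \<open>-f\<close>, each with the region that is used
  to decide nesting. The global window is used as a whole; it corresponds to the banana whose upper
  end is \<open>\<beta>\<close>, to the right of all items, so that it has no out-panel. It is a window of both \<open>f\<close> and
  \<open>-f\<close> but gives only one point.\<close>

definition ordinary_windows ::
    "(real \<Rightarrow> real) \<Rightarrow> nat \<Rightarrow> (diagram_point \<times> (real \<times> real) set) set" where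
  "ordinary_windows f N =
     {((Ordinary, f (real a), f (real b)), double_panel_window f a b x y) | a b x y.
        triple_panel_window f N a b x y} \<union>
     {((Essential, f (real a), f (real b)), {0..real N} \<times> {f (real a)..f (real b)}) | a b.
        global_window f N a b}"

definition relative_windows ::
    "(real \<Rightarrow> real) \<Rightarrow> nat \<Rightarrow> (diagram_point \<times> (real \<times> real) set) set" where
  "relative_windows f N =
     {((Relative, f (real b), f (real a)), double_panel_window (\<lambda>t. - f t) b a x y) | a b x y.
        triple_panel_window (\<lambda>t. - f t) N b a x y} \<union>
     {((Essential, f (real a), f (real b)), {0..real N} \<times> {- f (real b)..- f (real a)}) | a b.
        global_window f N a b}"

text \<open>Arrows point from the inner to the outer window.\<close>

definition nesting_arrows ::
    "(diagram_point \<times> (real \<times> real) set) set \<Rightarrow> (diagram_point \<times> diagram_point) set" where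
  "nesting_arrows \<W> =
     {(p, q) | p q. \<exists>P Q. (p, P) \<in> \<W> \<and> (q, Q) \<in> \<W> \<and> P \<subset> Q \<and>
        \<not> (\<exists>(r, R)\<in>\<W>. P \<subset> R \<and> R \<subset> Q)}"

definition diagram_points :: "(real \<Rightarrow> real) \<Rightarrow> nat \<Rightarrow> diagram_point set" where
  "diagram_points f N = fst ` (ordinary_windows f N \<union> relative_windows f N)"

definition diagram_arrows :: "(real \<Rightarrow> real) \<Rightarrow> nat \<Rightarrow> (diagram_point \<times> diagram_point) set" where
  "diagram_arrows f N =
     nesting_arrows (ordinary_windows f N) \<union> nesting_arrows (relative_windows f N)"


section \<open>Machine model\<close>

text \<open>A random access machine with named arrays of natural numbers (addresses and counters) and of
  reals. Natural numbers can only be incremented, decremented and compared, so a run of \<open>t\<close> steps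
  does not build numbers exceeding the largest initial number or program constant by more than
  \<open>O(t)\<close>; reals can only be copied and compared. Each assignment and each
  evaluation of a test costs one unit. Programs do not depend on the input, so the size of
  their expressions is bounded by a constant. A scalar variable is cell 0 of an array.\<close>

record state =
  nums :: "string \<Rightarrow> nat \<Rightarrow> nat"
  vals :: "string \<Rightarrow> nat \<Rightarrow> real"

datatype num_exp = Const nat | Inc num_exp | Dec num_exp | At string num_exp

datatype test =
    EqNum num_exp num_exp
  | LessNum num_exp num_exp
  | LessVal string num_exp string num_exp
  | Negate test
  | Both test test

datatype prog =
    Skip
  | PutNum string num_exp num_exp
  | PutVal string num_exp string num_exp
  | Seq prog prog
  | Cond test prog prog
  | While test prog

fun num_of :: "num_exp \<Rightarrow> state \<Rightarrow> nat" where
  "num_of (Const k) s = k"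
| "num_of (Inc e) s = num_of e s + 1"
| "num_of (Dec e) s = num_of e s - 1"
| "num_of (At x e) s = nums s x (num_of e s)"

fun holds :: "test \<Rightarrow> state \<Rightarrow> bool" where
  "holds (EqNum d e) s \<longleftrightarrow> num_of d s = num_of e s"
| "holds (LessNum d e) s \<longleftrightarrow> num_of d s < num_of e s"
| "holds (LessVal x d y e) s \<longleftrightarrow> vals s x (num_of d s) < vals s y (num_of e s)"
| "holds (Negate b) s \<longleftrightarrow> \<not> holds b s"
| "holds (Both b c) s \<longleftrightarrow> holds b s \<and> holds c s"

definition put_num :: "string \<Rightarrow> nat \<Rightarrow> nat \<Rightarrow> state \<Rightarrow> state" where
  "put_num x i k s = s\<lparr>nums := (nums s)(x := (nums s x)(i := k))\<rparr>"

definition put_val :: "string \<Rightarrow> nat \<Rightarrow> real \<Rightarrow> state \<Rightarrow> state" where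
  "put_val x i r s = s\<lparr>vals := (vals s)(x := (vals s x)(i := r))\<rparr>"

text \<open>\<open>runs p s t s'\<close>: started in \<open>s\<close>, the program \<open>p\<close> halts in \<open>s'\<close> after \<open>t\<close> steps.\<close>

inductive runs :: "prog \<Rightarrow> state \<Rightarrow> nat \<Rightarrow> state \<Rightarrow> bool" where
  Skip: "runs Skip s 1 s"
| PutNum: "runs (PutNum x d e) s 1 (put_num x (num_of d s) (num_of e s) s)"
| PutVal: "runs (PutVal x d y e) s 1 (put_val x (num_of d s) (vals s y (num_of e s)) s)"
| Seq: "runs p s t s' \<Longrightarrow> runs q s' u s'' \<Longrightarrow> runs (Seq p q) s (t + u) s''"
| CondTrue: "holds b s \<Longrightarrow> runs p s t s' \<Longrightarrow> runs (Cond b p q) s (1 + t) s'"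
| CondFalse: "\<not> holds b s \<Longrightarrow> runs q s t s' \<Longrightarrow> runs (Cond b p q) s (1 + t) s'"
| WhileFalse: "\<not> holds b s \<Longrightarrow> runs (While b p) s 1 s"
| WhileTrue: "holds b s \<Longrightarrow> runs p s t s' \<Longrightarrow> runs (While b p) s' u s'' \<Longrightarrow>
    runs (While b p) s (1 + t + u) s''"


section \<open>Representation in memory\<close>

text \<open>The predicates below leave all cells they do not mention unspecified. Nodes of the trees are
  addressed by their item number, the special root by \<open>Suc N\<close>.\<close>

definition stores_map :: "state \<Rightarrow> (real \<Rightarrow> real) \<Rightarrow> nat \<Rightarrow> bool" where
  "stores_map s f N \<longleftrightarrow> nums s ''N'' 0 = N \<and> (\<forall>i\<le>N. vals s ''f'' i = f (real i))"

definition stores_kept_list :: "state \<Rightarrow> (real \<Rightarrow> real) \<Rightarrow> nat \<Rightarrow> bool" where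
  "stores_kept_list s f N \<longleftrightarrow>
     nums s ''crit_count'' 0 = length (kept_list f N) \<and>
     (\<forall>k < length (kept_list f N). nums s ''crit'' k = kept_list f N ! k) \<and>
     (\<forall>i\<in>set (kept_list f N). vals s ''f'' i = f (real i))"

text \<open>Pointers along one trail \<open>T\<close>. The inner nodes of all trails of a tree are different, so they
  share the fields \<open>up\<close> and \<open>dn\<close>. The two ends lie on both trails of their banana and need
  separate fields, \<open>first\<close> and \<open>final\<close>, for each of them.\<close>

definition stores_trail :: "state \<Rightarrow> string \<Rightarrow> string \<Rightarrow> string \<Rightarrow> nat list \<Rightarrow> bool" where
  "stores_trail s pre first final T \<longleftrightarrow>
     nums s (pre @ first) (hd T) = T ! 1 \<and>
     nums s (pre @ final) (last T) = T ! (length T - 2) \<and>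
     (\<forall>j. 0 < j \<and> j < length T - 1 \<longrightarrow>
        nums s (pre @ ''up'') (T ! j) = T ! (j + 1) \<and>
        nums s (pre @ ''dn'') (T ! j) = T ! (j - 1))"

definition stores_bananas ::
    "state \<Rightarrow> string \<Rightarrow> (nat \<times> nat \<times> nat list \<times> nat list) set \<Rightarrow> bool" where
  "stores_bananas s pre \<B> \<longleftrightarrow>
     (\<forall>(a, b, L, R)\<in>\<B>.
        nums s (pre @ ''top'') a = b \<and> nums s (pre @ ''low'') b = a \<and>
        stores_trail s pre ''left_up'' ''left_dn'' L \<and>
        stores_trail s pre ''right_up'' ''right_dn'' R)"

text \<open>Both trees with their common special root and the values of their nodes; an item has the
  same value field in both trees, holding the value of \<open>f\<close>.\<close>

definition stores_trees :: "state \<Rightarrow> (real \<Rightarrow> real) \<Rightarrow> nat \<Rightarrow> bool" where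
  "stores_trees s f N \<longleftrightarrow>
     nums s ''root'' 0 = Suc N \<and>
     stores_bananas s ''U.'' (up_tree f N) \<and>
     stores_bananas s ''D.'' (down_tree f N) \<and>
     (\<forall>i\<in>set (kept_list f N). vals s ''f'' i = f (real i))"

fun subdiagram_code :: "subdiagram \<Rightarrow> nat" where
  "subdiagram_code Ordinary = 0"
| "subdiagram_code Relative = 1"
| "subdiagram_code Essential = 2"

text \<open>The diagram is stored as an array of points and an array of arrows between indices of points,
  both without repetitions.\<close>

definition stores_diagram ::
    "state \<Rightarrow> diagram_point set \<Rightarrow> (diagram_point \<times> diagram_point) set \<Rightarrow> bool" where
  "stores_diagram s P A \<longleftrightarrow>
     (\<exists>pt :: nat \<Rightarrow> diagram_point.
        bij_betw pt {..<nums s ''point_count'' 0} P \<and>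
        (\<forall>k < nums s ''point_count'' 0.
           case pt k of (d, x, y) \<Rightarrow>
             nums s ''point_kind'' k = subdiagram_code d \<and>
             vals s ''point_x'' k = x \<and> vals s ''point_y'' k = y) \<and>
        (\<forall>j < nums s ''arrow_count'' 0.
           nums s ''arrow_source'' j < nums s ''point_count'' 0 \<and>
           nums s ''arrow_target'' j < nums s ''point_count'' 0) \<and>
        bij_betw (\<lambda>j. (pt (nums s ''arrow_source'' j), pt (nums s ''arrow_target'' j)))
          {..<nums s ''arrow_count'' 0} A)"

end

theory Submission
  imports Defs
begin

text \<open>The tree of a wave arises from its critical items, read from left to right, by a stack scan as
  for Cartesian trees. At a maximum \<open>b\<close> two subtrees meet, and the lower minimum wins: the
  banana of the loser's minimum ends at \<open>b\<close>, while \<open>b\<close> is appended to one of the trails of the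
  winner's minimum. Keeping the last trail nodes of each stacked subtree makes every merge a
  constant number of pointer updates, and each maximum is merged once.

  The triple-panel windows are exactly these merges: the items inside the double-panel window of the
  merge at \<open>b\<close> are \<open>b\<close> and the items of the losing subtree, so two windows are nested iff one
  maximum lies in the losing subtree of the other. Hence each window has a single immediate
  successor, namely that of the minimum it loses to, and the arrow of a banana points to the
  banana on whose trail its upper end lies. A breadth-first search from the special root along the
  trails lists all points and arrows. The down-tree is the same for \<open>-f\<close>.\<close>

section \<open>Running times\<close>

text \<open>Everything is proved in the locale \<open>pl_wave\<close>, which is closed under
  negating \<open>f\<close> and under reflecting the domain. One argument thus serves both trees,
  both halves of the diagram and both orientations of a window; the programs handle
  \<open>- f\<close> by swapping the operands of comparisons, since only \<open>f\<close> is stored.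
  Completeness of the list of windows is obtained indirectly: a window is determined by its lower
  end, the lower end is a minimum other than the global one, and every such minimum loses exactly
  one merge. So it suffices to construct one window per merge. The construction works because the
  two subtrees meeting at \<open>b\<close> consist of the critical items visible from
  \<open>b\<close> on either side. In memory the obstacle is aliasing: all trails share the fields
  \<open>up\<close> and \<open>dn\<close>, and the scratch registers share the prefix of the tree.
  That a merge spares all finished bananas rests on the disjointness of the trails. Stack and queue
  loops are amortised by a potential. The bounds \<open>C * n\<close> have no additive term, so
  \<open>1 \<le> n\<close> is needed; it holds because the hooks keep the highest item away from the
  ends.\<close>

definition wp :: "prog \<Rightarrow> state \<Rightarrow> (nat \<Rightarrow> state \<Rightarrow> bool) \<Rightarrow> bool" where
  "wp p s Q \<longleftrightarrow> (\<exists>t s'. runs p s t s' \<and> Q t s')"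

inductive_cases runs_SkipE: "runs Skip s t s'"
inductive_cases runs_PutNumE: "runs (PutNum x d e) s t s'"
inductive_cases runs_PutValE: "runs (PutVal x d y e) s t s'"
inductive_cases runs_SeqE: "runs (Seq p q) s t s'"
inductive_cases runs_CondE: "runs (Cond b p q) s t s'"

lemma wp_Skip [simp]: "wp Skip s Q \<longleftrightarrow> Q 1 s"
  unfolding wp_def by (metis runs.Skip runs_SkipE)

lemma wp_PutNum [simp]: "wp (PutNum x d e) s Q \<longleftrightarrow> Q 1 (put_num x (num_of d s) (num_of e s) s)"
  unfolding wp_def by (metis runs.PutNum runs_PutNumE)

lemma wp_PutVal [simp]:
  "wp (PutVal x d y e) s Q \<longleftrightarrow> Q 1 (put_val x (num_of d s) (vals s y (num_of e s)) s)"
  unfolding wp_def by (metis runs.PutVal runs_PutValE)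

lemma wp_Seq [simp]:
  "wp (Seq p q) s Q \<longleftrightarrow> wp p s (\<lambda>t s'. wp q s' (\<lambda>u s''. Q (t + u) s''))"
  unfolding wp_def by (blast intro: runs.Seq elim: runs_SeqE)

lemma wp_Cond [simp]:
  "wp (Cond b p q) s Q \<longleftrightarrow>
     (if holds b s then wp p s (\<lambda>t. Q (1 + t)) else wp q s (\<lambda>t. Q (1 + t)))"
  unfolding wp_def using runs.CondTrue[of b s p _ _ q] runs.CondFalse[of b s q _ _ p]
  by (auto elim!: runs_CondE; blast)

text \<open>Keeps the simplifier out of the continuation until the intermediate state is known.\<close>

lemma wp_cong [cong]: "s = s' \<Longrightarrow> wp p s Q \<longleftrightarrow> wp p s' Q"
  by simp

lemma wp_mono: "wp p s Q \<Longrightarrow> (\<And>t s'. Q t s' \<Longrightarrow> Q' t s') \<Longrightarrow> wp p s Q'"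
  unfolding wp_def by blast

text \<open>The potential method: a logical value \<open>x\<close> describes the state, and each
  round pays for its body and its test by a drop of \<open>\<Phi>\<close>. The drop is at least one,
  so the induction on \<open>\<Phi> x\<close> also yields termination. Potential that is left at the
  exit stays available to later loops, and the extra 1 is the failing test.\<close>

lemma wp_While:
  assumes step: "\<And>x s. I x s \<Longrightarrow> holds b s \<Longrightarrow> wp p s (\<lambda>t s'. \<exists>y. I y s' \<and> t + 1 + \<Phi> y \<le> \<Phi> x)"
    and "I x s"
  shows "wp (While b p) s (\<lambda>t s'. \<exists>y. I y s' \<and> \<not> holds b s' \<and> t + \<Phi> y \<le> \<Phi> x + (1::nat))"
  using \<open>I x s\<close>
proof (induction "\<Phi> x" arbitrary: x s rule: less_induct)
  case less
  show ?case
  proof (cases "holds b s")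
    case True
    from step[OF less.prems True] obtain t s' y
      where 1: "runs p s t s'" "I y s'" "t + 1 + \<Phi> y \<le> \<Phi> x" unfolding wp_def by blast
    have "\<Phi> y < \<Phi> x" using 1 by simp
    from less.hyps[OF this 1(2)] obtain u s'' z
      where 2: "runs (While b p) s' u s''" "I z s''" "\<not> holds b s''" "u + \<Phi> z \<le> \<Phi> y + 1"
      unfolding wp_def by blast
    have "runs (While b p) s (1 + t + u) s''" using runs.WhileTrue[OF True 1(1) 2(1)] .
    moreover have "1 + t + u + \<Phi> z \<le> \<Phi> x + 1" using 1(3) 2(4) by simp
    ultimately show ?thesis unfolding wp_def using 2 by blast
  next
    case False
    then show ?thesis unfolding wp_def using less.prems runs.WhileFalse[OF False] by fastforce
  qed
qed

section \<open>State updates and the arrays a program may write\<close>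

lemma nums_put_num [simp]:
  "nums (put_num x i k s) y j = (if y = x \<and> j = i then k else nums s y j)"
  and vals_put_num [simp]: "vals (put_num x i k s) = vals s"
  and nums_put_val [simp]: "nums (put_val x i r s) = nums s"
  and vals_put_val [simp]:
  "vals (put_val x i r s) y j = (if y = x \<and> j = i then r else vals s y j)"
  by (auto simp: put_num_def put_val_def)

fun writes_num :: "prog \<Rightarrow> string set" where
  "writes_num Skip = {}"
| "writes_num (PutNum x d e) = {x}"
| "writes_num (PutVal x d y e) = {}"
| "writes_num (Seq p q) = writes_num p \<union> writes_num q"
| "writes_num (Cond b p q) = writes_num p \<union> writes_num q"
| "writes_num (While b p) = writes_num p"

fun writes_val :: "prog \<Rightarrow> string set" where
  "writes_val Skip = {}"
| "writes_val (PutNum x d e) = {}"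
| "writes_val (PutVal x d y e) = {x}"
| "writes_val (Seq p q) = writes_val p \<union> writes_val q"
| "writes_val (Cond b p q) = writes_val p \<union> writes_val q"
| "writes_val (While b p) = writes_val p"

text \<open>Arrays are named statically, so an array that is the target of no assignment survives
  every run. This carries facts about unrelated arrays across a whole program without listing them
  in its invariants.\<close>

lemma runs_frame:
  assumes "runs p s t s'"
  shows "(x \<notin> writes_num p \<longrightarrow> nums s' x = nums s x) \<and> (x \<notin> writes_val p \<longrightarrow> vals s' x = vals s x)"
  using assms by induction (auto simp: put_num_def put_val_def)

lemma wp_frame:
  assumes "wp p s Q"
  shows "wp p s (\<lambda>t s'. Q t s' \<and> (\<forall>x. x \<notin> writes_num p \<longrightarrow> nums s' x = nums s x) \<and>
           (\<forall>x. x \<notin> writes_val p \<longrightarrow> vals s' x = vals s x))"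
  using assms runs_frame unfolding wp_def by blast

section \<open>Full trees and their bananas\<close>

fun leaves :: "'a full_tree \<Rightarrow> 'a set" where
  "leaves (Tip a) = {a}"
| "leaves (Bin l b r) = leaves l \<union> leaves r"

fun inners :: "'a full_tree \<Rightarrow> 'a set" where
  "inners (Tip a) = {}"
| "inners (Bin l b r) = insert b (inners l \<union> inners r)"

lemma set_in_order: "set (in_order t) = items t"
  by (induction t) auto

lemma items_conv: "items t = leaves t \<union> inners t"
  by (induction t) auto

lemma in_order_nonempty [simp]: "in_order t \<noteq> []"
  by (cases t) auto

lemma root_in_items: "root t \<in> items t"
  by (cases t) auto

lemma finite_items [simp]: "finite (items t)"
  by (induction t) auto

lemma leaves_inners_disjoint: "distinct (in_order t) \<Longrightarrow> leaves t \<inter> inners t = {}"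
proof (induction t)
  case (Bin l b r)
  then have "leaves l \<inter> inners l = {}" "leaves r \<inter> inners r = {}"
    "items l \<inter> items r = {}" "b \<notin> items l" "b \<notin> items r"
    by (auto simp: set_in_order)
  then show ?case unfolding items_conv by auto
qed simp

lemma root_greatest: "increasing_upwards v t \<Longrightarrow> x \<in> items t \<Longrightarrow> v x \<le> v (root t)"
  by (induction t) fastforce+

text \<open>The largest item must be the root of both trees, and its position splits the in-order
  list into those of the two subtrees. This resolves the definite description in
  \<open>critical_tree\<close> and later identifies the tree left by the stack scan.\<close>

lemma increasing_tree_unique:
  assumes "in_order t = in_order t'" "increasing_upwards v t" "increasing_upwards v t'"
    "distinct (in_order t)" "inj_on v (items t)"
  shows "t = t'"
  using assms
proof (induction t arbitrary: t')
  case (Tip a)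
  then show ?case
    by (cases t') (auto simp: Cons_eq_append_conv)
next
  case (Bin l b r)
  show ?case
  proof (cases t')
    case (Tip a)
    then show ?thesis using Bin.prems(1) by (auto simp: append_eq_Cons_conv)
  next
    case t': (Bin l' b' r')
    have it: "items (Bin l b r) = items t'" using Bin.prems(1) set_in_order by metis
    \<comment> \<open>Each root is an item of the other tree and hence bounded by the other
      root.\<close>
    have "v b' \<le> v b" using root_greatest[OF Bin.prems(2), of b'] unfolding it t' by simp
    moreover have "b \<in> items t'" using it[symmetric] by simp
    then have "v b \<le> v b'" using root_greatest[OF Bin.prems(3), of b] t' by simp
    ultimately have "b = b'"
      using Bin.prems(5) it t' by (metis full_tree.set_intros(3) inj_onD order_antisym)
    moreover have "b \<notin> set (in_order l)" "b \<notin> set (in_order r)" using Bin.prems(4) by auto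
    ultimately have "in_order l = in_order l'" "in_order r = in_order r'"
      using Bin.prems(1) t' append_Cons_eq_iff[of b "in_order l" "in_order r"] by auto
    moreover have "inj_on v (items l)" "inj_on v (items r)"
      using Bin.prems(5) by (auto intro: inj_on_subset)
    ultimately show ?thesis using Bin.IH[of l'] Bin.IH(2)[of r'] Bin.prems t' \<open>b = b'\<close> by auto
  qed
qed

text \<open>Insertion into a Cartesian tree: a new maximum \<open>b\<close> with the minimum
  \<open>a\<close> to its right descends the right spine past all larger maxima and takes what lies
  below as its left subtree. The purpose is the existence of the critical tree; the program merges
  bottom up instead.\<close>

fun insert_right :: "('a \<Rightarrow> real) \<Rightarrow> 'a full_tree \<Rightarrow> 'a \<Rightarrow> 'a \<Rightarrow> 'a full_tree" where
  "insert_right v (Tip x) b a = Bin (Tip x) b (Tip a)"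
| "insert_right v (Bin l c r) b a =
     (if v c < v b then Bin (Bin l c r) b (Tip a) else Bin l c (insert_right v r b a))"

lemma in_order_insert_right [simp]: "in_order (insert_right v t b a) = in_order t @ [b, a]"
  by (induction t) auto

lemma leaves_insert_right: "leaves (insert_right v t b a) = insert a (leaves t)"
  and inners_insert_right: "inners (insert_right v t b a) = insert b (inners t)"
  by (induction t) auto

text \<open>The bound needed in the recursive case: an insertion into a right subtree cannot lift
  its root to the value of the parent. For a leaf the new root is \<open>b\<close> whatever the
  order of the values, hence the second alternative.\<close>

lemma root_insert_right: "v (root (insert_right v t b a)) = max (v b) (v (root t)) \<or> (\<exists>x. t = Tip x \<and> root (insert_right v t b a) = b)"
  by (cases t) auto

lemma increasing_insert_right:
  assumes "increasing_upwards v t" "v (last (in_order t)) < v b" "v a < v b" "v b \<notin> v ` items t"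
  shows "increasing_upwards v (insert_right v t b a)"
  using assms
proof (induction t)
  case (Bin l c r)
  show ?case
  proof (cases "v c < v b")
    case False
    then have "v b < v c" using Bin.prems(4) by force
    moreover have "increasing_upwards v (insert_right v r b a)"
      using Bin.IH(2) Bin.prems by (simp add: image_Un)
    ultimately show ?thesis using Bin.prems False root_insert_right[of v r b a] by (auto simp: max_def)
  qed (use Bin.prems in auto)
qed auto

subsection \<open>Merging order\<close>

fun low_leaf :: "('a \<Rightarrow> real) \<Rightarrow> 'a full_tree \<Rightarrow> 'a" where
  "low_leaf v (Tip a) = a"
| "low_leaf v (Bin l b r) =
     (if v (low_leaf v l) < v (low_leaf v r) then low_leaf v l else low_leaf v r)"

text \<open>The trails of the lowest leaf without their upper end, from the bottom up. If the left
  subtree wins, the path reaches \<open>b\<close> from its left child, which by the definition of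
  the trails puts \<open>b\<close> on the right trail; hence the apparent swap of sides.\<close>

fun lefts :: "('a \<Rightarrow> real) \<Rightarrow> 'a full_tree \<Rightarrow> 'a list" where
  "lefts v (Tip a) = [a]"
| "lefts v (Bin l b r) =
     (if v (low_leaf v l) < v (low_leaf v r) then lefts v l else lefts v r @ [b])"

fun rights :: "('a \<Rightarrow> real) \<Rightarrow> 'a full_tree \<Rightarrow> 'a list" where
  "rights v (Tip a) = [a]"
| "rights v (Bin l b r) =
     (if v (low_leaf v l) < v (low_leaf v r) then rights v l @ [b] else rights v r)"

text \<open>In a triple \<open>(b, w, u)\<close> the children of \<open>b\<close> are
  \<open>w\<close>, the loser, whose lowest leaf spans a banana ending at \<open>b\<close>, and
  \<open>u\<close>, the winner. Orientation is dropped on purpose: most later arguments are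
  symmetric in left and right.\<close>

fun merges :: "('a \<Rightarrow> real) \<Rightarrow> 'a full_tree \<Rightarrow> ('a \<times> 'a full_tree \<times> 'a full_tree) set" where
  "merges v (Tip a) = {}"
| "merges v (Bin l b r) =
     insert (if v (low_leaf v l) < v (low_leaf v r) then (b, r, l) else (b, l, r))
       (merges v l \<union> merges v r)"

definition banana_of :: "('a \<Rightarrow> real) \<Rightarrow> 'a \<Rightarrow> 'a full_tree \<Rightarrow> 'a \<times> 'a \<times> 'a list \<times> 'a list" where
  "banana_of v b w = (low_leaf v w, b, lefts v w @ [b], rights v w @ [b])"

text \<open>Every merge closes the banana of its loser. What is missing is the banana of the lowest
  leaf of the whole tree, whose upper end depends on what lies above \<open>t\<close>.\<close>

definition closed_bananas ::
    "('a \<Rightarrow> real) \<Rightarrow> 'a full_tree \<Rightarrow> ('a \<times> 'a \<times> 'a list \<times> 'a list) set" where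
  "closed_bananas v t = {banana_of v b w | b w u. (b, w, u) \<in> merges v t}"

lemma low_leaf_in_leaves: "low_leaf v t \<in> leaves t"
  by (induction t) auto

lemma low_leaf_in_items: "low_leaf v t \<in> items t"
  using low_leaf_in_leaves items_conv by fast

lemma low_leaf_least: "increasing_upwards v t \<Longrightarrow> x \<in> items t \<Longrightarrow> v (low_leaf v t) \<le> v x"
proof (induction t)
  case (Bin l b r)
  have "v (low_leaf v l) < v b"
    using root_greatest[of v l "low_leaf v l"] Bin.prems(1) low_leaf_in_items[of v l] by simp
  moreover have "v (low_leaf v r) < v b"
    using root_greatest[of v r "low_leaf v r"] Bin.prems(1) low_leaf_in_items[of v r] by simp
  ultimately show ?case using Bin by auto
qed simp

lemma hd_lefts: "hd (lefts v t) = low_leaf v t"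
  and hd_rights: "hd (rights v t) = low_leaf v t"
  and lefts_nonempty [simp]: "lefts v t \<noteq> []"
  and rights_nonempty [simp]: "rights v t \<noteq> []"
  by (induction t) auto

lemma set_tl_lefts: "set (tl (lefts v t)) \<subseteq> inners t"
  and set_tl_rights: "set (tl (rights v t)) \<subseteq> inners t"
  by (induction t) auto

lemma merges_items:
  "(b, w, u) \<in> merges v t \<Longrightarrow> b \<in> inners t \<and> items w \<subseteq> items t \<and> items u \<subseteq> items t \<and>
     leaves w \<subseteq> leaves t \<and> leaves u \<subseteq> leaves t \<and> inners w \<subseteq> inners t \<and> inners u \<subseteq> inners t"
  by (induction t) (auto split: if_splits)

lemma merges_node: "(b, w, u) \<in> merges v t \<Longrightarrow> b \<in> items t"
  by (induction t) (auto split: if_splits)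

text \<open>A leaf collects on its trails exactly the maxima at which it wins. So the inner trail
  nodes of a banana are the upper ends of the bananas whose arrows point to it, and the disjointness
  of the two trails lets them share pointer fields.\<close>

lemma trails_merge:
  assumes "distinct (in_order t)"
  shows "set (tl (lefts v t)) \<union> set (tl (rights v t)) = {b. \<exists>w u. (b, w, u) \<in> merges v t \<and> low_leaf v u = low_leaf v t}"
    and "distinct (tl (lefts v t) @ tl (rights v t))"
proof -
  have "set (tl (lefts v t)) \<union> set (tl (rights v t)) = {b. \<exists>w u. (b, w, u) \<in> merges v t \<and> low_leaf v u = low_leaf v t}
     \<and> distinct (tl (lefts v t) @ tl (rights v t))"
    using assms
  proof (induction t)
    case (Bin l b r)
    have d: "distinct (in_order l)" "distinct (in_order r)" "items l \<inter> items r = {}" "b \<notin> items l" "b \<notin> items r"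
      using Bin.prems by (auto simp: set_in_order)
    have no_r: "low_leaf v u \<noteq> low_leaf v l" if "(c, w, u) \<in> merges v r" for c w u
      using that merges_items[OF that] low_leaf_in_items[of v u] low_leaf_in_items[of v l] d(3) by auto
    have no_l: "low_leaf v u \<noteq> low_leaf v r" if "(c, w, u) \<in> merges v l" for c w u
      using that merges_items[OF that] low_leaf_in_items[of v u] low_leaf_in_items[of v r] d(3) by auto
    have nb: "b \<notin> set (tl (lefts v l))" "b \<notin> set (tl (lefts v r))"
      "b \<notin> set (tl (rights v l))" "b \<notin> set (tl (rights v r))"
      using d(4,5) set_tl_lefts[of v] set_tl_rights[of v] items_conv by fast+
    show ?case
      using Bin.IH(1)[OF d(1)] Bin.IH(2)[OF d(2)] nb
      by (cases "v (low_leaf v l) < v (low_leaf v r)") (auto dest: no_l no_r)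
  qed simp
  then show "set (tl (lefts v t)) \<union> set (tl (rights v t)) = {b. \<exists>w u. (b, w, u) \<in> merges v t \<and> low_leaf v u = low_leaf v t}"
    "distinct (tl (lefts v t) @ tl (rights v t))" by auto
qed

lemma inner_merge: "b \<in> inners t \<Longrightarrow> \<exists>w u. (b, w, u) \<in> merges v t"
  by (induction t) (auto split: if_splits)

text \<open>A leaf that is not the lowest one at the top must stop being lowest at some node on the
  way up, and there it loses.\<close>

lemma leaf_merge:
  "a \<in> leaves t \<Longrightarrow> a \<noteq> low_leaf v t \<Longrightarrow> \<exists>b w u. (b, w, u) \<in> merges v t \<and> a = low_leaf v w"
proof (induction t)
  case (Bin l b r)
  show ?case
  proof (cases "a = low_leaf v l \<or> a = low_leaf v r")
    case True
    then show ?thesis using Bin.prems(2)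
      by (cases "v (low_leaf v l) < v (low_leaf v r)") force+
  next
    case False
    have "a \<in> leaves l \<or> a \<in> leaves r" using Bin.prems(1) by simp
    then have "\<exists>c w u. (c, w, u) \<in> merges v l \<union> merges v r \<and> a = low_leaf v w"
      using Bin.IH False by (elim disjE) (blast+)
    then obtain c w u where "(c, w, u) \<in> merges v l \<union> merges v r" "a = low_leaf v w"
      by (elim exE conjE)
    then show ?thesis by (intro exI[of _ c] exI[of _ w] exI[of _ u]) auto
  qed
qed simp

lemma merge_node_unique:
  assumes "(b, w, u) \<in> merges v t" "(b, w', u') \<in> merges v t" "distinct (in_order t)"
  shows "w' = w \<and> u' = u"
  using assms
proof (induction t)
  case (Bin l c r)
  have d: "distinct (in_order l)" "distinct (in_order r)" "items l \<inter> items r = {}" "c \<notin> items l" "c \<notin> items r"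
    using Bin.prems by (auto simp: set_in_order)
  have "x \<in> items s" if "(x, y, z) \<in> merges v s" for x y z s
    using merges_node[OF that] .
  then have "(b, w, u) \<in> merges v l \<and> (b, w', u') \<in> merges v l \<or>
      (b, w, u) \<in> merges v r \<and> (b, w', u') \<in> merges v r \<or>
      b = c \<and> (b, w, u) \<notin> merges v l \<union> merges v r \<and> (b, w', u') \<notin> merges v l \<union> merges v r"
    using Bin.prems(1,2) d(3,4,5) by (simp split: if_splits) blast+
  then show ?case
  proof (elim disjE)
    assume "b = c \<and> (b, w, u) \<notin> merges v l \<union> merges v r \<and> (b, w', u') \<notin> merges v l \<union> merges v r"
    then show ?thesis using Bin.prems(1,2) by (simp split: if_splits)
  qed (use Bin.IH d in blast)+
qed simp

lemma merge_low_leaf: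
  assumes "(b, w, u) \<in> merges v t" "distinct (in_order t)"
  shows "low_leaf v w \<noteq> low_leaf v t"
  using assms
proof (induction t)
  case (Bin l c r)
  have d: "distinct (in_order l)" "distinct (in_order r)" "items l \<inter> items r = {}"
    using Bin.prems by (auto simp: set_in_order)
  have lr: "low_leaf v l \<noteq> low_leaf v r"
    using d(3) low_leaf_in_items by (metis IntI empty_iff)
  have l: "low_leaf v w \<noteq> low_leaf v r" if "(b, w, u) \<in> merges v l"
    using d(3) merges_items[OF that] low_leaf_in_items[of v w] low_leaf_in_items[of v r] by auto
  have r: "low_leaf v w \<noteq> low_leaf v l" if "(b, w, u) \<in> merges v r"
    using d(3) merges_items[OF that] low_leaf_in_items[of v w] low_leaf_in_items[of v l] by auto
  show ?case using Bin.prems(1) Bin.IH d lr l r by (auto split: if_splits)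
qed simp

text \<open>After losing, a leaf is never again the lowest of a subtree further up, and disjoint
  subtrees have different leaves. So a minimum identifies its banana.\<close>

lemma merge_unique:
  assumes "(b, w, u) \<in> merges v t" "(b', w', u') \<in> merges v t" "distinct (in_order t)"
    "low_leaf v w = low_leaf v w'"
  shows "b' = b \<and> w' = w \<and> u' = u"
  using assms
proof (induction t)
  case (Bin l c r)
  have d: "distinct (in_order l)" "distinct (in_order r)" "items l \<inter> items r = {}"
    using Bin.prems by (auto simp: set_in_order)
  have lr: "low_leaf v l \<noteq> low_leaf v r"
    using d(3) low_leaf_in_items by (metis IntI empty_iff)
  have l: "low_leaf v w \<noteq> low_leaf v l \<and> low_leaf v w \<in> items l" if "(b, w, u) \<in> merges v l" for b w u
    using merges_items[OF that] low_leaf_in_items[of v w] merge_low_leaf[OF that d(1)] by auto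
  have r: "low_leaf v w \<noteq> low_leaf v r \<and> low_leaf v w \<in> items r" if "(b, w, u) \<in> merges v r" for b w u
    using merges_items[OF that] low_leaf_in_items[of v w] merge_low_leaf[OF that d(2)] by auto
  let ?k = "if v (low_leaf v l) < v (low_leaf v r) then (c, r, l) else (c, l, r)"
  have l': "(x, y, z) \<in> merges v l" if "(x, y, z) \<in> merges v (Bin l c r)"
    "low_leaf v y \<in> items l" "low_leaf v y \<noteq> low_leaf v l" for x y z
    using that r[of x y z] d(3) low_leaf_in_items[of v r] by (auto split: if_splits)
  have r': "(x, y, z) \<in> merges v r" if "(x, y, z) \<in> merges v (Bin l c r)"
    "low_leaf v y \<in> items r" "low_leaf v y \<noteq> low_leaf v r" for x y z
    using that l[of x y z] d(3) low_leaf_in_items[of v l] by (auto split: if_splits)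
  have "(b, w, u) \<in> merges v l \<or> (b, w, u) \<in> merges v r \<or> (b, w, u) = ?k"
    using Bin.prems(1) by auto
  then show ?case
  proof (elim disjE)
    assume *: "(b, w, u) \<in> merges v l"
    then have "(b', w', u') \<in> merges v l" using l' Bin.prems(2,4) l by metis
    then show ?thesis using Bin.IH(1) * d(1) Bin.prems(4) by blast
  next
    assume *: "(b, w, u) \<in> merges v r"
    then have "(b', w', u') \<in> merges v r" using r' Bin.prems(2,4) r by metis
    then show ?thesis using Bin.IH(2) * d(2) Bin.prems(4) by blast
  next
    assume *: "(b, w, u) = ?k"
    then have "low_leaf v w = low_leaf v l \<or> low_leaf v w = low_leaf v r" by (auto split: if_splits)
    then have "(b', w', u') \<notin> merges v l \<union> merges v r"
      using l r d(3) low_leaf_in_items Bin.prems(4) by (metis IntI UnE empty_iff)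
    then have "(b', w', u') = ?k" using Bin.prems(2) by auto
    then show ?thesis using * by (auto split: if_splits)
  qed
qed simp

lemma merges_subtree:
  "(b, w, u) \<in> merges v t \<Longrightarrow> merges v w \<subseteq> merges v t"
  by (induction t) (auto split: if_splits)

lemma distinct_merge:
  "(b, w, u) \<in> merges v t \<Longrightarrow> distinct (in_order t) \<Longrightarrow> distinct (in_order w)"
  by (induction t) (auto split: if_splits)

lemma merge_values:
  assumes "(b, w, u) \<in> merges v t" "increasing_upwards v t"
  shows "(\<forall>x \<in> items w \<union> items u. v x < v b) \<and> v (low_leaf v u) \<le> v (low_leaf v w) \<and>
    increasing_upwards v w \<and> increasing_upwards v u"
  using assms
proof (induction t)
  case (Bin l c r)
  have "v x < v c" if "x \<in> items l \<union> items r" for x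
    using that root_greatest[of v l x] root_greatest[of v r x] Bin.prems(2) by force
  then show ?case using Bin by (auto split: if_splits)
qed simp

text \<open>The winner at \<open>b\<close> stays the lowest leaf of every subtree from
  \<open>u\<close> up to the one in which it loses, and that one contains \<open>b\<close>. This is
  the parent relation of bananas; \<open>b \<in> items w'\<close> is the form in which the nesting
  of windows is expressed later.\<close>

lemma winner_dies_above:
  assumes "(b, w, u) \<in> merges v t"
  shows "low_leaf v u = low_leaf v t \<or>
    (\<exists>b' w' u'. (b', w', u') \<in> merges v t \<and> low_leaf v w' = low_leaf v u \<and> b \<in> items w')"
  using assms
proof (induction t)
  case (Bin l c r)
  note i = merges_node
  consider "(b, w, u) \<in> merges v l" | "(b, w, u) \<in> merges v r"
    | "u = (if v (low_leaf v l) < v (low_leaf v r) then l else r)"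
    using Bin.prems by (auto split: if_splits)
  then show ?case
  proof cases
    case 1
    show ?thesis
    proof (cases "low_leaf v u = low_leaf v l \<and> \<not> v (low_leaf v l) < v (low_leaf v r)")
      case True
      then show ?thesis using i[OF 1] by (intro disjI2 exI[of _ c] exI[of _ l] exI[of _ r]) auto
    next
      case False
      then show ?thesis using Bin.IH(1)[OF 1] by auto
    qed
  next
    case 2
    show ?thesis
    proof (cases "low_leaf v u = low_leaf v r \<and> v (low_leaf v l) < v (low_leaf v r)")
      case True
      then show ?thesis using i[OF 2] by (intro disjI2 exI[of _ c] exI[of _ r] exI[of _ l]) auto
    next
      case False
      then show ?thesis using Bin.IH(2)[OF 2] by auto
    qed
  qed auto
qed simp

text \<open>An internal node of \<open>t\<close> that occurs in a subtree is an internal node there,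
  so its merge is recorded in the subtree as well, and a node has only one merge.\<close>

lemma merge_inside:
  assumes "(b, w, u) \<in> merges v t" "(b', w', u') \<in> merges v t" "distinct (in_order t)" "b \<in> items w'"
  shows "(b, w, u) \<in> merges v w'"
proof -
  have "b \<in> inners t" "leaves w' \<subseteq> leaves t"
    using merges_items[OF assms(1)] merges_items[OF assms(2)] by blast+
  then have "b \<in> inners w'" using leaves_inners_disjoint[OF assms(3)] assms(4) items_conv by fast
  then obtain y z where yz: "(b, y, z) \<in> merges v w'" using inner_merge[of b w' v] by blast
  then show ?thesis using merge_node_unique[OF assms(1) _ assms(3)] merges_subtree[OF assms(2)] by blast
qed

text \<open>The lowest leaf of \<open>w\<close> is a leaf of \<open>w'\<close> but not its lowest
  one, because a leaf loses only once and \<open>b \<noteq> b'\<close>. So it loses inside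
  \<open>w'\<close>, and the place of its loss is \<open>b\<close>. This passes from the position of
  the lower end of a window to that of its upper end.\<close>

lemma merge_inside_low_leaf:
  assumes "(b, w, u) \<in> merges v t" "(b', w', u') \<in> merges v t" "distinct (in_order t)"
    "low_leaf v w \<in> items w'" "b \<noteq> b'"
  shows "b \<in> items w'"
proof -
  have "low_leaf v w \<in> leaves t" using low_leaf_in_leaves merges_items[OF assms(1)] by blast
  moreover have "inners w' \<subseteq> inners t" using merges_items[OF assms(2)] by blast
  ultimately have "low_leaf v w \<in> leaves w'"
    using leaves_inners_disjoint[OF assms(3)] assms(4) items_conv by fast
  moreover have "low_leaf v w \<noteq> low_leaf v w'" using merge_unique[OF assms(1,2,3)] assms(5) by blast
  ultimately obtain b2 w2 u2 where *: "(b2, w2, u2) \<in> merges v w'" "low_leaf v w = low_leaf v w2"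
    using leaf_merge by metis
  then have "b2 = b" using merge_unique[OF assms(1) _ assms(3)] merges_subtree[OF assms(2)] by blast
  then show ?thesis using merges_node[OF *(1)] by simp
qed

text \<open>The items adjacent to the subtree of \<open>b\<close> in the in-order list are ancestors
  of \<open>b\<close>, hence larger. Thus the two children are the maximal runs on either side of
  \<open>b\<close> before a larger value is met, a description that no longer mentions the
  tree.\<close>

lemma merge_context:
  assumes "(b, w, u) \<in> merges v t" "increasing_upwards v t"
  shows "\<exists>xs ys. (in_order t = xs @ in_order w @ b # in_order u @ ys \<or>
                 in_order t = xs @ in_order u @ b # in_order w @ ys) \<and>
           (xs \<noteq> [] \<longrightarrow> v b < v (last xs)) \<and> (ys \<noteq> [] \<longrightarrow> v b < v (hd ys))"
  using assms
proof (induction t)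
  case (Bin l c r)
  note i = merges_node
  have lt: "v x < v c" if "x \<in> items l \<union> items r" for x
    using that root_greatest[of v l x] root_greatest[of v r x] Bin.prems(2) by force
  consider (L) "(b, w, u) \<in> merges v l" | (R) "(b, w, u) \<in> merges v r"
    | (C) "b = c" "w = l \<and> u = r \<or> w = r \<and> u = l"
    using Bin.prems by (auto split: if_splits)
  then show ?case
  proof cases
    case L
    with Bin obtain xs ys where "in_order l = xs @ in_order w @ b # in_order u @ ys \<or>
                 in_order l = xs @ in_order u @ b # in_order w @ ys"
      "xs \<noteq> [] \<longrightarrow> v b < v (last xs)" "ys \<noteq> [] \<longrightarrow> v b < v (hd ys)" by auto
    then show ?thesis using lt i[OF L]
      by (intro exI[of _ xs] exI[of _ "ys @ c # in_order r"]) (auto simp: hd_append)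
  next
    case R
    with Bin obtain xs ys where "in_order r = xs @ in_order w @ b # in_order u @ ys \<or>
                 in_order r = xs @ in_order u @ b # in_order w @ ys"
      "xs \<noteq> [] \<longrightarrow> v b < v (last xs)" "ys \<noteq> [] \<longrightarrow> v b < v (hd ys)" by auto
    then show ?thesis using lt i[OF R]
      by (intro exI[of _ "in_order l @ c # xs"] exI[of _ ys]) auto
  next
    case C
    then show ?thesis by (intro exI[of _ "[]"]) auto
  qed
qed simp

subsection \<open>Spanned paths\<close>

text \<open>The banana of \<open>a\<close> computed inside an arbitrary subtree \<open>t\<close>,
  with \<open>\<beta>\<close> standing for whatever node lies above \<open>t\<close>. Sides are
  decided by the position of \<open>a\<close> instead of the membership of a child in the path,
  which makes induction over the tree possible.\<close>

definition spanned :: "(real \<Rightarrow> real) \<Rightarrow> nat \<Rightarrow> nat full_tree \<Rightarrow> nat \<Rightarrow> nat \<times> nat \<times> nat list \<times> nat list" where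
  "spanned f \<beta> t a =
    (let P = takeWhile (is_smallest f a) (ancestors t a);
         b = (case find (\<lambda>u. \<not> is_smallest f a u) (ancestors t a) of None \<Rightarrow> \<beta> | Some u \<Rightarrow> root u)
     in (a, b, a # map root (filter (\<lambda>u. a \<in> items (right_child u)) P) @ [b],
               a # map root (filter (\<lambda>u. a \<in> items (left_child u)) P) @ [b]))"

lemma find_append:
  "find P (xs @ ys) = (case find P xs of None \<Rightarrow> find P ys | Some x \<Rightarrow> Some x)"
  by (induction xs) auto

lemma ancestors_items: "u \<in> set (ancestors t a) \<Longrightarrow> items u \<subseteq> items t"
  by (induction t) (auto split: if_splits)

lemma is_smallest_low_leaf:
  assumes "increasing_upwards (\<lambda>i. f (real i)) t" "inj_on (\<lambda>i. f (real i)) (items t)" "a \<in> items t"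
  shows "is_smallest f a t \<longleftrightarrow> a = low_leaf (\<lambda>i. f (real i)) t"
  using low_leaf_least[OF assms(1)] low_leaf_in_items[of "\<lambda>i. f (real i)" t] assms(2,3)
  unfolding is_smallest_def by (metis inj_onD order_antisym)

lemma ancestors_low_leaf:
  assumes "increasing_upwards (\<lambda>i. f (real i)) t"
  shows "\<forall>u \<in> set (ancestors t (low_leaf (\<lambda>i. f (real i)) t)). is_smallest f (low_leaf (\<lambda>i. f (real i)) t) u"
  unfolding is_smallest_def using ancestors_items low_leaf_least[OF assms] by fast

text \<open>All ancestors count because the lowest leaf wins at each of them; the bottom-up order of
  \<open>ancestors\<close> is that of the trails.\<close>

lemma trails_ancestors:
  assumes "distinct (in_order t)" "a = low_leaf v t"
  shows "lefts v t = a # map root (filter (\<lambda>u. a \<in> items (right_child u)) (ancestors t a))"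
    "rights v t = a # map root (filter (\<lambda>u. a \<in> items (left_child u)) (ancestors t a))"
proof -
  have "lefts v t = a # map root (filter (\<lambda>u. a \<in> items (right_child u)) (ancestors t a)) \<and>
    rights v t = a # map root (filter (\<lambda>u. a \<in> items (left_child u)) (ancestors t a))"
    using assms
  proof (induction t arbitrary: a)
    case (Bin l b r)
    have d: "distinct (in_order l)" "distinct (in_order r)" "items l \<inter> items r = {}"
      using Bin.prems by (auto simp: set_in_order)
    show ?case
    proof (cases "v (low_leaf v l) < v (low_leaf v r)")
      case True
      then have "a \<in> items l" "a \<notin> items r" using Bin.prems(2) low_leaf_in_items[of v l] d(3) by auto
      then show ?thesis using True Bin.IH(1)[OF d(1)] Bin.prems(2) by simp
    next
      case False
      then have "a \<in> items r" "a \<notin> items l" using Bin.prems(2) low_leaf_in_items[of v r] d(3) by auto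
      then show ?thesis using False Bin.IH(2)[OF d(2)] Bin.prems(2) by simp
    qed
  qed simp
  then show "lefts v t = a # map root (filter (\<lambda>u. a \<in> items (right_child u)) (ancestors t a))"
    "rights v t = a # map root (filter (\<lambda>u. a \<in> items (left_child u)) (ancestors t a))" by auto
qed

lemma spanned_low_leaf:
  fixes f :: "real \<Rightarrow> real"
  defines "v \<equiv> \<lambda>i. f (real i)"
  assumes "increasing_upwards v t" "distinct (in_order t)"
  shows "spanned f \<beta> t (low_leaf v t) = banana_of v \<beta> t"
proof -
  define a where "a = low_leaf v t"
  have s: "\<forall>u \<in> set (ancestors t a). is_smallest f a u"
    using ancestors_low_leaf assms(2) unfolding a_def v_def by blast
  then have fnd: "find (\<lambda>u. \<not> is_smallest f a u) (ancestors t a) = None"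
    by (simp add: find_None_iff)
  have tw: "takeWhile (is_smallest f a) (ancestors t a) = ancestors t a"
    using s by (simp add: takeWhile_eq_all_conv)
  show ?thesis
    by (simp add: spanned_def banana_of_def Let_def trails_ancestors[OF assms(3) a_def] tw fnd
        flip: a_def)
qed

text \<open>The parameter \<open>\<beta>\<close> has to be arbitrary in the induction: a leaf that
  is the lowest in a child of \<open>b\<close> but loses at \<open>b\<close> has \<open>b\<close> as
  its upper end, so the child is treated with \<open>\<beta>\<close> replaced by
  \<open>b\<close>.\<close>

lemma spanned_closed_bananas:
  fixes f :: "real \<Rightarrow> real"
  defines "v \<equiv> \<lambda>i. f (real i)"
  assumes "increasing_upwards v t" "distinct (in_order t)" "inj_on v (items t)"
  shows "spanned f \<beta> t ` (leaves t - {low_leaf v t}) = closed_bananas v t"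
  using assms(2-)
proof (induction t arbitrary: \<beta>)
  case (Tip a)
  then show ?case by (simp add: closed_bananas_def)
next
  case (Bin l b r)
  let ?t = "Bin l b r"
  have d: "distinct (in_order l)" "distinct (in_order r)" "items l \<inter> items r = {}"
    "increasing_upwards v l" "increasing_upwards v r" "inj_on v (items l)" "inj_on v (items r)"
    using Bin.prems by (auto simp: set_in_order intro: inj_on_subset)
  \<comment> \<open>A leaf that is not the lowest of the whole tree has its upper end in the child
    \<open>s\<close> or at \<open>b\<close>. In the latter case the search fails in
    \<open>s\<close>, and the default value \<open>b\<close> is what the search finds one level
    up.\<close>
  have reduce: "spanned f \<beta> ?t a = spanned f b s a"
    if s: "s = l \<or> s = r" and a: "a \<in> leaves s" "a \<noteq> low_leaf v ?t" for s a
  proof -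
    have ai: "a \<in> items s" using a items_conv by fast
    then have anc: "ancestors ?t a = ancestors s a @ [?t]" using s d(3) by auto
    have big: "\<not> is_smallest f a ?t"
      using is_smallest_low_leaf[of f ?t a] Bin.prems ai s a(2) unfolding v_def by auto
    show ?thesis
    proof (cases "\<forall>u \<in> set (ancestors s a). is_smallest f a u")
      case True
      then have "find (\<lambda>u. \<not> is_smallest f a u) (ancestors s a) = None"
        by (simp add: find_None_iff)
      moreover have tw: "takeWhile (is_smallest f a) (ancestors s a) = ancestors s a"
        using True by (simp add: takeWhile_eq_all_conv)
      ultimately show ?thesis unfolding spanned_def anc using True big
        by (simp add: find_append takeWhile_append Let_def tw)
    next
      case False
      then obtain u where "find (\<lambda>u. \<not> is_smallest f a u) (ancestors s a) = Some u"
        by (meson find_None_iff not_None_eq)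
      then show ?thesis unfolding spanned_def anc using False
        by (auto simp: find_append takeWhile_append Let_def)
    qed
  qed
  have sub: "spanned f b s ` leaves s = insert (banana_of v b s) (closed_bananas v s)" if "s = l \<or> s = r" for s
  proof -
    have "spanned f b s ` leaves s = insert (spanned f b s (low_leaf v s)) (spanned f b s ` (leaves s - {low_leaf v s}))"
      using low_leaf_in_leaves[of v s] by auto
    then show ?thesis using that Bin.IH(1)[of b] Bin.IH(2)[of b] d spanned_low_leaf[of f s b] unfolding v_def by auto
  qed
  have nl: "low_leaf v r \<notin> leaves l" "low_leaf v l \<notin> leaves r"
    using d(3) low_leaf_in_items items_conv by (metis IntI UnI1 empty_iff)+
  show ?case
  proof (cases "v (low_leaf v l) < v (low_leaf v r)")
    case True
    then have e: "leaves ?t - {low_leaf v ?t} = (leaves l - {low_leaf v l}) \<union> leaves r"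
      using nl by auto
    have "spanned f \<beta> ?t ` (leaves ?t - {low_leaf v ?t}) =
      spanned f b l ` (leaves l - {low_leaf v l}) \<union> spanned f b r ` leaves r"
      unfolding e image_Un using reduce[of l] reduce[of r] True nl
      by (intro arg_cong2[where f = "(\<union>)"] image_cong refl) auto
    then show ?thesis unfolding sub[of r, simplified] Bin.IH(1)[OF d(4) d(1) d(6)]
      using True by (auto simp: closed_bananas_def)
  next
    case False
    then have e: "leaves ?t - {low_leaf v ?t} = leaves l \<union> (leaves r - {low_leaf v r})"
      using nl by auto
    have "spanned f \<beta> ?t ` (leaves ?t - {low_leaf v ?t}) =
      spanned f b l ` leaves l \<union> spanned f b r ` (leaves r - {low_leaf v r})"
      unfolding e image_Un using reduce[of l] reduce[of r] False nl
      by (intro arg_cong2[where f = "(\<union>)"] image_cong refl) auto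
    then show ?thesis unfolding sub[of l, simplified] Bin.IH(2)[OF d(5) d(2) d(7)]
      using False by (auto simp: closed_bananas_def)
  qed
qed

text \<open>The subtrees of the ancestors of \<open>a\<close> form a chain, so every ancestor below
  \<open>x\<close> lies in the child of \<open>x\<close> that contains \<open>a\<close>.\<close>

lemma ancestor_in_right_child:
  assumes "x \<in> set (ancestors t a)" "y \<in> set (ancestors t a)" "distinct (in_order t)" "a \<in> leaves t"
  shows "root y \<in> items (right_child x) \<Longrightarrow> a \<in> items (right_child x)"
    "root y \<in> items (left_child x) \<Longrightarrow> a \<in> items (left_child x)"
proof -
  have r: "root u \<in> items s \<and> items (left_child u) \<subseteq> items s \<and> items (right_child u) \<subseteq> items s"
    if "u \<in> set (ancestors s a)" for u s
    using that by (induction s) (auto split: if_splits)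
  have "(root y \<in> items (right_child x) \<longrightarrow> a \<in> items (right_child x)) \<and>
    (root y \<in> items (left_child x) \<longrightarrow> a \<in> items (left_child x))"
    using assms
  proof (induction t)
    case (Bin l b r)
    have d: "distinct (in_order l)" "distinct (in_order r)" "items l \<inter> items r = {}" "b \<notin> items l" "b \<notin> items r"
      using Bin.prems by (auto simp: set_in_order)
    have a: "a \<in> leaves l \<and> a \<in> items l \<and> a \<notin> items r \<or> a \<in> leaves r \<and> a \<in> items r \<and> a \<notin> items l"
      using Bin.prems(4) d(3) items_conv by fastforce
    then show ?case
    proof
      assume a: "a \<in> leaves l \<and> a \<in> items l \<and> a \<notin> items r"
      then have "x = Bin l b r \<or> x \<in> set (ancestors l a)" "y = Bin l b r \<or> y \<in> set (ancestors l a)"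
        using Bin.prems(1,2) by auto
      then show ?thesis using Bin.IH(1) a d r[of x l] r[of y l] by auto
    next
      assume a: "a \<in> leaves r \<and> a \<in> items r \<and> a \<notin> items l"
      then have "x = Bin l b r \<or> x \<in> set (ancestors r a)" "y = Bin l b r \<or> y \<in> set (ancestors r a)"
        using Bin.prems(1,2) by auto
      then show ?thesis using Bin.IH(2) a d r[of x r] r[of y r] by auto
    qed
  qed simp
  then show "root y \<in> items (right_child x) \<Longrightarrow> a \<in> items (right_child x)"
    "root y \<in> items (left_child x) \<Longrightarrow> a \<in> items (left_child x)" by blast+
qed

text \<open>The child of a path node towards \<open>a\<close> is the previous path node or
  \<open>a\<close> itself. A prefix of the ancestors that contains \<open>u\<close> contains all
  ancestors below \<open>u\<close> too.\<close>

lemma child_on_path: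
  assumes "u \<in> set (takeWhile P (ancestors t a))" "a \<in> leaves t" "distinct (in_order t)"
  shows "a \<in> items (right_child u) \<Longrightarrow>
      root (right_child u) \<in> insert a (root ` set (takeWhile P (ancestors t a)))"
    "a \<in> items (left_child u) \<Longrightarrow>
      root (left_child u) \<in> insert a (root ` set (takeWhile P (ancestors t a)))"
proof -
  let ?S = "\<lambda>t. insert a (root ` set (takeWhile P (ancestors t a)))"
  have sub: "root s \<in> ?S s" if "a \<in> leaves s" "\<forall>x \<in> set (ancestors s a). P x" for s
    using that by (cases s) (auto simp: takeWhile_append)
  have "(a \<in> items (right_child u) \<longrightarrow> root (right_child u) \<in> ?S t) \<and>
    (a \<in> items (left_child u) \<longrightarrow> root (left_child u) \<in> ?S t)"
    using assms
  proof (induction t)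
    case (Bin l b r)
    have d: "distinct (in_order l)" "distinct (in_order r)" "items l \<inter> items r = {}" "b \<notin> items l" "b \<notin> items r"
      using Bin.prems by (auto simp: set_in_order)
    have step: ?case if s: "s = l \<or> s = r" "a \<in> leaves s" "ancestors (Bin l b r) a = ancestors s a @ [Bin l b r]" for s
    proof (cases "\<forall>x \<in> set (ancestors s a). P x")
      case True
      then have tw: "takeWhile P (ancestors s a) = ancestors s a"
        by (simp add: takeWhile_eq_all_conv)
      consider "u \<in> set (ancestors s a)" | "u = Bin l b r" "P u"
        using Bin.prems(1) s(3) True by (auto simp: takeWhile_append split: if_splits)
      then show ?thesis
      proof cases
        case 1
        then have "(a \<in> items (right_child u) \<longrightarrow> root (right_child u) \<in> ?S s) \<and>
            (a \<in> items (left_child u) \<longrightarrow> root (left_child u) \<in> ?S s)"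
          using Bin.IH s d tw by metis
        then show ?thesis using s(3) True tw by (auto simp: takeWhile_append)
      next
        case 2
        have ai: "a \<in> items s" using s(2) items_conv by fast
        have "root s \<in> ?S s" using sub s(2) True by blast
        then have "root s \<in> ?S (Bin l b r)" using s(3) True tw by (auto simp: takeWhile_append)
        then show ?thesis using 2(1) s(1) ai d(3) by auto
      qed
    next
      case False
      then have tw: "takeWhile P (ancestors (Bin l b r) a) = takeWhile P (ancestors s a)"
        using s(3) False by (auto simp: takeWhile_append)
      then show ?thesis using Bin.IH s d Bin.prems(1) by metis
    qed
    have "a \<in> leaves l \<and> a \<in> items l \<and> a \<notin> items r \<or> a \<in> leaves r \<and> a \<in> items r \<and> a \<notin> items l"
      using Bin.prems(2) d(3) items_conv by fastforce
    then show ?case using step[of l] step[of r] by auto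
  qed simp
  then show "a \<in> items (right_child u) \<Longrightarrow> root (right_child u) \<in> ?S t"
    "a \<in> items (left_child u) \<Longrightarrow> root (left_child u) \<in> ?S t" by blast+
qed

lemma ancestor_items:
  "u \<in> set (ancestors t a) \<Longrightarrow> root u \<in> items t \<and> items (left_child u) \<subseteq> items t \<and> items (right_child u) \<subseteq> items t \<and>
    root (left_child u) \<in> items (left_child u) \<and> root (right_child u) \<in> items (right_child u)"
  by (induction t) (auto simp: root_in_items split: if_splits)

lemma banana_tree_eq:
  fixes f :: "real \<Rightarrow> real"
  defines "v \<equiv> \<lambda>i. f (real i)"
  assumes t: "t = critical_tree f N" and inc: "increasing_upwards v t"
    and d: "distinct (in_order t)" and inj: "inj_on v (items t)"
    and lv: "leaves t = {a. minimum f N a}" and bd: "Suc N \<notin> items t"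
  shows "banana_tree f N = insert (banana_of v (Suc N) t) (closed_bananas v t)"
proof -
  have sp: "(a, upper_end f N a, left_trail f N a, right_trail f N a) = spanned f (Suc N) t a"
    if a: "a \<in> leaves t" for a
  proof -
    let ?P = "takeWhile (is_smallest f a) (ancestors t a)"
    have ip: "inner_path f N a = ?P" unfolding inner_path_def t ..
    have ue: "upper_end f N a = Suc N \<or> (\<exists>u \<in> set (ancestors t a). upper_end f N a = root u)"
    proof (cases "find (\<lambda>u. \<not> is_smallest f a u) (ancestors t a)")
      case (Some u)
      then have "u \<in> set (ancestors t a)" by (auto simp: find_Some_iff)
      then show ?thesis unfolding upper_end_def t[symmetric] Some by auto
    qed (simp add: upper_end_def t[symmetric])
    have sub: "set ?P \<subseteq> set (ancestors t a)" by (auto dest: set_takeWhileD)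
    \<comment> \<open>The definition asks whether a child lies on the path, \<open>spanned\<close>
      whether \<open>a\<close> lies below that child. The upper end belongs to the path but causes
      no confusion: it is another ancestor or \<open>Suc N\<close>, which is not an item of the
      tree.\<close>
    have R: "root (right_child u) \<in> path_nodes f N a \<longleftrightarrow> a \<in> items (right_child u)"
      and L: "root (left_child u) \<in> path_nodes f N a \<longleftrightarrow> a \<in> items (left_child u)"
      if u: "u \<in> set ?P" for u
    proof -
      have ua: "u \<in> set (ancestors t a)" using sub u by blast
      note i = ancestor_items[OF ua]
      have *: "x = a \<or> (\<exists>y \<in> set (ancestors t a). x = root y) \<or> x = Suc N" if "x \<in> path_nodes f N a" for x
        using that ue sub unfolding path_nodes_def ip by auto
      have "a \<in> items (right_child u)" if "root (right_child u) \<in> path_nodes f N a"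
        using *[OF that] i bd ancestor_in_right_child(1)[OF ua _ d a] by (metis subsetD)
      then show "root (right_child u) \<in> path_nodes f N a \<longleftrightarrow> a \<in> items (right_child u)"
        using child_on_path(1)[OF u a d] unfolding path_nodes_def ip by auto
      have "a \<in> items (left_child u)" if "root (left_child u) \<in> path_nodes f N a"
        using *[OF that] i bd ancestor_in_right_child(2)[OF ua _ d a] by (metis subsetD)
      then show "root (left_child u) \<in> path_nodes f N a \<longleftrightarrow> a \<in> items (left_child u)"
        using child_on_path(2)[OF u a d] unfolding path_nodes_def ip by auto
    qed
    show ?thesis unfolding spanned_def Let_def left_trail_def right_trail_def ip
      using R L by (simp add: upper_end_def t[symmetric] cong: filter_cong)
  qed
  have "banana_tree f N = spanned f (Suc N) t ` leaves t"
  proof -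
    have "banana_tree f N = (\<lambda>a. (a, upper_end f N a, left_trail f N a, right_trail f N a)) ` leaves t"
      unfolding lv by (auto simp: banana_tree_def)
    then show ?thesis using sp by simp
  qed
  also have "\<dots> = insert (spanned f (Suc N) t (low_leaf v t)) (spanned f (Suc N) t ` (leaves t - {low_leaf v t}))"
    using low_leaf_in_leaves[of v t] by auto
  finally show ?thesis
    using spanned_low_leaf[of f t "Suc N"] spanned_closed_bananas[of f t "Suc N"] inc d inj
    unfolding v_def by simp
qed

section \<open>Piecewise linear waves\<close>

text \<open>Growth by a pair at the right end matches both the insertion of a pair into the tree and
  one round of the scan, and it makes the list start and end low.\<close>

inductive zigzag :: "('a \<Rightarrow> real) \<Rightarrow> ('a \<Rightarrow> bool) \<Rightarrow> ('a \<Rightarrow> bool) \<Rightarrow> 'a list \<Rightarrow> bool"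
  for v :: "'a \<Rightarrow> real" and lo hi :: "'a \<Rightarrow> bool" where
  single: "lo a \<Longrightarrow> zigzag v lo hi [a]"
| extend: "zigzag v lo hi xs \<Longrightarrow> v (last xs) < v b \<Longrightarrow> v a < v b \<Longrightarrow> hi b \<Longrightarrow> lo a \<Longrightarrow>
    zigzag v lo hi (xs @ [b, a])"

lemma zigzag_odd: "zigzag v lo hi xs \<Longrightarrow> odd (length xs)"
  by (induction rule: zigzag.induct) auto

lemma zigzag_nonempty: "zigzag v lo hi xs \<Longrightarrow> xs \<noteq> []"
  by (induction rule: zigzag.induct) auto

lemma zigzag_nth:
  "zigzag v lo hi xs \<Longrightarrow> 2 * i + 2 < length xs \<Longrightarrow>
    v (xs ! (2 * i)) < v (xs ! (2 * i + 1)) \<and> v (xs ! (2 * i + 2)) < v (xs ! (2 * i + 1))"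
proof (induction rule: zigzag.induct)
  case (extend xs b a)
  obtain k where k: "length xs = 2 * k + 1" using zigzag_odd[OF extend.hyps(1)] oddE by blast
  have "last xs = xs ! (2 * k)" using k last_conv_nth[of xs] zigzag_nonempty[OF extend.hyps(1)] by simp
  moreover have "i < k \<or> i = k" using extend.prems k by auto
  ultimately show ?case using extend k
    by (auto simp: nth_append)
qed simp

lemma zigzag_length:
  assumes "zigzag v lo hi xs" "distinct xs" "\<And>x. \<not> (lo x \<and> hi x)"
  shows "length xs = 2 * card {x \<in> set xs. hi x} + 1"
  using assms(1,2)
proof (induction rule: zigzag.induct)
  case (single a)
  then show ?case using assms(3) by (auto simp: card_eq_0_iff)
next
  case (extend xs b a)
  have "{x \<in> set (xs @ [b, a]). hi x} = insert b {x \<in> set xs. hi x}"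
    using extend.hyps assms(3) by auto
  then show ?case using extend by simp
qed

lemma zigzag_tree:
  assumes "zigzag v lo hi xs" "distinct xs" "inj_on v (set xs)"
  shows "\<exists>t. in_order t = xs \<and> increasing_upwards v t \<and> (\<forall>a \<in> leaves t. lo a) \<and> (\<forall>b \<in> inners t. hi b)"
  using assms
proof (induction rule: zigzag.induct)
  case (single a)
  then show ?case by (intro exI[of _ "Tip a"]) simp
next
  case (extend xs b a)
  then obtain t where t: "in_order t = xs" "increasing_upwards v t" "\<forall>a \<in> leaves t. lo a" "\<forall>b \<in> inners t. hi b"
    by (auto intro: inj_on_subset)
  have "v b \<notin> v ` items t"
    using extend.prems t(1) set_in_order[of t] by (auto simp: inj_on_def)
  then have "increasing_upwards v (insert_right v t b a)"
    using increasing_insert_right t extend.hyps by metis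
  then show ?case using t extend.hyps
    by (intro exI[of _ "insert_right v t b a"]) (simp add: leaves_insert_right inners_insert_right)
qed

text \<open>Of the map of a list, only linearity between neighbouring items and distinct item values
  are kept. These properties survive negation and reflection; the hooks enter only through the
  existence of maxima.\<close>

locale pl_wave =
  fixes f :: "real \<Rightarrow> real" and N :: nat
  assumes N_pos: "0 < N"
    and inj_items: "inj_on (\<lambda>i. f (real i)) {0..N}"
    and affine: "\<And>i t. i < N \<Longrightarrow> real i \<le> t \<Longrightarrow> t \<le> real (Suc i) \<Longrightarrow>
      f t = f (real i) + (t - real i) * (f (real (Suc i)) - f (real i))"
begin

abbreviation v :: "nat \<Rightarrow> real" where "v \<equiv> \<lambda>i. f (real i)"

abbreviation cl :: "nat \<Rightarrow> nat list" where "cl k \<equiv> filter (critical f N) [0..<k]"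

abbreviation zz :: "nat list \<Rightarrow> bool" where
  "zz \<equiv> zigzag v (minimum f N) (maximum f N)"

lemma v_neq: "i \<le> N \<Longrightarrow> j \<le> N \<Longrightarrow> i \<noteq> j \<Longrightarrow> v i \<noteq> v j"
  using inj_items unfolding inj_on_def by auto

lemma min_max_exclusive: "\<not> (minimum f N i \<and> maximum f N i)"
  unfolding minimum_def maximum_def by force

text \<open>The invariant follows the direction of the last step into \<open>k\<close>. While
  rising, the critical items found so far form a complete zigzag ending below the current value;
  while falling, a maximum is pending after a complete zigzag, or nothing has been found yet. The
  last conjunct records that an initial descent ends below its start, which later lets the program
  recognise a left end that is not a minimum.\<close>

lemma scan:
  assumes "0 < k" "k \<le> N"
  shows "(v (k - 1) < v k \<longrightarrow> zz (cl k) \<and> v (last (cl k)) < v k) \<and>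
    (v k < v (k - 1) \<longrightarrow> cl k = [] \<and> v k < v 0 \<or>
      (\<exists>xs b. cl k = xs @ [b] \<and> zz xs \<and> v (last xs) < v b \<and> maximum f N b \<and> v k < v b)) \<and>
    (v 1 < v 0 \<longrightarrow> cl k \<noteq> [] \<longrightarrow> v (hd (cl k)) < v 0)"
  using assms
proof (induction k)
  case (Suc k)
  show ?case
  proof (cases "k = 0")
    case True
    have "minimum f N 0 \<longleftrightarrow> v 0 < v 1" "\<not> maximum f N 0"
      unfolding minimum_def maximum_def using N_pos by auto
    then show ?thesis using True by (auto simp: critical_def intro: zigzag.single)
  next
    case False
    then have IH: "(v (k - 1) < v k \<longrightarrow> zz (cl k) \<and> v (last (cl k)) < v k) \<and>
      (v k < v (k - 1) \<longrightarrow> cl k = [] \<and> v k < v 0 \<or>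
        (\<exists>xs b. cl k = xs @ [b] \<and> zz xs \<and> v (last xs) < v b \<and> maximum f N b \<and> v k < v b)) \<and>
      (v 1 < v 0 \<longrightarrow> cl k \<noteq> [] \<longrightarrow> v (hd (cl k)) < v 0)"
      using Suc by simp
    have mi: "minimum f N k \<longleftrightarrow> v k < v (k - 1) \<and> v k < v (Suc k)"
      and ma: "maximum f N k \<longleftrightarrow> v (k - 1) < v k \<and> v (Suc k) < v k"
      unfolding minimum_def maximum_def using False Suc.prems by auto
    have ne: "v (k - 1) \<noteq> v k" "v k \<noteq> v (Suc k)"
      using v_neq[of "k - 1" k] v_neq[of k "Suc k"] False Suc.prems by auto
    have cS: "cl (Suc k) = cl k @ (if critical f N k then [k] else [])" by simp
    consider "v (k - 1) < v k" "v k < v (Suc k)" | "v (k - 1) < v k" "v (Suc k) < v k"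
      | "v k < v (k - 1)" "v (Suc k) < v k" | "v k < v (k - 1)" "v k < v (Suc k)"
      using ne by linarith
    then show ?thesis
    proof cases
      case 1
      then have "cl (Suc k) = cl k" using mi ma by (simp add: critical_def)
      then show ?thesis using IH 1 by (auto simp del: upt_Suc)
    next
      case 2
      then have c: "cl (Suc k) = cl k @ [k]" "maximum f N k" using mi ma by (simp_all add: critical_def)
      have z: "zz (cl k)" "v (last (cl k)) < v k" using IH 2 by auto
      have ne: "cl k \<noteq> []" by (rule zigzag_nonempty[OF z(1)])
      then have "hd (cl (Suc k)) = hd (cl k)" unfolding c(1) by (rule hd_append2)
      then show ?thesis using IH 2 c z ne by (auto simp del: upt_Suc)
    next
      case 3
      then have c: "cl (Suc k) = cl k" using mi ma by (simp add: critical_def)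
      show ?thesis using IH 3 unfolding c by force
    next
      case 4
      then have c: "cl (Suc k) = cl k @ [k]" "minimum f N k" using mi ma by (simp_all add: critical_def)
      have "cl k = [] \<and> v k < v 0 \<or>
        (\<exists>xs b. cl k = xs @ [b] \<and> zz xs \<and> v (last xs) < v b \<and> maximum f N b \<and> v k < v b)"
        using IH 4 by blast
      then show ?thesis
      proof (elim disjE exE conjE)
        assume "cl k = []" "v k < v 0"
        then show ?thesis unfolding c(1) using c(2) 4 by (auto intro: zigzag.single)
      next
        fix xs b assume *: "cl k = xs @ [b]" "zz xs" "v (last xs) < v b" "maximum f N b" "v k < v b"
        then have "zz (xs @ [b, k])" by (intro zigzag.extend c(2))
        then show ?thesis unfolding c(1) using IH * 4 by (auto simp: hd_append)
      qed
    qed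
  qed
qed simp

lemma critical_list_zigzag: "zz (critical_list f N)"
  and hd_critical_list: "v 1 < v 0 \<Longrightarrow> v (hd (critical_list f N)) < v 0"
proof -
  have e: "critical_list f N = cl N @ (if critical f N N then [N] else [])"
    unfolding critical_list_def by simp
  have mi: "minimum f N N \<longleftrightarrow> v N < v (N - 1)" and ma: "\<not> maximum f N N"
    unfolding minimum_def maximum_def using N_pos by auto
  note s = scan[OF N_pos order_refl]
  have ne: "v (N - 1) \<noteq> v N" using v_neq[of "N - 1" N] N_pos by auto
  have "zz (critical_list f N) \<and> (v 1 < v 0 \<longrightarrow> v (hd (critical_list f N)) < v 0)"
  proof (cases "v (N - 1) < v N")
    case True
    then have "critical_list f N = cl N" using mi ma unfolding e by (simp add: critical_def)
    then show ?thesis using s True zigzag_nonempty[of _ _ _ "cl N"] by auto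
  next
    case False
    then have lt: "v N < v (N - 1)" using ne by simp
    then have c: "critical_list f N = cl N @ [N]" "minimum f N N"
      using mi ma unfolding e by (simp_all add: critical_def)
    have "cl N = [] \<and> v N < v 0 \<or>
        (\<exists>xs b. cl N = xs @ [b] \<and> zz xs \<and> v (last xs) < v b \<and> maximum f N b \<and> v N < v b)"
      using s lt by blast
    then show ?thesis
    proof (elim disjE exE conjE)
      assume "cl N = []" "v N < v 0"
      then show ?thesis unfolding c(1) using c(2) by (auto intro: zigzag.single)
    next
      fix xs b assume *: "cl N = xs @ [b]" "zz xs" "v (last xs) < v b" "maximum f N b" "v N < v b"
      then have "zz (xs @ [b, N])" by (intro zigzag.extend c(2))
      then show ?thesis unfolding c(1) using s * by (auto simp: hd_append)
    qed
  qed
  then show "zz (critical_list f N)" "v 1 < v 0 \<Longrightarrow> v (hd (critical_list f N)) < v 0" by auto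
qed

lemma set_critical_list: "set (critical_list f N) = {i. critical f N i}"
  unfolding critical_list_def critical_def minimum_def maximum_def by (auto simp del: upt_Suc)

lemma critical_le: "critical f N i \<Longrightarrow> i \<le> N"
  unfolding critical_def minimum_def maximum_def by auto

lemma sorted_critical_list: "sorted_wrt (<) (critical_list f N)"
  unfolding critical_list_def by (intro sorted_wrt_filter sorted_wrt_upt)

lemma distinct_critical_list: "distinct (critical_list f N)"
  unfolding critical_list_def by simp

lemma inj_critical: "inj_on v {i. critical f N i}"
  using inj_items critical_le by (auto simp: inj_on_def)

text \<open>Minima and maxima alternate with a minimum at each end. This converts costs per critical
  item into costs per maximum.\<close>

lemma length_critical_list: "length (critical_list f N) = 2 * card {i. maximum f N i} + 1"
proof -
  have "{x \<in> set (critical_list f N). maximum f N x} = {i. maximum f N i}"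
    unfolding set_critical_list critical_def by auto
  then show ?thesis
    using zigzag_length[OF critical_list_zigzag distinct_critical_list min_max_exclusive] by simp
qed

text \<open>In the interior \<open>f\<close> and \<open>- f\<close> have the same critical items,
  and each end of the domain is a minimum of one of them. So both trees can be built from the same
  array, read with or without its first and last entry.\<close>

lemma kept_list_eq:
  "kept_list f N = (if minimum f N 0 then [] else [0]) @ critical_list f N @ (if minimum f N N then [] else [N])"
proof -
  have u: "[0..<Suc N] = 0 # [1..<N] @ [N]" using N_pos by (simp add: upt_rec[of 0])
  let ?g = "\<lambda>t. - f t"
  have i: "critical ?g N i \<longleftrightarrow> critical f N i" if "i \<in> set [1..<N]" for i
    using that unfolding critical_def minimum_def maximum_def by auto
  have 0: "critical f N 0 \<longleftrightarrow> minimum f N 0" "minimum f N 0 \<or> critical ?g N 0"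
    using v_neq[of 0 1] N_pos unfolding critical_def minimum_def maximum_def by auto
  have N1: "N - 1 \<noteq> N" using N_pos by simp
  have n: "critical f N N \<longleftrightarrow> minimum f N N" "minimum f N N \<or> critical ?g N N"
    using v_neq[OF _ _ N1] N_pos unfolding critical_def minimum_def maximum_def by auto
  have f: "filter (\<lambda>i. critical f N i \<or> critical ?g N i) [1..<N] = filter (critical f N) [1..<N]"
    using i by (intro filter_cong) auto
  show ?thesis unfolding kept_list_def critical_list_def u filter.simps filter_append f using 0 n by auto
qed

definition tree :: "nat full_tree" where "tree = critical_tree f N"

lemma tree: "in_order tree = critical_list f N" "increasing_upwards v tree"
  "leaves tree = {i. minimum f N i}" "inners tree = {i. maximum f N i}"
proof -
  obtain t where t: "in_order t = critical_list f N" "increasing_upwards v t"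
    "\<forall>a \<in> leaves t. minimum f N a" "\<forall>b \<in> inners t. maximum f N b"
    using zigzag_tree[OF critical_list_zigzag distinct_critical_list] inj_critical set_critical_list by auto
  have it: "items t = {i. critical f N i}" using set_in_order[of t] t(1) set_critical_list by simp
  have "tree = t"
    unfolding tree_def critical_tree_def
  proof (rule the_equality)
    show "t' = t" if "in_order t' = critical_list f N \<and> increasing_upwards v t'" for t'
      using increasing_tree_unique[of t t' v] that t distinct_critical_list inj_critical it by auto
  qed (use t in auto)
  moreover have "leaves t = {i. minimum f N i}" "inners t = {i. maximum f N i}"
    using t(3,4) it items_conv[of t] min_max_exclusive unfolding critical_def by blast+
  ultimately show "in_order tree = critical_list f N" "increasing_upwards v tree"
    "leaves tree = {i. minimum f N i}" "inners tree = {i. maximum f N i}" using t by auto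
qed

lemma items_tree: "items tree = {i. critical f N i}"
  using set_in_order[of tree] tree(1) set_critical_list by simp

lemma distinct_tree: "distinct (in_order tree)"
  using tree(1) distinct_critical_list by simp

lemma inj_tree: "inj_on v (items tree)"
  using items_tree inj_critical by simp

lemma banana_tree_tree:
  "banana_tree f N = insert (banana_of v (Suc N) tree) (closed_bananas v tree)"
proof -
  have "Suc N \<notin> items tree" using critical_le unfolding items_tree by force
  then show ?thesis
    using banana_tree_eq[OF tree_def tree(2) distinct_tree inj_tree tree(3)] by blast
qed

end

section \<open>Frames and windows\<close>

text \<open>A triple-panel window without connected components: it suffices that \<open>f\<close>
  keeps to the range of values over the interval and that each end is on a boundary level or at the
  end of the domain, because a generic map leaves the range immediately beyond.\<close>

definition frame_right :: "(real \<Rightarrow> real) \<Rightarrow> nat \<Rightarrow> nat \<Rightarrow> nat \<Rightarrow> real \<Rightarrow> real \<Rightarrow> bool" where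
  "frame_right f N a b x y \<longleftrightarrow> critical f N a \<and> critical f N b \<and> f (real a) < f (real b) \<and>
     0 \<le> x \<and> x \<le> real a \<and> a < b \<and> real b \<le> y \<and> y \<le> real N \<and>
     (\<forall>t \<in> {x..y}. f (real a) \<le> f t \<and> f t \<le> f (real b)) \<and>
     f y = f (real a) \<and> (x = 0 \<or> f x = f (real b))"

definition frame_left :: "(real \<Rightarrow> real) \<Rightarrow> nat \<Rightarrow> nat \<Rightarrow> nat \<Rightarrow> real \<Rightarrow> real \<Rightarrow> bool" where
  "frame_left f N a b x y \<longleftrightarrow> critical f N a \<and> critical f N b \<and> f (real a) < f (real b) \<and>
     0 \<le> x \<and> x \<le> real b \<and> b < a \<and> real a \<le> y \<and> y \<le> real N \<and>
     (\<forall>t \<in> {x..y}. f (real a) \<le> f t \<and> f t \<le> f (real b)) \<and>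
     f x = f (real a) \<and> (y = real N \<or> f y = f (real b))"

text \<open>What is seen from \<open>b\<close> to the left before a higher critical item blocks the
  view. At a maximum \<open>b\<close> of the tree this turns out to be its left subtree.\<close>

definition visible_left :: "(real \<Rightarrow> real) \<Rightarrow> nat \<Rightarrow> nat \<Rightarrow> nat set" where
  "visible_left f N b = {c. critical f N c \<and> c < b \<and>
     (\<forall>k. critical f N k \<and> c \<le> k \<and> k < b \<longrightarrow> f (real k) < f (real b))}"

definition visible_right :: "(real \<Rightarrow> real) \<Rightarrow> nat \<Rightarrow> nat \<Rightarrow> nat set" where
  "visible_right f N b = {c. critical f N c \<and> b < c \<and>
     (\<forall>k. critical f N k \<and> b < k \<and> k \<le> c \<longrightarrow> f (real k) < f (real b))}"

text \<open>Points outside \<open>S\<close> arbitrarily close beyond the ends are enough to cut off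
  the component; no gap of positive length next to the interval has to be exhibited.\<close>

lemma connected_component_interval:
  fixes S :: "real set"
  assumes "{x..y} \<subseteq> S" "a \<in> {x..y}"
    and l: "\<And>z. z < x \<Longrightarrow> \<exists>t. z < t \<and> t < x \<and> t \<notin> S"
    and r: "\<And>z. y < z \<Longrightarrow> \<exists>t. y < t \<and> t < z \<and> t \<notin> S"
  shows "connected_component_set S a = {x..y}"
proof
  show "{x..y} \<subseteq> connected_component_set S a"
    using assms(1,2) by (intro connected_component_maximal) auto
  let ?C = "connected_component_set S a"
  have C: "connected ?C" "?C \<subseteq> S" "a \<in> ?C"
    using assms(1,2) connected_component_subset by (auto intro: connected_component_refl)
  have iv: "t \<in> S" if "p \<in> ?C" "q \<in> ?C" "p \<le> t" "t \<le> q" for p q t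
    using C(1,2) that unfolding connected_iff_interval by blast
  show "?C \<subseteq> {x..y}"
  proof
    fix z assume z: "z \<in> ?C"
    have "\<not> z < x"
    proof
      assume "z < x"
      then obtain t where "z < t" "t < x" "t \<notin> S" using l by blast
      then show False using iv[OF z C(3), of t] assms(2) by auto
    qed
    moreover have "\<not> y < z"
    proof
      assume "y < z"
      then obtain t where "y < t" "t < z" "t \<notin> S" using r by blast
      then show False using iv[OF C(3) z, of t] assms(2) by auto
    qed
    ultimately show "z \<in> {x..y}" by auto
  qed
qed

section \<open>Linear interpolation and level crossings\<close>

context pl_wave
begin

lemma unit_interval:
  assumes "0 \<le> t" "t \<le> real N"
  obtains i where "i < N" "real i \<le> t" "t \<le> real (Suc i)"
proof (cases "t = real N")
  case True
  then show ?thesis using that[of "N - 1"] N_pos by auto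
next
  case False
  then have "real (nat \<lfloor>t\<rfloor>) \<le> t" "t < real (nat \<lfloor>t\<rfloor>) + 1" using assms by linarith+
  moreover from this have "nat \<lfloor>t\<rfloor> < N" using False assms by linarith
  ultimately show ?thesis using that[of "nat \<lfloor>t\<rfloor>"] unfolding of_nat_Suc by linarith
qed

lemma affine_diff:
  assumes "i < N" "real i \<le> s" "s \<le> real (Suc i)" "real i \<le> t" "t \<le> real (Suc i)"
  shows "f t - f s = (t - s) * (v (Suc i) - v i)"
  using affine[OF assms(1,2,3)] affine[OF assms(1,4,5)] by (simp add: algebra_simps)

lemma between:
  assumes "i < N" "real i \<le> t" "t \<le> real (Suc i)"
  shows "min (v i) (v (Suc i)) \<le> f t" "f t \<le> max (v i) (v (Suc i))"
proof -
  let ?d = "v (Suc i) - v i"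
  have e: "f t = v i + (t - real i) * ?d" "f t = v (Suc i) - (real (Suc i) - t) * ?d"
    using affine[OF assms] by (simp_all add: algebra_simps)
  have "min (v i) (v (Suc i)) \<le> f t \<and> f t \<le> max (v i) (v (Suc i))"
  proof (cases "0 \<le> ?d")
    case True
    then have "0 \<le> (t - real i) * ?d" "0 \<le> (real (Suc i) - t) * ?d" using assms by simp_all
    then show ?thesis using True e by linarith
  next
    case False
    then have "(t - real i) * ?d \<le> 0" "(real (Suc i) - t) * ?d \<le> 0"
      using assms by (simp_all add: mult_nonneg_nonpos)
    then show ?thesis using False e by linarith
  qed
  then show "min (v i) (v (Suc i)) \<le> f t" "f t \<le> max (v i) (v (Suc i))" by auto
qed

lemma crossing:
  assumes "i < N" "v i < B \<and> B < v (Suc i) \<or> v (Suc i) < B \<and> B < v i"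
  obtains t where "real i < t" "t < real (Suc i)" "f t = B"
proof -
  let ?d = "v (Suc i) - v i"
  let ?t = "real i + (B - v i) / ?d"
  have d: "?d \<noteq> 0" using assms by auto
  have "0 < (B - v i) / ?d" "(B - v i) / ?d < 1" using assms by (auto simp: field_simps zero_less_divide_iff)
  moreover from this have "f ?t = B" using affine[OF assms(1), of ?t] d by simp
  ultimately show ?thesis using that[of ?t] by simp
qed

lemma items_ge:
  assumes "j \<le> N" "\<And>k. i \<le> k \<Longrightarrow> k \<le> j \<Longrightarrow> A \<le> v k" "real i \<le> t" "t \<le> real j"
  shows "A \<le> f t"
proof -
  obtain k where k: "k < N" "real k \<le> t" "t \<le> real (Suc k)"
    using unit_interval[of t] assms by (metis of_nat_0_le_iff of_nat_le_iff order_trans)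
  show ?thesis
  proof (cases "t = real k \<or> t = real (Suc k)")
    case True
    then show ?thesis using assms(2)[of k] assms(2)[of "Suc k"] assms(3,4) by auto
  next
    case False
    then have "i \<le> k" "Suc k \<le> j" using k assms(3,4) by linarith+
    then show ?thesis using between(1)[OF k] assms(2)[of k] assms(2)[of "Suc k"] by auto
  qed
qed

lemma items_le:
  assumes "j \<le> N" "\<And>k. i \<le> k \<Longrightarrow> k \<le> j \<Longrightarrow> v k \<le> B" "real i \<le> t" "t \<le> real j"
  shows "f t \<le> B"
proof -
  obtain k where k: "k < N" "real k \<le> t" "t \<le> real (Suc k)"
    using unit_interval[of t] assms by (metis of_nat_0_le_iff of_nat_le_iff order_trans)
  show ?thesis
  proof (cases "t = real k \<or> t = real (Suc k)")
    case True
    then show ?thesis using assms(2)[of k] assms(2)[of "Suc k"] assms(3,4) by auto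
  next
    case False
    then have "i \<le> k" "Suc k \<le> j" using k assms(3,4) by linarith+
    then show ?thesis using between(2)[OF k] assms(2)[of k] assms(2)[of "Suc k"] by auto
  qed
qed

text \<open>Away from the items there is no local extremum: if \<open>f\<close> stays on one side of \<open>f y\<close> between \<open>c\<close>
  and \<open>y\<close>, it is on the other side immediately beyond \<open>y\<close>. The sign \<open>s\<close> selects the side.\<close>

lemma passes_through:
  assumes y: "0 < y" "y < real N" "\<And>k. k \<le> N \<Longrightarrow> y \<noteq> real k"
    and c: "\<And>t. min c y \<le> t \<Longrightarrow> t \<le> max c y \<Longrightarrow> s * f y \<le> s * f t" "c \<noteq> y" "s \<noteq> 0"
    and z: "(z - y) * (c - y) < 0"
  shows "\<exists>t. min y z < t \<and> t < max y z \<and> 0 \<le> t \<and> t \<le> real N \<and> s * f t < s * f y"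
proof -
  obtain i where i: "i < N" "real i \<le> y" "y \<le> real (Suc i)" using unit_interval[of y] y by auto
  have yi: "real i < y" "y < real (Suc i)" using i y(3)[of i] y(3)[of "Suc i"] by linarith+
  let ?\<sigma> = "v (Suc i) - v i"
  have \<sigma>: "?\<sigma> \<noteq> 0" using v_neq[of i "Suc i"] i(1) by auto
  have lin: "f t - f y = (t - y) * ?\<sigma>" if "real i \<le> t" "t \<le> real (Suc i)" for t
    using affine_diff[OF i that] .
  show ?thesis
  proof (cases "c < y")
    case True
    then have "y < z" using z by (simp add: mult_less_0_iff)
    \<comment> \<open>\<open>c\<close> is moved towards \<open>y\<close> into the unit interval of
      \<open>y\<close>, where the slope alone decides; comparing \<open>f t1\<close> with
      \<open>f y\<close> gives the sign of the slope.\<close>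
    define t1 where "t1 = max c (real i)"
    have t1: "c \<le> t1" "t1 < y" "real i \<le> t1" using True yi t1_def by auto
    have "s * f y \<le> s * f t1" using c(1)[of t1] t1 True by auto
    then have "0 \<le> s * (f t1 - f y)" by (simp add: right_diff_distrib)
    moreover have "f t1 - f y = (t1 - y) * ?\<sigma>" using lin[of t1] t1 yi by simp
    ultimately have "0 \<le> (t1 - y) * (s * ?\<sigma>)" by (simp add: mult.left_commute)
    then have neg: "s * ?\<sigma> < 0" using t1(2) c(3) \<sigma> by (metis diff_gt_0_iff_gt less_le minus_diff_eq mult_eq_0_iff mult_le_0_iff neg_less_0_iff_less not_le zero_le_mult_iff)
    define t where "t = (y + min z (real (Suc i))) / 2"
    have t: "y < t" "t < z" "t < real (Suc i)" using \<open>y < z\<close> yi unfolding t_def by (auto simp: min_def)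
    then have "f t - f y = (t - y) * ?\<sigma>" using lin[of t] yi by simp
    then have "s * (f t - f y) = (t - y) * (s * ?\<sigma>)" by simp
    also have "\<dots> < 0" using t(1) by (intro mult_pos_neg[OF _ neg]) simp
    finally have "s * (f t - f y) < 0" .
    moreover have "real (Suc i) \<le> real N" using i(1) by linarith
    ultimately show ?thesis using t yi \<open>y < z\<close> y by (intro exI[of _ t]) (auto simp: algebra_simps)
  next
    case False
    then have cy: "y < c" using c(2) by simp
    then have "z < y" using z by (simp add: mult_less_0_iff)
    define t1 where "t1 = min c (real (Suc i))"
    have t1: "t1 \<le> c" "y < t1" "t1 \<le> real (Suc i)" using cy yi t1_def by auto
    have "s * f y \<le> s * f t1" using c(1)[of t1] t1 cy by auto
    then have "0 \<le> s * (f t1 - f y)" by (simp add: right_diff_distrib)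
    moreover have "f t1 - f y = (t1 - y) * ?\<sigma>" using lin[of t1] t1 yi by simp
    ultimately have "0 \<le> (t1 - y) * (s * ?\<sigma>)" by (simp add: mult.left_commute)
    then have pos: "0 < s * ?\<sigma>" using t1(2) c(3) \<sigma> by (metis diff_gt_0_iff_gt less_le mult_eq_0_iff not_le zero_le_mult_iff)
    define t where "t = (y + max z (real i)) / 2"
    have t: "t < y" "z < t" "real i < t" using \<open>z < y\<close> yi unfolding t_def by (auto simp: max_def)
    then have "f t - f y = (t - y) * ?\<sigma>" using lin[of t] yi by simp
    then have "s * (f t - f y) = (t - y) * (s * ?\<sigma>)" by simp
    also have "\<dots> < 0" using t(1) by (intro mult_neg_pos[OF _ pos]) simp
    finally have "s * (f t - f y) < 0" .
    then show ?thesis using t yi i(1) \<open>z < y\<close> y by (intro exI[of _ t]) (auto simp: algebra_simps)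
  qed
qed

text \<open>Item values are distinct. Hence an end of a frame that shares the value of an item
  without being that item falls strictly between items, where \<open>passes_through\<close>
  applies.\<close>

lemma value_nonitem:
  assumes "f y = v a" "a \<le> N" "y \<noteq> real a" "k \<le> N"
  shows "y \<noteq> real k"
  using assms v_neq[of k a] by auto

lemma triple_panel_window_iff:
  "triple_panel_window f N a b x y \<longleftrightarrow> frame_right f N a b x y \<or> frame_left f N a b x y"
proof
  assume "triple_panel_window f N a b x y"
  then have s: "spans_frame f N a b x y"
    and o: "a < b \<and> f y = f (real a) \<and> (x = 0 \<or> f x = f (real b)) \<or>
      b < a \<and> f x = f (real a) \<and> (y = real N \<or> f y = f (real b))"
    unfolding triple_panel_window_def by auto
  have "{x..y} \<subseteq> {t \<in> {0..real N}. f t \<in> {f (real a)..f (real b)}}"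
    using s connected_component_subset unfolding spans_frame_def by blast
  then have *: "0 \<le> t \<and> t \<le> real N \<and> f (real a) \<le> f t \<and> f t \<le> f (real b)" if "t \<in> {x..y}" for t
    using that by auto
  have "x \<le> y" using s unfolding spans_frame_def by auto
  then show "frame_right f N a b x y \<or> frame_left f N a b x y"
    using s o *[of x] *[of y] * unfolding spans_frame_def frame_right_def frame_left_def by auto
next
  have main: "triple_panel_window f N a b x y"
    if c: "critical f N a" "critical f N b" "v a < v b" "0 \<le> x" "y \<le> real N" "real a \<in> {x..y}" "real b \<in> {x..y}"
      and m: "\<And>t. t \<in> {x..y} \<Longrightarrow> v a \<le> f t \<and> f t \<le> v b"
      and o: "a < b \<and> f y = v a \<and> (x = 0 \<or> f x = v b) \<or> b < a \<and> f x = v a \<and> (y = real N \<or> f y = v b)"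
  proof -
    let ?S = "{t \<in> {0..real N}. f t \<in> {v a..v b}}"
    have N: "a \<le> N" "b \<le> N" using critical_le c(1,2) by auto
    have xy: "x < y" using c(6,7) o by auto
    have "connected_component_set ?S (real a) = {x..y}"
    proof (rule connected_component_interval)
      show "{x..y} \<subseteq> ?S" using m c(4,5) by auto
      show "real a \<in> {x..y}" by fact
    next
      fix z assume z: "z < x"
      show "\<exists>t. z < t \<and> t < x \<and> t \<notin> ?S"
      proof (cases "x = 0")
        case True
        then show ?thesis using z by (intro exI[of _ "z/2"]) auto
      next
        case False
        \<comment> \<open>At \<open>x\<close> the map is on the level of \<open>a\<close> and has to
          fall below it, or on the level of \<open>b\<close> and has to rise above it. The sign
          \<open>s\<close> encodes which, and \<open>q\<close> is the item of that level.\<close>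
        obtain q and s :: real where q: "f x = v q" "q \<le> N" "x \<noteq> real q" "s = 1 \<and> q = a \<or> s = - 1 \<and> q = b"
          using o False c(6,7) N by (cases "a < b") auto
        have "\<exists>t. min x z < t \<and> t < max x z \<and> 0 \<le> t \<and> t \<le> real N \<and> s * f t < s * f x"
          using q(4) m c(4,5,6) xy z False value_nonitem[OF q(1-3)] q(1)
          by (intro passes_through[where c = y]) (auto simp: mult_less_0_iff)
        then show ?thesis using q z by auto
      qed
    next
      fix z assume z: "y < z"
      show "\<exists>t. y < t \<and> t < z \<and> t \<notin> ?S"
      proof (cases "y = real N")
        case True
        then show ?thesis using z by (intro exI[of _ "(y + z)/2"]) auto
      next
        case False
        obtain q and s :: real where q: "f y = v q" "q \<le> N" "y \<noteq> real q" "s = 1 \<and> q = a \<or> s = - 1 \<and> q = b"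
          using o False c(6,7) N by (cases "a < b") auto
        have "\<exists>t. min y z < t \<and> t < max y z \<and> 0 \<le> t \<and> t \<le> real N \<and> s * f t < s * f y"
          using q(4) m c(4,5,6) xy z False value_nonitem[OF q(1-3)] q(1) less_le[of y "real N"]
          by (intro passes_through[where c = x]) (auto simp: mult_less_0_iff)
        then show ?thesis using q z by auto
      qed
    qed
    then show ?thesis using c o unfolding triple_panel_window_def spans_frame_def by auto
  qed
  assume "frame_right f N a b x y \<or> frame_left f N a b x y"
  then show "triple_panel_window f N a b x y"
    unfolding frame_right_def frame_left_def by (elim disjE; intro main) auto
qed

lemma drops_after:
  assumes y: "f y = v q" "q \<le> N" "y \<noteq> real q" and c: "0 \<le> c" "c < y" "\<And>t. c \<le> t \<Longrightarrow> t \<le> y \<Longrightarrow> f y \<le> f t"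
    and z: "y < z" "z \<le> real N"
  shows "\<exists>t. y < t \<and> t < z \<and> f t < f y"
proof -
  have n: "y \<noteq> real k" if "k \<le> N" for k using value_nonitem[OF y that] .
  have "0 < y" "y < real N" using n[of 0] n[of N] c z by auto
  moreover have "(z - y) * (c - y) < 0" using c z by (simp add: mult_less_0_iff)
  ultimately have "\<exists>t. min y z < t \<and> t < max y z \<and> 0 \<le> t \<and> t \<le> real N \<and> 1 * f t < 1 * f y"
    using n c z by (intro passes_through[where c = c]) auto
  then show ?thesis using z by auto
qed

lemma drops_before:
  assumes y: "f y = v q" "q \<le> N" "y \<noteq> real q" and c: "c \<le> real N" "y < c" "\<And>t. y \<le> t \<Longrightarrow> t \<le> c \<Longrightarrow> f y \<le> f t"
    and z: "z < y" "0 \<le> z"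
  shows "\<exists>t. z < t \<and> t < y \<and> f t < f y"
proof -
  have n: "y \<noteq> real k" if "k \<le> N" for k using value_nonitem[OF y that] .
  have "0 < y" "y < real N" using n[of 0] n[of N] c z by auto
  moreover have "(z - y) * (c - y) < 0" using c z by (simp add: mult_less_0_iff)
  ultimately have "\<exists>t. min y z < t \<and> t < max y z \<and> 0 \<le> t \<and> t \<le> real N \<and> 1 * f t < 1 * f y"
    using n c z by (intro passes_through[where c = c]) auto
  then show ?thesis using z by auto
qed

lemma rises_before:
  assumes y: "f y = v q" "q \<le> N" "y \<noteq> real q" and c: "c \<le> real N" "y < c" "\<And>t. y \<le> t \<Longrightarrow> t \<le> c \<Longrightarrow> f t \<le> f y"
    and z: "z < y" "0 \<le> z"
  shows "\<exists>t. z < t \<and> t < y \<and> f y < f t"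
proof -
  have n: "y \<noteq> real k" if "k \<le> N" for k using value_nonitem[OF y that] .
  have "0 < y" "y < real N" using n[of 0] n[of N] c z by auto
  moreover have "(z - y) * (c - y) < 0" using c z by (simp add: mult_less_0_iff)
  ultimately have "\<exists>t. min y z < t \<and> t < max y z \<and> 0 \<le> t \<and> t \<le> real N \<and> (-1) * f t < (-1) * f y"
    using n c z by (intro passes_through[where c = c]) auto
  then show ?thesis using z by auto
qed

section \<open>The lower end determines the window\<close>

lemma frame_rightD:
  assumes "frame_right f N a b x y"
  shows "a \<le> N" "b \<le> N" "a < b" "0 \<le> x" "x \<le> real a" "real a < real b" "real b \<le> y" "y \<le> real N" "v a < v b"
    "f y = v a" "\<And>t. x \<le> t \<Longrightarrow> t \<le> y \<Longrightarrow> v a \<le> f t" "\<And>t. x \<le> t \<Longrightarrow> t \<le> y \<Longrightarrow> f t \<le> v b"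
    "x = 0 \<or> f x = v b"
  using assms critical_le unfolding frame_right_def by auto

lemma frame_leftD:
  assumes "frame_left f N a b x y"
  shows "a \<le> N" "b \<le> N" "b < a" "0 \<le> x" "x \<le> real b" "real b < real a" "real a \<le> y" "y \<le> real N" "v a < v b"
    "f x = v a" "\<And>t. x \<le> t \<Longrightarrow> t \<le> y \<Longrightarrow> v a \<le> f t" "\<And>t. x \<le> t \<Longrightarrow> t \<le> y \<Longrightarrow> f t \<le> v b"
    "y = real N \<or> f y = v b"
  using assms critical_le unfolding frame_left_def by auto

text \<open>The map falls below the level of \<open>a\<close> right after \<open>y\<close>. So
  \<open>y\<close> is the limit of every interval starting at \<open>a\<close> on which
  \<open>f\<close> does not go below \<open>f a\<close>, and depends on \<open>a\<close>
  alone.\<close>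

lemma frame_right_end:
  assumes r: "frame_right f N a b x y"
    and g: "\<And>t. real a \<le> t \<Longrightarrow> t \<le> z \<Longrightarrow> v a \<le> f t" and z: "z \<le> real N"
  shows "z \<le> y"
proof (rule ccontr)
  note d = frame_rightD[OF r]
  assume "\<not> z \<le> y"
  then have "\<exists>t. y < t \<and> t < z \<and> f t < f y"
    using d(1,5-8,10) z by (intro drops_after[of y a "real a"]) (use d(10,11) d(5) in auto)
  then obtain t where "y < t" "t < z" "f t < v a" using d(10) by auto
  then show False using g[of t] d(6,7) by linarith
qed

text \<open>The right end is fixed by \<open>a\<close>. Each of \<open>b\<close> and
  \<open>b'\<close> lies in the interval of the other frame and is bounded by its top, so the tops
  agree and \<open>b = b'\<close>. If the left ends differed, the longer frame would contain a point
  above the top just before the shorter one begins.\<close>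

lemma frame_right_unique:
  assumes "frame_right f N a b x y" "frame_right f N a b' x' y'"
  shows "b' = b \<and> x' = x \<and> y' = y"
proof -
  have *: "y' \<le> y \<and> v b \<le> v b' \<and> (b = b' \<longrightarrow> x \<le> x')"
    if r: "frame_right f N a b x y" "frame_right f N a b' x' y'" for b x y b' x' y'
  proof -
    note d = frame_rightD[OF r(1)] note d' = frame_rightD[OF r(2)]
    have y: "y' \<le> y" using d'(5,8) by (intro frame_right_end[OF r(1)] d'(11)) linarith+
    have y2: "y \<le> y'" using d(5,8) by (intro frame_right_end[OF r(2)] d(11)) linarith+
    have b: "v b \<le> v b'" using d(5,6,7) d'(5) y2 by (intro d'(12)) linarith+
    have "x \<le> x'" if e: "b = b'"
    proof (rule ccontr)
      assume "\<not> x \<le> x'"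
      then have l: "x' < x" by simp
      then have x: "x \<noteq> 0" "f x = v b" using d(13) d'(4) by auto
      have "\<exists>t. x' < t \<and> t < x \<and> f x < f t"
      proof (rule rises_before[of x b "real b"])
        fix t assume "x \<le> t" "t \<le> real b"
        then have "f t \<le> v b" using d(7) by (intro d(12)) linarith+
        then show "f t \<le> f x" using x by simp
      qed (use l x d(2,5-8) d'(4) in linarith)+
      then obtain t where t: "x' < t" "t < x" "v b < f t" using x by auto
      have "f t \<le> v b'" using t d(5,6) d'(6,7) by (intro d'(12)) linarith+
      then show False using t e by simp
    qed
    then show ?thesis using y b by blast
  qed
  have "v b = v b'" using *[OF assms] *[OF assms(2,1)] by simp
  then have "b = b'" using v_neq[of b b'] frame_rightD(2)[OF assms(1)] frame_rightD(2)[OF assms(2)] by blast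
  then show ?thesis using *[OF assms] *[OF assms(2,1)] by auto
qed

text \<open>Each frame reaches at least as far as the other on the side where it ends on the level
  of \<open>a\<close>. The remaining two ends are therefore not at the ends of the domain and lie on
  the levels of \<open>b\<close> and \<open>b'\<close>. Both tops then bound each other, forcing
  \<open>b = b'\<close>, which cannot lie on both sides of \<open>a\<close>.\<close>

lemma not_frame_right_left:
  assumes "frame_right f N a b x y" "frame_left f N a b' x' y'"
  shows False
proof -
  note d = frame_rightD[OF assms(1)] note d' = frame_leftD[OF assms(2)]
  have y: "y' \<le> y" using d'(4-8) by (intro frame_right_end[OF assms(1)] d'(11)) linarith+
  have x: "x' \<le> x"
  proof (rule ccontr)
    assume "\<not> x' \<le> x"
    then have l: "x < x'" by simp
    have "\<exists>t. x < t \<and> t < x' \<and> f t < f x'"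
    proof (rule drops_before[of x' a "real a"])
      fix t assume "x' \<le> t" "t \<le> real a"
      then have "v a \<le> f t" using d'(7) by (intro d'(11)) linarith+
      then show "f x' \<le> f t" using d'(10) by simp
    qed (use l d(1,4) d'(5-8,10) in linarith)+
    then obtain t where t: "x < t" "t < x'" "f t < v a" using d'(10) by auto
    have "v a \<le> f t" using t d(6,7) d'(5,6) by (intro d(11)) linarith+
    then show False using t by simp
  qed
  have "y \<noteq> real N" "x' \<noteq> 0"
    using value_nonitem[OF d(10) d(1), of N] value_nonitem[OF d'(10) d(1), of 0] d(6,7) d'(5,6) by auto
  then have "y' \<noteq> real N" "x \<noteq> 0" using x y d(8) d'(4) by auto
  then have "f y' = v b'" "f x = v b" using d(13) d'(13) by auto
  moreover have "f y' \<le> v b" using y d(5) d'(7) by (intro d(12)) linarith+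
  moreover have "f x \<le> v b'" using x d(5) d'(7) by (intro d'(12)) linarith+
  ultimately have "v b = v b'" by simp
  then have "b = b'" using v_neq[of b b'] d(2) d'(2) by blast
  then show False using d(3) d'(3) by simp
qed

end

section \<open>Reflection of the domain\<close>

lemma pl_wave_mirror:
  assumes "pl_wave f N"
  shows "pl_wave (\<lambda>t. f (real N - t)) N"
proof -
  interpret pl_wave f N by fact
  show ?thesis
  proof
    show "inj_on (\<lambda>i. f (real N - real i)) {0..N}"
    proof (rule inj_onI)
      fix i j assume *: "i \<in> {0..N}" "j \<in> {0..N}" "f (real N - real i) = f (real N - real j)"
      then have "v (N - i) = v (N - j)" by (simp add: of_nat_diff)
      then have "N - i = N - j" using v_neq[of "N - i" "N - j"] by auto
      then show "i = j" using * by auto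
    qed
  next
    fix i t assume *: "i < N" "real i \<le> t" "t \<le> real (Suc i)"
    let ?j = "N - Suc i"
    have j: "?j < N" "real ?j = real N - real (Suc i)" "real (Suc ?j) = real N - real i" using * by (auto simp: of_nat_diff)
    have "f (real N - t) - f (real (Suc ?j)) = (real N - t - real (Suc ?j)) * (v (Suc ?j) - v ?j)"
      using * j by (intro affine_diff) auto
    then show "f (real N - t) = f (real N - real i) + (t - real i) * (f (real N - real (Suc i)) - f (real N - real i))"
      unfolding j by (simp add: algebra_simps)
  qed (use N_pos in auto)
qed

lemma pl_wave_uminus: "pl_wave f N \<Longrightarrow> pl_wave (\<lambda>t. - f t) N"
  unfolding pl_wave_def inj_on_def by (auto simp: algebra_simps)

lemma minimum_mirror: "i \<le> N \<Longrightarrow> minimum (\<lambda>t. f (real N - t)) N (N - i) \<longleftrightarrow> minimum f N i"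
  unfolding minimum_def by (auto simp: of_nat_diff algebra_simps)

lemma maximum_mirror: "i \<le> N \<Longrightarrow> maximum (\<lambda>t. f (real N - t)) N (N - i) \<longleftrightarrow> maximum f N i"
  unfolding maximum_def by (auto simp: of_nat_diff algebra_simps)

lemma critical_mirror: "i \<le> N \<Longrightarrow> critical (\<lambda>t. f (real N - t)) N (N - i) \<longleftrightarrow> critical f N i"
  unfolding critical_def using minimum_mirror maximum_mirror by blast

lemma frame_left_mirror:
  assumes "a \<le> N" "b \<le> N"
  shows "frame_left f N a b x y \<longleftrightarrow>
    frame_right (\<lambda>t. f (real N - t)) N (N - a) (N - b) (real N - y) (real N - x)"
proof -
  have "(\<forall>t \<in> {real N - y..real N - x}. P (f (real N - t))) \<longleftrightarrow> (\<forall>t \<in> {x..y}. P (f t))" for P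
  proof safe
    fix t assume "\<forall>t \<in> {real N - y..real N - x}. P (f (real N - t))" "t \<in> {x..y}"
    then show "P (f t)" by (auto dest!: bspec[of _ _ "real N - t"])
  qed auto
  then have ball: "(\<forall>t \<in> {real N - y..real N - x}. f (real a) \<le> f (real N - t) \<and> f (real N - t) \<le> f (real b)) \<longleftrightarrow>
      (\<forall>t \<in> {x..y}. f (real a) \<le> f t \<and> f t \<le> f (real b))"
    by (rule meta_spec[of _ "\<lambda>z. f (real a) \<le> z \<and> z \<le> f (real b)"])
  have r: "real N - real (N - a) = real a" "real N - real (N - b) = real b"
    "real N - (real N - y) = y" "real N - (real N - x) = x" using assms by (auto simp: of_nat_diff)
  have i: "0 \<le> real N - y \<longleftrightarrow> y \<le> real N" "real N - y \<le> real (N - a) \<longleftrightarrow> real a \<le> y"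
    "N - a < N - b \<longleftrightarrow> b < a" "real (N - b) \<le> real N - x \<longleftrightarrow> x \<le> real b" "real N - x \<le> real N \<longleftrightarrow> 0 \<le> x"
    "real N - y = 0 \<longleftrightarrow> y = real N"
    using assms by (auto simp: of_nat_diff)
  show ?thesis
    unfolding frame_left_def frame_right_def r i ball critical_mirror[OF assms(1)] critical_mirror[OF assms(2)]
    by argo
qed

lemma visible_right_mirror:
  assumes "b \<le> N" "c \<le> N"
  shows "N - c \<in> visible_left (\<lambda>t. f (real N - t)) N (N - b) \<longleftrightarrow> c \<in> visible_right f N b"
proof -
  let ?g = "\<lambda>t. f (real N - t)"
  have all: "(\<forall>k. critical ?g N k \<longrightarrow> P k) \<longleftrightarrow> (\<forall>k. critical f N k \<longrightarrow> P (N - k))" for P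
  proof -
    have "critical ?g N k \<longleftrightarrow> k \<le> N \<and> critical f N (N - k)" for k
    proof (cases "k \<le> N")
      case True
      then show ?thesis using critical_mirror[of "N - k" N f] by simp
    next
      case False
      then show ?thesis unfolding critical_def minimum_def maximum_def by auto
    qed
    moreover have "k \<le> N" if "critical f N k" for k
      using that unfolding critical_def minimum_def maximum_def by auto
    ultimately show ?thesis by (metis diff_diff_cancel diff_le_self)
  qed
  have "(\<forall>k. critical ?g N k \<longrightarrow> N - c \<le> k \<and> k < N - b \<longrightarrow> ?g (real k) < ?g (real (N - b))) \<longleftrightarrow>
    (\<forall>k. critical f N k \<longrightarrow> N - c \<le> N - k \<and> N - k < N - b \<longrightarrow> ?g (real (N - k)) < ?g (real (N - b)))"
    by (rule all)
  also have "\<dots> \<longleftrightarrow> (\<forall>k. critical f N k \<longrightarrow> b < k \<and> k \<le> c \<longrightarrow> f (real k) < f (real b))"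
  proof -
    have kN: "k \<le> N" if "critical f N k" for k
      using that unfolding critical_def minimum_def maximum_def by auto
    have "(N - c \<le> N - k \<and> N - k < N - b \<longrightarrow> ?g (real (N - k)) < ?g (real (N - b))) \<longleftrightarrow>
      (b < k \<and> k \<le> c \<longrightarrow> f (real k) < f (real b))" if "critical f N k" for k
    proof -
      have "N - c \<le> N - k \<longleftrightarrow> k \<le> c" "N - k < N - b \<longleftrightarrow> b < k" using assms kN[OF that] by auto
      then show ?thesis using assms kN[OF that] by (auto simp: of_nat_diff)
    qed
    then show ?thesis by blast
  qed
  finally show ?thesis
    unfolding visible_left_def visible_right_def using critical_mirror[OF assms(2)] assms by auto
qed

section \<open>Existence of a frame where two subtrees meet\<close>

context pl_wave
begin

lemma item_argmin:
  assumes "i \<le> j"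
  obtains k where "i \<le> k" "k \<le> j" "\<And>l. i \<le> l \<Longrightarrow> l \<le> j \<Longrightarrow> v k \<le> v l"
  using ex_is_arg_min_if_finite[of "{i..j}" v] assms unfolding is_arg_min_linorder by auto

lemma item_argmax:
  assumes "i \<le> j"
  obtains k where "i \<le> k" "k \<le> j" "\<And>l. i \<le> l \<Longrightarrow> l \<le> j \<Longrightarrow> v l \<le> v k"
  using ex_is_arg_min_if_finite[of "{i..j}" "\<lambda>i. - v i"] assms unfolding is_arg_min_linorder by auto

lemma minimumI:
  assumes "k \<le> N" "0 < k \<Longrightarrow> v k \<le> v (k - 1)" "k < N \<Longrightarrow> v k \<le> v (Suc k)"
  shows "minimum f N k"
proof -
  have "0 < k \<Longrightarrow> v k \<noteq> v (k - 1)" "k < N \<Longrightarrow> v k \<noteq> v (k + 1)"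
    using v_neq[of k "k - 1"] v_neq[of k "k + 1"] assms(1) by (simp_all del: of_nat_add)
  then show ?thesis using assms unfolding minimum_def by (auto simp: order_le_less simp del: of_nat_diff)
qed

lemma maximumI:
  assumes "0 < k" "k < N" "v (k - 1) \<le> v k" "v (Suc k) \<le> v k"
  shows "maximum f N k"
proof -
  have "v (k - 1) \<noteq> v k" "v (k + 1) \<noteq> v k"
    using v_neq[of "k - 1" k] v_neq[of "k + 1" k] assms(1,2) by (simp_all del: of_nat_add)
  then show ?thesis using assms unfolding maximum_def by (auto simp: order_le_less simp del: of_nat_diff)
qed

text \<open>Visibility speaks of critical items only. The highest item between \<open>c\<close> and
  \<open>b\<close>, if it were not \<open>b\<close>, would be \<open>c\<close> or a maximum, so the
  bound extends to all items in between.\<close>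

lemma visible_left_le:
  assumes "c \<in> visible_left f N b" "c \<le> k" "k \<le> b" "b \<le> N"
  shows "v k \<le> v b"
proof -
  have cb: "critical f N c" "c < b" "\<And>k. critical f N k \<Longrightarrow> c \<le> k \<Longrightarrow> k < b \<Longrightarrow> v k < v b"
    using assms(1) unfolding visible_left_def by auto
  obtain m where m: "c \<le> m" "m \<le> b" "\<And>l. c \<le> l \<Longrightarrow> l \<le> b \<Longrightarrow> v l \<le> v m"
    using item_argmax[of c b] cb(2) by auto
  have "m = b"
  proof (rule ccontr)
    assume "m \<noteq> b"
    have "critical f N m"
    proof (cases "m = c")
      case False
      then have "maximum f N m" using m(1,2) \<open>m \<noteq> b\<close> assms(4) by (intro maximumI m(3)) auto
      then show ?thesis unfolding critical_def ..
    qed (use cb in simp)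
    then have "v m < v b" using cb(3) m(1,2) \<open>m \<noteq> b\<close> by simp
    then show False using m(3)[of b] cb(2) by simp
  qed
  then show ?thesis using m(3) assms by simp
qed

lemma visible_right_le:
  assumes "c \<in> visible_right f N b" "b \<le> k" "k \<le> c"
  shows "v k \<le> v b"
proof -
  have cb: "critical f N c" "b < c" "\<And>k. critical f N k \<Longrightarrow> b < k \<Longrightarrow> k \<le> c \<Longrightarrow> v k < v b"
    using assms(1) unfolding visible_right_def by auto
  have cN: "c \<le> N" using critical_le cb(1) .
  obtain m where m: "b \<le> m" "m \<le> c" "\<And>l. b \<le> l \<Longrightarrow> l \<le> c \<Longrightarrow> v l \<le> v m"
    using item_argmax[of b c] cb(2) by auto
  have "m = b"
  proof (rule ccontr)
    assume "m \<noteq> b"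
    have "critical f N m"
    proof (cases "m = c")
      case False
      then have "maximum f N m" using m(1,2) \<open>m \<noteq> b\<close> cN by (intro maximumI m(3)) auto
      then show ?thesis unfolding critical_def ..
    qed (use cb in simp)
    then have "v m < v b" using cb(3) m(1,2) \<open>m \<noteq> b\<close> by simp
    then show False using m(3)[of b] cb(2) by simp
  qed
  then show ?thesis using m(3) assms by simp
qed

lemma unit_antimono:
  assumes "i < N" "v (Suc i) \<le> v i" "real i \<le> s" "s \<le> t" "t \<le> real (Suc i)"
  shows "f t \<le> f s"
proof -
  have "f t - f s = (t - s) * (v (Suc i) - v i)" using assms by (intro affine_diff) auto
  moreover have "(t - s) * (v (Suc i) - v i) \<le> 0" using assms by (intro mult_nonneg_nonpos) auto
  ultimately show ?thesis by linarith
qed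

text \<open>This is the case where the left side loses: its lowest item \<open>a\<close> is higher
  than some item \<open>d\<close> visible to the right. The frame is found by going left from
  \<open>b\<close> until its level or the end of the domain is reached, and right until the level of
  \<open>a\<close> is reached. The last clause ties the in-panel and mid-panel to the losing
  subtree.\<close>

lemma exists_frame_right:
  assumes b: "maximum f N b" and a: "a \<in> visible_left f N b" and least: "\<And>c. c \<in> visible_left f N b \<Longrightarrow> v a \<le> v c"
    and d: "d \<in> visible_right f N b" "v d < v a"
  shows "\<exists>x y. frame_right f N a b x y \<and> (\<forall>c. critical f N c \<longrightarrow> real c \<in> {x..real b} \<longleftrightarrow> c \<in> insert b (visible_left f N b))"
proof -
  have bN: "b < N" "b \<le> N" and ca: "critical f N a" "a < b" "v a < v b" and cd: "b < d" "d \<le> N"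
    using a b d(1) critical_le unfolding visible_left_def visible_right_def maximum_def by auto
  let ?P = "\<lambda>x. \<forall>k. x \<le> k \<and> k \<le> b \<longrightarrow> v k \<le> v b"
  \<comment> \<open>The leftmost item from which no item up to \<open>b\<close> exceeds
    \<open>b\<close>. The in-panel starts between it and its left neighbour, which is higher than
    \<open>b\<close>, or at 0.\<close>
  define x0 where "x0 = (LEAST x. ?P x)"
  have x0: "?P x0" unfolding x0_def by (rule LeastI[of ?P b]) auto
  have x0_least: "x0 \<le> x" if "?P x" for x unfolding x0_def using that by (rule Least_le)
  have x0_le: "x0 \<le> c" if "c \<in> visible_left f N b" for c
    using visible_left_le[OF that _ _ bN(2)] by (intro x0_least) auto
  have before: "v b < v (x0 - 1)" if "0 < x0"
  proof (rule ccontr)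
    assume *: "\<not> v b < v (x0 - 1)"
    have "?P (x0 - 1)"
    proof (intro allI impI)
      fix k assume k: "x0 - 1 \<le> k \<and> k \<le> b"
      show "v k \<le> v b"
      proof (cases "k = x0 - 1")
        case False
        then show ?thesis using x0 k by auto
      qed (use * in simp)
    qed
    then show False using x0_least[of "x0 - 1"] that by auto
  qed
  have vis: "c \<in> visible_left f N b \<longleftrightarrow> x0 \<le> c \<and> c < b" if "critical f N c" for c
  proof
    assume *: "x0 \<le> c \<and> c < b"
    show "c \<in> visible_left f N b"
      unfolding visible_left_def
    proof (safe)
      fix k assume k: "critical f N k" "c \<le> k" "k < b"
      then have "v k \<le> v b" using x0 * by simp
      moreover have "v k \<noteq> v b" using v_neq[of k b] k bN by simp
      ultimately show "v k < v b" by simp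
    qed (use that * in auto)
  qed (use x0_le in \<open>auto simp: visible_left_def\<close>)
  have x0a: "x0 \<le> a" using x0_le a .
  have left_ge: "v a \<le> v k" if k: "x0 \<le> k" "k \<le> b" for k
  proof -
    \<comment> \<open>A lowest item of the range is a local minimum even at the left edge, because
      the left neighbour of \<open>x0\<close> exceeds \<open>b\<close>. So it is visible from
      \<open>b\<close> and not lower than \<open>a\<close>.\<close>
    obtain m where m: "x0 \<le> m" "m \<le> b" "\<And>l. x0 \<le> l \<Longrightarrow> l \<le> b \<Longrightarrow> v m \<le> v l"
      using item_argmin[of x0 b] k by auto
    have "m \<noteq> b" using m(3)[of a] x0a ca by auto
    have "minimum f N m"
    proof (rule minimumI)
      show "v m \<le> v (m - 1)" if "0 < m"
      proof (cases "m = x0")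
        case True
        then show ?thesis using before x0[rule_format, of x0] that m(2) by auto
      next
        case False
        then show ?thesis using m(1,2) by (intro m(3)) auto
      qed
      show "v m \<le> v (Suc m)" using m(1,2) \<open>m \<noteq> b\<close> by (intro m(3)) auto
    qed (use m(2) bN in simp)
    then have "m \<in> visible_left f N b" using vis m(1,2) \<open>m \<noteq> b\<close> unfolding critical_def by auto
    then show ?thesis using least[of m] m(3)[OF k] by simp
  qed
  \<comment> \<open>The first item after \<open>b\<close> that is lower than \<open>a\<close>. It
    comes no later than \<open>d\<close>, so the visibility of \<open>d\<close> bounds all values up
    to \<open>y1\<close> by that of \<open>b\<close>.\<close>
  define y1 where "y1 = (LEAST j. b < j \<and> v j < v a)"
  have y1: "b < y1" "v y1 < v a" "y1 \<le> d"
    using LeastI[of "\<lambda>j. b < j \<and> v j < v a" d] Least_le[of "\<lambda>j. b < j \<and> v j < v a" d] cd(1) d(2)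
    unfolding y1_def by auto
  have right_ge: "v a \<le> v k" if "b \<le> k" "k < y1" for k
    using not_less_Least[of k "\<lambda>j. b < j \<and> v j < v a"] that ca(3) unfolding y1_def by (cases "k = b") auto
  define i where "i = y1 - 1"
  have i: "Suc i = y1" "b \<le> i" "i < N" "v a \<le> v i" "v a \<noteq> v i"
    using y1 cd right_ge[of i] v_neq[of a i] ca(2) unfolding i_def by auto
  obtain y where y: "real i < y" "y < real (Suc i)" "f y = v a"
    using crossing[of i "v a"] i y1(2) by auto
  have xi: "x0 < b" using x0a ca(2) by simp
  obtain x where x: "x \<le> real x0" "x0 = 0 \<longrightarrow> x = 0" "0 < x0 \<longrightarrow> real (x0 - 1) < x \<and> f x = v b"
    "\<And>t. x \<le> t \<Longrightarrow> t \<le> real x0 \<Longrightarrow> v x0 \<le> f t \<and> f t \<le> v b"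
  proof (cases "x0 = 0")
    case True
    then show ?thesis using that[of 0] x0 by auto
  next
    case False
    define j where "j = x0 - 1"
    have j: "Suc j = x0" "j < N" "v b < v j" using False xi bN before unfolding j_def by auto
    have "v x0 < v b" using x0[rule_format, of x0] v_neq[of x0 b] xi bN by auto
    then obtain x where x: "real j < x" "x < real (Suc j)" "f x = v b"
      using crossing[of j "v b"] j by auto
    have "v x0 \<le> f t \<and> f t \<le> v b" if "x \<le> t" "t \<le> real x0" for t
      using unit_antimono[of j t x0] unit_antimono[of j x t] that x j \<open>v x0 < v b\<close> by auto
    then show ?thesis using that[of x] x j False unfolding j_def by auto
  qed
  have le: "v a \<le> f t \<and> f t \<le> v b" if t: "x \<le> t" "t \<le> y" for t
  proof -
    consider "t \<le> real x0" | "real x0 \<le> t" "t \<le> real b" | "real b \<le> t" "t \<le> real i" | "real i \<le> t" by linarith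
    then show ?thesis
    proof cases
      case 1
      then show ?thesis using x(4)[OF t(1)] left_ge[of x0] xi by auto
    next
      case 2
      then show ?thesis using items_ge[of b x0 "v a" t] items_le[of b x0 "v b" t] left_ge x0 bN by auto
    next
      case 3
      then show ?thesis
        using items_ge[of i b "v a" t] items_le[of i b "v b" t] right_ge visible_right_le[OF d(1)] i y1(3) by auto
    next
      case 4
      have "f y \<le> f t" "f t \<le> v i"
        using unit_antimono[of i t y] unit_antimono[of i i t] 4 t(2) y i y1(2) by auto
      moreover have "v i \<le> v b" using visible_right_le[OF d(1)] i y1(3) by simp
      ultimately show ?thesis using y(3) by simp
    qed
  qed
  have "0 \<le> x" using x by (cases "x0 = 0") auto
  moreover have "y \<le> real N" "real b \<le> y" using y i by linarith+
  moreover have "x \<le> real a" using x(1) x0a by simp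
  ultimately have "frame_right f N a b x y"
    unfolding frame_right_def using ca b le x(2,3) y(3) unfolding critical_def by auto
  moreover have "real c \<in> {x..real b} \<longleftrightarrow> c \<in> insert b (visible_left f N b)" if "critical f N c" for c
  proof -
    have "x \<le> real c \<longleftrightarrow> x0 \<le> c"
    proof (cases "x0 = 0")
      case False
      then have "real x0 - 1 < x" using x(3) by (simp add: of_nat_diff)
      then show ?thesis using x(1) by linarith
    qed (use x in auto)
    then show ?thesis using vis[OF that] x0a ca(2) by auto
  qed
  ultimately show ?thesis by blast
qed

end

text \<open>The right-hand case for the reflected map, where item \<open>k\<close> becomes
  \<open>N - k\<close> and left and right visibility are exchanged.\<close>

lemma (in pl_wave) exists_frame_left:
  assumes b: "maximum f N b" and a: "a \<in> visible_right f N b" and least: "\<And>c. c \<in> visible_right f N b \<Longrightarrow> v a \<le> v c"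
    and d: "d \<in> visible_left f N b" "v d < v a"
  shows "\<exists>x y. frame_left f N a b x y \<and> (\<forall>c. critical f N c \<longrightarrow> real c \<in> {real b..y} \<longleftrightarrow> c \<in> insert b (visible_right f N b))"
proof -
  let ?g = "\<lambda>t. f (real N - t)"
  interpret m: pl_wave ?g N by (rule pl_wave_mirror) unfold_locales
  have gg: "(\<lambda>t. ?g (real N - t)) = f" by simp
  have bN: "b \<le> N" using b unfolding maximum_def by simp
  have vl: "c \<le> N" if "c \<in> visible_left h N e" for c e h
    using that unfolding visible_left_def critical_def minimum_def maximum_def by auto
  have vr: "c \<le> N" if "c \<in> visible_right h N e" for c e h
    using that unfolding visible_right_def critical_def minimum_def maximum_def by auto
  note N = bN vr[OF a] vl[OF d(1)]
  have L: "N - c \<in> visible_left ?g N (N - b) \<longleftrightarrow> c \<in> visible_right f N b" if "c \<le> N" for c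
    using visible_right_mirror[OF bN that] .
  have gv: "?g (real (N - c)) = v c" if "c \<le> N" for c using that by (simp add: of_nat_diff)
  have "\<exists>x y. frame_right ?g N (N - a) (N - b) x y \<and>
    (\<forall>c. critical ?g N c \<longrightarrow> real c \<in> {x..real (N - b)} \<longleftrightarrow> c \<in> insert (N - b) (visible_left ?g N (N - b)))"
  proof (rule m.exists_frame_right)
    show "maximum ?g N (N - b)" using b maximum_mirror[OF bN] by blast
    show "N - a \<in> visible_left ?g N (N - b)" using L N a by blast
    show "N - d \<in> visible_right ?g N (N - b)"
      using visible_right_mirror[of "N - b" N "N - d" ?g] d(1) N unfolding gg by simp
    show "?g (real (N - d)) < ?g (real (N - a))" using d(2) gv N by simp
    show "?g (real (N - a)) \<le> ?g (real c)" if "c \<in> visible_left ?g N (N - b)" for c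
      using least[of "N - c"] L[of "N - c"] gv[of "N - c"] gv[of a] vl[OF that] that N by auto
  qed
  then obtain x y where xy: "frame_right ?g N (N - a) (N - b) x y"
    "\<And>c. critical ?g N c \<Longrightarrow> real c \<in> {x..real (N - b)} \<longleftrightarrow> c \<in> insert (N - b) (visible_left ?g N (N - b))"
    by blast
  have "frame_left f N a b (real N - y) (real N - x)"
    using xy(1) frame_left_mirror[OF N(2,1), of f "real N - y" "real N - x"] by simp
  moreover have "real c \<in> {real b..real N - x} \<longleftrightarrow> c \<in> insert b (visible_right f N b)" if c: "critical f N c" for c
  proof -
    have cN: "c \<le> N" using critical_le c .
    have "real (N - c) \<in> {x..real (N - b)} \<longleftrightarrow> N - c \<in> insert (N - b) (visible_left ?g N (N - b))"
      using xy(2) c critical_mirror[OF cN] by blast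
    moreover have "real (N - c) \<in> {x..real (N - b)} \<longleftrightarrow> real c \<in> {real b..real N - x}"
      using cN bN by (auto simp: of_nat_diff)
    moreover have "N - c = N - b \<longleftrightarrow> c = b" using cN bN by auto
    ultimately show ?thesis using L[OF cN] by auto
  qed
  ultimately show ?thesis by blast
qed

section \<open>The diagram from the merges\<close>

lemma nesting_arrows_iff:
  "(p, q) \<in> nesting_arrows \<W> \<longleftrightarrow> (\<exists>P Q. (p, P) \<in> \<W> \<and> (q, Q) \<in> \<W> \<and> P \<subset> Q \<and>
     (\<forall>r S. (r, S) \<in> \<W> \<longrightarrow> P \<subset> S \<longrightarrow> S \<subset> Q \<longrightarrow> False))"
proof -
  have e: "(\<exists>(r, R) \<in> \<W>. P \<subset> R \<and> R \<subset> Q) \<longleftrightarrow>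
      \<not> (\<forall>r S. (r, S) \<in> \<W> \<longrightarrow> P \<subset> S \<longrightarrow> S \<subset> Q \<longrightarrow> False)" for P Q
    by (auto simp del: split_paired_Ex split_paired_All)
  show ?thesis
    by (simp only: nesting_arrows_def mem_Collect_eq e not_not prod.inject) metis
qed

section \<open>Merges of the tree as windows\<close>

context pl_wave
begin

lemma frame_left_unique:
  assumes "frame_left f N a b x y" "frame_left f N a b' x' y'"
  shows "b' = b \<and> x' = x \<and> y' = y"
proof -
  interpret m: pl_wave "\<lambda>t. f (real N - t)" N by (rule pl_wave_mirror) unfold_locales
  note N = frame_leftD(1,2)[OF assms(1)] frame_leftD(2)[OF assms(2)]
  have "N - b' = N - b \<and> real N - y' = real N - y \<and> real N - x' = real N - x"
    using assms frame_left_mirror[OF N(1,2)] frame_left_mirror[OF N(1,3)] by (intro m.frame_right_unique) auto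
  then show ?thesis using N by auto
qed

text \<open>The lower end fixes the orientation as well as the frame. This is what makes the list of
  windows complete once every minimum but the global one has been given a window.\<close>

lemma triple_panel_window_unique:
  assumes "triple_panel_window f N a b x y" "triple_panel_window f N a b' x' y'"
  shows "b' = b \<and> x' = x \<and> y' = y"
  using assms frame_right_unique frame_left_unique not_frame_right_left
  unfolding triple_panel_window_iff by metis

text \<open>In the sorted list of critical items the runs \<open>ls\<close> and \<open>rs\<close>
  next to \<open>b\<close> are lower than \<open>b\<close> and are stopped by higher items, so they
  are exactly what is seen from \<open>b\<close>.\<close>

lemma visible_from_critical_list:
  assumes cl: "critical_list f N = xs @ ls @ b # rs @ ys"
    and low: "\<And>x. x \<in> set ls \<union> set rs \<Longrightarrow> v x < v b"
    and ends: "xs \<noteq> [] \<longrightarrow> v b < v (last xs)" "ys \<noteq> [] \<longrightarrow> v b < v (hd ys)"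
  shows "set ls = visible_left f N b" "set rs = visible_right f N b"
proof -
  have crit: "critical f N c \<longleftrightarrow> c \<in> set xs \<union> set ls \<union> {b} \<union> set rs \<union> set ys" for c
    using set_critical_list unfolding cl by auto
  have "sorted_wrt (<) (xs @ ls @ b # rs @ ys)" using sorted_critical_list unfolding cl .
  then have so: "\<And>x y. x \<in> set xs \<Longrightarrow> y \<in> insert b (set ls) \<Longrightarrow> x < y"
    "\<And>x. x \<in> set ls \<Longrightarrow> x < b" "\<And>y. y \<in> set rs \<union> set ys \<Longrightarrow> b < y"
    "\<And>x y. x \<in> set rs \<Longrightarrow> y \<in> set ys \<Longrightarrow> x < y"
    and sxs: "sorted_wrt (<) xs" and sys: "sorted_wrt (<) ys"
    by (auto simp: sorted_wrt_append)
  show "set ls = visible_left f N b"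
  proof (intro set_eqI iffI)
    fix c assume c: "c \<in> set ls"
    have "v k < v b" if k: "critical f N k" "c \<le> k" "k < b" for k
    proof -
      have "k \<notin> set xs" "k \<notin> insert b (set rs \<union> set ys)" using so(1)[of k c] so(3)[of k] c k(2,3) by auto
      then show ?thesis using k(1) crit low by blast
    qed
    then show "c \<in> visible_left f N b" unfolding visible_left_def using c so(2)[OF c] crit by blast
  next
    fix c assume "c \<in> visible_left f N b"
    then have c: "critical f N c" "c < b" "\<And>k. critical f N k \<Longrightarrow> c \<le> k \<Longrightarrow> k < b \<Longrightarrow> v k < v b"
      unfolding visible_left_def by auto
    have "c \<notin> set xs"
    proof
      assume cx: "c \<in> set xs"
      then have ne: "xs \<noteq> []" by auto
      obtain zs z where xs: "xs = zs @ [z]" using ne rev_exhaust by blast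
      have "c \<le> z" "z < b" using cx sxs so(1)[of z b] unfolding xs by (auto simp: sorted_wrt_append)
      then show False using c(3)[of z] crit ends(1) xs by force
    qed
    moreover have "c \<notin> set rs \<union> set ys" using so(3)[of c] c(2) by auto
    ultimately show "c \<in> set ls" using c(1,2) crit by blast
  qed
  show "set rs = visible_right f N b"
  proof (intro set_eqI iffI)
    fix c assume c: "c \<in> set rs"
    have "v k < v b" if k: "critical f N k" "b < k" "k \<le> c" for k
    proof -
      have "k \<notin> set ys" "k \<notin> set xs \<union> insert b (set ls)"
        using so(4)[OF c, of k] so(1)[of k b] so(2)[of k] c k(2,3) by auto
      then show ?thesis using k(1) crit low by blast
    qed
    moreover have "b < c" using so(3) c by blast
    ultimately show "c \<in> visible_right f N b" unfolding visible_right_def using c crit by blast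
  next
    fix c assume "c \<in> visible_right f N b"
    then have c: "critical f N c" "b < c" "\<And>k. critical f N k \<Longrightarrow> b < k \<Longrightarrow> k \<le> c \<Longrightarrow> v k < v b"
      unfolding visible_right_def by auto
    have "c \<notin> set ys"
    proof
      assume cy: "c \<in> set ys"
      then obtain z zs where ys: "ys = z # zs" by (cases ys) auto
      have "z \<le> c" "b < z" using cy sys so(3)[of z] unfolding ys by auto
      then show False using c(3)[of z] crit ends(2) ys by force
    qed
    moreover have "c \<notin> set xs \<union> insert b (set ls)" using so(1)[of c b] so(2)[of c] c(2) by auto
    ultimately show "c \<in> set rs" using c(1) crit by blast
  qed
qed

lemma merge_visible:
  assumes "(b, w, u) \<in> merges v tree"
  shows "items w = visible_left f N b \<and> items u = visible_right f N b \<or>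
    items w = visible_right f N b \<and> items u = visible_left f N b"
proof -
  obtain xs ys where *: "critical_list f N = xs @ in_order w @ b # in_order u @ ys \<or>
      critical_list f N = xs @ in_order u @ b # in_order w @ ys"
    "xs \<noteq> [] \<longrightarrow> v b < v (last xs)" "ys \<noteq> [] \<longrightarrow> v b < v (hd ys)"
    using merge_context[OF assms tree(2)] unfolding tree(1) by auto
  have "v x < v b" if "x \<in> set (in_order w) \<union> set (in_order u)" for x
    using merge_values[OF assms tree(2)] that unfolding set_in_order by blast
  then have low: "\<And>x. x \<in> set (in_order w) \<union> set (in_order u) \<Longrightarrow> v x < v b"
    "\<And>x. x \<in> set (in_order u) \<union> set (in_order w) \<Longrightarrow> v x < v b" by auto
  show ?thesis
    using *(1)
  proof
    assume "critical_list f N = xs @ in_order w @ b # in_order u @ ys"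
    from visible_from_critical_list[OF this low(1) *(2,3)] show ?thesis unfolding set_in_order by blast
  next
    assume "critical_list f N = xs @ in_order u @ b # in_order w @ ys"
    from visible_from_critical_list[OF this low(2) *(2,3)] show ?thesis unfolding set_in_order by blast
  qed
qed

text \<open>\<open>merges\<close> gives ties to the right subtree, but the two lowest leaves are
  different critical items, so genericity makes the comparison strict.\<close>

lemma merge_strict:
  assumes "(b, w, u) \<in> merges v tree"
  shows "v (low_leaf v u) < v (low_leaf v w)"
proof -
  have "items w \<inter> items u = {}"
  proof -
    have "visible_left f N b \<inter> visible_right f N b = {}"
      unfolding visible_left_def visible_right_def by auto
    then show ?thesis using merge_visible[OF assms] by auto
  qed
  then have "low_leaf v u \<noteq> low_leaf v w" using low_leaf_in_items by (metis IntI empty_iff)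
  moreover have "low_leaf v u \<in> items tree" "low_leaf v w \<in> items tree"
    using merges_items[OF assms] low_leaf_in_items[of v u] low_leaf_in_items[of v w] by auto
  ultimately have "v (low_leaf v u) \<noteq> v (low_leaf v w)" using inj_tree unfolding inj_on_def by blast
  then show ?thesis using merge_values[OF assms tree(2)] by auto
qed

text \<open>What nesting depends on, stated without orientation: on both sides the interval extends
  to the level of \<open>b\<close> or to the end of the domain, \<open>f\<close> does not exceed
  that level in between, and the critical items inside are \<open>b\<close> and those of the losing
  subtree. In the windows of interest one end is \<open>b\<close> itself.\<close>

definition window_region :: "nat \<Rightarrow> nat full_tree \<Rightarrow> (real \<times> real) set \<Rightarrow> bool" where
  "window_region b w R \<longleftrightarrow> (\<exists>lo hi. R = {lo..hi} \<times> {v (low_leaf v w)..v b} \<and> 0 \<le> lo \<and> hi \<le> real N \<and>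
     (lo = 0 \<or> f lo = v b) \<and> (hi = real N \<or> f hi = v b) \<and> (\<forall>t \<in> {lo..hi}. f t \<le> v b) \<and>
     (\<forall>c. critical f N c \<longrightarrow> real c \<in> {lo..hi} \<longleftrightarrow> c \<in> insert b (items w)))"

lemma merge_window:
  assumes m: "(b, w, u) \<in> merges v tree"
  shows "\<exists>x y. triple_panel_window f N (low_leaf v w) b x y \<and>
    window_region b w (double_panel_window f (low_leaf v w) b x y)"
proof -
  have b: "maximum f N b" using merges_items[OF m] tree(4) by blast
  have least: "v (low_leaf v w) \<le> v c" if "c \<in> items w" for c
    using low_leaf_least[of v w c] that merge_values[OF m tree(2)] by blast
  note * = low_leaf_in_items[of v w] low_leaf_in_items[of v u] merge_strict[OF m]
  show ?thesis
    using merge_visible[OF m]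
  proof (elim disjE conjE)
    assume e: "items w = visible_left f N b" "items u = visible_right f N b"
    then obtain x y where xy: "frame_right f N (low_leaf v w) b x y"
      "\<And>c. critical f N c \<Longrightarrow> real c \<in> {x..real b} \<longleftrightarrow> c \<in> insert b (items w)"
      using exists_frame_right[OF b, of "low_leaf v w" "low_leaf v u"] least * by auto
    note d = frame_rightD[OF xy(1)]
    have "double_panel_window f (low_leaf v w) b x y = {x..real b} \<times> {v (low_leaf v w)..v b}"
      unfolding double_panel_window_def in_panel_def mid_panel_def using d(3,5,6) by auto
    moreover have "f t \<le> v b" if "t \<in> {x..real b}" for t using d(12)[of t] d(7) that by auto
    ultimately have "window_region b w (double_panel_window f (low_leaf v w) b x y)"
      unfolding window_region_def using xy(2) d(2,4,13) by (intro exI[of _ x] exI[of _ "real b"] conjI) simp_all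
    then show ?thesis using xy(1) triple_panel_window_iff by blast
  next
    assume e: "items w = visible_right f N b" "items u = visible_left f N b"
    then obtain x y where xy: "frame_left f N (low_leaf v w) b x y"
      "\<And>c. critical f N c \<Longrightarrow> real c \<in> {real b..y} \<longleftrightarrow> c \<in> insert b (items w)"
      using exists_frame_left[OF b, of "low_leaf v w" "low_leaf v u"] least * by auto
    note d = frame_leftD[OF xy(1)]
    have "double_panel_window f (low_leaf v w) b x y = {real b..y} \<times> {v (low_leaf v w)..v b}"
      unfolding double_panel_window_def in_panel_def mid_panel_def using d(3,6,7) by auto
    moreover have "f t \<le> v b" if "t \<in> {real b..y}" for t using d(12)[of t] d(5) that by auto
    ultimately have "window_region b w (double_panel_window f (low_leaf v w) b x y)"
      unfolding window_region_def using xy(2) d(2,8,13) by (intro exI[of _ "real b"] exI[of _ y] conjI) simp_all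
    then show ?thesis using xy(1) triple_panel_window_iff by blast
  qed
qed

text \<open>The lowest item of the domain is a local minimum, also when it is an end, and therefore
  an item of the tree.\<close>

lemma low_leaf_tree_least: "k \<le> N \<Longrightarrow> v (low_leaf v tree) \<le> v k"
proof -
  assume k: "k \<le> N"
  obtain m where m: "m \<le> N" "\<And>l. l \<le> N \<Longrightarrow> v m \<le> v l"
    using item_argmin[of 0 N] by auto
  have "minimum f N m" by (intro minimumI m) (use m(1) in auto)
  then have "m \<in> items tree" unfolding items_tree critical_def by simp
  then have "v (low_leaf v tree) \<le> v m" using low_leaf_least[OF tree(2)] by blast
  then show ?thesis using m(2)[OF k] by simp
qed

lemma low_leaf_tree_le: "low_leaf v tree \<le> N"
  using low_leaf_in_items[of v tree] critical_le unfolding items_tree by blast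

text \<open>The neighbour of \<open>a\<close> towards \<open>b\<close> lies in the frame and is not
  lower than \<open>a\<close>, so \<open>a\<close> is no maximum. Beyond the end on the level of
  \<open>a\<close> the map drops further, so \<open>a\<close> is not the global minimum.\<close>

lemma triple_panel_window_low:
  assumes "triple_panel_window f N a b x y"
  shows "minimum f N a" "a \<noteq> low_leaf v tree"
proof -
  have *: "critical f N a" "a \<le> N" "v a < v b"
    and adj: "\<exists>k \<le> N. (k = a + 1 \<or> k + 1 = a) \<and> v a \<le> v k"
    and lower: "\<exists>t. 0 \<le> t \<and> t \<le> real N \<and> f t < v a"
  proof -
    have "critical f N a \<and> a \<le> N \<and> v a < v b \<and> (\<exists>k \<le> N. (k = a + 1 \<or> k + 1 = a) \<and> v a \<le> v k) \<and>
      (\<exists>t. 0 \<le> t \<and> t \<le> real N \<and> f t < v a)"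
      using assms unfolding triple_panel_window_iff
    proof
      assume r: "frame_right f N a b x y"
      note d = frame_rightD[OF r]
      have "v a \<le> v (a + 1)" using d(3,5,7) by (intro d(11)) linarith+
      moreover have "y \<noteq> real N" using value_nonitem[OF d(10,1), of N] d(6,7) by auto
      then obtain t where t: "y < t" "t < real N" "f t < f y"
        using drops_after[of y a "real a" "real N"] d(1,5-8,10) d(11) by auto
      moreover have "a + 1 \<le> N" using d(2,3) by simp
      ultimately have "\<exists>k \<le> N. (k = a + 1 \<or> k + 1 = a) \<and> v a \<le> v k" by blast
      moreover have "0 \<le> t \<and> t \<le> real N \<and> f t < v a" using t d(5-7,10) by linarith
      ultimately show ?thesis using r d(1,9) unfolding frame_right_def by blast
    next
      assume r: "frame_left f N a b x y"
      note d = frame_leftD[OF r]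
      have "v a \<le> v (a - 1)" using d(3,5,7) by (intro d(11)) linarith+
      moreover have "x \<noteq> 0" using value_nonitem[OF d(10,1), of 0] d(5,6) by auto
      then obtain t where t: "0 < t" "t < x" "f t < f x"
        using drops_before[of x a "real a" 0] d(1,4-8,10) d(11) by auto
      moreover have "a - 1 \<le> N" "a - 1 + 1 = a" using d(1,3) by simp_all
      ultimately have "\<exists>k \<le> N. (k = a + 1 \<or> k + 1 = a) \<and> v a \<le> v k" by blast
      moreover have "0 \<le> t \<and> t \<le> real N \<and> f t < v a" using t d(5-8,10) by linarith
      ultimately show ?thesis using r d(1,9) unfolding frame_left_def by blast
    qed
    then show "critical f N a" "a \<le> N" "v a < v b" "\<exists>k \<le> N. (k = a + 1 \<or> k + 1 = a) \<and> v a \<le> v k"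
      "\<exists>t. 0 \<le> t \<and> t \<le> real N \<and> f t < v a" by auto
  qed
  have "\<not> maximum f N a"
  proof
    assume "maximum f N a"
    then have "v (a - 1) < v a" "v (a + 1) < v a" unfolding maximum_def by auto
    then show False using adj by auto
  qed
  then show "minimum f N a" using *(1) unfolding critical_def by blast
  show "a \<noteq> low_leaf v tree"
  proof
    assume "a = low_leaf v tree"
    then have "v a \<le> v k" if "k \<le> N" for k using low_leaf_tree_least that by simp
    then have "v a \<le> f t" if "0 \<le> t" "t \<le> real N" for t using items_ge[of N 0 "v a" t] that by auto
    then show False using lower by force
  qed
qed

text \<open>\<open>h\<close> stands for the position of the highest value. It is a parameter because
  it is supplied later by the tree of \<open>- f\<close>.\<close>

definition essential_point :: "nat \<Rightarrow> diagram_point" where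
  "essential_point h = (Essential, v (low_leaf v tree), v h)"

lemma global_window_iff:
  assumes h: "h \<le> N" "\<forall>k\<le>N. v k \<le> v h"
  shows "global_window f N a b \<longleftrightarrow> a = low_leaf v tree \<and> b = h"
proof
  assume g: "global_window f N a b"
  then have ab: "a \<le> N" "b \<le> N" "\<And>k. k \<le> N \<Longrightarrow> v a \<le> v k \<and> v k \<le> v b"
    unfolding global_window_def by auto
  have "v a = v (low_leaf v tree)" "v b = v h"
    using ab h low_leaf_tree_least low_leaf_tree_le by (meson order_antisym)+
  then show "a = low_leaf v tree \<and> b = h" using v_neq ab(1,2) h(1) low_leaf_tree_le by metis
next
  assume "a = low_leaf v tree \<and> b = h"
  then show "global_window f N a b"
    unfolding global_window_def using h low_leaf_tree_le low_leaf_tree_least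
      items_ge[of N 0 "v (low_leaf v tree)"] items_le[of N 0 "v h"] by auto
qed

text \<open>\<open>merge_window\<close> gives one window per merge. Conversely the lower end of any
  window loses in some merge, and the window of that merge has the same lower end, hence is the same
  window. The choice of \<open>R\<close> turns the region into a function of the merge.\<close>

lemma ordinary_windows_eq:
  assumes h: "h \<le> N" "\<forall>k\<le>N. v k \<le> v h"
  obtains R where "\<forall>b w u. (b, w, u) \<in> merges v tree \<longrightarrow> window_region b w (R b w)"
    "ordinary_windows f N = insert (essential_point h, {0..real N} \<times> {v (low_leaf v tree)..v h})
       {((Ordinary, v (low_leaf v w), v b), R b w) | b w u. (b, w, u) \<in> merges v tree}"
proof -
  define R where "R b w = (SOME S. \<exists>x y. triple_panel_window f N (low_leaf v w) b x y \<and>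
    S = double_panel_window f (low_leaf v w) b x y)" for b w
  have R: "R b w = double_panel_window f (low_leaf v w) b x y"
    if "triple_panel_window f N (low_leaf v w) b x y" for b w x y
    unfolding R_def
  proof (rule some_equality)
    show "\<exists>x' y'. triple_panel_window f N (low_leaf v w) b x' y' \<and>
      double_panel_window f (low_leaf v w) b x y = double_panel_window f (low_leaf v w) b x' y'"
      using that by blast
  qed (use triple_panel_window_unique[OF that] in blast)
  have trip: "{((Ordinary, v a, v b), double_panel_window f a b x y) | a b x y. triple_panel_window f N a b x y} =
    {((Ordinary, v (low_leaf v w), v b), R b w) | b w u. (b, w, u) \<in> merges v tree}" (is "?A = ?B")
  proof
    show "?A \<subseteq> ?B"
    proof
      fix p assume "p \<in> ?A"
      then obtain a b x y where p: "p = ((Ordinary, v a, v b), double_panel_window f a b x y)"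
        and t: "triple_panel_window f N a b x y" by blast
      have "a \<in> leaves tree" "a \<noteq> low_leaf v tree" using triple_panel_window_low[OF t] tree(3) by auto
      then obtain b' w u where m: "(b', w, u) \<in> merges v tree" "a = low_leaf v w"
        using leaf_merge[of a tree v] by blast
      obtain x' y' where "triple_panel_window f N a b' x' y'" using merge_window[OF m(1)] m(2) by blast
      then have "b' = b" using triple_panel_window_unique[OF t] by blast
      then show "p \<in> ?B" using m p R[of w b x y] t by blast
    qed
    show "?B \<subseteq> ?A"
    proof
      fix p assume "p \<in> ?B"
      then obtain b w u where m: "(b, w, u) \<in> merges v tree" "p = ((Ordinary, v (low_leaf v w), v b), R b w)" by blast
      then show "p \<in> ?A" using merge_window[OF m(1)] R by blast
    qed
  qed
  have glob: "{((Essential, v a, v b), {0..real N} \<times> {v a..v b}) | a b. global_window f N a b} =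
    {(essential_point h, {0..real N} \<times> {v (low_leaf v tree)..v h})}"
    unfolding global_window_iff[OF h] essential_point_def by auto
  show thesis
  proof (rule that)
    show "\<forall>b w u. (b, w, u) \<in> merges v tree \<longrightarrow> window_region b w (R b w)"
      using merge_window R by metis
    show "ordinary_windows f N = insert (essential_point h, {0..real N} \<times> {v (low_leaf v tree)..v h})
       {((Ordinary, v (low_leaf v w), v b), R b w) | b w u. (b, w, u) \<in> merges v tree}"
      unfolding ordinary_windows_def trip glob by blast
  qed
qed

text \<open>If the regions are nested, the lower end of \<open>R\<close> at its bottom level lies in
  \<open>R'\<close>, so this minimum belongs to \<open>w'\<close>, and then so does
  \<open>b\<close>. Conversely the interval of \<open>R'\<close> ends at the higher level of
  \<open>b'\<close> or at the ends of the domain, and the interval of \<open>R\<close> cannot cross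
  such an end because \<open>f\<close> does not exceed \<open>f b\<close> there.\<close>

lemma window_region_nested:
  assumes m: "(b, w, u) \<in> merges v tree" "(b', w', u') \<in> merges v tree" "b \<noteq> b'"
    and R: "window_region b w R" "window_region b' w' R'"
  shows "R \<subset> R' \<longleftrightarrow> b \<in> items w'"
proof -
  have le: "b \<in> items w'" if A: "R \<subseteq> R'" "(b, w, u) \<in> merges v tree" "(b', w', u') \<in> merges v tree" "b \<noteq> b'"
    "window_region b w R" "window_region b' w' R'" for b w u b' w' u' R R'
  proof -
    let ?a = "low_leaf v w"
    obtain lo hi where r: "R = {lo..hi} \<times> {v ?a..v b}" "\<And>c. critical f N c \<Longrightarrow> real c \<in> {lo..hi} \<longleftrightarrow> c \<in> insert b (items w)"
      using A(5) unfolding window_region_def by blast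
    obtain lo' hi' where r': "R' = {lo'..hi'} \<times> {v (low_leaf v w')..v b'}" "\<And>c. critical f N c \<Longrightarrow> real c \<in> {lo'..hi'} \<longleftrightarrow> c \<in> insert b' (items w')"
      using A(6) unfolding window_region_def by blast
    have a: "minimum f N ?a" using low_leaf_in_leaves[of v w] merges_items[OF A(2)] tree(3) by blast
    have b': "maximum f N b'" using merges_items[OF A(3)] tree(4) by blast
    have "real ?a \<in> {lo..hi}" using r(2) a low_leaf_in_items unfolding critical_def by blast
    moreover have "v ?a < v b"
      using merge_values[OF A(2) tree(2), THEN conjunct1] low_leaf_in_items[of v w] by blast
    ultimately have "(real ?a, v ?a) \<in> R" unfolding r(1) by auto
    then have "real ?a \<in> {lo'..hi'}" using A(1) unfolding r'(1) by auto
    then have "?a \<in> insert b' (items w')" using r'(2) a unfolding critical_def by blast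
    then have "?a \<in> items w'" using a b' min_max_exclusive by blast
    then show ?thesis using merge_inside_low_leaf[OF A(2,3) distinct_tree] A(4) by blast
  qed
  show ?thesis
  proof
    assume "R \<subset> R'"
    then show "b \<in> items w'" using le[OF _ m R] by blast
  next
    assume bw: "b \<in> items w'"
    have vb: "v b < v b'" using merge_values[OF m(2) tree(2)] bw by blast
    obtain lo hi where r: "R = {lo..hi} \<times> {v (low_leaf v w)..v b}" "0 \<le> lo" "hi \<le> real N"
      "\<And>t. t \<in> {lo..hi} \<Longrightarrow> f t \<le> v b" "\<And>c. critical f N c \<Longrightarrow> real c \<in> {lo..hi} \<longleftrightarrow> c \<in> insert b (items w)"
      using R(1) unfolding window_region_def by blast
    obtain lo' hi' where r': "R' = {lo'..hi'} \<times> {v (low_leaf v w')..v b'}"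
      "lo' = 0 \<or> f lo' = v b'" "hi' = real N \<or> f hi' = v b'"
      "\<And>c. critical f N c \<Longrightarrow> real c \<in> {lo'..hi'} \<longleftrightarrow> c \<in> insert b' (items w')"
      using R(2) unfolding window_region_def by blast
    have cb: "critical f N b" using merges_items[OF m(1)] tree(4) unfolding critical_def by blast
    have b: "real b \<in> {lo..hi}" "real b \<in> {lo'..hi'}" using r(5)[OF cb] r'(4)[OF cb] bw by auto
    have "lo' \<le> lo"
    proof (rule ccontr)
      assume l: "\<not> lo' \<le> lo"
      then have "f lo' = v b'" using r'(2) r(2) by auto
      moreover have "f lo' \<le> v b" using l b by (intro r(4)) auto
      ultimately show False using vb by simp
    qed
    moreover have "hi \<le> hi'"
    proof (rule ccontr)
      assume l: "\<not> hi \<le> hi'"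
      then have "f hi' = v b'" using r'(3) r(3) by auto
      moreover have "f hi' \<le> v b" using l b by (intro r(4)) auto
      ultimately show False using vb by simp
    qed
    moreover have "items w \<subseteq> items w'" using merges_items[OF merge_inside[OF m(1,2) distinct_tree bw]] by blast
    then have "v (low_leaf v w') \<le> v (low_leaf v w)"
      using low_leaf_least[of v w'] merge_values[OF m(2) tree(2)] low_leaf_in_items[of v w] by blast
    ultimately have "R \<subseteq> R'" unfolding r(1) r'(1) using vb by (intro Sigma_mono) auto
    \<comment> \<open>Equal regions would be nested the other way round as well and give
      \<open>v b' < v b\<close>.\<close>
    moreover have "R \<noteq> R'"
    proof
      assume "R = R'"
      then have "b' \<in> items w" using le[OF _ m(2,1) _ R(2,1)] m(3) by blast
      then have "v b' < v b" using merge_values[OF m(1) tree(2)] by blast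
      then show False using vb by simp
    qed
    ultimately show "R \<subset> R'" by blast
  qed
qed

text \<open>Properness is witnessed at position 0 on the level of the global minimum: the bottom of
  every other window is above that level.\<close>

lemma window_region_global:
  assumes m: "(b, w, u) \<in> merges v tree" and R: "window_region b w R"
    and h: "\<forall>k\<le>N. v k \<le> v h"
  shows "R \<subset> {0..real N} \<times> {v (low_leaf v tree)..v h}"
proof -
  let ?a = "low_leaf v w"
  obtain lo hi where r: "R = {lo..hi} \<times> {v ?a..v b}" "0 \<le> lo" "hi \<le> real N" using R unfolding window_region_def by blast
  have a: "?a \<in> items tree" using merges_items[OF m] low_leaf_in_items[of v w] by blast
  have "b \<le> N" using merges_node[OF m] critical_le items_tree by blast
  then have "v b \<le> v h" using h by blast
  moreover have "v (low_leaf v tree) \<le> v ?a" using low_leaf_least[OF tree(2) a] .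
  ultimately have "R \<subseteq> {0..real N} \<times> {v (low_leaf v tree)..v h}" using r by auto
  moreover have "v (low_leaf v tree) \<noteq> v ?a"
    using merge_low_leaf[OF m distinct_tree] inj_onD[OF inj_tree _ low_leaf_in_items a, of v] by metis
  then have "(0, v (low_leaf v tree)) \<notin> R" unfolding r using \<open>v (low_leaf v tree) \<le> v ?a\<close> by auto
  moreover have "(0, v (low_leaf v tree)) \<in> {0..real N} \<times> {v (low_leaf v tree)..v h}"
    using h low_leaf_tree_le by auto
  ultimately show ?thesis by blast
qed

definition point :: "nat \<Rightarrow> nat \<Rightarrow> diagram_point" where
  "point h a = (if a = low_leaf v tree then essential_point h else (Ordinary, v a, v (upper_end f N a)))"

lemma upper_end_merge:
  assumes "(b, w, u) \<in> merges v tree"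
  shows "upper_end f N (low_leaf v w) = b"
proof -
  have "banana_of v b w \<in> banana_tree f N"
    using assms unfolding banana_tree_tree closed_bananas_def by blast
  then show ?thesis unfolding banana_tree_def banana_of_def by auto
qed

lemma point_merge:
  assumes "(b, w, u) \<in> merges v tree"
  shows "point h (low_leaf v w) = (Ordinary, v (low_leaf v w), v b)"
  using upper_end_merge[OF assms] merge_low_leaf[OF assms distinct_tree] unfolding point_def by simp

lemma ordinary_points:
  assumes h: "h \<le> N" "\<forall>k\<le>N. v k \<le> v h"
  shows "fst ` ordinary_windows f N =
    insert (essential_point h) {(Ordinary, v (low_leaf v w), v b) | b w u. (b, w, u) \<in> merges v tree}"
proof -
  obtain R where R: "\<forall>b w u. (b, w, u) \<in> merges v tree \<longrightarrow> window_region b w (R b w)"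
    "ordinary_windows f N = insert (essential_point h, {0..real N} \<times> {v (low_leaf v tree)..v h})
       {((Ordinary, v (low_leaf v w), v b), R b w) | b w u. (b, w, u) \<in> merges v tree}"
    by (rule ordinary_windows_eq[OF h])
  show ?thesis unfolding R(2) by force
qed

text \<open>By \<open>window_region_nested\<close>, nesting is membership of maxima in losing
  subtrees. Among the losing subtrees that contain \<open>b\<close> the innermost is the one of the
  winner at \<open>b\<close>; if there is none, the winner is the global minimum and only the global
  window remains.\<close>

lemma ordinary_arrows:
  assumes h: "h \<le> N" "\<forall>k\<le>N. v k \<le> v h"
  shows "nesting_arrows (ordinary_windows f N) =
    {(point h (low_leaf v w), point h (low_leaf v u)) | b w u. (b, w, u) \<in> merges v tree}" (is "_ = ?A")
proof -
  let ?M = "merges v tree"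
  let ?G = "{0..real N} \<times> {v (low_leaf v tree)..v h}"
  obtain R where reg: "\<forall>b w u. (b, w, u) \<in> ?M \<longrightarrow> window_region b w (R b w)"
    and OW: "ordinary_windows f N = insert (essential_point h, ?G)
       {((Ordinary, v (low_leaf v w), v b), R b w) | b w u. (b, w, u) \<in> ?M}"
    by (rule ordinary_windows_eq[OF h])
  have glob: "R b w \<subset> ?G" if "(b, w, u) \<in> ?M" for b w u
    using window_region_global[OF that _ h(2)] reg that by blast
  have nest: "R b w \<subset> R b' w' \<longleftrightarrow> b \<in> items w'" if "(b, w, u) \<in> ?M" "(b', w', u') \<in> ?M" for b w u b' w' u'
  proof (cases "b = b'")
    case True
    then have "w' = w" using merge_node_unique[OF _ _ distinct_tree] that by metis
    then show ?thesis using True merge_values[OF that(1) tree(2)] by force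
  next
    case False
    then show ?thesis using window_region_nested[OF that False] reg[rule_format, OF that(1)] reg[rule_format, OF that(2)] by blast
  qed
  \<comment> \<open>\<open>winner_dies_above\<close> applied inside \<open>w'\<close>: a losing
    subtree that contains \<open>b\<close> is either the one in which the winner at \<open>b\<close>
    loses or contains a smaller losing subtree of that kind.\<close>
  have up: "low_leaf v u = low_leaf v w' \<or> (\<exists>b2 w2 u2. (b2, w2, u2) \<in> ?M \<and> b2 \<in> items w' \<and> low_leaf v w2 = low_leaf v u \<and> b \<in> items w2)"
    if "(b, w, u) \<in> ?M" "(b', w', u') \<in> ?M" "b \<in> items w'" for b w u b' w' u'
    using winner_dies_above[OF merge_inside[OF that(1,2) distinct_tree that(3)]]
  proof (elim disjE exE conjE)
    fix b2 w2 u2 assume *: "(b2, w2, u2) \<in> merges v w'" "low_leaf v w2 = low_leaf v u" "b \<in> items w2"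
    have "(b2, w2, u2) \<in> ?M" "b2 \<in> items w'" using merges_subtree[OF that(2)] *(1) merges_node[OF *(1)] by auto
    then show ?thesis using * by blast
  qed simp
  have OWI: "((Ordinary, v (low_leaf v w), v b), R b w) \<in> ordinary_windows f N" if "(b, w, u) \<in> ?M" for b w u
    unfolding OW using that by blast
  show ?thesis
  proof
    show "nesting_arrows (ordinary_windows f N) \<subseteq> ?A"
    proof
      fix pq assume *: "pq \<in> nesting_arrows (ordinary_windows f N)"
      obtain p q where pq0: "pq = (p, q)" by (cases pq)
      obtain P Q where pq: "pq = (p, q)" "(p, P) \<in> ordinary_windows f N" "(q, Q) \<in> ordinary_windows f N"
        "P \<subset> Q" and no: "\<And>r S. (r, S) \<in> ordinary_windows f N \<Longrightarrow> P \<subset> S \<Longrightarrow> S \<subset> Q \<Longrightarrow> False"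
        using * unfolding pq0 nesting_arrows_iff by metis
      have "P \<noteq> ?G"
      proof
        assume "P = ?G"
        then show False using pq(3,4) glob unfolding OW by blast
      qed
      then obtain b w u where m: "(b, w, u) \<in> ?M" "p = (Ordinary, v (low_leaf v w), v b)" "P = R b w"
        using pq(2) unfolding OW by blast
      have "q = point h (low_leaf v u)"
      proof (cases "Q = ?G")
        case True
        have "q = essential_point h"
          using pq(3) True glob unfolding OW by blast
        moreover have "low_leaf v u = low_leaf v tree"
        proof (rule ccontr)
          assume "low_leaf v u \<noteq> low_leaf v tree"
          then obtain b' w' u' where m': "(b', w', u') \<in> ?M" "b \<in> items w'" using winner_dies_above[OF m(1)] by blast
          then show False using no[OF OWI[OF m'(1)]] glob[OF m'(1)] nest[OF m(1) m'(1)] m(3) True by blast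
        qed
        ultimately show ?thesis unfolding point_def by simp
      next
        case False
        then obtain b' w' u' where m': "(b', w', u') \<in> ?M" "q = (Ordinary, v (low_leaf v w'), v b')" "Q = R b' w'"
          using pq(3) unfolding OW by blast
        then have "b \<in> items w'" using pq(4) nest[OF m(1) m'(1)] m(3) by blast
        then consider "low_leaf v u = low_leaf v w'"
          | b2 w2 u2 where "(b2, w2, u2) \<in> ?M" "b2 \<in> items w'" "b \<in> items w2"
          using up[OF m(1) m'(1)] by blast
        then show ?thesis
        proof cases
          case 1
          then show ?thesis using point_merge[OF m'(1)] m'(2) by simp
        next
          case 2
          then show ?thesis using no[OF OWI[OF 2(1)]] nest[OF m(1) 2(1)] nest[OF 2(1) m'(1)] m(3) m'(3) by blast
        qed
      qed
      then have "pq = (point h (low_leaf v w), point h (low_leaf v u))"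
        using pq(1) m(2) point_merge[OF m(1), of h] by simp
      then show "pq \<in> ?A" using m(1) by blast
    qed
    show "?A \<subseteq> nesting_arrows (ordinary_windows f N)"
    proof
      fix pq assume "pq \<in> ?A"
      then obtain b w u where m: "(b, w, u) \<in> ?M" and pq: "pq = (point h (low_leaf v w), point h (low_leaf v u))"
        by blast
      have "\<exists>Q. (point h (low_leaf v u), Q) \<in> ordinary_windows f N \<and> R b w \<subset> Q \<and>
        (\<forall>r S. (r, S) \<in> ordinary_windows f N \<longrightarrow> R b w \<subset> S \<longrightarrow> S \<subset> Q \<longrightarrow> False)"
        using winner_dies_above[OF m]
      proof (elim disjE exE conjE)
        assume e: "low_leaf v u = low_leaf v tree"
        have no: "False" if S: "(r, S) \<in> ordinary_windows f N" "R b w \<subset> S" "S \<subset> ?G" for r S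
        proof -
          obtain b' w' u' where m': "(b', w', u') \<in> ?M" "S = R b' w'" using S(1,3) unfolding OW by blast
          then have "b \<in> items w'" using S(2) nest[OF m m'(1)] by blast
          then show False
            using up[OF m m'(1)] merge_low_leaf[OF m'(1) distinct_tree] merge_low_leaf[OF _ distinct_tree] e by metis
        qed
        have "(point h (low_leaf v u), ?G) \<in> ordinary_windows f N"
          unfolding OW point_def using e by simp
        then show ?thesis using no glob[OF m] by (intro exI[of _ ?G] conjI allI impI)
      next
        fix b' w' u' assume m': "(b', w', u') \<in> ?M" "low_leaf v w' = low_leaf v u" "b \<in> items w'"
        have "False" if S: "(r, S) \<in> ordinary_windows f N" "R b w \<subset> S" "S \<subset> R b' w'" for r S
        proof -
          have "S \<noteq> ?G" using S(3) glob[OF m'(1)] by blast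
          then obtain b'' w'' u'' where m'': "(b'', w'', u'') \<in> ?M" "S = R b'' w''"
            using S(1) unfolding OW by blast
          have bb: "b \<in> items w''" "b'' \<in> items w'"
            using S(2,3) nest[OF m m''(1)] nest[OF m''(1) m'(1)] m''(2) by blast+
          \<comment> \<open>A window strictly in between contains \<open>b\<close>, so by
            \<open>up\<close> it is the winner's window or encloses it; but then \<open>b''\<close>
            is not lower than \<open>b'\<close>, against the nesting.\<close>
          have "b' = b'' \<or> b' \<in> items w''"
            using up[OF m m''(1) bb(1)] m'(2) merge_unique[OF m'(1) _ distinct_tree] m''(1) by metis
          moreover have "v b'' < v b'" using bb(2) merge_values[OF m'(1) tree(2)] by blast
          moreover have "v b' < v b''" if "b' \<in> items w''" using that merge_values[OF m''(1) tree(2)] by blast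
          ultimately show False by auto
        qed
        then show ?thesis using nest[OF m m'(1)] m' OWI[OF m'(1)] point_merge[OF m'(1)]
          by (intro exI[of _ "R b' w'"]) auto
      qed
      then obtain Q where "(point h (low_leaf v u), Q) \<in> ordinary_windows f N" "R b w \<subset> Q"
        "\<forall>r S. (r, S) \<in> ordinary_windows f N \<longrightarrow> R b w \<subset> S \<longrightarrow> S \<subset> Q \<longrightarrow> False"
        by (elim exE conjE)
      moreover have "(point h (low_leaf v w), R b w) \<in> ordinary_windows f N"
        using OWI[OF m] unfolding point_merge[OF m] .
      ultimately show "pq \<in> nesting_arrows (ordinary_windows f N)"
        unfolding pq nesting_arrows_iff by (intro exI conjI)
    qed
  qed
qed

end

section \<open>Building the tree with a stack\<close>

text \<open>Invariant of a trail under construction: the upper end is unknown, so the up-pointer of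
  the last node is unconstrained. \<open>F\<close> maps a field and a node to the stored number,
  which hides the array prefix of the tree.\<close>

definition open_trail :: "(string \<Rightarrow> nat \<Rightarrow> nat) \<Rightarrow> string \<Rightarrow> nat list \<Rightarrow> bool" where
  "open_trail F fld P \<longleftrightarrow> (1 < length P \<longrightarrow> F fld (hd P) = P ! 1) \<and>
     (\<forall>j. 0 < j \<and> j < length P \<longrightarrow> F ''dn'' (P ! j) = P ! (j - 1)) \<and>
     (\<forall>j. 0 < j \<and> Suc j < length P \<longrightarrow> F ''up'' (P ! j) = P ! Suc j)"

definition closed_trail :: "(string \<Rightarrow> nat \<Rightarrow> nat) \<Rightarrow> string \<Rightarrow> string \<Rightarrow> nat list \<Rightarrow> bool" where
  "closed_trail F fld fin T \<longleftrightarrow> F fld (hd T) = T ! 1 \<and> F fin (last T) = T ! (length T - 2) \<and>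
     (\<forall>j. 0 < j \<and> j < length T - 1 \<longrightarrow> F ''up'' (T ! j) = T ! (j + 1) \<and> F ''dn'' (T ! j) = T ! (j - 1))"

definition banana_ok :: "(string \<Rightarrow> nat \<Rightarrow> nat) \<Rightarrow> nat \<times> nat \<times> nat list \<times> nat list \<Rightarrow> bool" where
  "banana_ok F = (\<lambda>(a, b, L, R). F ''top'' a = b \<and> F ''low'' b = a \<and>
     closed_trail F ''left_up'' ''left_dn'' L \<and> closed_trail F ''right_up'' ''right_dn'' R)"

text \<open>Inside the subtree all bananas are final and only the two trails of its lowest leaf are
  open. Hence that leaf and the last nodes of these two trails are all the program has to remember
  of it.\<close>

definition built :: "(string \<Rightarrow> nat \<Rightarrow> nat) \<Rightarrow> (nat \<Rightarrow> real) \<Rightarrow> nat full_tree \<Rightarrow> bool" where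
  "built F v t \<longleftrightarrow> (\<forall>B \<in> closed_bananas v t. banana_ok F B) \<and>
     open_trail F ''left_up'' (lefts v t) \<and> open_trail F ''right_up'' (rights v t)"

lemma stores_bananas_iff: "stores_bananas s pre \<B> \<longleftrightarrow> (\<forall>B \<in> \<B>. banana_ok (\<lambda>x. nums s (pre @ x)) B)"
  unfolding stores_bananas_def stores_trail_def banana_ok_def closed_trail_def by auto

text \<open>The cell that changes when a node is attached after the last node \<open>e\<close> of a
  trail starting at \<open>m\<close>. A trail that consists of \<open>m\<close> alone uses the
  first-pointer of its side, because \<open>m\<close> lies on two trails; any other trail uses the
  shared field \<open>up\<close>.\<close>

definition link_cell :: "string \<Rightarrow> nat \<Rightarrow> nat \<Rightarrow> string \<Rightarrow> nat \<Rightarrow> bool" where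
  "link_cell fld m e x i \<longleftrightarrow> e = m \<and> x = fld \<and> i = m \<or> e \<noteq> m \<and> x = ''up'' \<and> i = e"

section \<open>Stability of trails under pointer updates\<close>

lemma nth_in_tl: "0 < j \<Longrightarrow> j < length P \<Longrightarrow> P ! j \<in> set (tl P)"
  by (cases P) auto

lemma nth_in_tl_neq_last:
  assumes "distinct P" "Suc j < length P"
  shows "P ! j \<noteq> last P"
proof -
  have "last P = P ! (length P - 1)" using assms by (intro last_conv_nth) auto
  then show ?thesis using assms nth_eq_iff_index_eq[of P j "length P - 1"] by simp
qed

text \<open>The up-pointer of the last node of a longer trail and the first-pointer of a trail of
  length one may change: they are not yet set and are the cells that the next attachment
  writes.\<close>

lemma open_trail_cong:
  assumes "open_trail F fld P" "1 < length P \<Longrightarrow> F' fld (hd P) = F fld (hd P)"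
    "\<And>x. x \<in> set (tl P) \<Longrightarrow> F' ''dn'' x = F ''dn'' x"
    "\<And>x. x \<in> set (tl P) \<Longrightarrow> x \<noteq> last P \<Longrightarrow> F' ''up'' x = F ''up'' x"
    "distinct P"
  shows "open_trail F' fld P"
  using assms nth_in_tl[of _ P] nth_in_tl_neq_last[OF assms(5)] unfolding open_trail_def by auto

lemma open_trail_snoc:
  assumes "open_trail F fld P" "P \<noteq> []" "length P = 1 \<Longrightarrow> F fld (hd P) = b"
    "1 < length P \<Longrightarrow> F ''up'' (last P) = b" "F ''dn'' b = last P"
  shows "open_trail F fld (P @ [b])"
proof -
  have l: "last P = P ! (length P - 1)" using assms(2) by (simp add: last_conv_nth)
  have "F fld (hd (P @ [b])) = (P @ [b]) ! 1"
    using assms(1-3) unfolding open_trail_def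
    by (cases "length P = 1"; cases "1 < length P") (simp_all add: nth_append Suc_lessI)
  moreover have "F ''dn'' ((P @ [b]) ! j) = (P @ [b]) ! (j - 1)" if "0 < j" "j < Suc (length P)" for j
  proof (cases "j = length P")
    case True
    then show ?thesis using assms(5) l that by (simp add: nth_append)
  next
    case False
    then have "j < length P" "j - 1 < length P" using that by simp_all
    then show ?thesis using assms(1) that unfolding open_trail_def by (simp add: nth_append)
  qed
  moreover have "F ''up'' ((P @ [b]) ! j) = (P @ [b]) ! Suc j" if "0 < j" "j < length P" for j
  proof (cases "Suc j = length P")
    case True
    then have "j = length P - 1" by simp
    then have "P ! j = last P" using l by simp
    then show ?thesis using assms(4) that True by (simp add: nth_append)
  next
    case False
    then show ?thesis using assms(1) that unfolding open_trail_def by (simp add: nth_append)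
  qed
  ultimately show ?thesis unfolding open_trail_def using assms(2) by (simp add: hd_append)
qed

lemma closed_trail_snoc:
  assumes "open_trail F fld P" "P \<noteq> []" "length P = 1 \<Longrightarrow> F fld (hd P) = b"
    "1 < length P \<Longrightarrow> F ''up'' (last P) = b" "F fin b = last P"
  shows "closed_trail F fld fin (P @ [b])"
proof -
  have l: "last P = P ! (length P - 1)" using assms(2) by (simp add: last_conv_nth)
  have "1 \<le> length P" using assms(2) by (simp add: Suc_leI)
  have "F ''up'' ((P @ [b]) ! j) = (P @ [b]) ! (j + 1) \<and> F ''dn'' ((P @ [b]) ! j) = (P @ [b]) ! (j - 1)"
    if j: "0 < j" "j < length P" for j
  proof (cases "Suc j = length P")
    case True
    then have "j = length P - 1" by simp
    then have "P ! j = last P" using l by simp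
    then show ?thesis using assms(1,4) j True unfolding open_trail_def by (auto simp: nth_append)
  next
    case False
    then show ?thesis using assms(1) j unfolding open_trail_def by (auto simp: nth_append)
  qed
  moreover have "F fld (hd (P @ [b])) = (P @ [b]) ! 1"
    using assms(1-3) \<open>1 \<le> length P\<close> unfolding open_trail_def
    by (cases "length P = 1") (auto simp: nth_append hd_append)
  moreover have "F fin (last (P @ [b])) = (P @ [b]) ! (length (P @ [b]) - 2)"
  proof -
    have "length P - 1 < length P" using \<open>1 \<le> length P\<close> by simp
    then show ?thesis using assms(5) l by (simp add: nth_append)
  qed
  ultimately show ?thesis unfolding closed_trail_def by auto
qed

lemma closed_trail_snoc_cong:
  assumes "closed_trail F fld fin (P @ [b])" "P \<noteq> []" "F' fld (hd P) = F fld (hd P)" "F' fin b = F fin b"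
    "\<And>x. x \<in> set (tl P) \<Longrightarrow> F' ''dn'' x = F ''dn'' x" "\<And>x. x \<in> set (tl P) \<Longrightarrow> F' ''up'' x = F ''up'' x"
  shows "closed_trail F' fld fin (P @ [b])"
  using assms nth_in_tl[of _ P] unfolding closed_trail_def by (auto simp: nth_append hd_append)

lemma banana_ok_cong:
  assumes "banana_ok F (banana_of v b w)"
    "\<And>x. x \<in> {''top'', ''left_up'', ''right_up''} \<Longrightarrow> F' x (low_leaf v w) = F x (low_leaf v w)"
    "\<And>x. x \<in> {''low'', ''left_dn'', ''right_dn''} \<Longrightarrow> F' x b = F x b"
    "\<And>x i. x \<in> {''up'', ''dn''} \<Longrightarrow> i \<in> set (tl (lefts v w)) \<union> set (tl (rights v w)) \<Longrightarrow> F' x i = F x i"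
  shows "banana_ok F' (banana_of v b w)"
  using assms closed_trail_snoc_cong[of F _ _ "lefts v w" b F'] closed_trail_snoc_cong[of F _ _ "rights v w" b F']
  unfolding banana_ok_def banana_of_def by (auto simp: hd_lefts hd_rights)

text \<open>The lowest leaf is no internal node, so it does not reappear further up its trail.
  Comparing the last node with the leaf therefore detects a trail of length one, which is how the
  program separates the two cases of \<open>link_cell\<close>.\<close>

lemma trail_distinct:
  assumes "distinct (in_order t)"
  shows "distinct (lefts v t)" "distinct (rights v t)"
    "length (lefts v t) = 1 \<longleftrightarrow> last (lefts v t) = low_leaf v t"
    "length (rights v t) = 1 \<longleftrightarrow> last (rights v t) = low_leaf v t"
proof -
  have n: "low_leaf v t \<notin> inners t" using leaves_inners_disjoint[OF assms] low_leaf_in_leaves[of v t] by blast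
  have P: "distinct P \<and> (length P = 1 \<longleftrightarrow> last P = low_leaf v t)"
    if "P \<noteq> []" "hd P = low_leaf v t" "set (tl P) \<subseteq> inners t" "distinct (tl P)" for P
  proof (cases P)
    case (Cons a as)
    have "last as \<noteq> low_leaf v t" if "as \<noteq> []"
      using last_in_set[OF that] \<open>set (tl P) \<subseteq> inners t\<close> n Cons by auto
    then show ?thesis using that n Cons by (cases "as = []") auto
  qed (use that in simp)
  show "distinct (lefts v t)" "distinct (rights v t)"
    "length (lefts v t) = 1 \<longleftrightarrow> last (lefts v t) = low_leaf v t"
    "length (rights v t) = 1 \<longleftrightarrow> last (rights v t) = low_leaf v t"
    using P[of "lefts v t"] P[of "rights v t"] trails_merge(2)[OF assms, of v] set_tl_lefts[of v t] set_tl_rights[of v t]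
    by (simp_all add: hd_lefts hd_rights)
qed

lemma last_lefts: "last (lefts v t) = low_leaf v t \<or> last (lefts v t) \<in> set (tl (lefts v t))"
  and last_rights: "last (rights v t) = low_leaf v t \<or> last (rights v t) \<in> set (tl (rights v t))"
proof -
  have "last P = hd P \<or> last P \<in> set (tl P)" if "P \<noteq> []" for P :: "'a list"
    using that by (cases P) auto
  from this[of "lefts v t"] this[of "rights v t"]
  show "last (lefts v t) = low_leaf v t \<or> last (lefts v t) \<in> set (tl (lefts v t))"
    "last (rights v t) = low_leaf v t \<or> last (rights v t) \<in> set (tl (rights v t))"
    by (simp_all add: hd_lefts hd_rights)
qed

text \<open>A node on the trails of \<open>w\<close> is won by the lowest leaf of \<open>w\<close>,
  a node on the open trails by that of \<open>t\<close>, and a merge has only one winner. So an open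
  trail can be extended through the shared fields without touching a closed banana.\<close>

lemma inner_trails_disjoint:
  assumes "distinct (in_order t)" "(b, w, u) \<in> merges v t"
  shows "(set (tl (lefts v t)) \<union> set (tl (rights v t))) \<inter> (set (tl (lefts v w)) \<union> set (tl (rights v w))) = {}"
proof -
  have "False" if c: "c \<in> set (tl (lefts v t)) \<union> set (tl (rights v t))"
    "c \<in> set (tl (lefts v w)) \<union> set (tl (rights v w))" for c
  proof -
    obtain w1 u1 where 1: "(c, w1, u1) \<in> merges v t" "low_leaf v u1 = low_leaf v t"
      using c(1) unfolding trails_merge(1)[OF assms(1)] by blast
    obtain w2 u2 where 2: "(c, w2, u2) \<in> merges v w" "low_leaf v u2 = low_leaf v w"
      using c(2) unfolding trails_merge(1)[OF distinct_merge[OF assms(2,1)]] by blast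
    have "(c, w2, u2) \<in> merges v t" using merges_subtree[OF assms(2)] 2(1) by blast
    then have "u2 = u1" using merge_node_unique[OF 1(1) _ assms(1)] by blast
    then show False using 1(2) 2(2) merge_low_leaf[OF assms(2,1)] by simp
  qed
  then show ?thesis by blast
qed

text \<open>The winner \<open>u\<close> keeps the trail \<open>Q\<close> and has \<open>b\<close> appended to the trail \<open>P\<close>, the two being its left and
  right trail in either order.\<close>

lemma merge_writes:
  assumes d: "distinct (in_order u)" "distinct (in_order w)" "items u \<inter> items w = {}" "b \<notin> items u" "b \<notin> items w"
    and bu: "built F v u" and bw: "built F v w"
    and side: "fp = ''right_up'' \<and> P = rights v u \<and> fq = ''left_up'' \<and> Q = lefts v u \<or>
      fp = ''left_up'' \<and> P = lefts v u \<and> fq = ''right_up'' \<and> Q = rights v u"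
    and F': "\<And>x i. F' x i =
      (if x = ''low'' \<and> i = b then low_leaf v w else if x = ''top'' \<and> i = low_leaf v w then b
       else if x = ''left_dn'' \<and> i = b then last (lefts v w)
       else if x = ''right_dn'' \<and> i = b then last (rights v w)
       else if x = ''dn'' \<and> i = b then last P
       else if link_cell ''left_up'' (low_leaf v w) (last (lefts v w)) x i \<or>
         link_cell ''right_up'' (low_leaf v w) (last (rights v w)) x i \<or>
         link_cell fp (low_leaf v u) (last P) x i then b
       else F x i)"
  shows "\<forall>B \<in> insert (banana_of v b w) (closed_bananas v u \<union> closed_bananas v w). banana_ok F' B"
    "open_trail F' fq Q" "open_trail F' fp (P @ [b])"
proof -
  note lu = low_leaf_in_items[of v u] low_leaf_in_leaves[of v u]
  note lw = low_leaf_in_items[of v w] low_leaf_in_leaves[of v w]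
  have lne: "low_leaf v u \<noteq> low_leaf v w" using lu(1) lw(1) d(3) by (metis IntI empty_iff)
  have tu: "set (tl (lefts v u)) \<union> set (tl (rights v u)) \<subseteq> items u"
    and tw: "set (tl (lefts v w)) \<union> set (tl (rights v w)) \<subseteq> items w"
    using set_tl_lefts[of v] set_tl_rights[of v] by (auto simp: items_conv)
  have P: "hd P = low_leaf v u" "distinct P" "length P = 1 \<longleftrightarrow> last P = low_leaf v u" "P \<noteq> []"
      "last P = low_leaf v u \<or> last P \<in> set (tl P)" "set (tl P) \<subseteq> set (tl (lefts v u)) \<union> set (tl (rights v u))"
    and Q: "hd Q = low_leaf v u" "distinct Q" "set (tl Q) \<subseteq> set (tl (lefts v u)) \<union> set (tl (rights v u))"
      "set (tl P) \<inter> set (tl Q) = {}"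
    and oP: "open_trail F fp P" and oQ: "open_trail F fq Q"
    and fp: "fp = ''right_up'' \<and> fq = ''left_up'' \<or> fp = ''left_up'' \<and> fq = ''right_up''"
  proof -
    have "set (tl (lefts v u)) \<inter> set (tl (rights v u)) = {}" using trails_merge(2)[OF d(1), of v] by auto
    moreover have "open_trail F ''left_up'' (lefts v u)" "open_trail F ''right_up'' (rights v u)"
      using bu unfolding built_def by auto
    moreover note trail_distinct[OF d(1), of v] last_lefts[of v u] last_rights[of v u] hd_lefts[of v u] hd_rights[of v u]
    ultimately have "hd P = low_leaf v u \<and> distinct P \<and> (length P = 1 \<longleftrightarrow> last P = low_leaf v u) \<and> P \<noteq> [] \<and>
      (last P = low_leaf v u \<or> last P \<in> set (tl P)) \<and> set (tl P) \<subseteq> set (tl (lefts v u)) \<union> set (tl (rights v u)) \<and>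
      hd Q = low_leaf v u \<and> distinct Q \<and> set (tl Q) \<subseteq> set (tl (lefts v u)) \<union> set (tl (rights v u)) \<and>
      set (tl P) \<inter> set (tl Q) = {} \<and> open_trail F fp P \<and> open_trail F fq Q \<and>
      (fp = ''right_up'' \<and> fq = ''left_up'' \<or> fp = ''left_up'' \<and> fq = ''right_up'')"
      using side by (elim disjE[of "fp = ''right_up'' \<and> _"]) (simp_all add: Int_commute)
    then show "hd P = low_leaf v u" "distinct P" "length P = 1 \<longleftrightarrow> last P = low_leaf v u" "P \<noteq> []"
      "last P = low_leaf v u \<or> last P \<in> set (tl P)" "set (tl P) \<subseteq> set (tl (lefts v u)) \<union> set (tl (rights v u))"
      "hd Q = low_leaf v u" "distinct Q" "set (tl Q) \<subseteq> set (tl (lefts v u)) \<union> set (tl (rights v u))"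
      "set (tl P) \<inter> set (tl Q) = {}" "open_trail F fp P" "open_trail F fq Q"
      "fp = ''right_up'' \<and> fq = ''left_up'' \<or> fp = ''left_up'' \<and> fq = ''right_up''"
      by - (elim conjE, assumption)+
  qed
  note Lw = trail_distinct[OF d(2), of v] last_lefts[of v w] last_rights[of v w]
  have lP: "last P \<in> items u"
    using P(5) subsetD[OF P(6), of "last P"] subsetD[OF tu, of "last P"] lu(1) by auto
  have lL: "last (lefts v w) \<in> items w" "last (rights v w) \<in> items w"
    using Lw(5,6) lw(1) subsetD[OF tw, of "last (lefts v w)"] subsetD[OF tw, of "last (rights v w)"] by auto
  \<comment> \<open>Bananas closed earlier inside the winner: their lower ends have lost and so
    differ from its lowest leaf, and their inner nodes avoid the last node of the open trail. None
    of the written cells is theirs.\<close>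
  have old_u: "banana_ok F' (banana_of v c x)" if m: "(c, x, y) \<in> merges v u" for c x y
  proof (rule banana_ok_cong)
    show "banana_ok F (banana_of v c x)" using bu m unfolding built_def closed_bananas_def by blast
    note mi = merges_items[OF m] merges_node[OF m] merge_low_leaf[OF m d(1)] inner_trails_disjoint[OF d(1) m]
    have a: "low_leaf v x \<in> items u" "low_leaf v x \<noteq> low_leaf v u" using mi(1,3) low_leaf_in_items[of v x] by auto
    then have a': "low_leaf v x \<noteq> low_leaf v w" "low_leaf v x \<noteq> b" using lw(1) d(3,4) by auto
    show "F' z (low_leaf v x) = F z (low_leaf v x)" if "z \<in> {''top'', ''left_up'', ''right_up''}" for z
      using that a(2) a' fp unfolding F' link_cell_def by auto
    have "c \<noteq> b" using mi(2) d(4) by blast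
    then show "F' z c = F z c" if "z \<in> {''low'', ''left_dn'', ''right_dn''}" for z
      using that fp unfolding F' link_cell_def by auto
    show "F' z i = F z i" if z: "z \<in> {''up'', ''dn''}" and i: "i \<in> set (tl (lefts v x)) \<union> set (tl (rights v x))" for z i
    proof -
      have "set (tl (lefts v x)) \<union> set (tl (rights v x)) \<subseteq> items u"
        using set_tl_lefts[of v x] set_tl_rights[of v x] mi(1) by (auto simp: items_conv)
      then have "i \<in> items u" using i by blast
      then have i': "i \<noteq> b" "i \<noteq> last (lefts v w)" "i \<noteq> last (rights v w)" using lL d(3,4) by auto
      have "last P \<noteq> low_leaf v u \<Longrightarrow> i \<noteq> last P" using P(5,6) mi(4) i by blast
      then show ?thesis using z i' fp unfolding F' link_cell_def by auto
    qed
  qed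
  have old_w: "banana_ok F' (banana_of v c x)" if m: "(c, x, y) \<in> merges v w" for c x y
  proof (rule banana_ok_cong)
    show "banana_ok F (banana_of v c x)" using bw m unfolding built_def closed_bananas_def by blast
    note mi = merges_items[OF m] merges_node[OF m] merge_low_leaf[OF m d(2)] inner_trails_disjoint[OF d(2) m]
    have a: "low_leaf v x \<in> items w" "low_leaf v x \<noteq> low_leaf v w" using mi(1,3) low_leaf_in_items[of v x] by auto
    then have a': "low_leaf v x \<noteq> low_leaf v u" "low_leaf v x \<noteq> b" using lu(1) d(3,5) by auto
    show "F' z (low_leaf v x) = F z (low_leaf v x)" if "z \<in> {''top'', ''left_up'', ''right_up''}" for z
      using that a(2) a' fp unfolding F' link_cell_def by auto
    have "c \<noteq> b" using mi(2) d(5) by blast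
    then show "F' z c = F z c" if "z \<in> {''low'', ''left_dn'', ''right_dn''}" for z
      using that fp unfolding F' link_cell_def by auto
    show "F' z i = F z i" if z: "z \<in> {''up'', ''dn''}" and i: "i \<in> set (tl (lefts v x)) \<union> set (tl (rights v x))" for z i
    proof -
      have "set (tl (lefts v x)) \<union> set (tl (rights v x)) \<subseteq> items w"
        using set_tl_lefts[of v x] set_tl_rights[of v x] mi(1) by (auto simp: items_conv)
      then have "i \<in> items w" using i by blast
      then have i': "i \<noteq> b" "i \<noteq> last P" using lP d(3,5) by auto
      have "last (lefts v w) \<noteq> low_leaf v w \<Longrightarrow> i \<noteq> last (lefts v w)"
        "last (rights v w) \<noteq> low_leaf v w \<Longrightarrow> i \<noteq> last (rights v w)" using Lw(5,6) mi(4) i by blast+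
      then show ?thesis using z i' fp unfolding F' link_cell_def by auto
    qed
  qed
  have dw: "set (tl (lefts v w)) \<inter> set (tl (rights v w)) = {}" using trails_merge(2)[OF d(2), of v] by auto
  have bw': "b \<notin> set (tl (lefts v w)) \<union> set (tl (rights v w))" "b \<noteq> low_leaf v w" using tw d(5) lw by blast+
  have bu': "b \<notin> set (tl P) \<union> set (tl Q)" "b \<noteq> low_leaf v u" using tu d(4) P(6) Q(3) lu by blast+
  have other: "i \<noteq> last P" if "i \<in> set (tl (lefts v w)) \<union> set (tl (rights v w))" for i
    using that tw lP d(3) by blast
  have other': "i \<noteq> last (lefts v w)" "i \<noteq> last (rights v w)" if "i \<in> set (tl P) \<union> set (tl Q)" for i
    using that P(6) Q(3) tu lL d(3) by blast+
  have ow: "open_trail F ''left_up'' (lefts v w)" "open_trail F ''right_up'' (rights v w)"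
    using bw unfolding built_def by auto
  have L: "open_trail F' ''left_up'' (lefts v w)"
  proof (rule open_trail_cong[OF ow(1) _ _ _ Lw(1)])
    show "F' ''left_up'' (hd (lefts v w)) = F ''left_up'' (hd (lefts v w))" if "1 < length (lefts v w)"
      using that Lw(3) lne fp unfolding F' link_cell_def by (auto simp: hd_lefts)
    show "F' ''dn'' x = F ''dn'' x" if "x \<in> set (tl (lefts v w))" for x
      using that bw' fp unfolding F' link_cell_def by auto
    show "F' ''up'' x = F ''up'' x" if "x \<in> set (tl (lefts v w))" "x \<noteq> last (lefts v w)" for x
      using that other[of x] Lw(6) dw fp unfolding F' link_cell_def by auto
  qed
  have R: "open_trail F' ''right_up'' (rights v w)"
  proof (rule open_trail_cong[OF ow(2) _ _ _ Lw(2)])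
    show "F' ''right_up'' (hd (rights v w)) = F ''right_up'' (hd (rights v w))" if "1 < length (rights v w)"
      using that Lw(4) lne fp unfolding F' link_cell_def by (auto simp: hd_rights)
    show "F' ''dn'' x = F ''dn'' x" if "x \<in> set (tl (rights v w))" for x
      using that bw' fp unfolding F' link_cell_def by auto
    show "F' ''up'' x = F ''up'' x" if "x \<in> set (tl (rights v w))" "x \<noteq> last (rights v w)" for x
      using that other[of x] Lw(5) dw fp unfolding F' link_cell_def by auto
  qed
  have "closed_trail F' ''left_up'' ''left_dn'' (lefts v w @ [b])"
    using Lw(3) fp by (intro closed_trail_snoc[OF L]) (auto simp: F' link_cell_def hd_lefts)
  moreover have "closed_trail F' ''right_up'' ''right_dn'' (rights v w @ [b])"
    using Lw(4) fp by (intro closed_trail_snoc[OF R]) (auto simp: F' link_cell_def hd_rights)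
  ultimately have "banana_ok F' (banana_of v b w)"
    unfolding banana_ok_def banana_of_def by (simp add: F')
  then show "\<forall>B \<in> insert (banana_of v b w) (closed_bananas v u \<union> closed_bananas v w). banana_ok F' B"
    using old_u old_w unfolding closed_bananas_def by blast
  show "open_trail F' fq Q"
  proof (rule open_trail_cong[OF oQ _ _ _ Q(2)])
    show "F' fq (hd Q) = F fq (hd Q)" using Q(1) lne fp bu' unfolding F' link_cell_def by auto
    show "F' ''dn'' x = F ''dn'' x" if "x \<in> set (tl Q)" for x
      using that bu' fp unfolding F' link_cell_def by auto
    show "F' ''up'' x = F ''up'' x" if "x \<in> set (tl Q)" "x \<noteq> last Q" for x
      using that other'[of x] P(5) Q(4) fp unfolding F' link_cell_def by auto
  qed
  have "open_trail F' fp P"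
  proof (rule open_trail_cong[OF oP _ _ _ P(2)])
    show "F' fp (hd P) = F fp (hd P)" if "1 < length P" using that P(1,3) lne fp bu' unfolding F' link_cell_def by auto
    show "F' ''dn'' x = F ''dn'' x" if "x \<in> set (tl P)" for x
      using that bu' fp unfolding F' link_cell_def by auto
    show "F' ''up'' x = F ''up'' x" if "x \<in> set (tl P)" "x \<noteq> last P" for x
      using that other'[of x] fp unfolding F' link_cell_def by auto
  qed
  then show "open_trail F' fp (P @ [b])"
    using P(1,3,4) fp lne by (intro open_trail_snoc) (auto simp: F' link_cell_def)
qed

section \<open>Removing non-critical items\<close>

abbreviation cell :: "string \<Rightarrow> num_exp" where "cell x \<equiv> At x (Const 0)"

abbreviation set_cell :: "string \<Rightarrow> num_exp \<Rightarrow> prog" where "set_cell x e \<equiv> PutNum x (Const 0) e"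

definition either :: "test \<Rightarrow> test \<Rightarrow> test" where
  "either b c = Negate (Both (Negate b) (Negate c))"

lemma holds_either [simp]: "holds (either b c) s \<longleftrightarrow> holds b s \<or> holds c s"
  by (simp add: either_def)

fun block :: "prog list \<Rightarrow> prog" where
  "block [] = Skip"
| "block [p] = p"
| "block (p # q # ps) = Seq p (block (q # ps))"

text \<open>There is no short-circuit: at 0 the decremented index is again 0, and at
  \<open>N\<close> the cell beyond the map is read. Both readings are harmless since the first
  alternative already decides there.\<close>

definition keep_test :: test where
  "keep_test = either (either (EqNum (cell ''i'') (Const 0)) (EqNum (cell ''i'') (cell ''N'')))
     (either
       (Both (LessVal ''f'' (Dec (cell ''i'')) ''f'' (cell ''i'')) (LessVal ''f'' (Inc (cell ''i'')) ''f'' (cell ''i'')))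
       (Both (LessVal ''f'' (cell ''i'') ''f'' (Dec (cell ''i''))) (LessVal ''f'' (cell ''i'') ''f'' (Inc (cell ''i'')))))"

definition remove_noncritical :: prog where
  "remove_noncritical = block
    [set_cell ''crit_count'' (Const 0), set_cell ''i'' (Const 0),
     While (LessNum (cell ''i'') (Inc (cell ''N''))) (block
       [Cond keep_test
          (block [PutNum ''crit'' (cell ''crit_count'') (cell ''i''),
                  set_cell ''crit_count'' (Inc (cell ''crit_count''))])
          Skip,
        set_cell ''i'' (Inc (cell ''i''))])]"

context pl_wave
begin

lemma kept_iff:
  assumes "i \<le> N"
  shows "critical f N i \<or> critical (\<lambda>t. - f t) N i \<longleftrightarrow>
    i = 0 \<or> i = N \<or> v (i - 1) < v i \<and> v (i + 1) < v i \<or> v i < v (i - 1) \<and> v i < v (i + 1)"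
proof (cases "i = 0 \<or> i = N")
  case True
  have "N - 1 \<noteq> N" using N_pos by simp
  then have "v (N - 1) \<noteq> v N" by (intro v_neq) auto
  then show ?thesis using True v_neq[of 0 1] N_pos
    unfolding critical_def minimum_def maximum_def by auto
next
  case False
  then show ?thesis using assms unfolding critical_def minimum_def maximum_def by auto
qed

lemma remove_noncritical:
  assumes "stores_map s f N"
  shows "wp remove_noncritical s (\<lambda>t s'. t \<le> 5 * N + 8 \<and> stores_kept_list s' f N)"
proof -
  define keep where "keep i \<longleftrightarrow> critical f N i \<or> critical (\<lambda>t. - f t) N i" for i
  define kl where "kl k = filter keep [0..<k]" for k
  have kl: "kl (Suc k) = kl k @ (if keep k then [k] else [])" for k by (simp add: kl_def)
  define I where "I k s \<longleftrightarrow> k \<le> Suc N \<and> nums s ''i'' 0 = k \<and> nums s ''N'' 0 = N \<and>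
    nums s ''crit_count'' 0 = length (kl k) \<and> (\<forall>j < length (kl k). nums s ''crit'' j = kl k ! j) \<and>
    (\<forall>i \<le> N. vals s ''f'' i = v i)" for k and s :: state
  define body where "body = block
       [Cond keep_test
          (block [PutNum ''crit'' (cell ''crit_count'') (cell ''i''),
                  set_cell ''crit_count'' (Inc (cell ''crit_count''))])
          Skip,
        set_cell ''i'' (Inc (cell ''i''))]"
  define test where "test = LessNum (cell ''i'') (Inc (cell ''N''))"
  \<comment> \<open>Five steps per item at most: the loop test, the conditional, two writes and the
    increment.\<close>
  have step: "wp body s (\<lambda>t s'. \<exists>y. I y s' \<and> t + 1 + 5 * (Suc N - y) \<le> 5 * (Suc N - x))"
    if I: "I x s" and h: "holds test s" for x and s :: state
  proof -
    have x: "x \<le> N" using I h unfolding I_def test_def by simp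
    have kt: "holds keep_test s \<longleftrightarrow> keep x"
    proof -
      have "vals s ''f'' x = v x" "vals s ''f'' (x - 1) = v (x - 1)" "x \<noteq> N \<longrightarrow> vals s ''f'' (x + 1) = v (x + 1)"
        using I x unfolding I_def by auto
      then show ?thesis unfolding keep_def kept_iff[OF x] using I x unfolding I_def keep_test_def by auto
    qed
    show ?thesis unfolding body_def block.simps
      using I x kt by (auto simp: I_def kl nth_append intro!: exI[of _ "Suc x"])
  qed
  have w: "wp (While test body) s (\<lambda>t s'. \<exists>y. I y s' \<and> \<not> holds test s' \<and> t + 5 * (Suc N - y) \<le> 5 * (Suc N - 0) + 1)"
    if "I 0 s" for s :: state
    by (rule wp_While[where \<Phi> = "\<lambda>k. 5 * (Suc N - k)" and I = I]) (use step that in auto)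
  have I0: "I 0 (put_num ''i'' 0 0 (put_num ''crit_count'' 0 0 s))"
    using assms unfolding I_def stores_map_def by (simp add: kl_def)
  have klN: "kl (Suc N) = kept_list f N" unfolding kl_def keep_def kept_list_def ..
  show ?thesis
    unfolding remove_noncritical_def block.simps body_def[symmetric, unfolded block.simps] test_def[symmetric] wp_Seq wp_PutNum num_of.simps
  proof (rule wp_mono[OF w[OF I0]])
    fix t s' assume "\<exists>y. I y s' \<and> \<not> holds test s' \<and> t + 5 * (Suc N - y) \<le> 5 * (Suc N - 0) + 1"
    then obtain y where y: "I y s'" "\<not> holds test s'" "t + 5 * (Suc N - y) \<le> 5 * (Suc N - 0) + 1" by blast
    then have yN: "y = Suc N" unfolding I_def test_def by auto
    have "i \<le> N" if "i \<in> set (kept_list f N)" for i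
      using that by (auto simp: kept_list_def simp del: upt_Suc)
    then have "stores_kept_list s' f N"
      using y(1) unfolding yN I_def klN stores_kept_list_def by auto
    then show "1 + (1 + t) \<le> 5 * N + 8 \<and> stores_kept_list s' f N" using y(3) by simp
  qed
qed

end

section \<open>Building the banana tree in memory\<close>

text \<open>The stored values are those of \<open>f\<close>, and the machine cannot negate reals;
  the order of \<open>- f\<close> is obtained by exchanging the operands.\<close>

definition less_test :: "bool \<Rightarrow> num_exp \<Rightarrow> num_exp \<Rightarrow> test" where
  "less_test flip d e = (if flip then LessVal ''f'' e ''f'' d else LessVal ''f'' d ''f'' e)"

lemma holds_less_test:
  "holds (less_test flip d e) s \<longleftrightarrow>
    (if flip then - vals s ''f'' (num_of d s) < - vals s ''f'' (num_of e s)
     else vals s ''f'' (num_of d s) < vals s ''f'' (num_of e s))"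
  by (simp add: less_test_def)

definition append_node :: "string \<Rightarrow> string \<Rightarrow> num_exp \<Rightarrow> num_exp \<Rightarrow> num_exp \<Rightarrow> prog" where
  "append_node p fld m e b = Cond (EqNum e m) (PutNum (p @ fld) m b) (PutNum (p @ ''up'') e b)"

definition link :: "string \<Rightarrow> string \<Rightarrow> nat \<Rightarrow> nat \<Rightarrow> nat \<Rightarrow> state \<Rightarrow> state" where
  "link p fld m e b s = (if e = m then put_num (p @ fld) m b s else put_num (p @ ''up'') e b s)"

lemma wp_append_node [simp]:
  "wp (append_node p fld m e b) s Q \<longleftrightarrow> Q 2 (link p fld (num_of m s) (num_of e s) (num_of b s) s)"
  unfolding append_node_def link_def by (simp add: numeral_2_eq_2)

lemma vals_link [simp]: "vals (link p fld m e b s) = vals s"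
  by (simp add: link_def)

lemma nums_link_field:
  "nums (link p fld m e b s) (p @ x) i = (if link_cell fld m e x i then b else nums s (p @ x) i)"
  by (simp add: link_def link_cell_def)

lemma nums_link_other:
  "y \<noteq> p @ fld \<Longrightarrow> y \<noteq> p @ ''up'' \<Longrightarrow> nums (link p fld m e b s) y i = nums s y i"
  by (simp add: link_def)

definition close_banana :: "string \<Rightarrow> num_exp \<Rightarrow> num_exp \<Rightarrow> num_exp \<Rightarrow> num_exp \<Rightarrow> prog" where
  "close_banana p m l r b = block
    [append_node p ''left_up'' m l b, append_node p ''right_up'' m r b,
     PutNum (p @ ''left_dn'') b l, PutNum (p @ ''right_dn'') b r,
     PutNum (p @ ''top'') m b, PutNum (p @ ''low'') b m]"

abbreviation reg :: "string \<Rightarrow> string \<Rightarrow> num_exp" where "reg p x \<equiv> cell (p @ x)"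

text \<open>The registers \<open>tm\<close>, \<open>tl\<close>, \<open>tr\<close> hold the lowest
  leaf and the last left and right trail node of the rightmost tree. \<open>m\<close>,
  \<open>l\<close>, \<open>r\<close> hold the same for the tree taken from the stack, and
  \<open>b\<close> is the maximum between the two.\<close>

definition pop_tree :: "string \<Rightarrow> prog" where
  "pop_tree p = block
    [set_cell (p @ ''sp'') (Dec (reg p ''sp'')),
     set_cell (p @ ''m'') (At (p @ ''sm'') (reg p ''sp'')),
     set_cell (p @ ''l'') (At (p @ ''sl'') (reg p ''sp'')),
     set_cell (p @ ''r'') (At (p @ ''sr'') (reg p ''sp'')),
     set_cell (p @ ''b'') (At (p @ ''sb'') (reg p ''sp''))]"

text \<open>The left tree wins, so the maximum becomes the last node of its right trail while the
  left trail keeps its last node.\<close>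

definition win_left :: "string \<Rightarrow> prog" where
  "win_left p = block
    [append_node p ''right_up'' (reg p ''m'') (reg p ''r'') (reg p ''b''),
     PutNum (p @ ''dn'') (reg p ''b'') (reg p ''r''),
     set_cell (p @ ''tm'') (reg p ''m''), set_cell (p @ ''tl'') (reg p ''l''),
     set_cell (p @ ''tr'') (reg p ''b'')]"

definition win_right :: "string \<Rightarrow> prog" where
  "win_right p = block
    [append_node p ''left_up'' (reg p ''tm'') (reg p ''tl'') (reg p ''b''),
     PutNum (p @ ''dn'') (reg p ''b'') (reg p ''tl''),
     set_cell (p @ ''tl'') (reg p ''b'')]"

definition merge_step :: "string \<Rightarrow> bool \<Rightarrow> prog" where
  "merge_step p flip = block
    [pop_tree p,
     Cond (less_test flip (reg p ''m'') (reg p ''tm''))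
       (block [close_banana p (reg p ''tm'') (reg p ''tl'') (reg p ''tr'') (reg p ''b''), win_left p])
       (block [close_banana p (reg p ''m'') (reg p ''l'') (reg p ''r'') (reg p ''b''), win_right p])]"

definition closed_state :: "string \<Rightarrow> nat \<Rightarrow> nat \<Rightarrow> nat \<Rightarrow> nat \<Rightarrow> state \<Rightarrow> state" where
  "closed_state p m l r b s = put_num (p @ ''low'') b m (put_num (p @ ''top'') m b
    (put_num (p @ ''right_dn'') b r (put_num (p @ ''left_dn'') b l
    (link p ''right_up'' m r b (link p ''left_up'' m l b s)))))"

lemma wp_close_banana:
  assumes "m \<in> {''m'', ''tm''}" "l \<in> {''l'', ''tl''}" "r \<in> {''r'', ''tr''}"
  shows "wp (close_banana p (reg p m) (reg p l) (reg p r) (reg p ''b'')) s Q \<longleftrightarrow>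
    Q 8 (closed_state p (nums s (p @ m) 0) (nums s (p @ l) 0) (nums s (p @ r) 0) (nums s (p @ ''b'') 0) s)"
  using assms unfolding close_banana_def block.simps closed_state_def
  by (elim insertE emptyE) (simp_all add: nums_link_other)

lemma wp_win_left:
  "wp (win_left p) s Q \<longleftrightarrow> Q 6
    (put_num (p @ ''tr'') 0 (nums s (p @ ''b'') 0) (put_num (p @ ''tl'') 0 (nums s (p @ ''l'') 0)
    (put_num (p @ ''tm'') 0 (nums s (p @ ''m'') 0)
    (put_num (p @ ''dn'') (nums s (p @ ''b'') 0) (nums s (p @ ''r'') 0)
    (link p ''right_up'' (nums s (p @ ''m'') 0) (nums s (p @ ''r'') 0) (nums s (p @ ''b'') 0) s)))))"
  unfolding win_left_def block.simps by (simp add: nums_link_other)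

lemma wp_win_right:
  "wp (win_right p) s Q \<longleftrightarrow> Q 4
    (put_num (p @ ''tl'') 0 (nums s (p @ ''b'') 0)
    (put_num (p @ ''dn'') (nums s (p @ ''b'') 0) (nums s (p @ ''tl'') 0)
    (link p ''left_up'' (nums s (p @ ''tm'') 0) (nums s (p @ ''tl'') 0) (nums s (p @ ''b'') 0) s)))"
  unfolding win_right_def block.simps by (simp add: nums_link_other)

lemma nums_closed_other:
  assumes "x \<notin> {''low'', ''top'', ''left_dn'', ''right_dn'', ''left_up'', ''right_up'', ''up''}"
  shows "nums (closed_state p m l r b s) (p @ x) i = nums s (p @ x) i"
  using assms unfolding closed_state_def by (simp add: nums_link_other)

text \<open>The head of the list is the top of the stack and the array grows upwards, hence
  \<open>rev\<close>.\<close>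

definition stack_cells :: "state \<Rightarrow> string \<Rightarrow> (nat \<Rightarrow> real) \<Rightarrow> (nat full_tree \<times> nat) list \<Rightarrow> bool" where
  "stack_cells s p v st \<longleftrightarrow> nums s (p @ ''sp'') 0 = length st \<and>
     (\<forall>j < length st. case rev st ! j of (t, b) \<Rightarrow>
        nums s (p @ ''sm'') j = low_leaf v t \<and> nums s (p @ ''sl'') j = last (lefts v t) \<and>
        nums s (p @ ''sr'') j = last (rights v t) \<and> nums s (p @ ''sb'') j = b)"

definition tree_cells :: "state \<Rightarrow> string \<Rightarrow> (nat \<Rightarrow> real) \<Rightarrow> nat full_tree \<Rightarrow> bool" where
  "tree_cells s p v t \<longleftrightarrow> nums s (p @ ''tm'') 0 = low_leaf v t \<and>
     nums s (p @ ''tl'') 0 = last (lefts v t) \<and> nums s (p @ ''tr'') 0 = last (rights v t)"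

text \<open>The in-order list of the tree that arises if all stacked trees are merged now, top of
  the stack first. It is the part of the input read so far and is invariant under a merge.\<close>

fun scanned :: "(nat full_tree \<times> nat) list \<Rightarrow> nat full_tree \<Rightarrow> nat list" where
  "scanned [] T = in_order T"
| "scanned ((t, b) # st) T = scanned st (Bin t b T)"

lemma scanned_eq: "scanned st T = concat (map (\<lambda>(t, b). in_order t @ [b]) (rev st)) @ in_order T"
  by (induction st T rule: scanned.induct) auto

text \<open>The stacked maxima are the right spine of the tree of the items read so far, lowest on
  top. They wait for their right subtree to be complete, and \<open>T\<close> is the current right
  subtree of the topmost one.\<close>

definition spine :: "(nat \<Rightarrow> real) \<Rightarrow> (nat full_tree \<times> nat) list \<Rightarrow> nat full_tree \<Rightarrow> bool" where
  "spine v st T \<longleftrightarrow> distinct (scanned st T) \<and> increasing_upwards v T \<and>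
     (\<forall>(t, b) \<in> set st. increasing_upwards v t \<and> v (root t) < v b) \<and>
     sorted_wrt (\<lambda>x y. v (snd x) < v (snd y)) st \<and> (st \<noteq> [] \<longrightarrow> v (root T) < v (snd (hd st)))"

lemma spine_merge:
  assumes "spine v ((t, b) # st) T"
  shows "spine v st (Bin t b T)"
  using assms unfolding spine_def by (cases st) auto

lemma scanned_mono: "set (in_order T) \<subseteq> set (scanned st T)"
  "(t, b) \<in> set st \<Longrightarrow> insert b (set (in_order t)) \<subseteq> set (scanned st T)"
  unfolding scanned_eq by force+

lemma spine_disjoint:
  assumes "spine v st T"
  shows "distinct (in_order T)" "\<And>t b. (t, b) \<in> set st \<Longrightarrow> items t \<inter> items T = {} \<and> b \<notin> items T"
proof -
  have d: "distinct (concat (map (\<lambda>(t, b). in_order t @ [b]) (rev st)) @ in_order T)"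
    using assms unfolding spine_def scanned_eq by blast
  then show "distinct (in_order T)" by simp
  show "items t \<inter> items T = {} \<and> b \<notin> items T" if "(t, b) \<in> set st" for t b
  proof -
    have "set (in_order t @ [b]) \<subseteq> set (concat (map (\<lambda>(t, b). in_order t @ [b]) (rev st)))"
      using that by force
    moreover have "set (concat (map (\<lambda>(t, b). in_order t @ [b]) (rev st))) \<inter> set (in_order T) = {}"
      using d by (simp only: distinct_append)
    ultimately show ?thesis unfolding set_in_order[symmetric] by auto
  qed
qed

definition forest_built :: "(string \<Rightarrow> nat \<Rightarrow> nat) \<Rightarrow> (nat \<Rightarrow> real) \<Rightarrow> (nat full_tree \<times> nat) list \<Rightarrow> nat full_tree \<Rightarrow> bool" where
  "forest_built F v st T \<longleftrightarrow> built F v T \<and> (\<forall>(t, b) \<in> set st. built F v t)"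

definition pointer_fields :: "string set" where
  "pointer_fields = {''top'', ''low'', ''left_up'', ''right_up'', ''left_dn'', ''right_dn'', ''up'', ''dn''}"

lemma built_cong:
  assumes "built F v t" "\<And>x i. x \<in> pointer_fields \<Longrightarrow> i \<in> items t \<Longrightarrow> F' x i = F x i" "distinct (in_order t)"
  shows "built F' v t"
proof -
  have f: "''top'' \<in> pointer_fields" "''low'' \<in> pointer_fields" "''left_up'' \<in> pointer_fields" "''right_up'' \<in> pointer_fields"
    "''left_dn'' \<in> pointer_fields" "''right_dn'' \<in> pointer_fields" "''up'' \<in> pointer_fields" "''dn'' \<in> pointer_fields"
    unfolding pointer_fields_def by simp_all
  have tr: "set (tl (lefts v w)) \<union> set (tl (rights v w)) \<subseteq> items w" for w
    using set_tl_lefts[of v] set_tl_rights[of v] by (auto simp: items_conv)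
  have "banana_ok F' (banana_of v b w)" if m: "(b, w, u) \<in> merges v t" for b w u
  proof (rule banana_ok_cong)
    show "banana_ok F (banana_of v b w)" using assms(1) m unfolding built_def closed_bananas_def by blast
    have "low_leaf v w \<in> items t" "b \<in> items t" "items w \<subseteq> items t"
      using merges_items[OF m] merges_node[OF m] low_leaf_in_items[of v w] by auto
    then show "F' x (low_leaf v w) = F x (low_leaf v w)" if "x \<in> {''top'', ''left_up'', ''right_up''}" for x
      using that f(1,3,4) assms(2)[of x "low_leaf v w"] by auto
    show "F' x b = F x b" if "x \<in> {''low'', ''left_dn'', ''right_dn''}" for x
      using that f(2,5,6) assms(2)[of x b] \<open>b \<in> items t\<close> by auto
    show "F' x i = F x i" if "x \<in> {''up'', ''dn''}" "i \<in> set (tl (lefts v w)) \<union> set (tl (rights v w))" for x i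
    proof -
      have "i \<in> items t" using that(2) tr[of w] \<open>items w \<subseteq> items t\<close> by blast
      then show ?thesis using that(1) f(7,8) assms(2)[of x i] by auto
    qed
  qed
  moreover have "open_trail F' ''left_up'' (lefts v t)"
    by (rule open_trail_cong[where F = F])
      (use assms(1,2) f tr[of t] trail_distinct[OF assms(3), of v] low_leaf_in_items[of v t] in
        \<open>auto simp: built_def hd_lefts\<close>)
  moreover have "open_trail F' ''right_up'' (rights v t)"
    by (rule open_trail_cong[where F = F])
      (use assms(1,2) f tr[of t] trail_distinct[OF assms(3), of v] low_leaf_in_items[of v t] in
        \<open>auto simp: built_def hd_rights\<close>)
  ultimately show ?thesis unfolding built_def closed_bananas_def by blast
qed

lemma closed_bananas_Bin:
  "closed_bananas v (Bin l b r) = insert (banana_of v b (if v (low_leaf v l) < v (low_leaf v r) then r else l))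
     (closed_bananas v l \<union> closed_bananas v r)"
  unfolding closed_bananas_def by auto

text \<open>The program takes 5 steps for the pop, 1 for the comparison, 8 to close the loser and at
  most 6 to extend the winner. All pointer cells it writes sit at items of the merged tree, so the
  other stacked trees are untouched.\<close>

lemma merge_step:
  fixes s :: state
  assumes sp: "spine v ((t, b) # st) T" and sc: "stack_cells s p v ((t, b) # st)"
    and tc: "tree_cells s p v T" and fb: "forest_built (\<lambda>x. nums s (p @ x)) v ((t, b) # st) T"
    and val: "\<And>i. i \<in> set (scanned ((t, b) # st) T) \<Longrightarrow> vals s ''f'' i = (if flip then - v i else v i)"
  shows "wp (merge_step p flip) s (\<lambda>k s'. k \<le> 22 \<and> stack_cells s' p v st \<and> tree_cells s' p v (Bin t b T) \<and>
     forest_built (\<lambda>x. nums s' (p @ x)) v st (Bin t b T))"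
proof -
  let ?F = "\<lambda>x. nums s (p @ x)"
  note d = spine_disjoint[OF spine_merge[OF sp]]
  have dis: "distinct (in_order t)" "distinct (in_order T)" "items t \<inter> items T = {}" "b \<notin> items t" "b \<notin> items T"
    "items T \<inter> items t = {}"
    using d(1) by (auto simp: set_in_order)
  have bt: "built ?F v t" "built ?F v T" and bst: "\<And>t b. (t, b) \<in> set st \<Longrightarrow> built ?F v t"
    using fb unfolding forest_built_def by auto
  have st: "nums s (p @ ''sp'') 0 = Suc (length st)"
    "nums s (p @ ''sm'') (length st) = low_leaf v t" "nums s (p @ ''sl'') (length st) = last (lefts v t)"
    "nums s (p @ ''sr'') (length st) = last (rights v t)" "nums s (p @ ''sb'') (length st) = b"
    and st': "\<And>j. j < length st \<Longrightarrow> case rev st ! j of (t, b) \<Rightarrow>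
        nums s (p @ ''sm'') j = low_leaf v t \<and> nums s (p @ ''sl'') j = last (lefts v t) \<and>
        nums s (p @ ''sr'') j = last (rights v t) \<and> nums s (p @ ''sb'') j = b"
  proof -
    have sp0: "nums s (p @ ''sp'') 0 = Suc (length st)"
      and all: "\<And>j. j < Suc (length st) \<Longrightarrow> case (rev st @ [(t, b)]) ! j of (t, b) \<Rightarrow>
        nums s (p @ ''sm'') j = low_leaf v t \<and> nums s (p @ ''sl'') j = last (lefts v t) \<and>
        nums s (p @ ''sr'') j = last (rights v t) \<and> nums s (p @ ''sb'') j = b"
      using sc unfolding stack_cells_def by auto
    show "nums s (p @ ''sp'') 0 = Suc (length st)" by (rule sp0)
    show "nums s (p @ ''sm'') (length st) = low_leaf v t" "nums s (p @ ''sl'') (length st) = last (lefts v t)"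
      "nums s (p @ ''sr'') (length st) = last (rights v t)" "nums s (p @ ''sb'') (length st) = b"
      using all[of "length st"] by (simp_all add: nth_append)
    show "case rev st ! j of (t, b) \<Rightarrow>
        nums s (p @ ''sm'') j = low_leaf v t \<and> nums s (p @ ''sl'') j = last (lefts v t) \<and>
        nums s (p @ ''sr'') j = last (rights v t) \<and> nums s (p @ ''sb'') j = b" if "j < length st" for j
      using all[of j] that by (simp add: nth_append)
  qed
  have T: "nums s (p @ ''tm'') 0 = low_leaf v T" "nums s (p @ ''tl'') 0 = last (lefts v T)" "nums s (p @ ''tr'') 0 = last (rights v T)"
    using tc unfolding tree_cells_def by auto
  have less: "(if flip then - vals s ''f'' (low_leaf v t) < - vals s ''f'' (low_leaf v T)
     else vals s ''f'' (low_leaf v t) < vals s ''f'' (low_leaf v T)) \<longleftrightarrow> v (low_leaf v t) < v (low_leaf v T)"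
  proof -
    have "low_leaf v t \<in> set (scanned ((t, b) # st) T)" "low_leaf v T \<in> set (scanned ((t, b) # st) T)"
      using scanned_mono(1)[of T "(t, b) # st"] scanned_mono(2)[of t b "(t, b) # st" T] low_leaf_in_items[of v]
      unfolding set_in_order by auto
    then show ?thesis using val by auto
  qed
  have tr: "set (tl (lefts v w)) \<union> set (tl (rights v w)) \<subseteq> items w" for w
    using set_tl_lefts[of v] set_tl_rights[of v] by (auto simp: items_conv)
  have lasts: "last (lefts v w) \<in> items w" "last (rights v w) \<in> items w" "low_leaf v w \<in> items w" for w
    using last_lefts[of v w] last_rights[of v w] low_leaf_in_items[of v w] tr[of w] by auto
  have stack_distinct: "distinct (in_order y)" if yz: "(y, z) \<in> set st" for y z
  proof -
    obtain xs ys where "st = xs @ (y, z) # ys" using split_list[OF yz] by blast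
    then show ?thesis using spine_merge[OF sp] unfolding spine_def scanned_eq by simp
  qed
  \<comment> \<open>\<open>merge_writes\<close> prescribes the new memory at every cell, but the
    scratch registers under the same prefix change as well. Blanking all fields that are no pointers
    gives memory of exactly that form.\<close>
  define rF where "rF s x i = (if x \<in> pointer_fields then nums s (p @ x) i else 0)" for s :: state and x i
  have rF: "built (rF s) v y" if "built ?F v y" "distinct (in_order y)" for y
    by (rule built_cong[OF that(1) _ that(2)]) (simp add: rF_def)
  define s5 where "s5 = put_num (p @ ''b'') 0 b (put_num (p @ ''r'') 0 (last (rights v t))
    (put_num (p @ ''l'') 0 (last (lefts v t)) (put_num (p @ ''m'') 0 (low_leaf v t)
    (put_num (p @ ''sp'') 0 (length st) s))))"
  have load: "wp (pop_tree p) s Q \<longleftrightarrow> Q 5 s5" for Q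
    unfolding pop_tree_def block.simps s5_def by (simp add: st eval_nat_numeral)
  have r5: "nums s5 (p @ ''m'') 0 = low_leaf v t" "nums s5 (p @ ''l'') 0 = last (lefts v t)"
    "nums s5 (p @ ''r'') 0 = last (rights v t)" "nums s5 (p @ ''b'') 0 = b" "nums s5 (p @ ''tm'') 0 = low_leaf v T"
    "nums s5 (p @ ''tl'') 0 = last (lefts v T)" "nums s5 (p @ ''tr'') 0 = last (rights v T)" "vals s5 = vals s"
    by (simp_all add: s5_def T)
  have tst: "holds (less_test flip (reg p ''m'') (reg p ''tm'')) s5 \<longleftrightarrow> v (low_leaf v t) < v (low_leaf v T)"
    unfolding holds_less_test using less by (cases flip) (simp_all add: r5)
  show ?thesis
  proof (cases "v (low_leaf v t) < v (low_leaf v T)")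
    case True
    define S where "S = put_num (p @ ''tr'') 0 b (put_num (p @ ''tl'') 0 (last (lefts v t)) (put_num (p @ ''tm'') 0 (low_leaf v t)
      (put_num (p @ ''dn'') b (last (rights v t)) (link p ''right_up'' (low_leaf v t) (last (rights v t)) b
      (closed_state p (low_leaf v T) (last (lefts v T)) (last (rights v T)) b s5)))))"
    have run: "wp (merge_step p flip) s Q" if "\<And>k. k \<le> 22 \<Longrightarrow> Q k S" for Q
      unfolding merge_step_def block.simps wp_Seq wp_Cond load tst
      using True by (simp add: r5 wp_close_banana wp_win_left nums_closed_other that[unfolded S_def])
    have F': "rF S x i =
      (if x = ''low'' \<and> i = b then low_leaf v T else if x = ''top'' \<and> i = low_leaf v T then b
       else if x = ''left_dn'' \<and> i = b then last (lefts v T)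
       else if x = ''right_dn'' \<and> i = b then last (rights v T)
       else if x = ''dn'' \<and> i = b then last (rights v t)
       else if link_cell ''left_up'' (low_leaf v T) (last (lefts v T)) x i \<or>
         link_cell ''right_up'' (low_leaf v T) (last (rights v T)) x i \<or>
         link_cell ''right_up'' (low_leaf v t) (last (rights v t)) x i then b
       else rF s x i)" for x i
    proof (cases "x \<in> pointer_fields")
      case True
      then show ?thesis unfolding pointer_fields_def
        by (elim insertE emptyE)
          (simp_all add: rF_def S_def closed_state_def s5_def nums_link_field pointer_fields_def link_cell_def)
    next
      case False
      then show ?thesis by (auto simp: rF_def pointer_fields_def link_cell_def)
    qed
    have mw: "\<forall>B \<in> insert (banana_of v b T) (closed_bananas v t \<union> closed_bananas v T). banana_ok (rF S) B"
      "open_trail (rF S) ''left_up'' (lefts v t)" "open_trail (rF S) ''right_up'' (rights v t @ [b])"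
      using merge_writes[where fp = "''right_up''" and P = "rights v t" and fq = "''left_up''" and Q = "lefts v t" and F' = "rF S",
        OF dis(1,2,3,4,5) rF[OF bt(1) dis(1)] rF[OF bt(2) dis(2)] _ F'] by simp_all
    have "built (rF S) v (Bin t b T)"
      using mw True unfolding built_def closed_bananas_Bin by auto
    then have new: "built (\<lambda>x. nums S (p @ x)) v (Bin t b T)"
      by (rule built_cong) (use d(1) in \<open>auto simp: rF_def\<close>)
    have keep: "nums S (p @ x) i = nums s (p @ x) i" if "x \<in> pointer_fields" "i \<notin> items (Bin t b T)" for x i
    proof -
      have "i \<noteq> b" "i \<noteq> low_leaf v t" "i \<noteq> low_leaf v T" "i \<noteq> last (lefts v t)" "i \<noteq> last (rights v t)"
        "i \<noteq> last (lefts v T)" "i \<noteq> last (rights v T)"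
        using that(2) lasts[of t] lasts[of T] by auto
      then show ?thesis using that(1) unfolding pointer_fields_def
        by (elim insertE emptyE) (simp_all add: S_def closed_state_def s5_def nums_link_field link_cell_def)
    qed
    have "built (\<lambda>x. nums S (p @ x)) v y" if "(y, z) \<in> set st" for y z
    proof (rule built_cong[OF bst[OF that]])
      show "nums S (p @ x) i = nums s (p @ x) i" if "x \<in> pointer_fields" "i \<in> items y" for x i
        using keep[OF that(1), of i] that(2) d(2)[OF \<open>(y, z) \<in> set st\<close>] by blast
      show "distinct (in_order y)" using stack_distinct[OF that] .
    qed
    then have "forest_built (\<lambda>x. nums S (p @ x)) v st (Bin t b T)" using new unfolding forest_built_def by auto
    moreover have "tree_cells S p v (Bin t b T)"
      using True T unfolding tree_cells_def S_def closed_state_def s5_def by (simp add: nums_link_other)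
    moreover have "stack_cells S p v st"
      using st' unfolding stack_cells_def S_def closed_state_def s5_def by (simp add: nums_link_other)
    ultimately show ?thesis by (intro run) auto
  next
    case False
    define S where "S = put_num (p @ ''tl'') 0 b
      (put_num (p @ ''dn'') b (last (lefts v T)) (link p ''left_up'' (low_leaf v T) (last (lefts v T)) b
      (closed_state p (low_leaf v t) (last (lefts v t)) (last (rights v t)) b s5)))"
    have run: "wp (merge_step p flip) s Q" if "\<And>k. k \<le> 22 \<Longrightarrow> Q k S" for Q
      unfolding merge_step_def block.simps wp_Seq wp_Cond load tst
      using False by (simp add: r5 wp_close_banana wp_win_right nums_closed_other that[unfolded S_def])
    have F': "rF S x i =
      (if x = ''low'' \<and> i = b then low_leaf v t else if x = ''top'' \<and> i = low_leaf v t then b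
       else if x = ''left_dn'' \<and> i = b then last (lefts v t)
       else if x = ''right_dn'' \<and> i = b then last (rights v t)
       else if x = ''dn'' \<and> i = b then last (lefts v T)
       else if link_cell ''left_up'' (low_leaf v t) (last (lefts v t)) x i \<or>
         link_cell ''right_up'' (low_leaf v t) (last (rights v t)) x i \<or>
         link_cell ''left_up'' (low_leaf v T) (last (lefts v T)) x i then b
       else rF s x i)" for x i
    proof (cases "x \<in> pointer_fields")
      case True
      then show ?thesis unfolding pointer_fields_def
        by (elim insertE emptyE)
          (simp_all add: rF_def S_def closed_state_def s5_def nums_link_field pointer_fields_def link_cell_def)
    next
      case False
      then show ?thesis by (auto simp: rF_def pointer_fields_def link_cell_def)
    qed
    have mw: "\<forall>B \<in> insert (banana_of v b t) (closed_bananas v T \<union> closed_bananas v t). banana_ok (rF S) B"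
      "open_trail (rF S) ''right_up'' (rights v T)" "open_trail (rF S) ''left_up'' (lefts v T @ [b])"
      using merge_writes[where fp = "''left_up''" and P = "lefts v T" and fq = "''right_up''" and Q = "rights v T" and F' = "rF S",
        OF dis(2,1,6,5,4) rF[OF bt(2) dis(2)] rF[OF bt(1) dis(1)] _ F'] by simp_all
    have "built (rF S) v (Bin t b T)"
      using mw False unfolding built_def closed_bananas_Bin by auto
    then have new: "built (\<lambda>x. nums S (p @ x)) v (Bin t b T)"
      by (rule built_cong) (use d(1) in \<open>auto simp: rF_def\<close>)
    have keep: "nums S (p @ x) i = nums s (p @ x) i" if "x \<in> pointer_fields" "i \<notin> items (Bin t b T)" for x i
    proof -
      have "i \<noteq> b" "i \<noteq> low_leaf v t" "i \<noteq> low_leaf v T" "i \<noteq> last (lefts v t)" "i \<noteq> last (rights v t)"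
        "i \<noteq> last (lefts v T)" "i \<noteq> last (rights v T)"
        using that(2) lasts[of t] lasts[of T] by auto
      then show ?thesis using that(1) unfolding pointer_fields_def
        by (elim insertE emptyE) (simp_all add: S_def closed_state_def s5_def nums_link_field link_cell_def)
    qed
    have "built (\<lambda>x. nums S (p @ x)) v y" if "(y, z) \<in> set st" for y z
    proof (rule built_cong[OF bst[OF that]])
      show "nums S (p @ x) i = nums s (p @ x) i" if "x \<in> pointer_fields" "i \<in> items y" for x i
        using keep[OF that(1), of i] that(2) d(2)[OF \<open>(y, z) \<in> set st\<close>] by blast
      show "distinct (in_order y)" using stack_distinct[OF that] .
    qed
    then have "forest_built (\<lambda>x. nums S (p @ x)) v st (Bin t b T)" using new unfolding forest_built_def by auto
    moreover have "tree_cells S p v (Bin t b T)"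
      using False T unfolding tree_cells_def S_def closed_state_def s5_def by (simp add: nums_link_other)
    moreover have "stack_cells S p v st"
      using st' unfolding stack_cells_def S_def closed_state_def s5_def by (simp add: nums_link_other)
    ultimately show ?thesis by (intro run) auto
  qed
qed

text \<open>Closing the last banana is a merge without a winner. A fictitious winner, a single fresh
  leaf \<open>z\<close>, reduces it to \<open>merge_writes\<close>; the two cells that only this
  winner needs belong to no banana concerned.\<close>

lemma close_writes:
  assumes d: "distinct (in_order w)" "b \<notin> items w" and bw: "built F v w"
    and F': "\<And>x i. F' x i =
      (if x = ''low'' \<and> i = b then low_leaf v w else if x = ''top'' \<and> i = low_leaf v w then b
       else if x = ''left_dn'' \<and> i = b then last (lefts v w)
       else if x = ''right_dn'' \<and> i = b then last (rights v w)
       else if link_cell ''left_up'' (low_leaf v w) (last (lefts v w)) x i \<or>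
         link_cell ''right_up'' (low_leaf v w) (last (rights v w)) x i then b
       else F x i)"
  shows "\<forall>B \<in> insert (banana_of v b w) (closed_bananas v w). banana_ok F' B"
proof -
  obtain z where z: "z \<notin> insert b (items w)" using ex_new_if_finite[of "insert b (items w)"] by auto
  define F2 where "F2 x i =
      (if x = ''low'' \<and> i = b then low_leaf v w else if x = ''top'' \<and> i = low_leaf v w then b
       else if x = ''left_dn'' \<and> i = b then last (lefts v w)
       else if x = ''right_dn'' \<and> i = b then last (rights v w)
       else if x = ''dn'' \<and> i = b then z
       else if link_cell ''left_up'' (low_leaf v w) (last (lefts v w)) x i \<or>
         link_cell ''right_up'' (low_leaf v w) (last (rights v w)) x i \<or>
         link_cell ''right_up'' z z x i then b
       else F x i)" for x i
  have "built F v (Tip z)" unfolding built_def closed_bananas_def open_trail_def by simp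
  then have ok: "\<forall>B \<in> insert (banana_of v b w) (closed_bananas v w). banana_ok F2 B"
    using merge_writes(1)[where u = "Tip z" and fp = "''right_up''" and fq = "''left_up''" and P = "[z]" and Q = "[z]"
        and F = F and F' = F2 and w = w and b = b and v = v] d bw z
    by (simp add: F2_def closed_bananas_def)
  have agree: "F' x i = F2 x i" if "(x, i) \<noteq> (''dn'', b)" "(x, i) \<noteq> (''right_up'', z)" for x i
  proof -
    have n: "(x = ''dn'' \<and> i = b) = False" "link_cell ''right_up'' z z x i = False"
      using that by (auto simp: link_cell_def)
    show ?thesis unfolding F' F2_def n by (simp only: if_False simp_thms)
  qed
  have "banana_ok F' (banana_of v c y)" if y: "banana_ok F2 (banana_of v c y)" "items y \<subseteq> items w" for c y
  proof (rule banana_ok_cong[OF y(1)])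
    have l: "low_leaf v y \<noteq> z" using low_leaf_in_items[of v y] y(2) z by auto
    show "F' x (low_leaf v y) = F2 x (low_leaf v y)" if "x \<in> {''top'', ''left_up'', ''right_up''}" for x
      using that l by (intro agree) auto
    show "F' x c = F2 x c" if "x \<in> {''low'', ''left_dn'', ''right_dn''}" for x
      using that by (intro agree) auto
    show "F' x i = F2 x i" if "x \<in> {''up'', ''dn''}" "i \<in> set (tl (lefts v y)) \<union> set (tl (rights v y))" for x i
    proof (rule agree)
      have "i \<in> items w"
        using that(2) set_tl_lefts[of v y] set_tl_rights[of v y] y(2) by (auto simp: items_conv)
      then show "(x, i) \<noteq> (''dn'', b)" using d(2) by auto
      show "(x, i) \<noteq> (''right_up'', z)" using that(1) by auto
    qed
  qed
  moreover have "items y \<subseteq> items w" if "(c, y, u) \<in> merges v w" for c y u using merges_items[OF that] by blast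
  ultimately show ?thesis using ok unfolding closed_bananas_def by blast
qed

section \<open>The scan program\<close>

definition start_leaf :: "string \<Rightarrow> num_exp \<Rightarrow> prog" where
  "start_leaf p e = block
    [set_cell (p @ ''tm'') e, set_cell (p @ ''tl'') e, set_cell (p @ ''tr'') e]"

definition push_tree :: "string \<Rightarrow> prog" where
  "push_tree p = block
    [PutNum (p @ ''sm'') (reg p ''sp'') (reg p ''tm''), PutNum (p @ ''sl'') (reg p ''sp'') (reg p ''tl''),
     PutNum (p @ ''sr'') (reg p ''sp'') (reg p ''tr''), PutNum (p @ ''sb'') (reg p ''sp'') (reg p ''nb''),
     set_cell (p @ ''sp'') (Inc (reg p ''sp''))]"

text \<open>With an empty stack the second conjunct reads index 0, as decrementing 0 gives 0; the
  first conjunct decides in this case.\<close>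

definition pop_test :: "string \<Rightarrow> bool \<Rightarrow> test" where
  "pop_test p flip = Both (LessNum (Const 0) (reg p ''sp''))
     (less_test flip (At (p @ ''sb'') (Dec (reg p ''sp''))) (reg p ''nb''))"

definition stack_test :: "string \<Rightarrow> test" where
  "stack_test p = LessNum (Const 0) (reg p ''sp'')"

definition scan_step :: "string \<Rightarrow> bool \<Rightarrow> prog" where
  "scan_step p flip = block
    [set_cell (p @ ''nb'') (At ''crit'' (reg p ''i'')),
     While (pop_test p flip) (merge_step p flip),
     push_tree p,
     set_cell (p @ ''i'') (Inc (reg p ''i'')),
     start_leaf p (At ''crit'' (reg p ''i'')),
     set_cell (p @ ''i'') (Inc (reg p ''i''))]"

text \<open>A round consumes a maximum and a minimum, so two unread entries are required. A right
  end that is no minimum of the scanned map remains as a single entry and is not consumed.\<close>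

definition scan_test :: "string \<Rightarrow> test" where
  "scan_test p = LessNum (Inc (reg p ''i'')) (cell ''crit_count'')"

text \<open>The first entry is passed over when the list starts with a descent, that is, when it is
  the left end kept only for the negated map.\<close>

definition skip_test :: "bool \<Rightarrow> test" where
  "skip_test flip = Both (LessNum (Const 1) (cell ''crit_count''))
     (less_test flip (At ''crit'' (Const 1)) (At ''crit'' (Const 0)))"

definition build_tree :: "string \<Rightarrow> bool \<Rightarrow> prog" where
  "build_tree p flip = block
    [set_cell (p @ ''sp'') (Const 0), set_cell (p @ ''i'') (Const 0),
     Cond (skip_test flip) (set_cell (p @ ''i'') (Const 1)) Skip,
     start_leaf p (At ''crit'' (reg p ''i'')), set_cell (p @ ''i'') (Inc (reg p ''i'')),
     While (scan_test p) (scan_step p flip),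
     While (stack_test p) (merge_step p flip),
     set_cell (p @ ''b'') (cell ''root''),
     close_banana p (reg p ''tm'') (reg p ''tl'') (reg p ''tr'') (reg p ''b'')]"

lemmas program_defs = merge_step_def pop_tree_def win_left_def win_right_def close_banana_def append_node_def
  start_leaf_def push_tree_def scan_step_def build_tree_def

lemma writes_merge_step:
  "writes_num (merge_step p flip) \<subseteq> (\<lambda>x. p @ x) ` ({''sp'', ''m'', ''l'', ''r'', ''b'', ''tm'', ''tl'', ''tr''} \<union> pointer_fields)"
  unfolding program_defs block.simps pointer_fields_def by auto

lemma writes_val_merge_step: "writes_val (merge_step p flip) = {}"
  unfolding program_defs block.simps by auto

lemma writes_build_tree: "writes_num (build_tree p flip) \<subseteq> range (\<lambda>x. p @ x)"
  unfolding program_defs block.simps by auto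

lemma writes_val_build_tree: "writes_val (build_tree p flip) = {}"
  unfolding program_defs block.simps by auto

definition tree_state :: "string \<Rightarrow> (nat \<Rightarrow> real) \<Rightarrow> state \<Rightarrow> (nat full_tree \<times> nat) list \<Rightarrow> nat full_tree \<Rightarrow> bool" where
  "tree_state p v s st T \<longleftrightarrow> spine v st T \<and> stack_cells s p v st \<and> tree_cells s p v T \<and>
     forest_built (\<lambda>x. nums s (p @ x)) v st T"

definition same_input :: "string \<Rightarrow> state \<Rightarrow> state \<Rightarrow> bool" where
  "same_input p s s' \<longleftrightarrow> (\<forall>y \<in> {''crit'', ''crit_count'', ''root'', p @ ''i'', p @ ''nb''}. nums s' y = nums s y) \<and>
     vals s' = vals s"

lemma merge_step_same_input:
  assumes "wp (merge_step p flip) s Q" and p: "p = [c, CHR ''.'']"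
  shows "wp (merge_step p flip) s (\<lambda>k s'. Q k s' \<and> same_input p s s')"
proof (rule wp_mono[OF wp_frame[OF assms(1)]])
  fix k s' assume *: "Q k s' \<and> (\<forall>x. x \<notin> writes_num (merge_step p flip) \<longrightarrow> nums s' x = nums s x) \<and>
    (\<forall>x. x \<notin> writes_val (merge_step p flip) \<longrightarrow> vals s' x = vals s x)"
  have "y \<notin> writes_num (merge_step p flip)" if "y \<in> {''crit'', ''crit_count'', ''root'', p @ ''i'', p @ ''nb''}" for y
  proof
    assume "y \<in> writes_num (merge_step p flip)"
    then have "y \<in> (\<lambda>x. p @ x) ` ({''sp'', ''m'', ''l'', ''r'', ''b'', ''tm'', ''tl'', ''tr''} \<union> pointer_fields)"
      using writes_merge_step by blast
    then show False using that unfolding pointer_fields_def p by auto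
  qed
  then show "Q k s' \<and> same_input p s s'" using * writes_val_merge_step unfolding same_input_def by auto
qed

text \<open>Both merging loops are instances: popping below a new maximum, where \<open>R\<close>
  keeps the root of the current tree under that maximum, and emptying the stack at the end, where
  \<open>R\<close> is trivial. Each stacked tree pays 23, for one merge and one test.\<close>

lemma merge_loop:
  assumes p: "p = [c, CHR ''.'']" and ts: "tree_state p v s st T"
    and val: "\<And>i. i \<in> set (scanned st T) \<Longrightarrow> vals s ''f'' i = (if flip then - v i else v i)"
    and nonempty: "\<And>s' st. holds tst s' \<Longrightarrow> stack_cells s' p v st \<Longrightarrow> st \<noteq> []"
    and R: "R T" "\<And>s' t b st' T'. same_input p s s' \<Longrightarrow> holds tst s' \<Longrightarrow> tree_state p v s' ((t, b) # st') T' \<Longrightarrow>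
      scanned ((t, b) # st') T' = scanned st T \<Longrightarrow> R T' \<Longrightarrow> R (Bin t b T')"
  shows "wp (While tst (merge_step p flip)) s (\<lambda>k s'. \<exists>st' T'. tree_state p v s' st' T' \<and>
    scanned st' T' = scanned st T \<and> R T' \<and> same_input p s s' \<and> \<not> holds tst s' \<and>
    k + 23 * length st' \<le> 23 * length st + 1)"
proof -
  define I where "I x s' \<longleftrightarrow> tree_state p v s' (fst x) (snd x) \<and> scanned (fst x) (snd x) = scanned st T \<and>
    R (snd x) \<and> same_input p s s'" for x and s' :: state
  have step: "wp (merge_step p flip) s' (\<lambda>k s''. \<exists>y. I y s'' \<and> k + (1::nat) + 23 * length (fst y) \<le> 23 * length (fst x))"
    if I: "I x s'" and h: "holds tst s'" for x s'
  proof -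
    have "fst x \<noteq> []" using nonempty[OF h] I unfolding I_def tree_state_def by blast
    then obtain t b st1 where x: "fst x = (t, b) # st1" by (cases "fst x") auto
    define T1 where "T1 = snd x"
    have i: "tree_state p v s' ((t, b) # st1) T1" "scanned ((t, b) # st1) T1 = scanned st T" "R T1" "same_input p s s'"
      using I unfolding I_def x T1_def by auto
    have sp: "spine v ((t, b) # st1) T1" using i(1) unfolding tree_state_def by blast
    have "wp (merge_step p flip) s' (\<lambda>k s''. k \<le> 22 \<and> stack_cells s'' p v st1 \<and> tree_cells s'' p v (Bin t b T1) \<and>
     forest_built (\<lambda>x. nums s'' (p @ x)) v st1 (Bin t b T1))"
    proof (rule merge_step[OF sp])
      show "vals s' ''f'' i = (if flip then - v i else v i)" if "i \<in> set (scanned ((t, b) # st1) T1)" for i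
        using val[of i] that i(2,4) unfolding same_input_def by simp
    qed (use i(1) in \<open>auto simp: tree_state_def\<close>)
    from merge_step_same_input[OF this p] show ?thesis
    proof (rule wp_mono)
      fix k :: nat and s'' assume *: "(k \<le> 22 \<and> stack_cells s'' p v st1 \<and> tree_cells s'' p v (Bin t b T1) \<and>
        forest_built (\<lambda>x. nums s'' (p @ x)) v st1 (Bin t b T1)) \<and> same_input p s' s''"
      have "I (st1, Bin t b T1) s''"
        unfolding I_def tree_state_def using * spine_merge[OF sp] i R(2)[OF i(4) h i(1,2,3)]
        by (auto simp: same_input_def)
      then show "\<exists>y. I y s'' \<and> k + 1 + 23 * length (fst y) \<le> 23 * length (fst x)"
        using * x by (intro exI[of _ "(st1, Bin t b T1)"]) auto
    qed
  qed
  have I0: "I (st, T) s" unfolding I_def using ts R(1) by (simp add: same_input_def)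
  have "wp (While tst (merge_step p flip)) s (\<lambda>k s'. \<exists>y. I y s' \<and> \<not> holds tst s' \<and>
      k + 23 * length (fst y) \<le> 23 * length (fst (st, T)) + 1)"
  proof (rule wp_While[where I = I and \<Phi> = "\<lambda>x. 23 * length (fst x)"])
    show "wp (merge_step p flip) s' (\<lambda>k s''. \<exists>y. I y s'' \<and> k + 1 + 23 * length (fst y) \<le> 23 * length (fst x))"
      if "I x s'" "holds tst s'" for x s'
      using step[OF that] .
  qed (rule I0)
  then show ?thesis
  proof (rule wp_mono)
    fix k s' assume "\<exists>y. I y s' \<and> \<not> holds tst s' \<and> k + 23 * length (fst y) \<le> 23 * length (fst (st, T)) + 1"
    then obtain y where "I y s'" "\<not> holds tst s'" "k + 23 * length (fst y) \<le> 23 * length st + 1" by auto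
    then show "\<exists>st' T'. tree_state p v s' st' T' \<and> scanned st' T' = scanned st T \<and> R T' \<and>
      same_input p s s' \<and> \<not> holds tst s' \<and> k + 23 * length st' \<le> 23 * length st + 1"
      unfolding I_def by blast
  qed
qed

lemma stack_cells_nonempty: "stack_cells s p v st \<Longrightarrow> 0 < nums s (p @ ''sp'') 0 \<Longrightarrow> st \<noteq> []"
  unfolding stack_cells_def by auto

lemma stack_cells_top:
  "stack_cells s p v ((t, b) # st) \<Longrightarrow> nums s (p @ ''sp'') 0 = Suc (length st) \<and> nums s (p @ ''sb'') (length st) = b"
  unfolding stack_cells_def by (auto dest!: spec[of _ "length st"] simp: nth_append)

lemma forest_built_cong:
  assumes "forest_built F v st T" "spine v st T" "\<And>x. x \<in> pointer_fields \<Longrightarrow> F' x = F x"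
  shows "forest_built F' v st T"
proof -
  have "distinct (in_order t)" if tb: "(t, b) \<in> set st" for t b
  proof -
    obtain xs ys where "st = xs @ (t, b) # ys" using split_list[OF tb] by blast
    then show ?thesis using assms(2) unfolding spine_def scanned_eq by simp
  qed
  then show ?thesis
    using assms(1,3) spine_disjoint(1)[OF assms(2)] built_cong[of F v _ F'] unfolding forest_built_def by fastforce
qed

lemma spine_push:
  assumes "spine v st T" "v (root T) < v b" "v a < v b" "st \<noteq> [] \<longrightarrow> v b < v (snd (hd st))"
    "distinct (scanned st T @ [b, a])"
  shows "spine v ((T, b) # st) (Tip a)" "scanned ((T, b) # st) (Tip a) = scanned st T @ [b, a]"
proof -
  show s: "scanned ((T, b) # st) (Tip a) = scanned st T @ [b, a]" unfolding scanned_eq by simp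
  have "v b < v (snd y)" if "y \<in> set st" for y
    using assms(1,4) that unfolding spine_def by (cases st) auto
  then show "spine v ((T, b) # st) (Tip a)" using assms s unfolding spine_def by auto
qed

lemma tree_state_cong:
  assumes "tree_state p v s st T"
    "\<And>x. x \<in> {''sp'', ''sm'', ''sl'', ''sr'', ''sb'', ''tm'', ''tl'', ''tr''} \<union> pointer_fields \<Longrightarrow> nums s' (p @ x) = nums s (p @ x)"
  shows "tree_state p v s' st T"
proof -
  have "spine v st T" and fb: "forest_built (\<lambda>x. nums s (p @ x)) v st T"
    using assms(1) unfolding tree_state_def by auto
  moreover have "forest_built (\<lambda>x. nums s' (p @ x)) v st T"
    by (rule forest_built_cong[OF fb \<open>spine v st T\<close>]) (use assms(2) in blast)
  ultimately show ?thesis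
    using assms unfolding tree_state_def stack_cells_def tree_cells_def by auto
qed

section \<open>Correctness and amortised cost of the scan\<close>

context pl_wave
begin

abbreviation crits :: "nat list" where "crits \<equiv> critical_list f N"

text \<open>For the down-tree the locale is instantiated with \<open>- f\<close>. Then
  \<open>v\<close> is the negated value, and \<open>flip\<close> says that the array holds
  \<open>- v\<close>, which is \<open>f\<close> again.\<close>

definition input_ok :: "bool \<Rightarrow> state \<Rightarrow> bool" where
  "input_ok flip s \<longleftrightarrow> nums s ''crit_count'' 0 = length (kept_list f N) \<and>
     (\<forall>k < length (kept_list f N). nums s ''crit'' k = kept_list f N ! k) \<and>
     (\<forall>i \<in> set (kept_list f N). vals s ''f'' i = (if flip then - v i else v i)) \<and>
     nums s ''root'' 0 = Suc N"

text \<open>Position of the first critical item in the array of kept items, which starts with a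
  foreign entry if the left end is a minimum of the negated map only.\<close>

definition offset :: nat where "offset = (if minimum f N 0 then 0 else 1)"

lemma crits_odd: "odd (length crits)"
  using length_critical_list by auto

lemma kept_crits:
  assumes "input_ok flip s" "j < length crits"
  shows "nums s ''crit'' (offset + j) = crits ! j"
  using assms unfolding input_ok_def offset_def kept_list_eq by (auto simp: nth_append)

lemma input_vals: "input_ok flip s \<Longrightarrow> i \<in> set crits \<Longrightarrow> vals s ''f'' i = (if flip then - v i else v i)"
  unfolding input_ok_def kept_list_eq by auto

lemma input_count:
  assumes "input_ok flip s"
  shows "offset + length crits \<le> nums s ''crit_count'' 0" "nums s ''crit_count'' 0 \<le> offset + length crits + 1"
  using assms unfolding input_ok_def offset_def kept_list_eq by auto

lemma input_ok_cong:
  assumes "input_ok flip s" "nums s' ''crit'' = nums s ''crit''" "nums s' ''crit_count'' = nums s ''crit_count''"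
    "nums s' ''root'' = nums s ''root''" "vals s' = vals s"
  shows "input_ok flip s'"
  using assms unfolding input_ok_def by simp

definition scan_state :: "string \<Rightarrow> bool \<Rightarrow> nat \<times> (nat full_tree \<times> nat) list \<Rightarrow> state \<Rightarrow> bool" where
  "scan_state p flip x s \<longleftrightarrow> (case x of (j, st) \<Rightarrow> 2 * j + 1 \<le> length crits \<and> input_ok flip s \<and>
     tree_state p v s st (Tip (crits ! (2 * j))) \<and> scanned st (Tip (crits ! (2 * j))) = take (2 * j + 1) crits \<and>
     nums s (p @ ''i'') 0 = offset + 2 * j + 1)"

text \<open>The potential is 23 per stacked tree and 40 per unread critical item. A round releases
  80: 23 of it is put on the newly stacked tree and the rest covers the constant work, while each
  pop is paid for by the tree it removes.\<close>

lemma scan_step: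
  assumes p: "p = [c, CHR ''.'']" and ss: "scan_state p flip (j, st) s" and h: "holds (scan_test p) s"
  shows "wp (scan_step p flip) s (\<lambda>k s'. \<exists>st'. scan_state p flip (j + 1, st') s' \<and>
    k + 1 + (23 * length st' + 40 * (length crits - 2 * (j + 1))) \<le> 23 * length st + 40 * (length crits - 2 * j))"
proof -
  have pn: "p @ x \<noteq> ''crit''" "''crit'' \<noteq> p @ x" for x by (simp_all add: p)
  define a0 where "a0 = crits ! (2 * j)"
  have io: "input_ok flip s" and ts: "tree_state p v s st (Tip a0)" and sc: "scanned st (Tip a0) = take (2 * j + 1) crits"
    and i: "nums s (p @ ''i'') 0 = offset + 2 * j + 1" and jl: "2 * j + 1 \<le> length crits"
    using ss unfolding scan_state_def a0_def by auto
  have "offset + 2 * j + 1 + 1 < offset + length crits + 1"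
    using h input_count(2)[OF io] unfolding scan_test_def by (simp add: i)
  then have "2 * j + 1 < length crits" by simp
  \<comment> \<open>The two unread entries might be one critical item and the right end. Since the
    number of critical items is odd and an odd number has been read, an even number is left, so a
    maximum and a minimum are available.\<close>
  then have j2: "2 * j + 2 < length crits" using crits_odd by (metis Suc_lessI add_2_eq_Suc' add_Suc_right dvd_triv_left even_Suc nat_arith.rule0 One_nat_def)
  define b where "b = crits ! (2 * j + 1)"
  define a where "a = crits ! (2 * j + 2)"
  have zz: "v a0 < v b" "v a < v b" using zigzag_nth[OF critical_list_zigzag j2] unfolding a0_def a_def b_def by auto
  have cr: "nums s ''crit'' (offset + 2 * j + 1) = b" "nums s ''crit'' (offset + 2 * j + 2) = a"
    using kept_crits[OF io, of "2 * j + 1"] kept_crits[OF io, of "2 * j + 2"] j2 unfolding a_def b_def by (simp_all add: add.assoc)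
  have tk: "take (2 * j + 3) crits = take (2 * j + 1) crits @ [b, a]"
    using j2 unfolding a_def b_def by (simp add: take_Suc_conv_app_nth numeral_3_eq_3)
  define s1 where "s1 = put_num (p @ ''nb'') 0 b s"
  have io1: "input_ok flip s1" by (rule input_ok_cong[OF io]) (auto simp: s1_def p put_num_def)
  have ts1: "tree_state p v s1 st (Tip a0)"
    by (rule tree_state_cong[OF ts]) (auto simp: s1_def put_num_def pointer_fields_def)
  have sub: "set (take (2 * j + 1) crits) \<subseteq> set crits" by (rule set_take_subset)
  have nb1: "nums s1 (p @ ''nb'') 0 = b" by (simp add: s1_def)
  have loop: "wp (While (pop_test p flip) (merge_step p flip)) s1 (\<lambda>k s'. \<exists>st' T'. tree_state p v s' st' T' \<and>
    scanned st' T' = scanned st (Tip a0) \<and> v (root T') < v b \<and> same_input p s1 s' \<and> \<not> holds (pop_test p flip) s' \<and>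
    k + 23 * length st' \<le> 23 * length st + 1)"
  proof (rule merge_loop[OF p ts1, where R = "\<lambda>T. v (root T) < v b"])
    show "vals s1 ''f'' i = (if flip then - v i else v i)" if "i \<in> set (scanned st (Tip a0))" for i
      using input_vals[OF io1] that sub unfolding sc by blast
    show "st \<noteq> []" if "holds (pop_test p flip) s'" "stack_cells s' p v st" for s' st
      using stack_cells_nonempty[OF that(2)] that(1) unfolding pop_test_def by simp
    show "v (root (Tip a0)) < v b" using zz by simp
    show "v (root (Bin t d T)) < v b"
      if si: "same_input p s1 s'" and ho: "holds (pop_test p flip) s'" and tr: "tree_state p v s' ((t, d) # st') T"
        and sd: "scanned ((t, d) # st') T = scanned st (Tip a0)" for s' t d st' T
    proof -
      have "d \<in> set crits" using scanned_mono(2)[of t d "(t, d) # st'" T] sub unfolding sd sc by auto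
      then have "vals s' ''f'' d = (if flip then - v d else v d)"
        using input_vals[OF io1] si unfolding same_input_def by simp
      moreover have "vals s' ''f'' b = (if flip then - v b else v b)"
        using input_vals[OF io1] si j2 unfolding same_input_def b_def by simp
      moreover have "nums s' (p @ ''sp'') 0 = Suc (length st')" "nums s' (p @ ''sb'') (length st') = d"
        using tr stack_cells_top unfolding tree_state_def by blast+
      moreover have "nums s' (p @ ''nb'') 0 = b" using si nb1 unfolding same_input_def by simp
      ultimately show ?thesis using ho unfolding pop_test_def by (cases flip) (simp_all add: holds_less_test)
    qed
  qed
  show ?thesis
    unfolding scan_step_def block.simps wp_Seq wp_PutNum num_of.simps i cr s1_def[symmetric]
  proof (rule wp_mono[OF loop], goal_cases)
    case (1 k s2)
    then obtain st' T' where ts2: "tree_state p v s2 st' T'" and sc2: "scanned st' T' = take (2 * j + 1) crits"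
      and rb: "v (root T') < v b" and si: "same_input p s1 s2" and nh: "\<not> holds (pop_test p flip) s2"
      and k: "k + 23 * length st' \<le> 23 * length st + 1" unfolding sc by blast
    have io2: "input_ok flip s2" by (rule input_ok_cong[OF io1]) (use si in \<open>auto simp: same_input_def\<close>)
    have c2: "nums s2 (p @ ''i'') 0 = offset + 2 * j + 1" "nums s2 (p @ ''nb'') 0 = b" "nums s2 ''crit'' (offset + 2 * j + 2) = a"
      using si nb1 i cr unfolding same_input_def s1_def by (auto simp: p)
    have c3: "nums s2 ''crit'' (Suc (Suc (offset + (j + j)))) = a" using c2(3) by (simp add: mult_2 numeral_2_eq_2)
    have t2: "nums s2 (p @ ''sp'') 0 = length st'" "nums s2 (p @ ''tm'') 0 = low_leaf v T'"
      "nums s2 (p @ ''tl'') 0 = last (lefts v T')" "nums s2 (p @ ''tr'') 0 = last (rights v T')"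
      using ts2 unfolding tree_state_def stack_cells_def tree_cells_def by auto
    \<comment> \<open>The loop stopped with a nonempty stack, so the top is not lower than
      \<open>b\<close>. It belongs to the part already read and hence differs from \<open>b\<close>,
      so it is higher.\<close>
    have top: "v b < v (snd (hd st'))" if ne: "st' \<noteq> []"
    proof -
      obtain t d st'' where st': "st' = (t, d) # st''" using ne by (cases st') auto
      have "d \<in> set (take (2 * j + 1) crits)"
      proof -
        have "(t, d) \<in> set st'" using st' by simp
        from scanned_mono(2)[OF this, of T'] show ?thesis unfolding sc2 by blast
      qed
      then have d: "d \<in> set crits" using sub by blast
      have "b \<notin> set (take (2 * j + 1) crits)"
        using distinct_critical_list unfolding b_def
        by (metis \<open>2 * j + 1 < length crits\<close> distinct_take take_Suc_conv_app_nth not_distinct_conv_prefix append_Nil2)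
      then have "d \<noteq> b" using \<open>d \<in> set (take (2 * j + 1) crits)\<close> by blast
      moreover have "b \<in> set crits" using j2 unfolding b_def by simp
      ultimately have "v d \<noteq> v b" using d inj_critical unfolding set_critical_list[symmetric] inj_on_def by blast
      moreover have "vals s2 ''f'' d = (if flip then - v d else v d)" "vals s2 ''f'' b = (if flip then - v b else v b)"
        using input_vals[OF io2] d \<open>b \<in> set crits\<close> by auto
      moreover have "nums s2 (p @ ''sp'') 0 = Suc (length st'')" "nums s2 (p @ ''sb'') (length st'') = d"
        using ts2 stack_cells_top unfolding tree_state_def st' by blast+
      ultimately have "\<not> v d < v b"
        using nh c2 unfolding pop_test_def by (cases flip) (simp_all add: holds_less_test)
      then show ?thesis using \<open>v d \<noteq> v b\<close> st' by simp
    qed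
    define S where "S = put_num (p @ ''i'') 0 (offset + 2 * j + 3) (put_num (p @ ''tr'') 0 a (put_num (p @ ''tl'') 0 a
      (put_num (p @ ''tm'') 0 a (put_num (p @ ''i'') 0 (offset + 2 * j + 2) (put_num (p @ ''sp'') 0 (Suc (length st'))
      (put_num (p @ ''sb'') (length st') b (put_num (p @ ''sr'') (length st') (last (rights v T'))
      (put_num (p @ ''sl'') (length st') (last (lefts v T')) (put_num (p @ ''sm'') (length st') (low_leaf v T') s2)))))))))"
    have run: "wp (push_tree p) s2 (\<lambda>t' s'. wp (set_cell (p @ ''i'') (Inc (reg p ''i''))) s' (\<lambda>t'' s''.
        wp (start_leaf p (At ''crit'' (reg p ''i''))) s'' (\<lambda>t3 s3. wp (set_cell (p @ ''i'') (Inc (reg p ''i''))) s3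
          (\<lambda>u. Q (k + (t' + (t'' + (t3 + u)))))))) \<longleftrightarrow> Q (k + 10) S" for Q
      unfolding push_tree_def start_leaf_def block.simps S_def
      by (simp add: c2 c3 t2 pn eval_nat_numeral)
    have zS: "scanned ((T', b) # st') (Tip a) = take (2 * (j + 1) + 1) crits"
      and spS: "spine v ((T', b) # st') (Tip a)"
    proof -
      have "distinct (scanned st' T' @ [b, a])"
        unfolding sc2 tk[symmetric] using distinct_critical_list by simp
      then have *: "spine v ((T', b) # st') (Tip a)" "scanned ((T', b) # st') (Tip a) = scanned st' T' @ [b, a]"
        using spine_push[of v st' T' b a] ts2 rb zz(2) top unfolding tree_state_def by auto
      show "spine v ((T', b) # st') (Tip a)" by (rule *(1))
      have e: "2 * (j + 1) + 1 = 2 * j + 3" by simp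
      show "scanned ((T', b) # st') (Tip a) = take (2 * (j + 1) + 1) crits" unfolding e *(2) sc2 tk[symmetric] ..
    qed
    have fld: "nums S (p @ x) = nums s2 (p @ x)" if "x \<in> pointer_fields" for x
      using that unfolding pointer_fields_def by (elim insertE emptyE) (simp_all add: S_def put_num_def)
    have "forest_built (\<lambda>x. nums s2 (p @ x)) v st' T'" "spine v st' T'" using ts2 unfolding tree_state_def by auto
    from forest_built_cong[OF this, of "\<lambda>x. nums S (p @ x)"] have fb: "forest_built (\<lambda>x. nums S (p @ x)) v st' T'"
      using fld by blast
    have "forest_built (\<lambda>x. nums S (p @ x)) v ((T', b) # st') (Tip a)"
      using fb unfolding forest_built_def built_def[of _ _ "Tip a"] by (auto simp: closed_bananas_def open_trail_def)
    moreover have "stack_cells S p v ((T', b) # st')"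
      using ts2 unfolding tree_state_def stack_cells_def S_def by (auto simp: nth_append less_Suc_eq)
    moreover have "tree_cells S p v (Tip a)" unfolding tree_cells_def S_def by simp
    ultimately have tsS: "tree_state p v S ((T', b) # st') (Tip a)" using spS unfolding tree_state_def by blast
    have "input_ok flip S" by (rule input_ok_cong[OF io2]) (auto simp: S_def p put_num_def)
    then have "scan_state p flip (j + 1, (T', b) # st') S"
      using tsS zS j2 unfolding scan_state_def a_def by (simp add: S_def)
    then have "wp (push_tree p) s2 (\<lambda>t' s'. wp (set_cell (p @ ''i'') (Inc (reg p ''i''))) s' (\<lambda>t'' s''.
        wp (start_leaf p (At ''crit'' (reg p ''i''))) s'' (\<lambda>t3 s3. wp (set_cell (p @ ''i'') (Inc (reg p ''i''))) s3
          (\<lambda>u s4. \<exists>st'. scan_state p flip (j + 1, st') s4 \<and>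
            1 + (k + (t' + (t'' + (t3 + u)))) + 1 + (23 * length st' + 40 * (length crits - 2 * (j + 1)))
              \<le> 23 * length st + 40 * (length crits - 2 * j)))))"
      using k j2
      by (intro iffD2[OF run[of "\<lambda>u s4. \<exists>st'. scan_state p flip (j + 1, st') s4 \<and>
            1 + u + 1 + (23 * length st' + 40 * (length crits - 2 * (j + 1)))
              \<le> 23 * length st + 40 * (length crits - 2 * j)"]] exI[of _ "(T', b) # st'"]) auto
    from this[unfolded wp_PutNum num_of.simps] show ?case .
  qed
qed

text \<open>If the left end is a minimum, the array begins with a minimum and a higher maximum.
  Otherwise it begins with the left end followed by the first critical item, which is lower by
  \<open>hd_critical_list\<close>.\<close>

lemma holds_skip_test:
  assumes io: "input_ok flip s" and len: "1 < length crits"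
  shows "holds (skip_test flip) s \<longleftrightarrow> offset = 1"
proof -
  have c: "1 < nums s ''crit_count'' 0" "nums s ''crit'' 0 = kept_list f N ! 0" "nums s ''crit'' 1 = kept_list f N ! 1"
    "vals s ''f'' (kept_list f N ! 0) = (if flip then - v (kept_list f N ! 0) else v (kept_list f N ! 0))"
    "vals s ''f'' (kept_list f N ! 1) = (if flip then - v (kept_list f N ! 1) else v (kept_list f N ! 1))"
  proof -
    have l: "1 < length (kept_list f N)" using len unfolding kept_list_eq by auto
    then have "0 < length (kept_list f N)" by linarith
    then show "1 < nums s ''crit_count'' 0" "nums s ''crit'' 0 = kept_list f N ! 0" "nums s ''crit'' 1 = kept_list f N ! 1"
      "vals s ''f'' (kept_list f N ! 0) = (if flip then - v (kept_list f N ! 0) else v (kept_list f N ! 0))"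
      "vals s ''f'' (kept_list f N ! 1) = (if flip then - v (kept_list f N ! 1) else v (kept_list f N ! 1))"
      using io l nth_mem[of 0 "kept_list f N"] nth_mem[of 1 "kept_list f N"] unfolding input_ok_def by (simp_all del: nth_mem)
  qed
  have "holds (skip_test flip) s \<longleftrightarrow> v (kept_list f N ! 1) < v (kept_list f N ! 0)"
    using c unfolding skip_test_def by (cases flip) (simp_all add: holds_less_test)
  also have "\<dots> \<longleftrightarrow> offset = 1"
  proof (cases "minimum f N 0")
    case True
    have "2 * 0 + 2 < length crits" using len crits_odd by (cases "length crits = 2") auto
    from zigzag_nth[OF critical_list_zigzag this] have "v (crits ! 0) < v (crits ! 1)" by simp
    moreover have "crits \<noteq> []" using zigzag_nonempty[OF critical_list_zigzag] .
    ultimately show ?thesis using True len unfolding kept_list_eq offset_def by (simp add: nth_append)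
  next
    case False
    have "minimum f N 0 \<longleftrightarrow> v 0 < v 1" unfolding minimum_def using N_pos by auto
    then have "v 1 < v 0" using False v_neq[of 0 1] N_pos by auto
    then have "v (hd crits) < v 0" by (rule hd_critical_list)
    moreover have "hd crits = crits ! 0" using len by (intro hd_conv_nth) auto
    moreover have "crits \<noteq> []" using zigzag_nonempty[OF critical_list_zigzag] .
    ultimately show ?thesis using False len unfolding kept_list_eq offset_def by (simp add: nth_append)
  qed
  finally show ?thesis .
qed

lemma scan_loop:
  assumes p: "p = [c, CHR ''.'']" and ss: "scan_state p flip (0, []) s"
  shows "wp (While (scan_test p) (scan_step p flip)) s (\<lambda>k s'. \<exists>st T. tree_state p v s' st T \<and> scanned st T = crits \<and>
    input_ok flip s' \<and> k + 23 * length st \<le> 40 * length crits + 1)"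
proof -
  let ?\<Phi> = "\<lambda>x. 23 * length (snd x) + 40 * (length crits - 2 * fst x)"
  have "wp (While (scan_test p) (scan_step p flip)) s (\<lambda>k s'. \<exists>y. scan_state p flip y s' \<and> \<not> holds (scan_test p) s' \<and>
    k + ?\<Phi> y \<le> ?\<Phi> (0::nat, [] :: (nat full_tree \<times> nat) list) + 1)"
  proof (rule wp_While[where I = "scan_state p flip" and \<Phi> = ?\<Phi> and x = "(0, [])"])
    fix x s' assume x: "scan_state p flip x s'" "holds (scan_test p) s'"
    obtain j st where xj: "x = (j, st)" by (cases x)
    show "wp (scan_step p flip) s' (\<lambda>t s''. \<exists>y. scan_state p flip y s'' \<and> t + 1 + ?\<Phi> y \<le> ?\<Phi> x)"
      using x unfolding xj by (intro wp_mono[OF scan_step[OF p, of flip j st s']]) fastforce+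
  qed (rule ss)
  then show ?thesis
  proof (rule wp_mono)
    fix k s' assume "\<exists>y. scan_state p flip y s' \<and> \<not> holds (scan_test p) s' \<and> k + ?\<Phi> y \<le> ?\<Phi> (0::nat, [] :: (nat full_tree \<times> nat) list) + 1"
    then obtain j st where y: "scan_state p flip (j, st) s'" "\<not> holds (scan_test p) s'"
      "k + (23 * length st + 40 * (length crits - 2 * j)) \<le> 40 * length crits + 1" by auto
    have io: "input_ok flip s'" using y(1) unfolding scan_state_def by simp
    have "length crits \<le> 2 * j + 2" "2 * j + 1 \<le> length crits"
      using y(1,2) input_count(1)[OF io] unfolding scan_state_def scan_test_def by auto
    \<comment> \<open>Parity again excludes that a single critical item is left unread.\<close>
    then have "length crits = 2 * j + 1" using crits_odd by (cases "length crits = 2 * j + 2") auto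
    then show "\<exists>st T. tree_state p v s' st T \<and> scanned st T = crits \<and> input_ok flip s' \<and>
        k + 23 * length st \<le> 40 * length crits + 1"
      using y(1,3) unfolding scan_state_def
      by (intro exI[of _ st] exI[of _ "Tip (crits ! (2 * j))"]) auto
  qed
qed

lemma build_tree:
  assumes p: "p = [c, CHR ''.'']" and io: "input_ok flip s" and len: "1 < length crits"
  shows "wp (build_tree p flip) s (\<lambda>k s'. k \<le> 40 * length crits + 20 \<and> stores_bananas s' p (banana_tree f N))"
proof -
  have pn: "p @ x \<noteq> ''crit''" "''crit'' \<noteq> p @ x" for x by (simp_all add: p)
  define s1 where "s1 = put_num (p @ ''i'') 0 0 (put_num (p @ ''sp'') 0 0 s)"
  have io1: "input_ok flip s1" by (rule input_ok_cong[OF io]) (auto simp: s1_def p put_num_def)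
  define s2 where "s2 = (if offset = 1 then put_num (p @ ''i'') 0 1 s1 else s1)"
  define a where "a = crits ! 0"
  define s3 where "s3 = put_num (p @ ''i'') 0 (offset + 1) (put_num (p @ ''tr'') 0 a (put_num (p @ ''tl'') 0 a (put_num (p @ ''tm'') 0 a s2)))"
  have off: "offset = 0 \<or> offset = 1" unfolding offset_def by auto
  have i2: "nums s2 (p @ ''i'') 0 = offset" using off unfolding s2_def s1_def by auto
  have io2: "input_ok flip s2" by (rule input_ok_cong[OF io1]) (auto simp: s2_def p put_num_def)
  have "0 < length crits" using len by linarith
  from kept_crits[OF io2 this] have ca: "nums s2 ''crit'' offset = a" unfolding a_def by simp
  have io3: "input_ok flip s3" by (rule input_ok_cong[OF io2]) (auto simp: s3_def p put_num_def)
  have "spine v [] (Tip a)" unfolding spine_def by simp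
  moreover have "built F v (Tip a)" for F by (simp add: built_def closed_bananas_def open_trail_def)
  ultimately have "tree_state p v s3 [] (Tip a)"
    unfolding tree_state_def stack_cells_def tree_cells_def forest_built_def s3_def s2_def s1_def by simp
  moreover have "take 1 crits = [a]" using len unfolding a_def by (cases crits) auto
  ultimately have ss: "scan_state p flip (0, []) s3"
    unfolding scan_state_def using io3 len by (simp add: a_def s3_def)
  have start: "wp (Cond (skip_test flip) (set_cell (p @ ''i'') (Const 1)) Skip) s1 Q" if "Q 2 s2" for Q
    using that holds_skip_test[OF io1 len] unfolding s2_def by (auto simp: numeral_2_eq_2 split: if_splits)
  define s2a where "s2a = put_num (p @ ''tr'') 0 a (put_num (p @ ''tl'') 0 a (put_num (p @ ''tm'') 0 a s2))"
  have leaf: "wp (start_leaf p (At ''crit'' (reg p ''i''))) s2 Q" if "Q 3 s2a" for Q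
    using that ca unfolding start_leaf_def block.simps s2a_def by (simp add: i2 pn eval_nat_numeral)
  have s3: "put_num (p @ ''i'') 0 (nums s2a (p @ ''i'') 0 + 1) s2a = s3"
    unfolding s2a_def s3_def by (simp add: i2)
  have finish: "wp (set_cell (p @ ''b'') (cell ''root'')) s4 (\<lambda>t s'. wp (close_banana p (reg p ''tm'') (reg p ''tl'') (reg p ''tr'') (reg p ''b'')) s'
      (\<lambda>u s''. t + u = 9 \<and> stores_bananas s'' p (banana_tree f N)))"
    if ts: "tree_state p v s4 [] T" and sc: "scanned [] T = crits" and io4: "input_ok flip s4" for s4 T
  proof -
    \<comment> \<open>With an empty stack there is one increasing tree whose in-order list consists
      of all critical items, and such a tree is unique.\<close>
    have T: "T = tree"
      using increasing_tree_unique[of T tree v] ts sc tree(1,2) distinct_tree inj_tree set_in_order[of T] set_in_order[of tree]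
      unfolding tree_state_def spine_def by simp
    have tc: "nums s4 (p @ ''tm'') 0 = low_leaf v T" "nums s4 (p @ ''tl'') 0 = last (lefts v T)"
      "nums s4 (p @ ''tr'') 0 = last (rights v T)" and bt: "built (\<lambda>x. nums s4 (p @ x)) v T"
      using ts unfolding tree_state_def tree_cells_def forest_built_def by auto
    have rt: "nums s4 ''root'' 0 = Suc N" using io4 unfolding input_ok_def by simp
    define s5 where "s5 = put_num (p @ ''b'') 0 (Suc N) s4"
    define S where "S = closed_state p (low_leaf v T) (last (lefts v T)) (last (rights v T)) (Suc N) s5"
    define rF where "rF s x i = (if x \<in> pointer_fields then nums s (p @ x) i else 0)" for s :: state and x i
    have dT: "distinct (in_order T)" "Suc N \<notin> items T"
      using distinct_tree critical_le[of "Suc N"] unfolding T items_tree by auto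
    have b4: "built (rF s4) v T" by (rule built_cong[OF bt _ dT(1)]) (simp add: rF_def)
    have F': "rF S x i =
      (if x = ''low'' \<and> i = Suc N then low_leaf v T else if x = ''top'' \<and> i = low_leaf v T then Suc N
       else if x = ''left_dn'' \<and> i = Suc N then last (lefts v T)
       else if x = ''right_dn'' \<and> i = Suc N then last (rights v T)
       else if link_cell ''left_up'' (low_leaf v T) (last (lefts v T)) x i \<or>
         link_cell ''right_up'' (low_leaf v T) (last (rights v T)) x i then Suc N
       else rF s4 x i)" for x i
    proof (cases "x \<in> pointer_fields")
      case True
      then show ?thesis unfolding pointer_fields_def
        by (elim insertE emptyE)
          (simp_all add: rF_def S_def closed_state_def s5_def nums_link_field pointer_fields_def link_cell_def)
    next
      case False
      then show ?thesis by (auto simp: rF_def pointer_fields_def link_cell_def)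
    qed
    have ok: "\<forall>B \<in> insert (banana_of v (Suc N) T) (closed_bananas v T). banana_ok (rF S) B"
      using close_writes[OF dT b4 F'] .
    have pf: "rF S x = (\<lambda>x. nums S (p @ x)) x" if "x \<in> pointer_fields" for x using that by (auto simp: rF_def)
    have "banana_ok (rF S) B \<longleftrightarrow> banana_ok (\<lambda>x. nums S (p @ x)) B" for B
      unfolding banana_ok_def closed_trail_def using pf by (simp add: pointer_fields_def)
    then have "stores_bananas S p (banana_tree f N)"
      using ok unfolding stores_bananas_iff banana_tree_tree T by simp
    then show ?thesis
      by (simp add: wp_close_banana rt s5_def[symmetric]) (simp add: s5_def tc S_def)
  qed
  show ?thesis
    unfolding build_tree_def block.simps wp_Seq wp_PutNum num_of.simps s1_def[symmetric]
  proof (rule start, rule leaf, unfold s3, rule wp_mono[OF scan_loop[OF p ss]], goal_cases)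
    case (1 k s4)
    then obtain st T where ts: "tree_state p v s4 st T" and sc: "scanned st T = crits" and io4: "input_ok flip s4"
      and k: "k + 23 * length st \<le> 40 * length crits + 1" by blast
    have loop: "wp (While (stack_test p) (merge_step p flip)) s4 (\<lambda>k s'. \<exists>st' T'. tree_state p v s' st' T' \<and>
      scanned st' T' = scanned st T \<and> True \<and> same_input p s4 s' \<and> \<not> holds (stack_test p) s' \<and>
      k + 23 * length st' \<le> 23 * length st + 1)"
    proof (rule merge_loop[OF p ts, where R = "\<lambda>_. True"])
      show "vals s4 ''f'' i = (if flip then - v i else v i)" if "i \<in> set (scanned st T)" for i
        using input_vals[OF io4] that unfolding sc by blast
      show "st \<noteq> []" if "holds (stack_test p) s'" "stack_cells s' p v st" for s' st
        using stack_cells_nonempty[OF that(2)] that(1) unfolding stack_test_def by simp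
    qed auto
    show ?case
    proof (rule wp_mono[OF loop], goal_cases)
      case (1 k2 s5)
      then obtain st' T' where ts': "tree_state p v s5 st' T'" and sc': "scanned st' T' = crits"
        and si: "same_input p s4 s5" and nh: "\<not> holds (stack_test p) s5" and k2: "k2 + 23 * length st' \<le> 23 * length st + 1"
        unfolding sc by blast
      have "st' = []" using nh ts' unfolding stack_test_def tree_state_def stack_cells_def by simp
      moreover have "input_ok flip s5" by (rule input_ok_cong[OF io4]) (use si in \<open>auto simp: same_input_def\<close>)
      ultimately have "wp (set_cell (p @ ''b'') (cell ''root'')) s5 (\<lambda>t s'. wp (close_banana p (reg p ''tm'') (reg p ''tl'') (reg p ''tr'') (reg p ''b'')) s'
        (\<lambda>u s''. t + u = 9 \<and> stores_bananas s'' p (banana_tree f N)))"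
        using finish ts' sc' by blast
      from this[unfolded wp_PutNum num_of.simps] show ?case
        by (rule wp_mono) (use k k2 in auto)
    qed
  qed
qed

end

section \<open>Building the diagram in memory\<close>

type_synonym entry = "nat \<times> nat \<times> nat \<times> nat"

text \<open>An entry consists of the code of the subdiagram, the lower and the upper end of the banana, and
  the index of the point at the head of its arrow. The arrow of point \<open>k + 1\<close> has index \<open>k\<close>.\<close>

definition stores_entries :: "state \<Rightarrow> entry list \<Rightarrow> bool" where
  "stores_entries s W \<longleftrightarrow> nums s ''point_count'' 0 = length W \<and>
     (\<forall>k < length W. case W ! k of (kd, a, q, t) \<Rightarrow>
        nums s ''point_kind'' k = kd \<and> vals s ''point_x'' k = vals s ''f'' a \<and> vals s ''point_y'' k = vals s ''f'' q \<and>
        (0 < k \<longrightarrow> nums s ''queue'' k = a \<and> nums s ''arrow_source'' (k - 1) = k \<and> nums s ''arrow_target'' (k - 1) = t))"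

text \<open>Queue and point arrays are filled in lockstep, so a position in the queue is also the
  index of a point. \<open>idx\<close> is the point of the banana being expanded and becomes the
  head of the arrow. The point at index 0 has no outgoing arrow, which shifts the arrows by
  one.\<close>

definition emit :: "string \<Rightarrow> nat \<Rightarrow> prog" where
  "emit p kd = block
    [PutNum ''queue'' (cell ''point_count'') (At (p @ ''low'') (cell ''q'')),
     PutNum ''point_kind'' (cell ''point_count'') (Const kd),
     PutVal ''point_x'' (cell ''point_count'') ''f'' (At (p @ ''low'') (cell ''q'')),
     PutVal ''point_y'' (cell ''point_count'') ''f'' (cell ''q''),
     PutNum ''arrow_source'' (Dec (cell ''point_count'')) (cell ''point_count''),
     PutNum ''arrow_target'' (Dec (cell ''point_count'')) (cell ''idx''),
     set_cell ''point_count'' (Inc (cell ''point_count'')),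
     set_cell ''q'' (At (p @ ''up'') (cell ''q''))]"

definition trail_test :: "string \<Rightarrow> test" where
  "trail_test p = Negate (EqNum (cell ''q'') (At (p @ ''top'') (cell ''cur'')))"

definition walk_trail :: "string \<Rightarrow> nat \<Rightarrow> string \<Rightarrow> prog" where
  "walk_trail p kd fld = block
    [set_cell ''q'' (At (p @ fld) (cell ''cur'')), While (trail_test p) (emit p kd)]"

definition expand :: "string \<Rightarrow> nat \<Rightarrow> prog" where
  "expand p kd = block [walk_trail p kd ''left_up'', walk_trail p kd ''right_up'']"

definition visit_next :: "string \<Rightarrow> nat \<Rightarrow> prog" where
  "visit_next p kd = block
    [set_cell ''cur'' (At ''queue'' (cell ''head'')), set_cell ''idx'' (cell ''head''), expand p kd,
     set_cell ''head'' (Inc (cell ''head''))]"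

definition queue_test :: test where
  "queue_test = LessNum (cell ''head'') (cell ''point_count'')"

text \<open>The banana ending at the special root is expanded without being queued: its point is the
  one at index 0, shared by both trees. The queue of the second tree continues right after that of
  the first.\<close>

definition visit_all :: "string \<Rightarrow> nat \<Rightarrow> prog" where
  "visit_all p kd = block
    [set_cell ''cur'' (At (p @ ''low'') (cell ''root'')), set_cell ''idx'' (Const 0), expand p kd,
     While queue_test (visit_next p kd)]"

definition build_diagram :: prog where
  "build_diagram = block
    [set_cell ''point_kind'' (Const 2),
     PutVal ''point_x'' (Const 0) ''f'' (At ''U.low'' (cell ''root'')),
     PutVal ''point_y'' (Const 0) ''f'' (At ''D.low'' (cell ''root'')),
     set_cell ''point_count'' (Const 1), set_cell ''head'' (Const 1),
     visit_all ''U.'' 0, visit_all ''D.'' 1,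
     set_cell ''arrow_count'' (Dec (cell ''point_count''))]"

definition unchanged :: "string set \<Rightarrow> state \<Rightarrow> state \<Rightarrow> bool" where
  "unchanged X s s' \<longleftrightarrow> (\<forall>y. y \<notin> X \<longrightarrow> nums s' y = nums s y) \<and> vals s' ''f'' = vals s ''f''"

abbreviation output_arrays :: "string set" where
  "output_arrays \<equiv> {''queue'', ''point_kind'', ''arrow_source'', ''arrow_target'', ''point_count'', ''q''}"

lemma unchanged_trans: "unchanged X s s' \<Longrightarrow> unchanged X s' s'' \<Longrightarrow> unchanged X s s''"
  unfolding unchanged_def by auto

lemma unchanged_mono: "unchanged X s s' \<Longrightarrow> X \<subseteq> Y \<Longrightarrow> unchanged Y s s'"
  unfolding unchanged_def by blast

lemma emit_step:
  assumes p: "p = [c, CHR ''.'']" and W: "stores_entries s W" "W \<noteq> []"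
  shows "wp (emit p kd) s (\<lambda>k s'. k = 8 \<and>
    stores_entries s' (W @ [(kd, nums s (p @ ''low'') (nums s ''q'' 0), nums s ''q'' 0, nums s ''idx'' 0)]) \<and>
    nums s' ''q'' 0 = nums s (p @ ''up'') (nums s ''q'' 0) \<and> unchanged output_arrays s s')"
proof -
  let ?n = "length W" and ?q = "nums s ''q'' 0" and ?a = "nums s (p @ ''low'') (nums s ''q'' 0)"
  have pn: "p @ x \<noteq> ''queue''" "p @ x \<noteq> ''point_kind''" "p @ x \<noteq> ''arrow_source''" "p @ x \<noteq> ''arrow_target''"
    "p @ x \<noteq> ''point_count''" "p @ x \<noteq> ''q''" for x by (simp_all add: p)
  have n: "nums s ''point_count'' 0 = ?n" using W(1) unfolding stores_entries_def by simp
  define S where "S = put_num ''q'' 0 (nums s (p @ ''up'') ?q) (put_num ''point_count'' 0 (Suc ?n)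
    (put_num ''arrow_target'' (?n - 1) (nums s ''idx'' 0) (put_num ''arrow_source'' (?n - 1) ?n
    (put_val ''point_y'' ?n (vals s ''f'' ?q) (put_val ''point_x'' ?n (vals s ''f'' ?a)
    (put_num ''point_kind'' ?n kd (put_num ''queue'' ?n ?a s)))))))"
  have run: "wp (emit p kd) s Q \<longleftrightarrow> Q 8 S" for Q
    unfolding emit_def block.simps S_def by (simp add: n pn eval_nat_numeral)
  have un: "unchanged output_arrays s S"
    unfolding unchanged_def S_def by (auto simp: put_num_def put_val_def)
  have len: "nums S ''point_count'' 0 = Suc ?n" by (simp add: S_def)
  have new: "nums S ''point_kind'' ?n = kd" "vals S ''point_x'' ?n = vals S ''f'' ?a" "vals S ''point_y'' ?n = vals S ''f'' ?q"
    "nums S ''queue'' ?n = ?a" "nums S ''arrow_source'' (?n - 1) = ?n" "nums S ''arrow_target'' (?n - 1) = nums s ''idx'' 0"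
    by (simp_all add: S_def)
  have old: "nums S ''point_kind'' k = nums s ''point_kind'' k" "vals S ''point_x'' k = vals s ''point_x'' k"
    "vals S ''point_y'' k = vals s ''point_y'' k" "nums S ''queue'' k = nums s ''queue'' k"
    "vals S ''f'' = vals s ''f''" if "k < ?n" for k
    using that by (auto simp: S_def put_val_def put_num_def)
  have old': "nums S ''arrow_source'' (k - 1) = nums s ''arrow_source'' (k - 1)"
    "nums S ''arrow_target'' (k - 1) = nums s ''arrow_target'' (k - 1)" if "k < ?n" "0 < k" for k
  proof -
    have "k - 1 \<noteq> ?n - 1" using that by linarith
    then show "nums S ''arrow_source'' (k - 1) = nums s ''arrow_source'' (k - 1)"
      "nums S ''arrow_target'' (k - 1) = nums s ''arrow_target'' (k - 1)" by (simp_all add: S_def)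
  qed
  have "case (W @ [(kd, ?a, ?q, nums s ''idx'' 0)]) ! k of (kd, a, q, t) \<Rightarrow>
        nums S ''point_kind'' k = kd \<and> vals S ''point_x'' k = vals S ''f'' a \<and> vals S ''point_y'' k = vals S ''f'' q \<and>
        (0 < k \<longrightarrow> nums S ''queue'' k = a \<and> nums S ''arrow_source'' (k - 1) = k \<and> nums S ''arrow_target'' (k - 1) = t)"
    if "k < Suc ?n" for k
  proof (cases "k = ?n")
    case True
    then show ?thesis using new by simp
  next
    case False
    then have k: "k < ?n" using that by simp
    obtain kd' a' q' t' where e: "W ! k = (kd', a', q', t')" by (cases "W ! k") auto
    have "case W ! k of (kd, a, q, t) \<Rightarrow>
        nums s ''point_kind'' k = kd \<and> vals s ''point_x'' k = vals s ''f'' a \<and> vals s ''point_y'' k = vals s ''f'' q \<and>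
        (0 < k \<longrightarrow> nums s ''queue'' k = a \<and> nums s ''arrow_source'' (k - 1) = k \<and> nums s ''arrow_target'' (k - 1) = t)"
      using conjunct2[OF W(1)[unfolded stores_entries_def]] k by (elim allE[of _ k] impE)
    then show ?thesis using old[OF k] old'[OF k] k e by (simp add: nth_append)
  qed
  then have "stores_entries S (W @ [(kd, ?a, ?q, nums s ''idx'' 0)])"
    unfolding stores_entries_def using len by simp
  then show ?thesis unfolding run using un by (simp add: S_def)
qed

text \<open>Each inner node costs 9, for its emission and the test before it. The upper end
  \<open>b\<close> acts as a sentinel.\<close>

lemma walk_trail:
  assumes p: "p = [c, CHR ''.'']" and W: "stores_entries s W" "W \<noteq> []"
    and a: "nums s ''cur'' 0 = a" "nums s (p @ ''top'') a = b" "nums s (p @ fld) a = (qs @ [b]) ! 0"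
    and up: "\<And>j. j < length qs \<Longrightarrow> nums s (p @ ''up'') (qs ! j) = (qs @ [b]) ! Suc j" and b: "b \<notin> set qs"
  shows "wp (walk_trail p kd fld) s (\<lambda>k s'. k \<le> 9 * length qs + 2 \<and>
    stores_entries s' (W @ map (\<lambda>q. (kd, nums s (p @ ''low'') q, q, nums s ''idx'' 0)) qs) \<and> unchanged output_arrays s s')"
proof -
  let ?e = "\<lambda>q. (kd, nums s (p @ ''low'') q, q, nums s ''idx'' 0)"
  have pn: "p @ x \<notin> output_arrays" for x by (simp add: p)
  define I where "I j s' \<longleftrightarrow> j \<le> length qs \<and> stores_entries s' (W @ map ?e (take j qs)) \<and>
    nums s' ''q'' 0 = (qs @ [b]) ! j \<and> unchanged output_arrays s s'" for j s'
  define s1 where "s1 = put_num ''q'' 0 ((qs @ [b]) ! 0) s"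
  have I0: "I 0 s1"
    using W(1) unfolding I_def s1_def stores_entries_def unchanged_def by (auto simp: put_num_def)
  have tst: "holds (trail_test p) s' \<longleftrightarrow> j < length qs" if I: "I j s'" for j s'
  proof -
    have "nums s' (p @ ''top'') = nums s (p @ ''top'')" "nums s' ''cur'' = nums s ''cur''"
      using I pn[of "''top''"] unfolding I_def unchanged_def by auto
    then have "holds (trail_test p) s' \<longleftrightarrow> (qs @ [b]) ! j \<noteq> b" using I a unfolding trail_test_def I_def by simp
    also have "\<dots> \<longleftrightarrow> j < length qs"
    proof (cases "j < length qs")
      case True
      then have "qs ! j \<in> set qs" by simp
      then show ?thesis using True b by (auto simp: nth_append)
    next
      case False
      then have "j = length qs" using I unfolding I_def by simp
      then show ?thesis by simp
    qed
    finally show ?thesis .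
  qed
  have "wp (While (trail_test p) (emit p kd)) s1 (\<lambda>k s'. \<exists>j. I j s' \<and> \<not> holds (trail_test p) s' \<and>
     k + 9 * (length qs - j) \<le> 9 * (length qs - 0) + 1)"
  proof (rule wp_While[where I = I and \<Phi> = "\<lambda>j. 9 * (length qs - j)"])
    fix j s' assume I: "I j s'" and h: "holds (trail_test p) s'"
    have j: "j < length qs" using tst[OF I] h by simp
    have st: "stores_entries s' (W @ map ?e (take j qs))" "nums s' ''q'' 0 = qs ! j" "unchanged output_arrays s s'"
      using I j unfolding I_def by (auto simp: nth_append)
    have eq: "nums s' (p @ x) = nums s (p @ x)" "nums s' ''idx'' = nums s ''idx''" for x
      using st(3) pn[of x] unfolding unchanged_def by auto
    show "wp (emit p kd) s' (\<lambda>t s''. \<exists>y. I y s'' \<and> t + (1::nat) + 9 * (length qs - y) \<le> 9 * (length qs - j))"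
    proof (rule wp_mono[OF emit_step[OF p st(1)]])
      show "W @ map ?e (take j qs) \<noteq> []" using W(2) by simp
      fix k :: nat and s'' assume *: "k = 8 \<and> stores_entries s'' ((W @ map ?e (take j qs)) @
        [(kd, nums s' (p @ ''low'') (nums s' ''q'' 0), nums s' ''q'' 0, nums s' ''idx'' 0)]) \<and>
        nums s'' ''q'' 0 = nums s' (p @ ''up'') (nums s' ''q'' 0) \<and> unchanged output_arrays s' s''"
      have "I (Suc j) s''"
        unfolding I_def using * j up[OF j] unchanged_trans[OF st(3)] st(2) eq
        by (auto simp: take_Suc_conv_app_nth)
      then show "\<exists>y. I y s'' \<and> k + 1 + 9 * (length qs - y) \<le> 9 * (length qs - j)"
        using * j by (intro exI[of _ "Suc j"]) auto
    qed
  qed (rule I0)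
  then have w: "wp (While (trail_test p) (emit p kd)) s1 (\<lambda>k s'. 1 + k \<le> 9 * length qs + 2 \<and>
    stores_entries s' (W @ map ?e qs) \<and> unchanged output_arrays s s')"
  proof (rule wp_mono)
    fix k s' assume "\<exists>j. I j s' \<and> \<not> holds (trail_test p) s' \<and> k + 9 * (length qs - j) \<le> 9 * (length qs - 0) + 1"
    then obtain j where j: "I j s'" "\<not> holds (trail_test p) s'" "k \<le> 9 * length qs + 1" by auto
    then have "j = length qs" using tst[OF j(1)] unfolding I_def by simp
    then show "1 + k \<le> 9 * length qs + 2 \<and> stores_entries s' (W @ map ?e qs) \<and> unchanged output_arrays s s'"
      using j unfolding I_def by simp
  qed
  have "nums s (p @ fld) (nums s ''cur'' 0) = (qs @ [b]) ! 0" using a by simp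
  then show ?thesis unfolding walk_trail_def block.simps wp_Seq wp_PutNum num_of.simps
    using w unfolding s1_def by simp
qed

definition entry_leaf :: "entry \<Rightarrow> nat" where "entry_leaf e = fst (snd e)"

definition entry_node :: "entry \<Rightarrow> nat" where "entry_node e = fst (snd (snd e))"

lemma entry_simps [simp]: "entry_leaf (kd, a, q, t) = a" "entry_node (kd, a, q, t) = q"
  by (simp_all add: entry_leaf_def entry_node_def)

text \<open>Listed in the order in which the program meets them. By \<open>trails_merge\<close>
  these are the maxima at which the lowest leaf of \<open>w\<close> wins.\<close>

definition kids :: "('a \<Rightarrow> real) \<Rightarrow> 'a full_tree \<Rightarrow> 'a list" where
  "kids v w = tl (lefts v w) @ tl (rights v w)"

lemma expand:
  assumes p: "p = [c, CHR ''.'']" and W: "stores_entries s W" "W \<noteq> []"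
    and bs: "stores_bananas s p \<B>" "banana_of v b w \<in> \<B>" and cur: "nums s ''cur'' 0 = low_leaf v w"
    and b: "b \<notin> items w"
  shows "wp (expand p kd) s (\<lambda>k s'. k \<le> 9 * length (kids v w) + 4 \<and>
    stores_entries s' (W @ map (\<lambda>q. (kd, nums s (p @ ''low'') q, q, nums s ''idx'' 0)) (kids v w)) \<and>
    unchanged output_arrays s s')"
proof -
  have pn: "p @ x \<notin> output_arrays" for x by (simp add: p)
  have "banana_ok (\<lambda>x. nums s (p @ x)) (banana_of v b w)" using bs unfolding stores_bananas_iff by blast
  then have top: "nums s (p @ ''top'') (low_leaf v w) = b"
    and L: "closed_trail (\<lambda>x. nums s (p @ x)) ''left_up'' ''left_dn'' (lefts v w @ [b])"
    and R: "closed_trail (\<lambda>x. nums s (p @ x)) ''right_up'' ''right_dn'' (rights v w @ [b])"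
    unfolding banana_ok_def banana_of_def by auto
  have lf: "lefts v w = low_leaf v w # tl (lefts v w)" "rights v w = low_leaf v w # tl (rights v w)"
    using hd_lefts[of v w] hd_rights[of v w] by (metis lefts_nonempty list.collapse, metis rights_nonempty list.collapse)
  have bn: "b \<notin> set (tl (lefts v w))" "b \<notin> set (tl (rights v w))"
    using b set_tl_lefts[of v w] set_tl_rights[of v w] by (auto simp: items_conv)
  have ct: "F fld a = (qs @ [b]) ! 0 \<and> (\<forall>j < length qs. F ''up'' (qs ! j) = (qs @ [b]) ! Suc j)"
    if ct: "closed_trail F fld fin ((a # qs) @ [b])" for F fld fin a qs
  proof (intro conjI allI impI)
    show "F fld a = (qs @ [b]) ! 0" using ct unfolding closed_trail_def by simp
    fix j assume "j < length qs"
    then show "F ''up'' (qs ! j) = (qs @ [b]) ! Suc j"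
      using ct unfolding closed_trail_def by (auto simp: nth_append dest!: spec[of _ "Suc j"])
  qed
  have Lf: "nums s (p @ ''left_up'') (low_leaf v w) = (tl (lefts v w) @ [b]) ! 0"
    "\<And>j. j < length (tl (lefts v w)) \<Longrightarrow> nums s (p @ ''up'') (tl (lefts v w) ! j) = (tl (lefts v w) @ [b]) ! Suc j"
    using ct[of "\<lambda>x. nums s (p @ x)" "''left_up''" "''left_dn''" "low_leaf v w" "tl (lefts v w)"] L lf(1) by metis+
  have Rf: "nums s (p @ ''right_up'') (low_leaf v w) = (tl (rights v w) @ [b]) ! 0"
    "\<And>j. j < length (tl (rights v w)) \<Longrightarrow> nums s (p @ ''up'') (tl (rights v w) ! j) = (tl (rights v w) @ [b]) ! Suc j"
    using ct[of "\<lambda>x. nums s (p @ x)" "''right_up''" "''right_dn''" "low_leaf v w" "tl (rights v w)"] R lf(2) by metis+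
  let ?e = "\<lambda>q. (kd, nums s (p @ ''low'') q, q, nums s ''idx'' 0)"
  show ?thesis
    unfolding expand_def block.simps wp_Seq
  proof (rule wp_mono[OF walk_trail[OF p W cur top Lf bn(1)]], assumption)
    fix k s' assume *: "k \<le> 9 * length (tl (lefts v w)) + 2 \<and>
      stores_entries s' (W @ map ?e (tl (lefts v w))) \<and> unchanged output_arrays s s'"
    have eq: "nums s' (p @ x) = nums s (p @ x)" "nums s' ''idx'' = nums s ''idx''" "nums s' ''cur'' = nums s ''cur''" for x
      using * pn[of x] unfolding unchanged_def by auto
    have "wp (walk_trail p kd ''right_up'') s' (\<lambda>k s''. k \<le> 9 * length (tl (rights v w)) + 2 \<and>
      stores_entries s'' ((W @ map ?e (tl (lefts v w))) @ map (\<lambda>q. (kd, nums s' (p @ ''low'') q, q, nums s' ''idx'' 0)) (tl (rights v w))) \<and>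
      unchanged output_arrays s' s'')"
      using * W(2) cur top Rf bn(2) by (intro walk_trail[OF p, of _ _ "low_leaf v w" b]) (simp_all add: eq)
    then show "wp (walk_trail p kd ''right_up'') s' (\<lambda>u s''. k + u \<le> 9 * length (kids v w) + 4 \<and>
      stores_entries s'' (W @ map ?e (kids v w)) \<and> unchanged output_arrays s s'')"
      by (rule wp_mono) (use * unchanged_trans[of output_arrays s s'] in \<open>auto simp: kids_def eq\<close>)
  qed
qed

section \<open>The breadth-first search as a self-generating list\<close>

context pl_wave
begin

text \<open>Recovers from a minimum the subtree of which it is the lowest leaf when its banana is
  closed: the losing subtree of its merge, or the whole tree for the global minimum. The chosen
  subtree is unique by \<open>merge_unique\<close>.\<close>

definition owner :: "nat \<Rightarrow> nat full_tree" where
  "owner a = (if a = low_leaf v tree then tree else (SOME w. \<exists>b u. (b, w, u) \<in> merges v tree \<and> low_leaf v w = a))"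

lemma owner_tree: "owner (low_leaf v tree) = tree"
  by (simp add: owner_def)

lemma owner_merge:
  assumes "(b, w, u) \<in> merges v tree"
  shows "owner (low_leaf v w) = w"
proof -
  have "(SOME w'. \<exists>b u. (b, w', u) \<in> merges v tree \<and> low_leaf v w' = low_leaf v w) = w"
    by (rule some_equality) (use assms merge_unique[OF assms _ distinct_tree] in metis)+
  then show ?thesis using merge_low_leaf[OF assms distinct_tree] unfolding owner_def by simp
qed

definition kid_entries :: "nat \<Rightarrow> (nat \<Rightarrow> nat) \<Rightarrow> nat \<Rightarrow> nat \<Rightarrow> entry list" where
  "kid_entries kd low a t = map (\<lambda>q. (kd, low q, q, t)) (kids v (owner a))"

text \<open>An equation instead of a recursion: the root banana and the entries at positions below
  \<open>h\<close> generate all of \<open>A\<close>, including entries from \<open>h\<close> on that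
  still wait in the queue. \<open>W0\<close> is what was stored before this search, so that
  positions are absolute. Distinct nodes bound the length of \<open>A\<close>.\<close>

definition visited :: "nat \<Rightarrow> (nat \<Rightarrow> nat) \<Rightarrow> entry list \<Rightarrow> nat \<Rightarrow> entry list \<Rightarrow> bool" where
  "visited kd low W0 h A \<longleftrightarrow> length W0 \<le> h \<and> h \<le> length (W0 @ A) \<and>
     A = kid_entries kd low (low_leaf v tree) 0 @
       concat (map (\<lambda>k. kid_entries kd low (entry_leaf ((W0 @ A) ! k)) k) [length W0..<h]) \<and>
     distinct (map entry_node A) \<and> entry_node ` set A \<subseteq> inners tree"

definition low_of :: "(nat \<Rightarrow> nat) \<Rightarrow> bool" where
  "low_of low \<longleftrightarrow> (\<forall>(b, w, u) \<in> merges v tree. low b = low_leaf v w)"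

lemma kids_tree: "distinct (kids v tree)" "set (kids v tree) \<subseteq> inners tree"
  using trails_merge(2)[OF distinct_tree] set_tl_lefts[of v tree] set_tl_rights[of v tree] unfolding kids_def by auto

lemma kids_merge:
  assumes "(b, w, u) \<in> merges v tree"
  shows "distinct (kids v w)" "set (kids v w) \<subseteq> inners tree"
  using trails_merge(2)[OF distinct_merge[OF assms distinct_tree]] set_tl_lefts[of v w] set_tl_rights[of v w]
    merges_items[OF assms] unfolding kids_def by auto

lemma in_kids_tree: "c \<in> set (kids v tree) \<longleftrightarrow> (\<exists>w u. (c, w, u) \<in> merges v tree \<and> low_leaf v u = low_leaf v tree)"
  using trails_merge(1)[OF distinct_tree, of v] unfolding kids_def by auto

lemma in_kids_merge:
  assumes "(b, w, u) \<in> merges v tree"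
  shows "c \<in> set (kids v w) \<longleftrightarrow> (\<exists>w' u'. (c, w', u') \<in> merges v w \<and> low_leaf v u' = low_leaf v w)"
  using trails_merge(1)[OF distinct_merge[OF assms distinct_tree], of v] unfolding kids_def by auto

lemma kids_parent:
  assumes "(b, w, u) \<in> merges v tree" "c \<in> set (kids v w)"
  obtains w' u' where "(c, w', u') \<in> merges v tree" "low_leaf v u' = low_leaf v w"
  using assms(2) merges_subtree[OF assms(1)] unfolding in_kids_merge[OF assms(1)] by blast

lemma kid_entries_nodes: "map entry_node (kid_entries kd low a t) = kids v (owner a)"
  unfolding kid_entries_def by (simp add: comp_def)

lemma visited_entry:
  assumes vis: "visited kd low W0 h A" and low: "low_of low" and e: "e \<in> set A"
  obtains w u where "(entry_node e, w, u) \<in> merges v tree" "entry_leaf e = low_leaf v w"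
proof -
  have "entry_node e \<in> inners tree" using vis e unfolding visited_def by blast
  then obtain w u where m: "(entry_node e, w, u) \<in> merges v tree" using inner_merge[where v = v] by blast
  have "A = kid_entries kd low (low_leaf v tree) 0 @
       concat (map (\<lambda>k. kid_entries kd low (entry_leaf ((W0 @ A) ! k)) k) [length W0..<h])"
    using vis unfolding visited_def by blast
  then have "e \<in> set (kid_entries kd low (low_leaf v tree) 0 @
       concat (map (\<lambda>k. kid_entries kd low (entry_leaf ((W0 @ A) ! k)) k) [length W0..<h]))" using e by simp
  then have "entry_leaf e = low (entry_node e)" unfolding kid_entries_def by auto
  then show thesis using that[OF m] m low unfolding low_of_def by auto
qed

text \<open>A trail node of the expanded banana has the minimum of this banana as its winner. Had it
  been listed before, it would have come from the root banana or from an earlier entry with the same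
  minimum; the former is a different minimum, and the latter would repeat a node.\<close>

lemma visited_step:
  assumes vis: "visited kd low W0 h A" and low: "low_of low" and h: "h < length (W0 @ A)"
  shows "visited kd low W0 (Suc h) (A @ kid_entries kd low (entry_leaf ((W0 @ A) ! h)) h)"
    and "owner (entry_leaf ((W0 @ A) ! h)) \<noteq> tree \<and> (\<exists>b u. (b, owner (entry_leaf ((W0 @ A) ! h)), u) \<in> merges v tree \<and>
      entry_leaf ((W0 @ A) ! h) = low_leaf v (owner (entry_leaf ((W0 @ A) ! h))))"
proof -
  let ?n = "length W0"
  let ?e = "(W0 @ A) ! h"
  let ?N = "kid_entries kd low (entry_leaf ?e) h"
  have v: "?n \<le> h" "A = kid_entries kd low (low_leaf v tree) 0 @
       concat (map (\<lambda>k. kid_entries kd low (entry_leaf ((W0 @ A) ! k)) k) [?n..<h])"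
    "distinct (map entry_node A)" "entry_node ` set A \<subseteq> inners tree"
    using vis unfolding visited_def by auto
  have nthA: "(W0 @ A) ! k = A ! (k - ?n)" if "?n \<le> k" for k using that by (simp add: nth_append)
  have inA: "(W0 @ A) ! k \<in> set A" if "?n \<le> k" "k \<le> h" for k
    using that h nthA[OF that(1)] by simp
  obtain w u where m: "(entry_node ?e, w, u) \<in> merges v tree" "entry_leaf ?e = low_leaf v w"
    using visited_entry[OF vis low inA[of h]] v(1) by blast
  have ow: "owner (entry_leaf ?e) = w" using owner_merge[OF m(1)] m(2) by simp
  have nt: "low_leaf v w \<noteq> low_leaf v tree" using merge_low_leaf[OF m(1) distinct_tree] .
  show "owner (entry_leaf ?e) \<noteq> tree \<and> (\<exists>b u. (b, owner (entry_leaf ?e), u) \<in> merges v tree \<and>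
      entry_leaf ?e = low_leaf v (owner (entry_leaf ?e)))"
    unfolding ow using m nt by auto
  have disj: "False" if cN: "c \<in> set (kids v w)" and cA: "c \<in> entry_node ` set A" for c
  proof -
    obtain w1 u1 where 1: "(c, w1, u1) \<in> merges v tree" "low_leaf v u1 = low_leaf v w"
      using kids_parent[OF m(1) cN] .
    have "entry_node ` set A = set (map entry_node A)" by simp
    also have "\<dots> = set (map entry_node (kid_entries kd low (low_leaf v tree) 0 @
       concat (map (\<lambda>k. kid_entries kd low (entry_leaf ((W0 @ A) ! k)) k) [?n..<h])))"
      using v(2) by simp
    also have "\<dots> = set (kids v tree) \<union> (\<Union>k \<in> {?n..<h}. set (kids v (owner (entry_leaf ((W0 @ A) ! k)))))"
      by (simp add: map_concat kid_entries_nodes owner_tree comp_def)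
    finally have "c \<in> set (kids v tree) \<union> (\<Union>k \<in> {?n..<h}. set (kids v (owner (entry_leaf ((W0 @ A) ! k)))))"
      using cA by simp
    then consider "c \<in> set (kids v tree)" | k where "?n \<le> k" "k < h" "c \<in> set (kids v (owner (entry_leaf ((W0 @ A) ! k))))"
      by auto
    then show False
    proof cases
      case 1
      then obtain w2 u2 where "(c, w2, u2) \<in> merges v tree" "low_leaf v u2 = low_leaf v tree"
        unfolding in_kids_tree by blast
      then show False using merge_node_unique[OF _ _ distinct_tree] \<open>(c, w1, u1) \<in> merges v tree\<close> \<open>low_leaf v u1 = low_leaf v w\<close> nt by metis
    next
      case 2
      obtain w' u' where m': "(entry_node ((W0 @ A) ! k), w', u') \<in> merges v tree" "entry_leaf ((W0 @ A) ! k) = low_leaf v w'"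
        using visited_entry[OF vis low inA[of k]] 2(1,2) by auto
      then have "c \<in> set (kids v w')" using 2(3) owner_merge[OF m'(1)] by simp
      then obtain w2 u2 where "(c, w2, u2) \<in> merges v tree" "low_leaf v u2 = low_leaf v w'"
        using kids_parent[OF m'(1)] by blast
      then have "low_leaf v w = low_leaf v w'"
        using merge_node_unique[OF _ _ distinct_tree] \<open>(c, w1, u1) \<in> merges v tree\<close> \<open>low_leaf v u1 = low_leaf v w\<close> by metis
      then have "entry_node ?e = entry_node ((W0 @ A) ! k)"
        using merge_unique[OF m'(1) m(1) distinct_tree] by simp
      then have "map entry_node A ! (h - ?n) = map entry_node A ! (k - ?n)"
        using nthA[of h] nthA[of k] h v(1) 2(1,2) by simp
      then have "h - ?n = k - ?n"
        using v(3) h v(1) 2(1,2) nth_eq_iff_index_eq[of "map entry_node A" "h - ?n" "k - ?n"] by simp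
      then show False using 2(1,2) v(1) by simp
    qed
  qed
  \<comment> \<open>Appending entries does not disturb the positions to which the equation
    refers.\<close>
  have same: "(W0 @ A @ ?N) ! k = (W0 @ A) ! k" if "k < Suc h" for k
  proof -
    have "k < length (W0 @ A)" using that h by linarith
    then have "((W0 @ A) @ ?N) ! k = (W0 @ A) ! k" by (simp only: nth_append if_True)
    then show ?thesis by simp
  qed
  have "A @ ?N = kid_entries kd low (low_leaf v tree) 0 @
       concat (map (\<lambda>k. kid_entries kd low (entry_leaf ((W0 @ A) ! k)) k) [?n..<h]) @ ?N"
    using v(2) by simp
  also have "\<dots> = kid_entries kd low (low_leaf v tree) 0 @
       concat (map (\<lambda>k. kid_entries kd low (entry_leaf ((W0 @ A) ! k)) k) [?n..<Suc h])"
    using v(1) by simp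
  also have "map (\<lambda>k. kid_entries kd low (entry_leaf ((W0 @ A) ! k)) k) [?n..<Suc h] =
      map (\<lambda>k. kid_entries kd low (entry_leaf ((W0 @ A @ ?N) ! k)) k) [?n..<Suc h]"
    using same by (intro map_cong refl) (auto simp del: upt_Suc)
  finally have "A @ ?N = kid_entries kd low (low_leaf v tree) 0 @
      concat (map (\<lambda>k. kid_entries kd low (entry_leaf ((W0 @ A @ ?N) ! k)) k) [?n..<Suc h])" .
  moreover have "distinct (map entry_node (A @ ?N))"
    using v(3) kids_merge(1)[OF m(1)] disj by (auto simp: kid_entries_nodes ow)
  moreover have "entry_node ` set (A @ ?N) \<subseteq> inners tree"
  proof -
    have "entry_node ` set ?N = set (map entry_node ?N)" by simp
    also have "\<dots> = set (kids v w)" by (simp only: kid_entries_nodes ow)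
    finally show ?thesis using v(4) kids_merge(2)[OF m(1)] by (simp add: image_Un)
  qed
  ultimately show "visited kd low W0 (Suc h) (A @ ?N)"
    unfolding visited_def using v(1) h by simp
qed

text \<open>Induction from the highest maximum downwards. The winner at \<open>b\<close> is the
  global minimum, expanded at the start, or it loses at a higher \<open>b'\<close>. By induction
  \<open>b'\<close> is listed, and since no entry waits any more, its banana has been expanded and
  has delivered \<open>b\<close>.\<close>

lemma visited_complete:
  assumes vis: "visited kd low W0 (length (W0 @ A)) A" and low: "low_of low"
  shows "entry_node ` set A = inners tree"
proof -
  let ?n = "length W0"
  have v: "A = kid_entries kd low (low_leaf v tree) 0 @
       concat (map (\<lambda>k. kid_entries kd low (entry_leaf ((W0 @ A) ! k)) k) [?n..<length (W0 @ A)])"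
    "entry_node ` set A \<subseteq> inners tree"
    using vis unfolding visited_def by auto
  have nodes: "entry_node ` set A = set (kids v tree) \<union> (\<Union>k \<in> {?n..<length (W0 @ A)}. set (kids v (owner (entry_leaf ((W0 @ A) ! k)))))"
  proof -
    have "entry_node ` set A = set (map entry_node A)" by simp
    also have "\<dots> = set (map entry_node (kid_entries kd low (low_leaf v tree) 0 @
       concat (map (\<lambda>k. kid_entries kd low (entry_leaf ((W0 @ A) ! k)) k) [?n..<length (W0 @ A)])))"
      using v(1) by simp
    also have "\<dots> = set (kids v tree) \<union> (\<Union>k \<in> {?n..<length (W0 @ A)}. set (kids v (owner (entry_leaf ((W0 @ A) ! k)))))"
      by (simp add: map_concat kid_entries_nodes owner_tree comp_def)
    finally show ?thesis .
  qed
  have "b \<in> entry_node ` set A" if "b \<in> inners tree" for b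
    using that
  proof (induction "card {x \<in> inners tree. v b < v x}" arbitrary: b rule: less_induct)
    case less
    have fin: "finite (inners tree)" using finite_items[of tree] items_conv[of tree] by simp
    have "\<exists>w u. (b, w, u) \<in> merges v tree" by (rule inner_merge[OF less.prems])
    then obtain w u where m: "(b, w, u) \<in> merges v tree" by (elim exE)
    show ?case
      using winner_dies_above[OF m]
    proof (elim disjE exE conjE)
      assume "low_leaf v u = low_leaf v tree"
      then have "b \<in> set (kids v tree)" using m by (intro iffD2[OF in_kids_tree] exI conjI)
      then show ?thesis unfolding nodes by (rule UnI1)
    next
      fix b' w' u' assume m': "(b', w', u') \<in> merges v tree" "low_leaf v w' = low_leaf v u" "b \<in> items w'"
      have vb: "v b < v b'" using merge_values[OF m'(1) tree(2)] m'(3) by blast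
      have b': "b' \<in> inners tree" using merges_items[OF m'(1)] by blast
      have "{x \<in> inners tree. v b' < v x} \<subset> {x \<in> inners tree. v b < v x}"
        using vb b' by (intro psubsetI subsetI) auto
      then have "card {x \<in> inners tree. v b' < v x} < card {x \<in> inners tree. v b < v x}"
        using fin by (intro psubset_card_mono) auto
      from less.hyps[OF this b'] obtain e where e: "e \<in> set A" "b' = entry_node e" by blast
      obtain w2 u2 where "(b', w2, u2) \<in> merges v tree" "entry_leaf e = low_leaf v w2"
        using visited_entry[OF vis low e(1)] e(2) by blast
      then have el: "owner (entry_leaf e) = w'"
        using merge_node_unique[OF _ _ distinct_tree] m'(1) owner_merge by metis
      obtain j where j: "j < length A" "A ! j = e" using e(1) by (meson in_set_conv_nth)
      then have "(W0 @ A) ! (?n + j) = e" by simp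
      moreover have "(b, w, u) \<in> merges v w'" using merge_inside[OF m m'(1) distinct_tree m'(3)] .
      then have "b \<in> set (kids v w')" unfolding in_kids_merge[OF m'(1)] using m'(2) by metis
      ultimately have "b \<in> set (kids v (owner (entry_leaf ((W0 @ A) ! (?n + j)))))" using el by simp
      moreover have "?n + j \<in> {?n..<length (W0 @ A)}" using j(1) by simp
      ultimately show ?thesis unfolding nodes by blast
    qed
  qed
  then show ?thesis using v(2) by blast
qed

text \<open>The last component of an entry is the position from which the entry was generated, and
  the entry there belongs to the winner at \<open>q\<close>, position 0 standing for the global
  minimum. This is where the arrows are read off the search.\<close>

lemma visited_target:
  assumes vis: "visited kd low W0 (length (W0 @ A)) A" and low: "low_of low" and e: "(k, a, q, t) \<in> set A"
  obtains w u where "k = kd" "(q, w, u) \<in> merges v tree" "a = low_leaf v w"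
    "t = 0 \<and> low_leaf v u = low_leaf v tree \<or>
     length W0 \<le> t \<and> t < length (W0 @ A) \<and> low_leaf v u = entry_leaf ((W0 @ A) ! t)"
proof -
  let ?n = "length W0"
  have v: "A = kid_entries kd low (low_leaf v tree) 0 @
       concat (map (\<lambda>k. kid_entries kd low (entry_leaf ((W0 @ A) ! k)) k) [?n..<length (W0 @ A)])"
    using vis unfolding visited_def by auto
  obtain w u where m: "(q, w, u) \<in> merges v tree" "a = low_leaf v w"
    using visited_entry[OF vis low e] by auto
  have "(k, a, q, t) \<in> set (kid_entries kd low (low_leaf v tree) 0 @
       concat (map (\<lambda>k. kid_entries kd low (entry_leaf ((W0 @ A) ! k)) k) [?n..<length (W0 @ A)]))"
    using e v by simp
  then consider "(k, a, q, t) \<in> set (kid_entries kd low (low_leaf v tree) 0)"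
    | j where "?n \<le> j" "j < length (W0 @ A)" "(k, a, q, t) \<in> set (kid_entries kd low (entry_leaf ((W0 @ A) ! j)) j)"
    by auto
  then show thesis
  proof cases
    case 1
    then have "k = kd" "t = 0" "q \<in> set (kids v tree)" unfolding kid_entries_def owner_tree by auto
    moreover have "low_leaf v u = low_leaf v tree"
      using calculation(3) m(1) merge_node_unique[OF _ _ distinct_tree] unfolding in_kids_tree by metis
    ultimately show thesis using that m by blast
  next
    case 2
    have "(W0 @ A) ! j \<in> set A" using 2(1,2) by (simp add: nth_append)
    then obtain w' u' where m': "(entry_node ((W0 @ A) ! j), w', u') \<in> merges v tree" "entry_leaf ((W0 @ A) ! j) = low_leaf v w'"
      using visited_entry[OF vis low] by blast
    have "k = kd" "t = j" "q \<in> set (kids v w')"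
      using 2(3) m'(2) owner_merge[OF m'(1)] unfolding kid_entries_def by auto
    moreover obtain w2 u2 where "(q, w2, u2) \<in> merges v tree" "low_leaf v u2 = low_leaf v w'"
      using kids_parent[OF m'(1) calculation(3)] .
    then have "low_leaf v u = low_leaf v w'" using m(1) merge_node_unique[OF _ _ distinct_tree] by metis
    ultimately show thesis using that[of w u] m 2(1,2) m'(2) by simp
  qed
qed

lemma expand_owner:
  assumes p: "p = [c, CHR ''.'']" and W: "stores_entries s W" "W \<noteq> []"
    and bs: "stores_bananas s p (banana_tree f N)" and cur: "nums s ''cur'' 0 = a"
    and a: "a = low_leaf v tree \<or> (\<exists>b w u. (b, w, u) \<in> merges v tree \<and> a = low_leaf v w)"
  shows "wp (expand p kd) s (\<lambda>k s'. k \<le> 9 * length (kids v (owner a)) + 4 \<and>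
    stores_entries s' (W @ kid_entries kd (nums s (p @ ''low'')) a (nums s ''idx'' 0)) \<and> unchanged output_arrays s s')"
proof -
  obtain b where b: "banana_of v b (owner a) \<in> banana_tree f N" "b \<notin> items (owner a)" "a = low_leaf v (owner a)"
    using a
  proof (elim disjE exE conjE)
    assume a: "a = low_leaf v tree"
    have "Suc N \<notin> items tree" using critical_le unfolding items_tree by force
    then show thesis using that[of "Suc N"] a unfolding banana_tree_tree by (simp add: owner_tree)
  next
    fix b w u assume m: "(b, w, u) \<in> merges v tree" "a = low_leaf v w"
    have "b \<notin> items w" using merge_values[OF m(1) tree(2)] by auto
    then show thesis
      using that[of b] m owner_merge[OF m(1)] unfolding banana_tree_tree closed_bananas_def by auto
  qed
  have "wp (expand p kd) s (\<lambda>k s'. k \<le> 9 * length (kids v (owner a)) + 4 \<and>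
    stores_entries s' (W @ map (\<lambda>q. (kd, nums s (p @ ''low'') q, q, nums s ''idx'' 0)) (kids v (owner a))) \<and>
    unchanged output_arrays s s')"
    using expand[OF p W bs b(1) _ b(2)] cur b(3) by simp
  then show ?thesis unfolding kid_entries_def .
qed

lemma stores_bananas_low:
  assumes "stores_bananas s p (banana_tree f N)"
  shows "low_of (nums s (p @ ''low''))" "nums s (p @ ''low'') (Suc N) = low_leaf v tree"
proof -
  have ok: "\<forall>B \<in> banana_tree f N. banana_ok (\<lambda>x. nums s (p @ x)) B" using assms unfolding stores_bananas_iff .
  show "low_of (nums s (p @ ''low''))"
    unfolding low_of_def
  proof (intro ballI, clarify)
    fix b w u assume "(b, w, u) \<in> merges v tree"
    then have "banana_of v b w \<in> banana_tree f N" unfolding banana_tree_tree closed_bananas_def by blast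
    then have "banana_ok (\<lambda>x. nums s (p @ x)) (banana_of v b w)" using ok by blast
    then show "nums s (p @ ''low'') b = low_leaf v w" by (simp add: banana_ok_def banana_of_def)
  qed
  show "nums s (p @ ''low'') (Suc N) = low_leaf v tree"
    using ok unfolding banana_tree_tree by (auto simp: banana_ok_def banana_of_def)
qed

text \<open>The potential is 9 for each maximum not yet listed and 10 for each entry not yet
  expanded. Distinct nodes bound the list by the number of maxima, so 19 per maximum
  suffice.\<close>

lemma visit_all:
  assumes p: "p = [c, CHR ''.'']" and W: "stores_entries s W0" "W0 \<noteq> []"
    and bs: "stores_bananas s p (banana_tree f N)" and rt: "nums s ''root'' 0 = Suc N"
    and hd: "nums s ''head'' 0 = length W0"
  shows "wp (visit_all p kd) s (\<lambda>k s'. k \<le> 19 * card (inners tree) + 10 \<and>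
    (\<exists>A. visited kd (nums s (p @ ''low'')) W0 (length (W0 @ A)) A \<and> stores_entries s' (W0 @ A) \<and>
      nums s' ''head'' 0 = length (W0 @ A) \<and> unchanged (output_arrays \<union> {''cur'', ''idx'', ''head''}) s s'))"
proof -
  let ?X = "output_arrays \<union> {''cur'', ''idx'', ''head''}"
  define low where "low = nums s (p @ ''low'')"
  have low: "low_of low" "low (Suc N) = low_leaf v tree" unfolding low_def using stores_bananas_low[OF bs] .
  have pn: "p @ x \<notin> ?X" for x by (simp add: p)
  define M where "M = length W0 + card (inners tree)"
  have fin: "finite (inners tree)" using finite_items[of tree] items_conv[of tree] by simp
  have lenM: "length (W0 @ A) \<le> M" if "visited kd low W0 h A" for h A
  proof -
    have d: "distinct (map entry_node A)" "entry_node ` set A \<subseteq> inners tree" using that unfolding visited_def by auto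
    then have "length A = card (entry_node ` set A)" using distinct_card[OF d(1)] by simp
    then show ?thesis using card_mono[OF fin d(2)] unfolding M_def by simp
  qed
  have pres: "stores_bananas s' p (banana_tree f N) \<and> nums s' (p @ ''low'') = low" if "unchanged ?X s s'" for s'
  proof -
    have "nums s' (p @ x) = nums s (p @ x)" for x using that pn[of x] unfolding unchanged_def by blast
    then show ?thesis using bs unfolding stores_bananas_iff low_def by simp
  qed
  define I where "I x s' \<longleftrightarrow> (case x of (h, A) \<Rightarrow> visited kd low W0 h A \<and> stores_entries s' (W0 @ A) \<and>
    nums s' ''head'' 0 = h \<and> unchanged ?X s s')" for x s'
  let ?\<Phi> = "\<lambda>x. 9 * (M - length (W0 @ snd x)) + 10 * (M - fst x)"
  have step: "wp (visit_next p kd) s' (\<lambda>t s''. \<exists>y. I y s'' \<and> t + 1 + ?\<Phi> y \<le> ?\<Phi> x)"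
    if I: "I x s'" and h: "holds queue_test s'" for x s'
  proof -
    obtain h A where x: "x = (h, A)" by (cases x)
    have i: "visited kd low W0 h A" "stores_entries s' (W0 @ A)" "nums s' ''head'' 0 = h" "unchanged ?X s s'"
      using I unfolding I_def x by auto
    have hl: "h < length (W0 @ A)" using h i(2,3) unfolding queue_test_def stores_entries_def by simp
    have h0: "0 < h" using i(1) W(2) unfolding visited_def by (cases W0) auto
    define a where "a = entry_leaf ((W0 @ A) ! h)"
    have qa: "nums s' ''queue'' h = a"
    proof -
      obtain kd' a' q' t' where e: "(W0 @ A) ! h = (kd', a', q', t')" by (cases "(W0 @ A) ! h") auto
      show ?thesis using conjunct2[OF i(2)[unfolded stores_entries_def], THEN spec, of h] hl h0 e unfolding a_def by simp
    qed
    note vs = visited_step[OF i(1) low(1) hl, folded a_def]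
    define s1 where "s1 = put_num ''idx'' 0 h (put_num ''cur'' 0 a s')"
    have u1: "unchanged ?X s s1" using i(4) unfolding unchanged_def s1_def by (auto simp: put_num_def)
    have e1: "stores_entries s1 (W0 @ A)" using i(2) unfolding stores_entries_def s1_def by simp
    have "wp (expand p kd) s1 (\<lambda>k s2. k \<le> 9 * length (kids v (owner a)) + 4 \<and>
      stores_entries s2 ((W0 @ A) @ kid_entries kd (nums s1 (p @ ''low'')) a (nums s1 ''idx'' 0)) \<and> unchanged output_arrays s1 s2)"
      using pres[OF u1] vs(2) W(2) by (intro expand_owner[OF p e1]) (auto simp: s1_def)
    moreover have "nums s1 (p @ ''low'') = low" "nums s1 ''idx'' 0 = h" using pres[OF u1] by (simp_all add: s1_def)
    ultimately have ex: "wp (expand p kd) s1 (\<lambda>k s2. k \<le> 9 * length (kids v (owner a)) + 4 \<and>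
      stores_entries s2 (W0 @ A @ kid_entries kd low a h) \<and> unchanged output_arrays s1 s2)"
      by (simp only: append_assoc)
    show ?thesis
      unfolding visit_next_def block.simps wp_Seq wp_PutNum num_of.simps
    proof -
      have s1': "put_num ''idx'' 0 (nums (put_num ''cur'' 0 (nums s' ''queue'' (nums s' ''head'' 0)) s') ''head'' 0)
          (put_num ''cur'' 0 (nums s' ''queue'' (nums s' ''head'' 0)) s') = s1"
        unfolding s1_def by (simp add: i(3) qa)
      show "wp (expand p kd) (put_num ''idx'' 0 (nums (put_num ''cur'' 0 (nums s' ''queue'' (nums s' ''head'' 0)) s') ''head'' 0)
          (put_num ''cur'' 0 (nums s' ''queue'' (nums s' ''head'' 0)) s'))
        (\<lambda>t s''. \<exists>y. I y (put_num ''head'' 0 (nums s'' ''head'' 0 + 1) s'') \<and> 1 + (1 + (t + 1)) + 1 + ?\<Phi> y \<le> ?\<Phi> x)"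
        unfolding s1'
      proof (rule wp_mono[OF ex])
        fix k s2 assume *: "k \<le> 9 * length (kids v (owner a)) + 4 \<and>
          stores_entries s2 (W0 @ A @ kid_entries kd low a h) \<and> unchanged output_arrays s1 s2"
        let ?s3 = "put_num ''head'' 0 (nums s2 ''head'' 0 + 1) s2"
        let ?A = "A @ kid_entries kd low a h"
        have hd2: "nums s2 ''head'' 0 = h" using * i(3) unfolding unchanged_def s1_def by simp
        have "unchanged ?X s s2" using u1 unchanged_mono[of output_arrays s1 s2 ?X] * unchanged_trans by blast
        then have "unchanged ?X s ?s3" unfolding unchanged_def by (auto simp: put_num_def)
        moreover have "stores_entries ?s3 (W0 @ ?A)" using * unfolding stores_entries_def by simp
        ultimately have I': "I (Suc h, ?A) ?s3" unfolding I_def using vs(1) hd2 by simp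
        have "length (W0 @ ?A) \<le> M" using lenM[OF vs(1)] .
        moreover have "length ?A = length A + length (kids v (owner a))" by (simp add: kid_entries_def)
        moreover have "k \<le> 9 * length (kids v (owner a)) + 4" using * by blast
        ultimately have "1 + (1 + (k + 1)) + 1 + ?\<Phi> (Suc h, ?A) \<le> ?\<Phi> x"
          using hl unfolding x length_append fst_conv snd_conv by arith
        then show "\<exists>y. I y ?s3 \<and> 1 + (1 + (k + 1)) + 1 + ?\<Phi> y \<le> ?\<Phi> x" using I' by blast
      qed
    qed
  qed
  define A0 where "A0 = kid_entries kd low (low_leaf v tree) 0"
  have v0: "visited kd low W0 (length W0) A0"
    unfolding visited_def A0_def using kids_tree by (simp add: kid_entries_nodes owner_tree flip: set_map)
  define s1 where "s1 = put_num ''idx'' 0 0 (put_num ''cur'' 0 (low_leaf v tree) s)"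
  have u1: "unchanged ?X s s1" unfolding unchanged_def s1_def by (auto simp: put_num_def)
  have e1: "stores_entries s1 W0" using W(1) unfolding stores_entries_def s1_def by simp
  have "wp (expand p kd) s1 (\<lambda>k s2. k \<le> 9 * length (kids v (owner (low_leaf v tree))) + 4 \<and>
    stores_entries s2 (W0 @ kid_entries kd (nums s1 (p @ ''low'')) (low_leaf v tree) (nums s1 ''idx'' 0)) \<and> unchanged output_arrays s1 s2)"
    using pres[OF u1] W(2) by (intro expand_owner[OF p e1]) (auto simp: s1_def)
  moreover have "nums s1 (p @ ''low'') = low" "nums s1 ''idx'' 0 = 0" using pres[OF u1] by (simp_all add: s1_def)
  ultimately have ex: "wp (expand p kd) s1 (\<lambda>k s2. k \<le> 9 * length (kids v tree) + 4 \<and>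
    stores_entries s2 (W0 @ A0) \<and> unchanged output_arrays s1 s2)"
    by (simp only: owner_tree A0_def)
  have s1': "put_num ''idx'' 0 0 (put_num ''cur'' 0 (low (nums s ''root'' 0)) s) = s1"
    unfolding s1_def using low(2) by (simp add: rt)
  show ?thesis
    unfolding visit_all_def block.simps wp_Seq wp_PutNum num_of.simps low_def[symmetric] s1'
  proof (rule wp_mono[OF ex], goal_cases)
    case (1 k s2)
    have "nums s2 ''head'' 0 = length W0" using 1 hd unfolding unchanged_def s1_def by simp
    moreover have "unchanged ?X s s2" using u1 unchanged_mono[of output_arrays s1 s2 ?X] 1 unchanged_trans by blast
    ultimately have I0: "I (length W0, A0) s2" unfolding I_def using v0 1 by simp
    have "wp (While queue_test (visit_next p kd)) s2 (\<lambda>t s'. \<exists>y. I y s' \<and> \<not> holds queue_test s' \<and> t + ?\<Phi> y \<le> ?\<Phi> (length W0, A0) + 1)"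
    proof (rule wp_While[where I = I and \<Phi> = ?\<Phi>])
      show "wp (visit_next p kd) s' (\<lambda>t s''. \<exists>y. I y s'' \<and> t + 1 + ?\<Phi> y \<le> ?\<Phi> x)"
        if "I x s'" "holds queue_test s'" for x s' using step[OF that] .
    qed (rule I0)
    then show ?case
    proof (rule wp_mono, goal_cases)
      case (1 k2 s3)
      then obtain h A where y: "I (h, A) s3" "\<not> holds queue_test s3" "k2 \<le> ?\<Phi> (length W0, A0) + 1" by fastforce
      have "length (W0 @ A) \<le> h" using y(1,2) unfolding I_def queue_test_def stores_entries_def by simp
      then have h: "h = length (W0 @ A)" using y(1) unfolding I_def visited_def by simp
      have "length A0 = length (kids v tree)" unfolding A0_def by (simp add: kid_entries_def owner_tree)
      moreover have "length (W0 @ A0) \<le> M" using lenM[OF v0] .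
      ultimately have "9 * length (kids v tree) + ?\<Phi> (length W0, A0) \<le> 19 * card (inners tree)"
        unfolding M_def by simp
      then show ?case using y \<open>k \<le> 9 * length (kids v tree) + 4 \<and> _\<close> unfolding I_def h
        by (intro conjI exI[of _ A]) auto
    qed
  qed
qed

end

section \<open>The main theorem\<close>

lemma pl_map_item: "pl_map c \<epsilon> (real i) = item_value c \<epsilon> i"
  by (simp add: pl_map_def)

lemma pl_map_affine:
  assumes "real i \<le> t" "t \<le> real (Suc i)"
  shows "pl_map c \<epsilon> t = item_value c \<epsilon> i + (t - real i) * (item_value c \<epsilon> (Suc i) - item_value c \<epsilon> i)"
proof (cases "t = real (Suc i)")
  case True
  then show ?thesis using pl_map_item[of c \<epsilon> "Suc i"] by simp
next
  case False
  then have "\<lfloor>t\<rfloor> = int i" using assms by (intro floor_unique) auto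
  then show ?thesis by (simp add: pl_map_def)
qed

lemma pl_wave_pl_map:
  assumes "generic (pl_map c \<epsilon>) N" "0 < N"
  shows "pl_wave (pl_map c \<epsilon>) N"
proof
  show "inj_on (\<lambda>i. pl_map c \<epsilon> (real i)) {0..N}" using assms(1) unfolding generic_def .
  show "pl_map c \<epsilon> t = pl_map c \<epsilon> (real i) + (t - real i) * (pl_map c \<epsilon> (real (Suc i)) - pl_map c \<epsilon> (real i))"
    if "i < N" "real i \<le> t" "t \<le> real (Suc i)" for i t
    using pl_map_affine[OF that(2,3)] unfolding pl_map_item .
qed (rule assms(2))

text \<open>The highest item is a maximum unless it is an end of the domain. An end that is highest
  is above its neighbour, and for such an end the assumptions provide a higher item.\<close>

lemma (in pl_wave) exists_maximum:
  assumes "v 1 < v 0 \<Longrightarrow> \<exists>k \<le> N. v 0 < v k" "v (N - 1) < v N \<Longrightarrow> \<exists>k \<le> N. v N < v k"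
  shows "\<exists>i. maximum f N i"
proof -
  obtain m where m: "m \<le> N" "\<And>l. l \<le> N \<Longrightarrow> v l \<le> v m"
    using item_argmax[of 0 N] by auto
  have N1: "N - 1 \<noteq> N" using N_pos by simp
  have "m \<noteq> 0"
  proof
    assume m0: "m = 0"
    have "v 1 \<le> v 0" using m(2)[of 1] m0 N_pos by simp
    moreover have "v 1 \<noteq> v 0" using N_pos by (intro v_neq) auto
    ultimately have "v 1 < v 0" by simp
    then obtain k where "k \<le> N" "v 0 < v k" using assms(1) by blast
    then show False using m(2)[of k] m0 by simp
  qed
  moreover have "m \<noteq> N"
  proof
    assume mN: "m = N"
    have "v (N - 1) \<le> v N" using m(2)[of "N - 1"] mN by simp
    moreover have "v (N - 1) \<noteq> v N" using N1 by (intro v_neq) auto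
    ultimately have "v (N - 1) < v N" by simp
    then obtain k where "k \<le> N" "v N < v k" using assms(2) by blast
    then show False using m(2)[of k] mN by simp
  qed
  ultimately have "maximum f N m" using m(1) by (intro maximumI m(2)) auto
  then show ?thesis ..
qed

text \<open>A hook is higher than the neighbouring item only if the item after that one is higher
  too, and as \<open>\<epsilon>\<close> is smaller than their difference, that item is also above
  the hook. The sign \<open>s\<close> covers \<open>- f\<close>. Hence both maps have a
  maximum.\<close>

lemma hooks_dominated:
  assumes ll: "linear_list c" and hk: "hook_size c \<epsilon>" and s: "s = 1 \<or> s = - 1"
  defines "v \<equiv> \<lambda>i. s * pl_map c \<epsilon> (real i)"
  shows "v 1 < v 0 \<Longrightarrow> \<exists>k \<le> length c + 1. v 0 < v k"
    "v (length c) < v (length c + 1) \<Longrightarrow> \<exists>k \<le> length c + 1. v (length c + 1) < v k"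
proof -
  let ?m = "length c"
  have m: "2 \<le> ?m" and d: "distinct c" using ll unfolding linear_list_def by auto
  have eps: "0 < \<epsilon>" "\<And>i j. i < ?m \<Longrightarrow> j < ?m \<Longrightarrow> i \<noteq> j \<Longrightarrow> \<epsilon> < \<bar>c ! i - c ! j\<bar>"
    using hk d unfolding hook_size_def by (auto simp: nth_eq_iff_index_eq)
  have it: "v i = s * c ! (i - 1)" if "0 < i" "i \<le> ?m" for i
    using that unfolding v_def pl_map_item item_value_def by simp
  have ends: "v 0 = s * (c ! 0 + \<epsilon> * sgn (c ! 1 - c ! 0))"
    "v (?m + 1) = s * (c ! (?m - 1) + \<epsilon> * sgn (c ! (?m - 2) - c ! (?m - 1)))"
    unfolding v_def pl_map_item item_value_def by simp_all
  {
    assume lt: "v 1 < v 0"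
    have "0 < ?m" "1 < ?m" using m by linarith+
    then have "\<epsilon> < \<bar>c ! 1 - c ! 0\<bar>" by (intro eps(2)) auto
    then have "v 0 < v 2" using lt s m it[of 1] it[of 2] eps(1) unfolding ends by (auto simp: sgn_if split: if_splits)
    then show "\<exists>k \<le> ?m + 1. v 0 < v k" using m by (intro exI[of _ 2]) auto
  }
  {
    assume lt: "v ?m < v (?m + 1)"
    have i: "?m - 1 - 1 = ?m - 2" "0 < ?m - 1" using m by auto
    have "?m - 2 < ?m" "?m - 1 < ?m" "?m - 2 \<noteq> ?m - 1" using m by linarith+
    then have "\<epsilon> < \<bar>c ! (?m - 2) - c ! (?m - 1)\<bar>" by (rule eps(2))
    moreover have "v ?m = s * c ! (?m - 1)" using m by (intro it) linarith+
    moreover have "v (?m - 1) = s * c ! (?m - 2)" using it[of "?m - 1"] i by simp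
    ultimately have "v (?m + 1) < v (?m - 1)"
      using lt s eps(1) unfolding ends by (auto simp: sgn_if split: if_splits)
    then show "\<exists>k \<le> ?m + 1. v (?m + 1) < v k" by (intro exI[of _ "?m - 1"]) auto
  }
qed

text \<open>Relabels the points of \<open>-f\<close> as points of \<open>f\<close>.\<close>

fun flip_point :: "diagram_point \<Rightarrow> diagram_point" where
  "flip_point (Essential, x, y) = (Essential, - y, - x)"
| "flip_point (d, x, y) = (Relative, - x, - y)"

lemma global_window_uminus: "global_window (\<lambda>t. - f t) N a b \<longleftrightarrow> global_window f N b a"
  unfolding global_window_def by auto

text \<open>The regions of relative windows are already regions of windows of \<open>- f\<close>;
  only the points need relabelling.\<close>

lemma relative_windows_eq:
  "relative_windows f N = map_prod flip_point id ` ordinary_windows (\<lambda>t. - f t) N"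
  unfolding relative_windows_def ordinary_windows_def global_window_uminus image_Un
  by (intro arg_cong2[where f = "(\<union>)"]) (force simp: image_iff)+

text \<open>Nesting depends on the regions alone, and relabelling the points leaves these as they
  are. So the arrows of \<open>- f\<close> carry over to the relative subdiagram.\<close>

lemma nesting_arrows_map:
  "nesting_arrows (map_prod \<phi> id ` \<W>) = map_prod \<phi> \<phi> ` nesting_arrows \<W>"
proof -
  have m: "(p, P) \<in> map_prod \<phi> id ` \<W> \<longleftrightarrow> (\<exists>p'. p = \<phi> p' \<and> (p', P) \<in> \<W>)" for p P
    by force
  show ?thesis
  proof (intro set_eqI iffI)
    fix pq assume *: "pq \<in> nesting_arrows (map_prod \<phi> id ` \<W>)"
    obtain p q where pq: "pq = (p, q)" by (cases pq)
    obtain P Q p' q' where "p = \<phi> p'" "(p', P) \<in> \<W>" "q = \<phi> q'" "(q', Q) \<in> \<W>" "P \<subset> Q"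
      and no: "\<And>r S. (r, S) \<in> map_prod \<phi> id ` \<W> \<Longrightarrow> P \<subset> S \<Longrightarrow> S \<subset> Q \<Longrightarrow> False"
      using * unfolding pq nesting_arrows_iff m by blast
    moreover have "False" if "(r, S) \<in> \<W>" "P \<subset> S" "S \<subset> Q" for r S
      using no[of "\<phi> r" S] that unfolding m by blast
    ultimately have "(p', q') \<in> nesting_arrows \<W>" unfolding nesting_arrows_iff by metis
    then show "pq \<in> map_prod \<phi> \<phi> ` nesting_arrows \<W>" unfolding pq \<open>p = \<phi> p'\<close> \<open>q = \<phi> q'\<close> by force
  next
    fix pq assume "pq \<in> map_prod \<phi> \<phi> ` nesting_arrows \<W>"
    then obtain p q where pq: "pq = (\<phi> p, \<phi> q)" and "(p, q) \<in> nesting_arrows \<W>" by auto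
    then obtain P Q where "(p, P) \<in> \<W>" "(q, Q) \<in> \<W>" "P \<subset> Q"
      and no: "\<And>r S. (r, S) \<in> \<W> \<Longrightarrow> P \<subset> S \<Longrightarrow> S \<subset> Q \<Longrightarrow> False"
      unfolding nesting_arrows_iff by blast
    then show "pq \<in> nesting_arrows (map_prod \<phi> id ` \<W>)"
      unfolding pq nesting_arrows_iff m by metis
  qed
qed

text \<open>The special root is \<open>Suc N\<close>, and \<open>N\<close> can be read off the last
  kept item because both ends of the domain are always kept.\<close>

definition build_trees :: prog where
  "build_trees = block
    [set_cell ''root'' (Inc (At ''crit'' (Dec (cell ''crit_count'')))),
     build_tree ''U.'' False, build_tree ''D.'' True]"

lemma kept_list_uminus: "kept_list (\<lambda>t. - f t) N = kept_list f N"
  unfolding kept_list_def by (intro filter_cong) auto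

lemma (in pl_wave) last_kept_list: "kept_list f N ! (length (kept_list f N) - 1) = N" "0 < length (kept_list f N)"
proof -
  have "critical f N N \<or> critical (\<lambda>t. - f t) N N" unfolding kept_iff[OF order_refl] by simp
  then have "\<exists>xs. kept_list f N = xs @ [N]" unfolding kept_list_def by simp
  then obtain xs where "kept_list f N = xs @ [N]" by blast
  then show "kept_list f N ! (length (kept_list f N) - 1) = N" "0 < length (kept_list f N)" by simp_all
qed

text \<open>The critical items of both maps are taken from the same kept list, which exceeds either
  critical list by at most the two ends. The lengths of these lists are twice the numbers of maxima
  plus one.\<close>

lemma (in pl_wave) card_maxima_uminus:
  "card {i. maximum (\<lambda>t. - f t) N i} \<le> card {i. maximum f N i} + 1"
proof -
  interpret D: pl_wave "\<lambda>t. - f t" N by (rule pl_wave_uminus) unfold_locales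
  have "length (critical_list (\<lambda>t. - f t) N) \<le> length (kept_list f N)"
    using D.kept_list_eq unfolding kept_list_uminus by simp
  also have "\<dots> \<le> length (critical_list f N) + 2" unfolding kept_list_eq by simp
  finally show ?thesis unfolding length_critical_list D.length_critical_list by simp
qed

lemma (in pl_wave) card_inners: "card (inners tree) = card {i. maximum f N i}"
  using tree(4) by simp

text \<open>The bound is 40 per critical item and 20 for each tree, plus 1 for the root. With n
  maxima of \<open>f\<close> there are 2n+1 critical items of \<open>f\<close> and at most 2n+3 of
  \<open>- f\<close>.\<close>

lemma (in pl_wave) build_trees:
  assumes st: "stores_kept_list s f N" and ex: "\<exists>i. maximum f N i" "\<exists>i. maximum (\<lambda>t. - f t) N i"
  shows "wp build_trees s (\<lambda>k s'. k \<le> 160 * card {i. maximum f N i} + 201 \<and> stores_trees s' f N)"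
proof -
  interpret D: pl_wave "\<lambda>t. - f t" N by (rule pl_wave_uminus) unfold_locales
  let ?n = "card {i. maximum f N i}" and ?n' = "card {i. maximum (\<lambda>t. - f t) N i}"
  have fin: "finite {i. maximum f N i}" "finite {i. maximum (\<lambda>t. - f t) N i}"
    by (rule finite_subset[of _ "{..N}"], auto simp: maximum_def)+
  have n: "0 < ?n" "0 < ?n'" using ex fin by (auto simp: card_gt_0_iff)
  have len: "1 < length (critical_list f N)" "1 < length (critical_list (\<lambda>t. - f t) N)"
    using n unfolding length_critical_list D.length_critical_list by auto
  define s1 where "s1 = put_num ''root'' 0 (Suc N) s"
  have s1: "put_num ''root'' 0 (nums s ''crit'' (nums s ''crit_count'' 0 - 1) + 1) s = s1"
    using st last_kept_list unfolding stores_kept_list_def s1_def by simp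
  have i1: "input_ok False s1"
    using st unfolding input_ok_def stores_kept_list_def s1_def by simp
  have vals1: "vals s1 = vals s" by (simp add: s1_def)
  have U: "wp (build_tree ''U.'' False) s1 (\<lambda>k s'. k \<le> 40 * length (critical_list f N) + 20 \<and>
      stores_bananas s' ''U.'' (banana_tree f N))"
    by (rule build_tree[OF _ i1 len(1)]) simp
  show ?thesis
    unfolding build_trees_def block.simps wp_Seq wp_PutNum num_of.simps s1
  proof (rule wp_mono[OF wp_frame[OF U]], goal_cases)
    case (1 k s2)
    then have k: "k \<le> 40 * length (critical_list f N) + 20" and U2: "stores_bananas s2 ''U.'' (banana_tree f N)"
      and fr: "\<And>y. y \<notin> range (\<lambda>x. ''U.'' @ x) \<Longrightarrow> nums s2 y = nums s1 y" and v2: "vals s2 = vals s"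
      using writes_build_tree[of "''U.''" False] writes_val_build_tree[of "''U.''" False] vals1 by (blast, blast, blast, auto)
    have eq: "nums s2 ''crit'' = nums s1 ''crit''" "nums s2 ''crit_count'' = nums s1 ''crit_count''" "nums s2 ''root'' = nums s1 ''root''"
      by (rule fr; auto)+
    \<comment> \<open>The first construction writes only under its own prefix, so the kept items are
      intact for the second one; negating twice identifies the stored values.\<close>
    have i2: "D.input_ok True s2"
      using i1 eq v2 vals1 unfolding D.input_ok_def input_ok_def kept_list_uminus by simp
    have D: "wp (build_tree ''D.'' True) s2 (\<lambda>k s'. k \<le> 40 * length (critical_list (\<lambda>t. - f t) N) + 20 \<and>
        stores_bananas s' ''D.'' (banana_tree (\<lambda>t. - f t) N))"
      by (rule D.build_tree[OF _ i2 len(2)]) simp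
    show ?case
    proof (rule wp_mono[OF wp_frame[OF D]], goal_cases)
      case (1 k2 s3)
      then have k2: "k2 \<le> 40 * length (critical_list (\<lambda>t. - f t) N) + 20" and D3: "stores_bananas s3 ''D.'' (banana_tree (\<lambda>t. - f t) N)"
        and fr3: "\<And>y. y \<notin> range (\<lambda>x. ''D.'' @ x) \<Longrightarrow> nums s3 y = nums s2 y" and v3: "vals s3 = vals s"
        using writes_build_tree[of "''D.''" True] writes_val_build_tree[of "''D.''" True] v2 by (blast, blast, blast, auto)
      have "nums s3 (''U.'' @ x) = nums s2 (''U.'' @ x)" for x by (rule fr3) auto
      then have U3: "stores_bananas s3 ''U.'' (banana_tree f N)" using U2 unfolding stores_bananas_iff by simp
      have "''root'' \<notin> range (\<lambda>x. ''D.'' @ x)" by auto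
      then have "nums s3 ''root'' 0 = Suc N" using fr3[of "''root''"] eq(3) by (simp add: s1_def)
      moreover have "\<forall>i \<in> set (kept_list f N). vals s3 ''f'' i = f (real i)"
        using st v3 unfolding stores_kept_list_def by simp
      ultimately have "stores_trees s3 f N"
        using U3 D3 unfolding stores_trees_def up_tree_def down_tree_def by blast
      moreover have "1 + (k + k2) \<le> 160 * ?n + 201"
        using k k2 card_maxima_uminus unfolding length_critical_list D.length_critical_list by simp
      ultimately show ?case by blast
    qed
  qed
qed

section \<open>From the list of entries to the diagram\<close>

definition entry_point :: "(real \<Rightarrow> real) \<Rightarrow> entry \<Rightarrow> diagram_point" where
  "entry_point f = (\<lambda>(k, a, q, t). (if k = 0 then Ordinary else if k = 1 then Relative else Essential, f (real a), f (real q)))"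

lemma (in pl_wave) visited_points:
  assumes vis: "visited kd low W0 (length (W0 @ A)) A" and low: "low_of low"
  shows "(\<lambda>e. (fst e, entry_leaf e, entry_node e)) ` set A = {(kd, low_leaf v w, q) | q w u. (q, w, u) \<in> merges v tree}"
proof (intro set_eqI iffI)
  fix x assume "x \<in> (\<lambda>e. (fst e, entry_leaf e, entry_node e)) ` set A"
  then obtain k a q t where e: "(k, a, q, t) \<in> set A" "x = (k, a, q)" by (auto simp: image_iff)
  from visited_target[OF vis low e(1)] obtain w u where "k = kd" "(q, w, u) \<in> merges v tree" "a = low_leaf v w" by metis
  then show "x \<in> {(kd, low_leaf v w, q) | q w u. (q, w, u) \<in> merges v tree}" using e(2) by blast
next
  fix x assume "x \<in> {(kd, low_leaf v w, q) | q w u. (q, w, u) \<in> merges v tree}"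
  then obtain q w u where m: "(q, w, u) \<in> merges v tree" "x = (kd, low_leaf v w, q)" by blast
  have "q \<in> entry_node ` set A" using merges_items[OF m(1)] visited_complete[OF vis low] by blast
  then obtain k a t where e: "(k, a, q, t) \<in> set A" by (auto simp: image_iff entry_node_def)
  from visited_target[OF vis low e] obtain w' u' where "k = kd" "(q, w', u') \<in> merges v tree" "a = low_leaf v w'" by metis
  then have "x = (k, a, q)" using m merge_node_unique[OF _ _ distinct_tree] by metis
  then show "x \<in> (\<lambda>e. (fst e, entry_leaf e, entry_node e)) ` set A" using e by (force simp: image_iff)
qed

text \<open>\<open>\<pi>\<close> assigns to an entry its point and \<open>P\<close> to a minimum the point of its banana.\<close>

lemma (in pl_wave) visited_arrows:
  assumes vis: "visited kd low W0 (length (W0 @ A)) A" and low: "low_of low"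
    and root: "\<pi> ((W0 @ A) ! 0) = P (low_leaf v tree)"
    and ent: "\<And>e w u. e \<in> set A \<Longrightarrow> fst e = kd \<Longrightarrow> (entry_node e, w, u) \<in> merges v tree \<Longrightarrow>
      entry_leaf e = low_leaf v w \<Longrightarrow> \<pi> e = P (low_leaf v w)"
  shows "(\<lambda>e. (\<pi> e, \<pi> ((W0 @ A) ! snd (snd (snd e))))) ` set A =
    {(P (low_leaf v w), P (low_leaf v u)) | b w u. (b, w, u) \<in> merges v tree}"
proof -
  have key: "(\<pi> (k, a, q, t), \<pi> ((W0 @ A) ! t)) = (P (low_leaf v w), P (low_leaf v u))"
    if e: "(k, a, q, t) \<in> set A" and m: "(q, w, u) \<in> merges v tree" for k a q t w u
  proof -
    from visited_target[OF vis low e] obtain w' u' where m': "k = kd" "(q, w', u') \<in> merges v tree" "a = low_leaf v w'"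
      and t': "t = 0 \<and> low_leaf v u' = low_leaf v tree \<or>
        length W0 \<le> t \<and> t < length (W0 @ A) \<and> low_leaf v u' = entry_leaf ((W0 @ A) ! t)" by metis
    have eq: "w' = w" "u' = u" using merge_node_unique[OF m m'(2) distinct_tree] by auto
    have 1: "\<pi> (k, a, q, t) = P (low_leaf v w)" using ent[OF e, of w u] m m' eq by simp
    have "\<pi> ((W0 @ A) ! t) = P (low_leaf v u)"
      using t'
    proof (elim disjE conjE)
      assume "t = 0" "low_leaf v u' = low_leaf v tree"
      then show ?thesis using root eq by simp
    next
      assume *: "length W0 \<le> t" "t < length (W0 @ A)" "low_leaf v u' = entry_leaf ((W0 @ A) ! t)"
      then have inA: "(W0 @ A) ! t \<in> set A" by (simp add: nth_append)
      obtain k2 a2 q2 t2 where e2: "(W0 @ A) ! t = (k2, a2, q2, t2)" by (cases "(W0 @ A) ! t") auto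
      from visited_target[OF vis low inA[unfolded e2]] obtain w2 u2 where m2: "k2 = kd" "(q2, w2, u2) \<in> merges v tree" "a2 = low_leaf v w2"
        by metis
      then have "\<pi> ((W0 @ A) ! t) = P (low_leaf v w2)" using ent[OF inA, of w2 u2] e2 by simp
      then show ?thesis using * e2 m2 eq by simp
    qed
    then show ?thesis using 1 by simp
  qed
  show ?thesis
  proof (intro set_eqI iffI)
    fix x assume "x \<in> (\<lambda>e. (\<pi> e, \<pi> ((W0 @ A) ! snd (snd (snd e))))) ` set A"
    then obtain k a q t where e: "(k, a, q, t) \<in> set A" "x = (\<pi> (k, a, q, t), \<pi> ((W0 @ A) ! t))" by (auto simp: image_iff)
    from visited_target[OF vis low e(1)] obtain w u where m: "(q, w, u) \<in> merges v tree" by metis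
    show "x \<in> {(P (low_leaf v w), P (low_leaf v u)) | b w u. (b, w, u) \<in> merges v tree}"
      using key[OF e(1) m] e(2) m by blast
  next
    fix x assume "x \<in> {(P (low_leaf v w), P (low_leaf v u)) | b w u. (b, w, u) \<in> merges v tree}"
    then obtain b w u where m: "(b, w, u) \<in> merges v tree" "x = (P (low_leaf v w), P (low_leaf v u))" by blast
    have "b \<in> entry_node ` set A" using merges_items[OF m(1)] visited_complete[OF vis low] by blast
    then obtain k a t where e: "(k, a, b, t) \<in> set A" by (auto simp: image_iff entry_node_def)
    then show "x \<in> (\<lambda>e. (\<pi> e, \<pi> ((W0 @ A) ! snd (snd (snd e))))) ` set A"
      using key[OF e m(1)] m(2) by (force simp: image_iff)
  qed
qed

text \<open>Arrow \<open>j\<close> starts at point \<open>j + 1\<close>, so different arrows have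
  different sources and the arrow array has no repetitions as soon as the points have none.\<close>

lemma stores_diagram_entries:
  fixes \<pi> :: "entry \<Rightarrow> diagram_point"
  assumes W: "stores_entries s W" and ac: "nums s ''arrow_count'' 0 = length W - 1" and ne: "W \<noteq> []"
    and pt: "\<And>k a q t. (k, a, q, t) \<in> set W \<Longrightarrow> case \<pi> (k, a, q, t) of (d, x, y) \<Rightarrow>
      k = subdiagram_code d \<and> vals s ''f'' a = x \<and> vals s ''f'' q = y"
    and inj: "distinct (map \<pi> W)" and tgt: "\<And>k a q t. (k, a, q, t) \<in> set (tl W) \<Longrightarrow> t < length W"
    and P: "\<pi> ` set W = P" and A: "(\<lambda>e. (\<pi> e, \<pi> (W ! snd (snd (snd e))))) ` set (tl W) = A"
  shows "stores_diagram s P A"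
  unfolding stores_diagram_def
proof (intro exI[of _ "\<lambda>k. \<pi> (W ! k)"] conjI)
  let ?pt = "\<lambda>k. \<pi> (W ! k)"
  have cnt: "nums s ''point_count'' 0 = length W" using W unfolding stores_entries_def by simp
  have ent: "case W ! k of (kd, a, q, t) \<Rightarrow>
        nums s ''point_kind'' k = kd \<and> vals s ''point_x'' k = vals s ''f'' a \<and> vals s ''point_y'' k = vals s ''f'' q \<and>
        (0 < k \<longrightarrow> nums s ''queue'' k = a \<and> nums s ''arrow_source'' (k - 1) = k \<and> nums s ''arrow_target'' (k - 1) = t)"
    if "k < length W" for k
    using conjunct2[OF W[unfolded stores_entries_def]] that by (elim allE[of _ k] impE)
  have ij: "i = j" if "?pt i = ?pt j" "i < length W" "j < length W" for i j
    using that inj nth_eq_iff_index_eq[of "map \<pi> W" i j] by simp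
  show "bij_betw ?pt {..<nums s ''point_count'' 0} P"
    unfolding bij_betw_def cnt P[symmetric]
    by (auto simp: inj_on_def ij set_conv_nth)
  show "\<forall>k<nums s ''point_count'' 0. case ?pt k of (d, x, y) \<Rightarrow>
      nums s ''point_kind'' k = subdiagram_code d \<and> vals s ''point_x'' k = x \<and> vals s ''point_y'' k = y"
    unfolding cnt
  proof (intro allI impI)
    fix k assume k: "k < length W"
    obtain kd a q t where e: "W ! k = (kd, a, q, t)" by (cases "W ! k") auto
    show "case ?pt k of (d, x, y) \<Rightarrow>
      nums s ''point_kind'' k = subdiagram_code d \<and> vals s ''point_x'' k = x \<and> vals s ''point_y'' k = y"
      using ent[OF k] pt[of kd a q t] nth_mem[OF k] unfolding e by (auto split: prod.splits)
  qed
  have src: "nums s ''arrow_source'' j = Suc j" "nums s ''arrow_target'' j = snd (snd (snd (W ! Suc j)))"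
    if "j < length W - 1" for j
  proof -
    have "Suc j < length W" using that by linarith
    from ent[OF this] show "nums s ''arrow_source'' j = Suc j" "nums s ''arrow_target'' j = snd (snd (snd (W ! Suc j)))"
      by (auto split: prod.splits)
  qed
  have tlW: "W ! Suc j = tl W ! j" if "j < length W - 1" for j using that by (simp add: nth_tl)
  show "\<forall>j<nums s ''arrow_count'' 0. nums s ''arrow_source'' j < nums s ''point_count'' 0 \<and>
      nums s ''arrow_target'' j < nums s ''point_count'' 0"
    unfolding ac cnt
  proof (intro allI impI)
    fix j assume j: "j < length W - 1"
    obtain kd a q t where e: "tl W ! j = (kd, a, q, t)" by (cases "tl W ! j") auto
    have "(kd, a, q, t) \<in> set (tl W)" using nth_mem[of j "tl W"] j e by simp
    then have "t < length W" by (rule tgt)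
    then show "nums s ''arrow_source'' j < length W \<and> nums s ''arrow_target'' j < length W"
      using src[OF j] tlW[OF j] e j by simp
  qed
  let ?ar = "\<lambda>j. (\<pi> (W ! nums s ''arrow_source'' j), \<pi> (W ! nums s ''arrow_target'' j))"
  have ar: "?ar j = (\<lambda>e. (\<pi> e, \<pi> (W ! snd (snd (snd e))))) (tl W ! j)" if "j < length W - 1" for j
    using src[OF that] tlW[OF that] by simp
  have "inj_on ?ar {..<length W - 1}"
  proof (rule inj_onI)
    fix i j assume *: "i \<in> {..<length W - 1}" "j \<in> {..<length W - 1}" "?ar i = ?ar j"
    then have "?pt (Suc i) = ?pt (Suc j)" using src(1) by simp
    then have "Suc i = Suc j" using * by (intro ij) auto
    then show "i = j" by simp
  qed
  moreover have "?ar ` {..<length W - 1} = A"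
  proof -
    have "?ar ` {..<length W - 1} = (\<lambda>e. (\<pi> e, \<pi> (W ! snd (snd (snd e))))) ` ((!) (tl W) ` {..<length (tl W)})"
      unfolding image_image using ar by (intro image_cong) auto
    also have "(!) (tl W) ` {..<length (tl W)} = set (tl W)" by (auto simp: set_conv_nth)
    finally show ?thesis using A by simp
  qed
  ultimately show "bij_betw ?ar {..<nums s ''arrow_count'' 0} A" unfolding bij_betw_def ac by blast
qed

lemma image_triples: "\<phi> ` {F b w u | b w u. (b, w, u) \<in> M} = {\<phi> (F b w u) | b w u. (b, w, u) \<in> M}"
  by blast

lemma entry_point_alt:
  "entry_point f e = (if fst e = 0 then Ordinary else if fst e = 1 then Relative else Essential,
     f (real (entry_leaf e)), f (real (entry_node e)))"
  unfolding entry_point_def by (cases e) simp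

text \<open>The upper ends are distinct and \<open>g\<close> separates them, so already the last
  coordinates of the points differ. \<open>g\<close> is separate from the map of the locale because
  the points of the down-tree carry values of \<open>f\<close> rather than of
  \<open>- f\<close>.\<close>

lemma (in pl_wave) distinct_entry_points:
  assumes vis: "visited kd low W0 h A" and g: "inj_on (\<lambda>i. g (real i)) (items tree)"
  shows "distinct (map (entry_point g) A)"
proof -
  have A: "distinct (map entry_node A)" "entry_node ` set A \<subseteq> items tree"
    using vis items_conv[of tree] unfolding visited_def by auto
  have "inj_on (entry_point g) (set A)"
  proof (rule inj_onI)
    fix e e' assume e: "e \<in> set A" "e' \<in> set A" "entry_point g e = entry_point g e'"
    obtain k a q t where s: "e = (k, a, q, t)" by (cases e) auto
    obtain k' a' q' t' where s': "e' = (k', a', q', t')" by (cases e') auto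
    have "q \<in> items tree" "q' \<in> items tree" using A(2) e(1,2) unfolding s s' by force+
    moreover have "g (real q) = g (real q')" using e(3) unfolding s s' entry_point_def by simp
    ultimately have "entry_node e = entry_node e'" using inj_onD[OF g] unfolding s s' by simp
    then show "e = e'" using A(1) e(1,2) unfolding distinct_map by (meson inj_onD)
  qed
  then show ?thesis using A(1) unfolding distinct_map by simp
qed

text \<open>The kind of a point separates the essential point, the points of the up-tree and those
  of the down-tree. Entry 0 combines the lowest leaves of both trees: that of the tree of
  \<open>- f\<close> is the global maximum.\<close>

lemma (in pl_wave) stores_diagram_visited:
  fixes A B :: "entry list"
  defines "h \<equiv> low_leaf (\<lambda>i. - f (real i)) (pl_wave.tree (\<lambda>t. - f t) N)"
  defines "e0 \<equiv> (2, low_leaf v tree, h, 0)"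
  assumes U: "visited 0 lowU [e0] (length ([e0] @ A)) A" "low_of lowU"
    and D: "pl_wave.visited (\<lambda>t. - f t) N 1 lowD ([e0] @ A) (length (([e0] @ A) @ B)) B"
      "pl_wave.low_of (\<lambda>t. - f t) N lowD"
    and s: "stores_entries s (([e0] @ A) @ B)" "nums s ''arrow_count'' 0 = length A + length B"
    and vals: "\<forall>i \<in> set (kept_list f N). vals s ''f'' i = f (real i)"
  shows "stores_diagram s (diagram_points f N) (diagram_arrows f N)"
proof -
  interpret D: pl_wave "\<lambda>t. - f t" N by (rule pl_wave_uminus) unfold_locales
  let ?W = "([e0] @ A) @ B" and ?l = "low_leaf v tree" and ?\<pi> = "entry_point f"
  have h: "h \<le> N" "\<forall>k\<le>N. v k \<le> v h"
    using D.low_leaf_tree_le D.low_leaf_tree_least unfolding h_def by auto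
  have l: "?l \<le> N" "\<forall>k\<le>N. - f (real k) \<le> - f (real ?l)"
    using low_leaf_tree_le low_leaf_tree_least by auto
  have e0: "?\<pi> e0 = essential_point h"
    unfolding e0_def entry_point_def essential_point_def by simp
  have D0: "flip_point (D.point ?l h) = essential_point h"
    unfolding D.point_def D.essential_point_def essential_point_def h_def by simp
  have D0': "flip_point (D.essential_point ?l) = essential_point h"
    unfolding D.essential_point_def essential_point_def h_def by simp
  have DP: "flip_point (D.point ?l (low_leaf (\<lambda>i. - f (real i)) w)) = (Relative, f (real (low_leaf (\<lambda>i. - f (real i)) w)), f (real b))"
    if "(b, w, u) \<in> merges (\<lambda>i. - f (real i)) (pl_wave.tree (\<lambda>t. - f t) N)" for b w u
    using D.point_merge[OF that, of ?l] by simp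
  have Ue: "k = 0 \<and> (\<exists>w u. (q, w, u) \<in> merges v tree \<and> a = low_leaf v w) \<and> t < length ([e0] @ A)"
    if "(k, a, q, t) \<in> set A" for k a q t
  proof -
    from visited_target[OF U that] obtain w u where "k = 0" "(q, w, u) \<in> merges v tree" "a = low_leaf v w"
      "t = 0 \<or> t < length ([e0] @ A)" by metis
    then show ?thesis by auto
  qed
  have De: "k = 1 \<and> (\<exists>w u. (q, w, u) \<in> merges (\<lambda>i. - f (real i)) (pl_wave.tree (\<lambda>t. - f t) N) \<and>
      a = low_leaf (\<lambda>i. - f (real i)) w) \<and> t < length ?W" if "(k, a, q, t) \<in> set B" for k a q t
  proof -
    from D.visited_target[OF D that] obtain w u where "k = 1"
      "(q, w, u) \<in> merges (\<lambda>i. - f (real i)) (pl_wave.tree (\<lambda>t. - f t) N)" "a = low_leaf (\<lambda>i. - f (real i)) w"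
      "t = 0 \<or> t < length ?W" by metis
    then show ?thesis by auto
  qed
  have kept: "i \<in> set (kept_list f N)" if "critical f N i \<or> critical (\<lambda>t. - f t) N i" for i
    using that critical_le[of i] D.critical_le[of i] unfolding kept_list_def by (auto simp del: upt_Suc)
  have itemsU: "a \<in> items tree" "q \<in> items tree" if "(k, a, q, t) \<in> set A" for k a q t
    using Ue[OF that] merges_items[of q _ _ v tree] merges_node[of q _ _ v tree] low_leaf_in_items by blast+
  have itemsD: "a \<in> items (pl_wave.tree (\<lambda>t. - f t) N)" "q \<in> items (pl_wave.tree (\<lambda>t. - f t) N)"
    if "(k, a, q, t) \<in> set B" for k a q t
    using De[OF that] merges_items[of q _ _ _ "pl_wave.tree (\<lambda>t. - f t) N"]
      merges_node[of q _ _ _ "pl_wave.tree (\<lambda>t. - f t) N"] low_leaf_in_items by blast+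
  have val: "vals s ''f'' a = f (real a) \<and> vals s ''f'' q = f (real q)" if "(k, a, q, t) \<in> set ?W" for k a q t
  proof -
    consider "(k, a, q, t) = e0" | "(k, a, q, t) \<in> set A" | "(k, a, q, t) \<in> set B" using \<open>(k, a, q, t) \<in> set ?W\<close> by auto
    then have "a \<in> items tree \<union> items (pl_wave.tree (\<lambda>t. - f t) N) \<and> q \<in> items tree \<union> items (pl_wave.tree (\<lambda>t. - f t) N)"
    proof cases
      case 1
      then show ?thesis using low_leaf_in_items[of v tree]
          low_leaf_in_items[of "\<lambda>i. - f (real i)" "pl_wave.tree (\<lambda>t. - f t) N"] unfolding e0_def h_def by blast
    next
      case 2
      then show ?thesis using itemsU by blast
    next
      case 3
      then show ?thesis using itemsD by blast
    qed
    then have "a \<in> set (kept_list f N)" "q \<in> set (kept_list f N)"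
      using kept unfolding items_tree D.items_tree by blast+
    then show ?thesis using vals by blast
  qed
  show ?thesis
  proof (rule stores_diagram_entries[OF s(1), where \<pi> = ?\<pi>])
    show "nums s ''arrow_count'' 0 = length ?W - 1" using s(2) by simp
    show "?W \<noteq> []" by simp
    fix k a q t assume e: "(k, a, q, t) \<in> set ?W"
    have "k = 0 \<or> k = 1 \<or> k = 2" using e Ue[of k a q t] De[of k a q t] unfolding e0_def by auto
    then show "case ?\<pi> (k, a, q, t) of (d, x, y) \<Rightarrow> k = subdiagram_code d \<and> vals s ''f'' a = x \<and> vals s ''f'' q = y"
      using val[OF e] unfolding entry_point_def by auto
  next
    have "distinct (map ?\<pi> A)" by (rule distinct_entry_points[OF U(1) inj_tree])
    moreover have "inj_on (\<lambda>i. f (real i)) (items (pl_wave.tree (\<lambda>t. - f t) N))"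
      using D.inj_tree unfolding inj_on_def by simp
    then have "distinct (map ?\<pi> B)" by (rule D.distinct_entry_points[OF D(1)])
    moreover have UA: "fst (?\<pi> e) = Ordinary" if "e \<in> set A" for e
      using Ue that unfolding entry_point_def by (cases e) fastforce
    have DB: "fst (?\<pi> e) = Relative" if "e \<in> set B" for e
      using De that unfolding entry_point_def by (cases e) fastforce
    have "fst (?\<pi> e0) = Essential" unfolding e0 essential_point_def by simp
    then have "?\<pi> e0 \<noteq> ?\<pi> e" if "e \<in> set (A @ B)" for e using UA[of e] DB[of e] that by auto
    then have "?\<pi> e0 \<notin> ?\<pi> ` set (A @ B)" by blast
    moreover have "?\<pi> ` set A \<inter> ?\<pi> ` set B = {}"
    proof -
      have "?\<pi> e \<noteq> ?\<pi> e'" if "e \<in> set A" "e' \<in> set B" for e e' using UA[OF that(1)] DB[OF that(2)] by auto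
      then show ?thesis by blast
    qed
    ultimately show "distinct (map ?\<pi> ?W)" by (simp add: image_Un)
  next
    fix k a q t assume "(k, a, q, t) \<in> set (tl ?W)"
    then show "t < length ?W" using Ue[of k a q t] De[of k a q t] by auto
  next
    let ?g = "\<lambda>(k, a, q). (if k = (0::nat) then Ordinary else if k = 1 then Relative else Essential, f (real a), f (real q))"
    have g: "?\<pi> ` X = ?g ` (\<lambda>e. (fst e, entry_leaf e, entry_node e)) ` X" for X :: "entry set"
      unfolding image_image entry_point_def by (intro image_cong) auto
    have "?\<pi> ` set A = {(Ordinary, v (low_leaf v w), v b) | b w u. (b, w, u) \<in> merges v tree}"
      unfolding g visited_points[OF U] by (force simp: image_iff)
    moreover have "?\<pi> ` set B = {(Relative, f (real (low_leaf (\<lambda>i. - f (real i)) w)), f (real b)) | b w u.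
        (b, w, u) \<in> merges (\<lambda>i. - f (real i)) (pl_wave.tree (\<lambda>t. - f t) N)}"
      unfolding g D.visited_points[OF D] by (force simp: image_iff)
    moreover have "fst ` relative_windows f N = flip_point ` fst ` ordinary_windows (\<lambda>t. - f t) N"
      unfolding relative_windows_eq image_image by simp
    then have "fst ` relative_windows f N = insert (essential_point h)
        {(Relative, f (real (low_leaf (\<lambda>i. - f (real i)) w)), f (real b)) | b w u.
        (b, w, u) \<in> merges (\<lambda>i. - f (real i)) (pl_wave.tree (\<lambda>t. - f t) N)}"
      unfolding D.ordinary_points[OF l] image_insert image_triples D0' by simp
    ultimately show "?\<pi> ` set ?W = diagram_points f N"
      unfolding diagram_points_def image_Un ordinary_points[OF h] set_append by (simp add: e0 image_Un Un_ac)
  next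
    let ?ar = "\<lambda>W e. (?\<pi> e, ?\<pi> (W ! snd (snd (snd e))))"
    \<comment> \<open>The arrows of the up-tree have their heads in the first segment and do not see
      the entries appended by the second search.\<close>
    have "?ar ?W ` set A = ?ar ([e0] @ A) ` set A"
    proof (intro image_cong refl)
      fix e assume "e \<in> set A"
      then have "snd (snd (snd e)) < length ([e0] @ A)" using Ue[of "fst e" "fst (snd e)" "fst (snd (snd e))"] by simp
      then show "?ar ?W e = ?ar ([e0] @ A) e" by (simp only: nth_append if_True)
    qed
    also have "\<dots> = nesting_arrows (ordinary_windows f N)"
      unfolding ordinary_arrows[OF h]
    proof (rule visited_arrows[OF U])
      show "?\<pi> (([e0] @ A) ! 0) = point h ?l" using e0 unfolding point_def by simp
      fix e w u assume "e \<in> set A" "fst e = 0" "(entry_node e, w, u) \<in> merges v tree" "entry_leaf e = low_leaf v w"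
      then show "?\<pi> e = point h (low_leaf v w)"
        using point_merge[of "entry_node e" w u h] unfolding entry_point_alt by simp
    qed
    finally have A: "?ar ?W ` set A = nesting_arrows (ordinary_windows f N)" .
    have "?ar ?W ` set B = {(flip_point (D.point ?l (low_leaf (\<lambda>i. - f (real i)) w)), flip_point (D.point ?l (low_leaf (\<lambda>i. - f (real i)) u))) | b w u.
        (b, w, u) \<in> merges (\<lambda>i. - f (real i)) (pl_wave.tree (\<lambda>t. - f t) N)}"
    \<comment> \<open>Position 0 also stands for the root banana of the down-tree, although its
      entry was written for \<open>f\<close>: after relabelling, the two essential points
      coincide.\<close>
    proof (rule D.visited_arrows[OF D, where P = "\<lambda>a. flip_point (D.point ?l a)"])
      show "?\<pi> (?W ! 0) = flip_point (D.point ?l (low_leaf (\<lambda>i. - f (real i)) (pl_wave.tree (\<lambda>t. - f t) N)))"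
        using e0 D0 unfolding h_def by simp
      fix e w u assume "e \<in> set B" "fst e = 1"
        and m: "(entry_node e, w, u) \<in> merges (\<lambda>i. - f (real i)) (pl_wave.tree (\<lambda>t. - f t) N)"
        and "entry_leaf e = low_leaf (\<lambda>i. - f (real i)) w"
      then show "?\<pi> e = flip_point (D.point ?l (low_leaf (\<lambda>i. - f (real i)) w))"
        unfolding DP[OF m] entry_point_alt by simp
    qed
    also have "\<dots> = nesting_arrows (relative_windows f N)"
      unfolding relative_windows_eq nesting_arrows_map D.ordinary_arrows[OF l] image_triples by simp
    finally show "?ar ?W ` set (tl ?W) = diagram_arrows f N"
      unfolding diagram_arrows_def A[symmetric] by (simp add: image_Un)
  qed
qed

text \<open>The 26 consists of six single assignments and of 10 for starting each of the two
  searches.\<close>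

lemma (in pl_wave) build_diagram:
  assumes st: "stores_trees s f N"
  shows "wp build_diagram s (\<lambda>k s'. k \<le> 19 * card {i. maximum f N i} + 19 * card {i. maximum (\<lambda>t. - f t) N i} + 26 \<and>
    stores_diagram s' (diagram_points f N) (diagram_arrows f N))"
proof -
  interpret D: pl_wave "\<lambda>t. - f t" N by (rule pl_wave_uminus) unfold_locales
  let ?X = "output_arrays \<union> {''cur'', ''idx'', ''head''}"
  define h where "h = low_leaf (\<lambda>i. - f (real i)) (pl_wave.tree (\<lambda>t. - f t) N)"
  define e0 :: entry where "e0 = (2, low_leaf v tree, h, 0)"
  have rt: "nums s ''root'' 0 = Suc N" and bU: "stores_bananas s ''U.'' (banana_tree f N)"
    and bD: "stores_bananas s ''D.'' (banana_tree (\<lambda>t. - f t) N)"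
    and vf: "\<forall>i \<in> set (kept_list f N). vals s ''f'' i = f (real i)"
    using st unfolding stores_trees_def up_tree_def down_tree_def by auto
  have low: "nums s ''U.low'' (Suc N) = low_leaf v tree" "nums s ''D.low'' (Suc N) = h"
    using stores_bananas_low(2)[OF bU] D.stores_bananas_low(2)[OF bD] unfolding h_def by simp_all
  define s1 where "s1 = put_num ''head'' 0 1 (put_num ''point_count'' 0 1
    (put_val ''point_y'' 0 (vals s ''f'' h) (put_val ''point_x'' 0 (vals s ''f'' (low_leaf v tree)) (put_num ''point_kind'' 0 2 s))))"
  have W: "stores_entries s1 [e0]" unfolding stores_entries_def s1_def e0_def by simp
  have s1: "stores_bananas s1 ''U.'' (banana_tree f N)" "stores_bananas s1 ''D.'' (banana_tree (\<lambda>t. - f t) N)"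
    "nums s1 ''root'' 0 = Suc N" "nums s1 ''head'' 0 = length [e0]" "vals s1 ''f'' = vals s ''f''"
    using bU bD rt unfolding stores_bananas_iff s1_def by (auto simp: put_val_def put_num_def)
  have start: "wp build_diagram s Q \<longleftrightarrow> wp (visit_all ''U.'' 0) s1 (\<lambda>k. \<lambda>s'. wp (visit_all ''D.'' 1) s' (\<lambda>k' s''.
      Q (1 + (1 + (1 + (1 + (1 + (k + (k' + 1))))))) (put_num ''arrow_count'' 0 (nums s'' ''point_count'' 0 - 1) s'')))" for Q
    unfolding build_diagram_def block.simps wp_Seq wp_PutNum wp_PutVal num_of.simps s1_def
    by (simp add: rt low)
  show ?thesis
    unfolding start
  proof (rule wp_mono[OF visit_all[OF refl W _ s1(1,3,4)]])
    show "[e0] \<noteq> []" by simp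
    fix k s2
    assume "k \<le> 19 * card (inners tree) + 10 \<and> (\<exists>A. visited 0 (nums s1 (''U.'' @ ''low'')) [e0] (length ([e0] @ A)) A \<and>
      stores_entries s2 ([e0] @ A) \<and> nums s2 ''head'' 0 = length ([e0] @ A) \<and> unchanged ?X s1 s2)"
    then obtain A where k: "k \<le> 19 * card (inners tree) + 10"
      and A: "visited 0 (nums s1 (''U.'' @ ''low'')) [e0] (length ([e0] @ A)) A"
      "stores_entries s2 ([e0] @ A)" "nums s2 ''head'' 0 = length ([e0] @ A)" "unchanged ?X s1 s2"
      by blast
    have "nums s2 (''D.'' @ x) = nums s1 (''D.'' @ x)" for x using A(4) unfolding unchanged_def by simp
    then have b2: "stores_bananas s2 ''D.'' (banana_tree (\<lambda>t. - f t) N)" using s1(2) unfolding stores_bananas_iff by simp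
    have r2: "nums s2 ''root'' 0 = Suc N" using A(4) s1(3) unfolding unchanged_def by simp
    have v2: "vals s2 ''f'' = vals s ''f''" using A(4) s1(5) unfolding unchanged_def by simp
    show "wp (visit_all ''D.'' 1) s2 (\<lambda>k' s''. 1 + (1 + (1 + (1 + (1 + (k + (k' + 1)))))) \<le> 19 * card {i. maximum f N i} + 19 * card {i. maximum (\<lambda>t. - f t) N i} + 26 \<and>
      stores_diagram (put_num ''arrow_count'' 0 (nums s'' ''point_count'' 0 - 1) s'') (diagram_points f N) (diagram_arrows f N))"
    proof (rule wp_mono[OF D.visit_all[OF refl A(2) _ b2 r2 A(3)]])
      show "[e0] @ A \<noteq> []" by simp
      fix k' s3
      assume "k' \<le> 19 * card (inners (pl_wave.tree (\<lambda>t. - f t) N)) + 10 \<and>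
        (\<exists>B. D.visited 1 (nums s2 (''D.'' @ ''low'')) ([e0] @ A) (length (([e0] @ A) @ B)) B \<and>
        stores_entries s3 (([e0] @ A) @ B) \<and> nums s3 ''head'' 0 = length (([e0] @ A) @ B) \<and> unchanged ?X s2 s3)"
      then obtain B where k': "k' \<le> 19 * card (inners (pl_wave.tree (\<lambda>t. - f t) N)) + 10"
        and B: "D.visited 1 (nums s2 (''D.'' @ ''low'')) ([e0] @ A) (length (([e0] @ A) @ B)) B"
          "stores_entries s3 (([e0] @ A) @ B)" "unchanged ?X s2 s3"
        by blast
      let ?s = "put_num ''arrow_count'' 0 (nums s3 ''point_count'' 0 - 1) s3"
      have "stores_diagram ?s (diagram_points f N) (diagram_arrows f N)"
      proof (rule stores_diagram_visited[folded h_def, folded e0_def])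
        show "visited 0 (nums s1 (''U.'' @ ''low'')) [e0] (length ([e0] @ A)) A" by (rule A(1))
        show "low_of (nums s1 (''U.'' @ ''low''))" by (rule stores_bananas_low(1)[OF s1(1)])
        show "D.visited 1 (nums s2 (''D.'' @ ''low'')) ([e0] @ A) (length (([e0] @ A) @ B)) B" by (rule B(1))
        show "D.low_of (nums s2 (''D.'' @ ''low''))" by (rule D.stores_bananas_low(1)[OF b2])
        show "stores_entries ?s (([e0] @ A) @ B)" using B(2) unfolding stores_entries_def by simp
        show "nums ?s ''arrow_count'' 0 = length A + length B" using B(2) unfolding stores_entries_def by simp
        show "\<forall>i \<in> set (kept_list f N). vals ?s ''f'' i = f (real i)"
          using B(3) v2 vf unfolding unchanged_def by simp
      qed
      then show "1 + (1 + (1 + (1 + (1 + (k + (k' + 1)))))) \<le> 19 * card {i. maximum f N i} + 19 * card {i. maximum (\<lambda>t. - f t) N i} + 26 \<and>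
        stores_diagram ?s (diagram_points f N) (diagram_arrows f N)"
        using k k' unfolding card_inners D.card_inners by simp
    qed
  qed
qed

theorem theorem4p1:
  shows "\<exists>(remove_noncritical :: prog) (build_trees :: prog) (build_diagram :: prog) (C :: nat).
    \<forall>(c :: real list) (\<epsilon> :: real) (m :: nat) (n :: nat) (f :: real \<Rightarrow> real).
      linear_list c \<and> hook_size c \<epsilon> \<and> m = length c \<and> f = pl_map c \<epsilon> \<and> generic f (m + 1) \<and>
      n = card {i. maximum f (m + 1) i} \<longrightarrow>
        (\<forall>s. stores_map s f (m + 1) \<longrightarrow>
           (\<exists>t s'. runs remove_noncritical s t s' \<and> t \<le> C * m \<and>
              stores_kept_list s' f (m + 1))) \<and>
        (\<forall>s. stores_kept_list s f (m + 1) \<longrightarrow>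
           (\<exists>t s'. runs build_trees s t s' \<and> t \<le> C * n \<and>
              stores_trees s' f (m + 1))) \<and>
        (\<forall>s. stores_trees s f (m + 1) \<longrightarrow>
           (\<exists>t s'. runs build_diagram s t s' \<and> t \<le> C * n \<and>
              stores_diagram s' (diagram_points f (m + 1)) (diagram_arrows f (m + 1))))"
proof (rule exI[of _ remove_noncritical], rule exI[of _ build_trees], rule exI[of _ build_diagram], rule exI[of _ 400],
    intro allI impI)
  fix c :: "real list" and \<epsilon> :: real and m n :: nat and f :: "real \<Rightarrow> real"
  assume *: "linear_list c \<and> hook_size c \<epsilon> \<and> m = length c \<and> f = pl_map c \<epsilon> \<and> generic f (m + 1) \<and>
    n = card {i. maximum f (m + 1) i}"
  then have c: "linear_list c" "hook_size c \<epsilon>" and m: "m = length c" and f: "f = pl_map c \<epsilon>"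
    and n: "n = card {i. maximum f (m + 1) i}" by auto
  interpret pl_wave f "m + 1" unfolding f by (rule pl_wave_pl_map) (use * in auto)
  interpret D: pl_wave "\<lambda>t. - f t" "m + 1" by (rule pl_wave_uminus) unfold_locales
  have m2: "2 \<le> m" using c m unfolding linear_list_def by simp
  have ex: "\<exists>i. maximum f (m + 1) i"
    by (rule exists_maximum) (use hooks_dominated[OF c, of 1] in \<open>simp_all add: f m\<close>)
  have ex': "\<exists>i. maximum (\<lambda>t. - f t) (m + 1) i"
    by (rule D.exists_maximum) (use hooks_dominated[OF c, of "- 1"] in \<open>simp_all add: f m\<close>)
  have "finite {i. maximum f (m + 1) i}" by (rule finite_subset[of _ "{..m + 1}"]) (auto simp: maximum_def)
  \<comment> \<open>This absorbs the additive constants: with \<open>2 \<le> m\<close> and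
    \<open>1 \<le> n\<close> the three running times are at most \<open>12 * m\<close>,
    \<open>361 * n\<close> and \<open>83 * n\<close>, so 400 is a generous constant.\<close>
  then have n1: "1 \<le> n" using ex card_gt_0_iff[of "{i. maximum f (m + 1) i}"] unfolding n by auto
  show "(\<forall>s. stores_map s f (m + 1) \<longrightarrow>
           (\<exists>t s'. runs remove_noncritical s t s' \<and> t \<le> 400 * m \<and>
              stores_kept_list s' f (m + 1))) \<and>
        (\<forall>s. stores_kept_list s f (m + 1) \<longrightarrow>
           (\<exists>t s'. runs build_trees s t s' \<and> t \<le> 400 * n \<and>
              stores_trees s' f (m + 1))) \<and>
        (\<forall>s. stores_trees s f (m + 1) \<longrightarrow>
           (\<exists>t s'. runs build_diagram s t s' \<and> t \<le> 400 * n \<and>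
              stores_diagram s' (diagram_points f (m + 1)) (diagram_arrows f (m + 1))))"
  proof (intro conjI allI impI)
    fix s assume "stores_map s f (m + 1)"
    from remove_noncritical[OF this] obtain t s' where
      "runs remove_noncritical s t s'" "t \<le> 5 * (m + 1) + 8" "stores_kept_list s' f (m + 1)"
      unfolding wp_def by blast
    then show "\<exists>t s'. runs remove_noncritical s t s' \<and> t \<le> 400 * m \<and> stores_kept_list s' f (m + 1)"
      using m2 by (intro exI[of _ t] exI[of _ s']) simp
  next
    fix s assume "stores_kept_list s f (m + 1)"
    from build_trees[OF this ex ex'] obtain t s' where
      "runs build_trees s t s'" "t \<le> 160 * n + 201" "stores_trees s' f (m + 1)"
      unfolding wp_def n by blast
    then show "\<exists>t s'. runs build_trees s t s' \<and> t \<le> 400 * n \<and> stores_trees s' f (m + 1)"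
      using n1 by (intro exI[of _ t] exI[of _ s']) simp
  next
    fix s assume "stores_trees s f (m + 1)"
    from build_diagram[OF this] obtain t s' where
      "runs build_diagram s t s'" "t \<le> 19 * n + 19 * card {i. maximum (\<lambda>t. - f t) (m + 1) i} + 26"
      "stores_diagram s' (diagram_points f (m + 1)) (diagram_arrows f (m + 1))"
      unfolding wp_def n by blast
    then show "\<exists>t s'. runs build_diagram s t s' \<and> t \<le> 400 * n \<and>
        stores_diagram s' (diagram_points f (m + 1)) (diagram_arrows f (m + 1))"
      using n1 card_maxima_uminus unfolding n[symmetric] by (intro exI[of _ t] exI[of _ s']) simp
  qed
qed

end
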